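(* Let $\{X_{t,T}\}_{t=1}^{T}$, $T\ge1$, be a locally stationary functional time series in $L^2_H$: for every $u\in[0,1]$ there is an associated process $\{X_t^{(u)}\}_{t\in\mathbb Z}$ in $L^2_H$ as in the definition of local stationarity with $p=2$ and some $\rho\ge2$. Assume moreover that for every $u$ the process $\{X_t^{(u)}\}$ is $L^2$-$m$-approximable and $E[X_t^{(u)}]=0$ in $L^2$. Let $K_1:\mathbb R\to\mathbb R$ be symmetric around zero, bounded, Lipschitz continuous, with compact support and $\int K_1(z)\,dz=1$. Let $h=h_T>0$ with $h\to0$ and $\min\{Th,\frac1{Th^3}\}\to\infty$ as $T\to\infty$, put $K_{1,h}(x)=K_1(x/h)$ and $$\bar X_T^{(u)}=\frac1{Th}\sum_{t=1}^{T}K_{1,h}\Big(u-\frac tT\Big)X_{t,T}.$$ Then for each $u\in(0,1)$, $$\sqrt{Th}\,\bar X_T^{(u)}\stackrel{d}{\to}G^{(u)}\quad\text{in }L^2\ \text{ as }T\to\infty,$$ where $G^{(u)}$ is a Gaussian element of $L^2$ with $E[G^{(u)}(s)]=0$ and covariance kernel $E[G^{(u)}(s_1)G^{(u)}(s_2)]=c^{(u)}(s_1,s_2)\int K_1^2(z)\,dz$, with $$c^{(u)}(s_1,s_2)=E[X_0^{(u)}(s_1)X_0^{(u)}(s_2)]+\sum_{t\ge1}E[X_0^{(u)}(s_1)X_t^{(u)}(s_2)]+\sum_{t\ge1}E[X_0^{(u)}(s_2)X_t^{(u)}(s_1)].$$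
   Context: $H=L^2=L^2([0,1]^d)$ is the real Hilbert space with $\langle x,y\rangle=\int_{[0,1]^d}x(t)y(t)\,dt$ and norm $\|\cdot\|$. $L^p_H$ is the space of $H$-valued random functions $X$ on a probability space with $v_p(X)=(E\|X\|^p)^{1/p}<\infty$. $\stackrel d\to$ denotes convergence in distribution. The infinite sums defining $c^{(u)}$ are understood in $L^2([0,1]^d\times[0,1]^d)$. Local stationarity. $\{X_{t,T}\}_{t=1}^T$ in $L^p_H$ is locally stationary if for each $u\in[0,1]$ there is an $H$-valued process $\{X_t^{(u)}\}_{t\in\mathbb Z}$ in $L^p_H$ such that (i) $\{X_t^{(u)}\}_t$ is strictly stationary; (ii) for all $1\le t\le T$, almost surely $$\|X_{t,T}-X_t^{(u)}\|\le\Big(\Big|\frac tT-u\Big|+\frac1T\Big)U_{t,T}^{(u)},$$ where $U_{t,T}^{(u)}$ are positive random variables with $E[(U_{t,T}^{(u)})^\rho]<C$ for some $\rho>0$ and $C<\infty$ independent of $u,t,T$. $L^p$-$m$-approximability. $\{X_t^{(u)}\}$ is $L^p$-$m$-approximable if $X_t^{(u)}\in L^p_H$ has the form $X_t^{(u)}=f_u(\varepsilon_t,\varepsilon_{t-1},\dots)$ with $\varepsilon_j$ i.i.d. elements of a measurable space $S$ and $f_u:S^\infty\to H$ measurable, and, with $\{\varepsilon_{t,k}^{(m)}\}_k$ (for each $t$ and $m$) independent copies of $\{\varepsilon_k\}_k$ defined on the same probability space and $$X_{m,t}^{(u)}=f_u(\varepsilon_t,\dots,\varepsilon_{t-m+1},\varepsilon_{t,t-m}^{(m)},\varepsilon_{t,t-m-1}^{(m)},\dots),$$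 one has $\sum_{m\ge1}v_p(X_t^{(u)}-X_{m,t}^{(u)})<\infty$. *)

theory Defs
  imports "HOL-Probability.Probability"
begin

section \<open>The Hilbert space of square integrable functions on the unit cube\<close>

definition unit_cube :: "'a::euclidean_space measure" where
  "unit_cube = restrict_space lborel (cbox 0 One)"

definition square_integrable :: "('a::euclidean_space \<Rightarrow> real) \<Rightarrow> bool" where
  "square_integrable f \<longleftrightarrow>
     f \<in> borel_measurable unit_cube \<and> integrable unit_cube (\<lambda>x. (f x)\<^sup>2)"

lemma cbox_unit_borel [measurable]: "cbox 0 One \<in> sets (borel :: 'a::euclidean_space measure)"
  by simp

lemma finite_measure_unit_cube: "finite_measure (unit_cube :: 'a::euclidean_space measure)"
proof
  have "emeasure (unit_cube :: 'a measure) (space unit_cube) = emeasure lborel (cbox 0 (One::'a))"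
    by (simp add: unit_cube_def emeasure_restrict_space space_restrict_space)
  also have "\<dots> < \<infinity>"
    by (simp add: emeasure_lborel_cbox_eq)
  finally show "emeasure (unit_cube :: 'a measure) (space unit_cube) \<noteq> \<infinity>" by simp
qed

interpretation unit_cube: finite_measure "unit_cube :: 'a::euclidean_space measure"
  by (rule finite_measure_unit_cube)

lemma borel_measurable_unit_cubeI:
  "f \<in> borel_measurable borel \<Longrightarrow> f \<in> borel_measurable unit_cube"
  by (simp add: unit_cube_def measurable_restrict_space1)

lemma square_integrableD [measurable_dest]:
  "square_integrable f \<Longrightarrow> f \<in> borel_measurable unit_cube"
  by (simp add: square_integrable_def)

lemma square_integrable_mult:
  assumes f: "square_integrable f" and g: "square_integrable g"
  shows "integrable unit_cube (\<lambda>x. f x * g x)"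
proof (rule Bochner_Integration.integrable_bound)
  show "integrable unit_cube (\<lambda>x. (f x)\<^sup>2 + (g x)\<^sup>2)"
    using f g by (simp add: square_integrable_def)
  show "(\<lambda>x. f x * g x) \<in> borel_measurable unit_cube"
    using f g by measurable
  have "\<bar>a * b\<bar> \<le> a\<^sup>2 + b\<^sup>2" for a b :: real
  proof -
    have "2 * (\<bar>a\<bar> * \<bar>b\<bar>) \<le> a\<^sup>2 + b\<^sup>2"
      using sum_squares_bound[of "\<bar>a\<bar>" "\<bar>b\<bar>"] by (simp add: mult.assoc)
    moreover have "0 \<le> \<bar>a\<bar> * \<bar>b\<bar>" by simp
    ultimately show ?thesis unfolding abs_mult by linarith
  qed
  then show "AE x in unit_cube. norm (f x * g x) \<le> norm ((f x)\<^sup>2 + (g x)\<^sup>2)"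
    by (intro always_eventually allI) simp
qed

lemma square_integrable_zero: "square_integrable (\<lambda>x. 0)"
  by (simp add: square_integrable_def)

lemma square_integrable_add:
  assumes f: "square_integrable f" and g: "square_integrable g"
  shows "square_integrable (\<lambda>x. f x + g x)"
proof -
  have "integrable unit_cube (\<lambda>x. (f x)\<^sup>2 + (g x)\<^sup>2 + 2 * (f x * g x))"
    using f g square_integrable_mult[OF f g] by (simp add: square_integrable_def)
  moreover have "(\<lambda>x. f x + g x) \<in> borel_measurable unit_cube"
    using f g by measurable
  ultimately show ?thesis
    by (simp add: square_integrable_def power2_sum mult.assoc)
qed

lemma square_integrable_cmult:
  assumes f: "square_integrable f"
  shows "square_integrable (\<lambda>x. c * f x)"
proof -
  have "(\<lambda>x. c * f x) \<in> borel_measurable unit_cube"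
    using f by measurable
  moreover have "integrable unit_cube (\<lambda>x. (c * f x)\<^sup>2)"
    using f by (simp add: square_integrable_def power_mult_distrib)
  ultimately show ?thesis
    unfolding square_integrable_def by blast
qed

lemma square_integrable_minus:
  assumes f: "square_integrable f"
  shows "square_integrable (\<lambda>x. - f x)"
  using square_integrable_cmult[OF f, of "-1"] by simp

lemma square_integrable_diff:
  assumes f: "square_integrable f" and g: "square_integrable g"
  shows "square_integrable (\<lambda>x. f x - g x)"
  using square_integrable_add[OF f square_integrable_minus[OF g]] by simp

lemma square_integrable_bound:
  assumes "square_integrable g" "f \<in> borel_measurable unit_cube"
    and "AE x in unit_cube. \<bar>f x\<bar> \<le> \<bar>g x\<bar>"
  shows "square_integrable f"
  unfolding square_integrable_def
proof
  show "f \<in> borel_measurable unit_cube" by fact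
  show "integrable unit_cube (\<lambda>x. (f x)\<^sup>2)"
  proof (rule Bochner_Integration.integrable_bound)
    show "integrable unit_cube (\<lambda>x. (g x)\<^sup>2)"
      using assms(1) by (simp add: square_integrable_def)
    show "(\<lambda>x. (f x)\<^sup>2) \<in> borel_measurable unit_cube"
      using assms(2) by measurable
    show "AE x in unit_cube. norm ((f x)\<^sup>2) \<le> norm ((g x)\<^sup>2)"
      using assms(3) by eventually_elim (simp add: abs_le_square_iff)
  qed
qed

lemma square_integrable_const: "square_integrable (\<lambda>x. c)"
  by (simp add: square_integrable_def)

text \<open>
  For \<open>'a = real^'d\<close> the cube \<open>cbox 0 One\<close> is \<open>[0,1]\<^sup>d\<close>; for \<open>'a \<times> 'a\<close> it is the product
  of two cubes, so the same type constructor also serves for kernels. Every Lebesgue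
  measurable function has a Borel version, so Borel representatives suffice.
\<close>

quotient_type (overloaded) 'a L2 = "'a::euclidean_space \<Rightarrow> real" / partial:
  "\<lambda>f g. square_integrable f \<and> square_integrable g \<and> (AE x in unit_cube. f x = g x)"
proof (rule part_equivpI)
  show "\<exists>f. square_integrable f \<and> square_integrable f \<and> (AE x in unit_cube. f x = f x)"
    by (intro exI[of _ "\<lambda>x. 0"]) (simp add: square_integrable_zero)
  show "symp (\<lambda>f g. square_integrable f \<and> square_integrable g \<and> (AE x in unit_cube. f x = g x))"
    by (intro sympI) (auto simp: eq_commute)
  show "transp (\<lambda>f g. square_integrable f \<and> square_integrable g \<and> (AE x in unit_cube. f x = g x))"
    by (intro transpI) auto
qed

instantiation L2 :: (euclidean_space) real_inner
begin

lift_definition zero_L2 :: "'a L2" is "\<lambda>x. 0"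
  by (simp add: square_integrable_zero)

lift_definition plus_L2 :: "'a L2 \<Rightarrow> 'a L2 \<Rightarrow> 'a L2" is "\<lambda>f g x. f x + g x"
  by (auto intro: square_integrable_add)

lift_definition uminus_L2 :: "'a L2 \<Rightarrow> 'a L2" is "\<lambda>f x. - f x"
  by (auto intro: square_integrable_minus)

lift_definition minus_L2 :: "'a L2 \<Rightarrow> 'a L2 \<Rightarrow> 'a L2" is "\<lambda>f g x. f x - g x"
  by (auto intro: square_integrable_diff)

lift_definition scaleR_L2 :: "real \<Rightarrow> 'a L2 \<Rightarrow> 'a L2" is "\<lambda>c f x. c * f x"
  by (auto intro: square_integrable_cmult)

lift_definition inner_L2 :: "'a L2 \<Rightarrow> 'a L2 \<Rightarrow> real" is
  "\<lambda>f g. \<integral>x. f x * g x \<partial>unit_cube"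
  by (intro integral_cong_AE) (auto simp: square_integrable_def)

definition norm_L2 :: "'a L2 \<Rightarrow> real" where "norm_L2 x = sqrt (x \<bullet> x)"

definition sgn_L2 :: "'a L2 \<Rightarrow> 'a L2" where "sgn_L2 x = inverse (norm x) *\<^sub>R x"

definition dist_L2 :: "'a L2 \<Rightarrow> 'a L2 \<Rightarrow> real" where "dist_L2 x y = norm (x - y)"

definition uniformity_L2 :: "('a L2 \<times> 'a L2) filter" where
  "uniformity_L2 = (INF e\<in>{0<..}. principal {(x, y). dist x y < e})"

definition open_L2 :: "'a L2 set \<Rightarrow> bool" where
  "open_L2 U \<longleftrightarrow> (\<forall>x\<in>U. eventually (\<lambda>(x', y). x' = x \<longrightarrow> y \<in> U) uniformity)"

instance
proof
  fix x y z :: "'a L2" and a b r :: real and U :: "'a L2 set"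
  show "x + y + z = x + (y + z)"
    by transfer (auto intro!: square_integrable_add simp: algebra_simps)
  show "x + y = y + x"
    by transfer (auto intro!: square_integrable_add simp: algebra_simps)
  show "0 + x = x" by transfer auto
  show "- x + x = 0"
    by transfer (auto intro!: square_integrable_add square_integrable_minus square_integrable_zero)
  show "x - y = x + - y"
    by transfer (auto intro!: square_integrable_add square_integrable_minus square_integrable_diff)
  show "a *\<^sub>R (x + y) = a *\<^sub>R x + a *\<^sub>R y"
    by transfer
      (auto intro!: square_integrable_add square_integrable_cmult simp: algebra_simps)
  show "(a + b) *\<^sub>R x = a *\<^sub>R x + b *\<^sub>R x"
    by transfer
      (auto intro!: square_integrable_add square_integrable_cmult simp: algebra_simps)
  show "a *\<^sub>R b *\<^sub>R x = (a * b) *\<^sub>R x"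
    by transfer (auto intro!: square_integrable_cmult simp: algebra_simps)
  show "1 *\<^sub>R x = x" by transfer auto
  show "dist x y = norm (x - y)" by (rule dist_L2_def)
  show "sgn x = inverse (norm x) *\<^sub>R x" by (rule sgn_L2_def)
  show "uniformity = (INF e\<in>{0<..}. principal {(x, y::'a L2). dist x y < e})"
    by (rule uniformity_L2_def)
  show "open U \<longleftrightarrow> (\<forall>x\<in>U. eventually (\<lambda>(x', y). x' = x \<longrightarrow> y \<in> U) uniformity)"
    by (rule open_L2_def)
  show "x \<bullet> y = y \<bullet> x" by transfer (simp add: mult.commute)
  show "(x + y) \<bullet> z = x \<bullet> z + y \<bullet> z"
    by transfer (auto simp: distrib_right square_integrable_mult)
  show "(r *\<^sub>R x) \<bullet> y = r * (x \<bullet> y)"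
    by transfer (simp add: mult.assoc)
  show "0 \<le> x \<bullet> x" by transfer simp
  show "x \<bullet> x = 0 \<longleftrightarrow> x = 0"
  proof transfer
    fix f :: "'a \<Rightarrow> real"
    assume "square_integrable f \<and> square_integrable f \<and> (AE x in unit_cube. f x = f x)"
    then have f: "square_integrable f" by simp
    have "(\<integral>x. f x * f x \<partial>unit_cube) = 0 \<longleftrightarrow> (AE x in unit_cube. f x * f x = 0)"
      by (intro integral_nonneg_eq_0_iff_AE square_integrable_mult f) auto
    then show "(\<integral>x. f x * f x \<partial>unit_cube) = 0 \<longleftrightarrow>
      square_integrable f \<and> square_integrable (\<lambda>x. 0 :: real) \<and> (AE x in unit_cube. f x = 0)"
      using f square_integrable_zero by auto
  qed
  show "norm x = sqrt (x \<bullet> x)" by (rule norm_L2_def)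
qed

end

lemma square_integrable_rep: "square_integrable (rep_L2 x)"
  using Quotient3_rep_reflp[OF Quotient3_L2, of x] by simp

lemma abs_rep_L2 [simp]: "abs_L2 (rep_L2 x) = x"
  by (rule Quotient3_abs_rep[OF Quotient3_L2])

lemma rep_abs_L2:
  assumes "square_integrable f"
  shows "AE x in unit_cube. rep_L2 (abs_L2 f) x = f x"
  using rep_abs_rsp[OF Quotient3_L2, of f f] assms by (auto simp: eq_commute)

lemma abs_L2_eqI:
  assumes "square_integrable f" "square_integrable g" "AE x in unit_cube. f x = g x"
  shows "abs_L2 f = abs_L2 g"
  using assms by (intro Quotient3_rel_abs[OF Quotient3_L2]) simp

lemma norm_abs_L2_power2:
  assumes f: "square_integrable f"
  shows "(norm (abs_L2 f))\<^sup>2 = (\<integral>x. (f x)\<^sup>2 \<partial>unit_cube)"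
  unfolding power2_norm_eq_inner using f by (simp add: inner_L2.abs_eq power2_eq_square)

lemma abs_L2_diff:
  assumes "square_integrable f" "square_integrable g"
  shows "abs_L2 f - abs_L2 g = abs_L2 (\<lambda>x. f x - g x)"
  using assms by (simp add: minus_L2.abs_eq)

lemma abs_L2_add:
  assumes "square_integrable f" "square_integrable g"
  shows "abs_L2 f + abs_L2 g = abs_L2 (\<lambda>x. f x + g x)"
  using assms by (simp add: plus_L2.abs_eq)

lemma abs_L2_scaleR:
  assumes "square_integrable f"
  shows "c *\<^sub>R abs_L2 f = abs_L2 (\<lambda>x. c * f x)"
  using assms by (simp add: scaleR_L2.abs_eq)

lemma abs_L2_tendsto:
  assumes f: "\<And>n. f n \<in> borel_measurable unit_cube" and g: "g \<in> borel_measurable unit_cube"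
    and lim: "AE x in unit_cube. (\<lambda>n. f n x) \<longlonglongrightarrow> g x"
    and w: "square_integrable w" and bd: "\<And>n. AE x in unit_cube. \<bar>f n x\<bar> \<le> w x"
  shows "square_integrable (f n)" "square_integrable g" "(\<lambda>n. abs_L2 (f n)) \<longlonglongrightarrow> abs_L2 g"
proof -
  have w': "AE x in unit_cube. \<bar>f n x\<bar> \<le> \<bar>w x\<bar>" for n
    using bd[of n] by eventually_elim simp
  show fn: "square_integrable (f n)" for n
    by (rule square_integrable_bound[OF w f w'])
  have allbd: "AE x in unit_cube. \<forall>n. \<bar>f n x\<bar> \<le> w x"
    using bd by (simp add: AE_all_countable)
  have gbd: "AE x in unit_cube. \<bar>g x\<bar> \<le> w x"
    using lim allbd
  proof eventually_elim
    case (elim x)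
    then have "(\<lambda>n. \<bar>f n x\<bar>) \<longlonglongrightarrow> \<bar>g x\<bar>" by (intro tendsto_rabs)
    then show ?case by (rule LIMSEQ_le_const2) (use elim in auto)
  qed
  show gn: "square_integrable g"
    by (rule square_integrable_bound[OF w g]) (use gbd in eventually_elim, simp)
  have "(\<lambda>n. \<integral>x. (f n x - g x)\<^sup>2 \<partial>unit_cube) \<longlonglongrightarrow> (\<integral>x. 0 \<partial>(unit_cube :: 'a measure))"
  proof (rule integral_dominated_convergence)
    show "integrable unit_cube (\<lambda>x. 4 * (w x)\<^sup>2)"
      using w by (simp add: square_integrable_def)
    show "AE x in unit_cube. (\<lambda>n. (f n x - g x)\<^sup>2) \<longlonglongrightarrow> 0"
      using lim
    proof eventually_elim
      case (elim x)
      then have "(\<lambda>n. (f n x - g x)\<^sup>2) \<longlonglongrightarrow> (g x - g x)\<^sup>2" by (intro tendsto_intros)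
      then show ?case by simp
    qed
    show "AE x in unit_cube. norm ((f n x - g x)\<^sup>2) \<le> 4 * (w x)\<^sup>2" for n
      using bd[of n] gbd
    proof eventually_elim
      case (elim x)
      then have "\<bar>f n x - g x\<bar> \<le> \<bar>2 * w x\<bar>" by linarith
      then show ?case by (simp add: abs_le_square_iff power_mult_distrib)
    qed
  qed (use f g in auto)
  then have "(\<lambda>n. (norm (abs_L2 (f n) - abs_L2 g))\<^sup>2) \<longlonglongrightarrow> 0"
    using fn gn by (simp add: abs_L2_diff norm_abs_L2_power2 square_integrable_diff)
  then have "(\<lambda>n. sqrt ((norm (abs_L2 (f n) - abs_L2 g))\<^sup>2)) \<longlonglongrightarrow> sqrt 0"
    by (rule tendsto_real_sqrt)
  then show "(\<lambda>n. abs_L2 (f n)) \<longlonglongrightarrow> abs_L2 g"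
    by (simp add: LIM_zero_iff tendsto_norm_zero_iff)
qed

lemma integral_abs_le_norm_L2:
  fixes f :: "'a::euclidean_space \<Rightarrow> real"
  assumes f: "square_integrable f"
  shows "integrable unit_cube f"
    and "(\<integral>x. \<bar>f x\<bar> \<partial>unit_cube) \<le>
           norm (abs_L2 f) * norm (abs_L2 (\<lambda>x. 1) :: 'a L2)"
proof -
  have "integrable unit_cube (\<lambda>x. f x * 1)"
    by (rule square_integrable_mult[OF f square_integrable_const])
  then show "integrable unit_cube f" by simp
  have af: "square_integrable (\<lambda>x. \<bar>f x\<bar>)"
    by (rule square_integrable_bound[OF f]) (use f in auto)
  have "(\<integral>x. \<bar>f x\<bar> \<partial>unit_cube) = abs_L2 (\<lambda>x. \<bar>f x\<bar>) \<bullet> abs_L2 (\<lambda>x. 1)"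
    using af by (simp add: inner_L2.abs_eq square_integrable_const)
  also have "\<dots> \<le> norm (abs_L2 (\<lambda>x. \<bar>f x\<bar>)) * norm (abs_L2 (\<lambda>x. 1) :: 'a L2)"
    by (rule norm_cauchy_schwarz)
  also have "norm (abs_L2 (\<lambda>x. \<bar>f x\<bar>)) = norm (abs_L2 f)"
  proof (rule power2_eq_imp_eq)
    show "(norm (abs_L2 (\<lambda>x. \<bar>f x\<bar>)))\<^sup>2 = (norm (abs_L2 f))\<^sup>2"
      unfolding norm_abs_L2_power2[OF af] norm_abs_L2_power2[OF f] by simp
  qed (rule norm_ge_zero)+
  finally show "(\<integral>x. \<bar>f x\<bar> \<partial>unit_cube) \<le>
      norm (abs_L2 f) * norm (abs_L2 (\<lambda>x. 1) :: 'a L2)" .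
qed

instance L2 :: (euclidean_space) banach
proof
  fix X :: "nat \<Rightarrow> 'a L2"
  assume X: "Cauchy X"
  define s where "s n = rep_L2 (X n)" for n
  have s: "square_integrable (s n)" for n
    by (simp add: s_def square_integrable_rep)
  have s_meas [measurable]: "s n \<in> borel_measurable unit_cube" for n
    using s by measurable
  have Xs: "X n = abs_L2 (s n)" for n by (simp add: s_def)
  have XX: "X i - X j = abs_L2 (\<lambda>x. s i x - s j x)" for i j
    by (simp add: Xs abs_L2_diff s)
  define N1 where "N1 = norm (abs_L2 (\<lambda>x. 1) :: 'a L2)"
  obtain r where r: "strict_mono r" and cau: "AE x in unit_cube. Cauchy (\<lambda>i. s (r i) x)"
  proof (rule cauchy_L1_AE_cauchy_subseq)
    show "integrable unit_cube (s n)" for n by (rule integral_abs_le_norm_L2(1)[OF s])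
    fix e :: real assume e: "e > 0"
    have "N1 \<ge> 0" by (simp add: N1_def)
    then have e': "e / (N1 + 1) > 0" using e by simp
    then obtain N where N: "\<And>i j. i \<ge> N \<Longrightarrow> j \<ge> N \<Longrightarrow> norm (X i - X j) < e / (N1 + 1)"
      using CauchyD[OF X, of "e / (N1 + 1)"] by blast
    show "\<exists>N. \<forall>i\<ge>N. \<forall>j\<ge>N. (LINT x|unit_cube. norm (s i x - s j x)) < e"
    proof (intro exI[of _ N] allI impI)
      fix i j assume ij: "i \<ge> N" "j \<ge> N"
      have "(LINT x|unit_cube. norm (s i x - s j x)) \<le> norm (X i - X j) * N1"
        using integral_abs_le_norm_L2(2)[OF square_integrable_diff[OF s s], of i j]
        by (simp add: XX N1_def)
      also have "\<dots> \<le> norm (X i - X j) * (N1 + 1)" by (intro mult_left_mono) auto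
      also have "\<dots> < e"
        using N[OF ij] \<open>N1 \<ge> 0\<close> by (simp add: pos_less_divide_eq)
      finally show "(LINT x|unit_cube. norm (s i x - s j x)) < e" .
    qed
  qed auto
  define g where "g x = lim (\<lambda>i. s (r i) x)" for x
  have g_meas [measurable]: "g \<in> borel_measurable unit_cube"
    unfolding g_def by measurable
  have lim: "AE x in unit_cube. (\<lambda>i. s (r i) x) \<longlonglongrightarrow> g x"
    using cau by eventually_elim (simp add: g_def Cauchy_convergent_iff convergent_LIMSEQ_iff)
  have Fatou: "(\<integral>\<^sup>+x. ennreal ((s n x - g x)\<^sup>2) \<partial>unit_cube) \<le> ennreal (e\<^sup>2)"
    if e: "e > 0" and n: "\<And>j. j \<ge> n \<Longrightarrow> norm (X n - X j) < e" for n e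
  proof -
    have "(\<integral>\<^sup>+x. ennreal ((s n x - g x)\<^sup>2) \<partial>unit_cube) =
          (\<integral>\<^sup>+x. liminf (\<lambda>i. ennreal ((s n x - s (r i) x)\<^sup>2)) \<partial>unit_cube)"
    proof (rule nn_integral_cong_AE, use lim in eventually_elim)
      case (elim x)
      then have "(\<lambda>i. ennreal ((s n x - s (r i) x)\<^sup>2)) \<longlonglongrightarrow> ennreal ((s n x - g x)\<^sup>2)"
        by (intro tendsto_intros)
      then show ?case by (rule lim_imp_Liminf[OF sequentially_bot, symmetric])
    qed
    also have "\<dots> \<le> liminf (\<lambda>i. \<integral>\<^sup>+x. ennreal ((s n x - s (r i) x)\<^sup>2) \<partial>unit_cube)"
      by (intro nn_integral_liminf) measurable
    also have "\<dots> \<le> liminf (\<lambda>i. ennreal (e\<^sup>2))"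
    proof (rule Liminf_mono, rule eventually_sequentiallyI[of n])
      fix i assume "n \<le> i"
      then have "n \<le> r i" using seq_suble[OF r, of i] by linarith
      have "(\<integral>\<^sup>+x. ennreal ((s n x - s (r i) x)\<^sup>2) \<partial>unit_cube) =
            ennreal (\<integral>x. (s n x - s (r i) x)\<^sup>2 \<partial>unit_cube)"
        using square_integrable_diff[OF s s, of n "r i"]
        by (intro nn_integral_eq_integral) (auto simp: square_integrable_def)
      also have "\<dots> = ennreal ((norm (X n - X (r i)))\<^sup>2)"
        using square_integrable_diff[OF s s, of n "r i"] by (simp add: XX norm_abs_L2_power2)
      also have "\<dots> \<le> ennreal (e\<^sup>2)"
        using n[OF \<open>n \<le> r i\<close>] by (intro ennreal_leI power_mono) auto
      finally show "(\<integral>\<^sup>+x. ennreal ((s n x - s (r i) x)\<^sup>2) \<partial>unit_cube) \<le> ennreal (e\<^sup>2)" .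
    qed
    also have "\<dots> = ennreal (e\<^sup>2)" by (simp add: Liminf_const)
    finally show ?thesis .
  qed
  have sq_diff: "square_integrable (\<lambda>x. s n x - g x)"
    if e: "e > 0" and n: "\<And>j. j \<ge> n \<Longrightarrow> norm (X n - X j) < e" for n e
    unfolding square_integrable_def
  proof
    show "integrable unit_cube (\<lambda>x. (s n x - g x)\<^sup>2)"
      using Fatou[OF that] by (intro integrableI_bounded) (auto simp: less_top[symmetric] top_unique)
  qed measurable
  obtain N0 where N0: "\<And>i j. i \<ge> N0 \<Longrightarrow> j \<ge> N0 \<Longrightarrow> norm (X i - X j) < 1"
    using CauchyD[OF X, of 1] by auto
  have "square_integrable (\<lambda>x. s N0 x - g x)" by (rule sq_diff[of 1]) (use N0 in auto)
  from square_integrable_diff[OF s this, of N0] have g: "square_integrable g" by simp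
  have "X \<longlonglongrightarrow> abs_L2 g"
  proof (rule LIMSEQ_I)
    fix e :: real assume "e > 0"
    then have e2: "e / 2 > 0" by simp
    obtain N where N: "\<And>i j. i \<ge> N \<Longrightarrow> j \<ge> N \<Longrightarrow> norm (X i - X j) < e / 2"
      using CauchyD[OF X e2] by auto
    show "\<exists>N. \<forall>n\<ge>N. norm (X n - abs_L2 g) < e"
    proof (intro exI[of _ N] allI impI)
      fix n assume n: "n \<ge> N"
      have n': "\<And>j. j \<ge> n \<Longrightarrow> norm (X n - X j) < e / 2" using N n by auto
      have sd: "square_integrable (\<lambda>x. s n x - g x)" by (rule square_integrable_diff[OF s g])
      have "ennreal ((norm (X n - abs_L2 g))\<^sup>2) = ennreal (\<integral>x. (s n x - g x)\<^sup>2 \<partial>unit_cube)"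
        using sd by (simp add: Xs abs_L2_diff s g norm_abs_L2_power2)
      also have "\<dots> = (\<integral>\<^sup>+x. ennreal ((s n x - g x)\<^sup>2) \<partial>unit_cube)"
        using sd by (intro nn_integral_eq_integral[symmetric]) (auto simp: square_integrable_def)
      also have "\<dots> \<le> ennreal ((e / 2)\<^sup>2)" by (rule Fatou[OF e2 n'])
      finally have "(norm (X n - abs_L2 g))\<^sup>2 \<le> (e / 2)\<^sup>2" by (subst (asm) ennreal_le_iff) auto
      then have "norm (X n - abs_L2 g) \<le> e / 2" by (rule power2_le_imp_le) (use e2 in simp)
      then show "norm (X n - abs_L2 g) < e" using \<open>e > 0\<close> by linarith
    qed
  qed
  then show "convergent X" by (rule convergentI)
qed


lemma second_countable_topologyI_dense:
  fixes D :: "'a::metric_space set"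
  assumes D: "countable D" and dense: "closure D = UNIV"
  shows "\<exists>B::'a set set. countable B \<and> open = generate_topology B"
proof -
  define B where "B = (\<lambda>(x, n). ball x (1 / real (Suc n))) ` (D \<times> (UNIV :: nat set))"
  have "topological_basis B"
  proof (rule topological_basisI)
    show "open b" if "b \<in> B" for b using that by (auto simp: B_def)
    fix U :: "'a set" and x assume U: "open U" "x \<in> U"
    then obtain e where e: "e > 0" "ball x e \<subseteq> U" by (meson open_contains_ball)
    obtain n where n: "1 / real (Suc n) < e / 2"
      using e(1) nat_approx_posE[of "e / 2"] by (metis half_gt_zero)
    have "x \<in> closure D" using dense by simp
    then obtain y where y: "y \<in> D" "dist y x < 1 / real (Suc n)"
      by (meson closure_approachable of_nat_0_less_iff zero_less_Suc zero_less_divide_1_iff)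
    have "ball y (1 / real (Suc n)) \<subseteq> ball x e"
    proof
      fix z assume "z \<in> ball y (1 / real (Suc n))"
      then have "dist y z < 1 / real (Suc n)" by simp
      moreover have "dist x z \<le> dist y x + dist y z" by (metis dist_commute dist_triangle)
      ultimately show "z \<in> ball x e" using y n by simp
    qed
    then show "\<exists>b\<in>B. x \<in> b \<and> b \<subseteq> U"
      using y e by (intro bexI[of _ "ball y (1 / real (Suc n))"]) (auto simp: B_def)
  qed
  moreover have "countable B" using D by (auto simp: B_def)
  ultimately show ?thesis
    using topological_basis_imp_subbasis by blast
qed

lemma subspace_closure:
  fixes S :: "'a::real_normed_vector set"
  assumes S: "subspace S"
  shows "subspace (closure S)"
proof (rule subspaceI)
  show "0 \<in> closure S"
    using subspace_0[OF S] closure_subset by blast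
  show "x + y \<in> closure S" if xy: "x \<in> closure S" "y \<in> closure S" for x y
  proof -
    obtain f g where "\<And>n :: nat. f n \<in> S" "f \<longlonglongrightarrow> x" "\<And>n :: nat. g n \<in> S" "g \<longlonglongrightarrow> y"
      using xy unfolding closure_sequential by blast
    then show ?thesis unfolding closure_sequential
      by (intro exI[of _ "\<lambda>n. f n + g n"]) (auto intro: subspace_add[OF S] tendsto_add)
  qed
  show "c *\<^sub>R x \<in> closure S" if x: "x \<in> closure S" for c x
  proof -
    obtain f where "\<And>n :: nat. f n \<in> S" "f \<longlonglongrightarrow> x"
      using x unfolding closure_sequential by blast
    then show ?thesis unfolding closure_sequential
      by (intro exI[of _ "\<lambda>n. c *\<^sub>R f n"])
        (auto intro: subspace_scale[OF S] tendsto_scaleR)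
  qed
qed

lemma countable_dense_closure_span:
  fixes S :: "'a::real_normed_vector set"
  assumes S: "countable S" and dense: "closure (span S) = UNIV"
  shows "\<exists>D::'a set. countable D \<and> closure D = UNIV"
proof -
  define comb where "comb = (\<lambda>l :: (rat \<times> 'a) list. \<Sum>(q, s)\<leftarrow>l. real_of_rat q *\<^sub>R s)"
  define D where "D = comb ` lists ((UNIV :: rat set) \<times> S)"
  have "countable D"
    unfolding D_def using S by (intro countable_image countable_lists countable_SIGMA) auto
  moreover have "span S \<subseteq> closure D"
  proof
    fix x assume "x \<in> span S"
    then show "x \<in> closure D"
    proof (induction rule: span_induct_alt)
      case base
      have "comb [] \<in> D" unfolding D_def by (intro imageI) simp
      then show ?case using closure_subset[of D] by (auto simp: comb_def)
    next
      case (step c x y)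
      from step obtain f where f: "\<And>n :: nat. f n \<in> D" "f \<longlonglongrightarrow> y"
        using closure_sequential[of y D] by auto
      have "\<exists>q :: rat. \<bar>real_of_rat q - c\<bar> < 1 / real (Suc n)" for n
      proof -
        have "c - 1 / real (Suc n) < c + 1 / real (Suc n)" by simp
        then obtain q where "c - 1 / real (Suc n) < real_of_rat q"
          "real_of_rat q < c + 1 / real (Suc n)" using of_rat_dense by blast
        then show ?thesis by (intro exI[of _ q]) linarith
      qed
      then obtain q where q: "\<And>n. \<bar>real_of_rat (q n) - c\<bar> < 1 / real (Suc n)" by metis
      have "(\<lambda>n. real_of_rat (q n) - c) \<longlonglongrightarrow> 0"
        using q by (intro Lim_null_comparison[OF _ LIMSEQ_inverse_real_of_nat])
          (auto simp: inverse_eq_divide less_imp_le)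
      then have "(\<lambda>n. real_of_rat (q n)) \<longlonglongrightarrow> c" by (rule LIM_zero_cancel)
      then have lim: "(\<lambda>n. real_of_rat (q n) *\<^sub>R x + f n) \<longlonglongrightarrow> c *\<^sub>R x + y"
        using f(2) by (intro tendsto_intros)
      have "real_of_rat (q n) *\<^sub>R x + f n \<in> D" for n
      proof -
        from f(1)[of n] obtain l where l: "l \<in> lists ((UNIV :: rat set) \<times> S)" "f n = comb l"
          by (auto simp: D_def)
        have "comb ((q n, x) # l) \<in> D"
          unfolding D_def using l(1) step(1) by (intro imageI) simp
        then show ?thesis by (simp add: comb_def l(2))
      qed
      with lim show ?case unfolding closure_sequential
        by (intro exI[of _ "\<lambda>n. real_of_rat (q n) *\<^sub>R x + f n"]) simp
    qed
  qed
  then have "closure D = UNIV"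
    using dense closure_mono[of "span S" "closure D"] by (simp add: top_unique)
  ultimately show ?thesis by blast
qed

lemma abs_L2_zero: "abs_L2 (\<lambda>x. 0) = 0"
  unfolding zero_L2_def ..

lemma square_integrable_indicator:
  assumes "A \<in> sets borel"
  shows "square_integrable (indicator A :: 'a::euclidean_space \<Rightarrow> real)"
  by (rule square_integrable_bound[OF square_integrable_const[of 1]])
    (use assms in \<open>auto intro!: borel_measurable_unit_cubeI simp: indicator_def\<close>)

lemma abs_L2_indicator_tendsto:
  assumes A: "\<And>n. A n \<in> sets borel" and B: "B \<in> sets (borel :: 'a::euclidean_space measure)"
    and lim: "\<And>x. (\<lambda>n. indicator (A n) x :: real) \<longlonglongrightarrow> indicator B x"
  shows "(\<lambda>n. abs_L2 (indicator (A n))) \<longlonglongrightarrow> (abs_L2 (indicator B) :: 'a L2)"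
proof (rule abs_L2_tendsto(3))
  show "square_integrable (\<lambda>x::'a. 1)" by (rule square_integrable_const)
  show "AE x in unit_cube. \<bar>indicator (A n) x\<bar> \<le> (1::real)" for n
    by (auto simp: indicator_def)
qed (use A B lim square_integrable_indicator in \<open>auto intro!: borel_measurable_unit_cubeI\<close>)

lemma sets_unit_cube_borel:
  "A \<in> sets (unit_cube :: 'a::euclidean_space measure) \<Longrightarrow> A \<in> sets borel"
  by (auto simp: unit_cube_def sets_restrict_space)

lemma closure_span_indicators_L2:
  fixes \<B> :: "'a::euclidean_space set set"
  assumes \<B>: "countable \<B>" "topological_basis \<B>"
  shows "closure (span ((\<lambda>F. abs_L2 (indicator (\<Union>F))) ` {F. finite F \<and> F \<subseteq> \<B>})) = UNIV"
    (is "closure (span ?S) = UNIV")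
proof -
  define V where "V = closure (span ?S)"
  have sub: "subspace V" unfolding V_def by (rule subspace_closure) (rule subspace_span)
  have V_lim: "x \<in> V" if "\<And>n. f n \<in> V" "f \<longlonglongrightarrow> x" for f x
    using that closed_sequentially[of V f x] by (auto simp: V_def)
  have \<B>_borel: "b \<in> sets borel" if "b \<in> \<B>" for b
    using topological_basis_open[OF \<B>(2) that] by auto
  have open_V: "abs_L2 (indicator U) \<in> V" if U: "open U" for U
  proof (cases "U = {}")
    case True
    have "abs_L2 (indicator (\<Union>{})) \<in> span ?S" by (intro span_base imageI) simp
    then show ?thesis using True closure_subset[of "span ?S"] by (auto simp: V_def)
  next
    case False
    obtain \<B>' where \<B>': "\<B>' \<subseteq> \<B>" "\<Union>\<B>' = U" using \<B>(2) U
      unfolding topological_basis_def by meson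
    then have "\<B>' \<noteq> {}" "countable \<B>'" using False \<B>(1) countable_subset by auto
    then obtain b :: "nat \<Rightarrow> 'a set" where b: "range b = \<B>'"
      using range_from_nat_into[of \<B>'] by blast
    define A where "A n = (\<Union>i<n::nat. b i)" for n
    have lim: "(\<lambda>n. indicator (A n) x :: real) \<longlonglongrightarrow> indicator U x" for x
      unfolding A_def using LIMSEQ_indicator_UN[of b x] b \<B>'(2) by simp
    have "abs_L2 (indicator (A n)) \<in> V" for n
    proof -
      have "abs_L2 (indicator (\<Union>(b ` {..<n}))) \<in> span ?S"
        using b \<B>'(1) by (intro span_base imageI) auto
      then show ?thesis using closure_subset[of "span ?S"] by (auto simp: V_def A_def)
    qed
    moreover have "(\<lambda>n. abs_L2 (indicator (A n))) \<longlonglongrightarrow> (abs_L2 (indicator U) :: 'a L2)"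
      using lim that b \<B>'(1) \<B>_borel
      by (intro abs_L2_indicator_tendsto) (auto simp: A_def intro!: sets.finite_UN)
    ultimately show ?thesis by (rule V_lim)
  qed
  have borel_V: "abs_L2 (indicator A) \<in> V" if "A \<in> sets (borel :: 'a measure)" for A
  proof -
    have "Int_stable {S::'a set. open S}" by (auto simp: Int_stable_def)
    moreover have "{S::'a set. open S} \<subseteq> Pow UNIV" by simp
    moreover have "A \<in> sigma_sets UNIV {S. open S}" using that by (simp add: borel_def)
    ultimately show ?thesis
    proof (induction rule: sigma_sets_induct_disjoint)
      case (basic A)
      then show ?case using open_V by simp
    next
      case empty
      show ?case by (rule open_V[OF open_empty])
    next
      case (compl A)
      then have A: "A \<in> sets borel" by (simp add: borel_def)
      have "abs_L2 (indicator UNIV) - (abs_L2 (indicator A) :: 'a L2) =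
            abs_L2 (\<lambda>x. indicator UNIV x - indicator A x)"
        using A by (intro abs_L2_diff square_integrable_indicator) auto
      also have "(\<lambda>x. indicator UNIV x - indicator A x) = (indicator (UNIV - A) :: 'a \<Rightarrow> real)"
        by (simp add: indicator_def fun_eq_iff)
      finally have "abs_L2 (indicator (UNIV - A)) =
          abs_L2 (indicator UNIV) - (abs_L2 (indicator A) :: 'a L2)" ..
      then show ?case
        using subspace_diff[OF sub open_V[OF open_UNIV] compl(2)] by metis
    next
      case (union A)
      then have A: "A i \<in> sets borel" for i by (auto simp: borel_def)
      have sumeq: "abs_L2 (indicator (\<Union>i<n. A i)) = (\<Sum>i<n. abs_L2 (indicator (A i)) :: 'a L2)" for n
      proof (induction n)
        case 0
        have "(indicator (\<Union>i<0. A i) :: 'a \<Rightarrow> real) = (\<lambda>x. 0)"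
          by (simp add: fun_eq_iff)
        then show ?case by (simp only: lessThan_0 sum.empty abs_L2_zero)
      next
        case (Suc n)
        have disj: "A n \<inter> (\<Union>i<n. A i) = {}"
        proof -
          have "A n \<inter> A i = {}" if "i < n" for i
            by (rule disjoint_family_onD[OF union(1)]) (use that in auto)
          then show ?thesis by blast
        qed
        have "(\<Sum>i<Suc n. abs_L2 (indicator (A i)) :: 'a L2) =
              abs_L2 (indicator (\<Union>i<n. A i)) + abs_L2 (indicator (A n))"
          using Suc by simp
        also have "\<dots> = abs_L2 (\<lambda>x. indicator (\<Union>i<n. A i) x + indicator (A n) x)"
          using A by (intro abs_L2_add square_integrable_indicator) auto
        also have "(\<lambda>x. indicator (\<Union>i<n. A i) x + indicator (A n) x) =
              (indicator (\<Union>i<Suc n. A i) :: 'a \<Rightarrow> real)"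
          using disj by (auto simp: indicator_def fun_eq_iff less_Suc_eq)
        finally show ?case by simp
      qed
      have "abs_L2 (indicator (\<Union>i<n. A i)) \<in> V" for n
        unfolding sumeq using union by (intro subspace_sum[OF sub]) auto
      moreover have "(\<lambda>n. abs_L2 (indicator (\<Union>i<n. A i))) \<longlonglongrightarrow>
          (abs_L2 (indicator (\<Union>i. A i)) :: 'a L2)"
        using A LIMSEQ_indicator_UN[of A] by (intro abs_L2_indicator_tendsto) auto
      ultimately show ?case by (rule V_lim)
    qed
  qed
  have simple_V: "square_integrable f \<and> abs_L2 f \<in> V"
    if f: "simple_function (unit_cube :: 'a measure) f" for f :: "'a \<Rightarrow> real"
  proof -
    let ?X = "f ` space unit_cube" and ?P = "\<lambda>y. f -` {y} \<inter> space unit_cube"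
    have fin: "finite ?X" using f by (rule simple_functionD(1))
    have P: "?P y \<in> sets borel" for y
      using simple_functionD(2)[OF f] by (rule sets_unit_cube_borel)
    define g where "g Y x = (\<Sum>y\<in>Y. y * indicator (?P y) x)" for Y :: "real set" and x
    have g: "square_integrable (g Y) \<and> abs_L2 (g Y) \<in> V" if "finite Y" for Y
      using that
    proof induction
      case empty
      then show ?case
        using subspace_0[OF sub] by (simp add: g_def[abs_def] abs_L2_zero square_integrable_zero)
    next
      case (insert y Y)
      have sq: "square_integrable (indicator (?P y) :: 'a \<Rightarrow> real)"
        using P by (rule square_integrable_indicator)
      have eq: "g (insert y Y) = (\<lambda>x. y * indicator (?P y) x + g Y x)"
        unfolding g_def by (rule ext, rule sum.insert) (use insert in auto)
      have "abs_L2 (g (insert y Y)) = y *\<^sub>R abs_L2 (indicator (?P y)) + abs_L2 (g Y)"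
        unfolding eq abs_L2_scaleR[OF sq]
        by (rule abs_L2_add[symmetric]) (use insert sq square_integrable_cmult in auto)
      moreover have "y *\<^sub>R abs_L2 (indicator (?P y)) + abs_L2 (g Y) \<in> V"
        using insert borel_V[OF P] by (intro subspace_add[OF sub] subspace_scale[OF sub]) auto
      moreover have "square_integrable (g (insert y Y))"
        unfolding eq using insert sq by (intro square_integrable_add square_integrable_cmult) auto
      ultimately show ?case by simp
    qed
    have gf: "g ?X x = f x" if "x \<in> space unit_cube" for x
    proof -
      have "g ?X x = (\<Sum>y\<in>?X. if y = f x then y else 0)"
        unfolding g_def by (intro sum.cong) (use that in \<open>auto simp: indicator_def\<close>)
      also have "\<dots> = f x" using fin that by simp
      finally show ?thesis .
    qed
    have fm: "f \<in> borel_measurable unit_cube"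
      using f by (rule borel_measurable_simple_function)
    have AE: "AE x in unit_cube. g ?X x = f x" using gf by (intro AE_I2) auto
    have sf: "square_integrable f"
      by (rule square_integrable_bound[of "g ?X"]) (use g[OF fin] fm AE in auto)
    have "abs_L2 (g ?X) = abs_L2 f"
      using g[OF fin] sf AE by (intro abs_L2_eqI) auto
    then show ?thesis using g[OF fin] sf by simp
  qed
  have "x \<in> V" for x
  proof -
    have sq: "square_integrable (rep_L2 x)" by (rule square_integrable_rep)
    then have m: "rep_L2 x \<in> borel_measurable unit_cube" by measurable
    obtain F where F: "\<And>i. simple_function unit_cube (F i)"
      "\<And>t. t \<in> space unit_cube \<Longrightarrow> (\<lambda>i. F i t) \<longlonglongrightarrow> rep_L2 x t"
      "\<And>i t. t \<in> space unit_cube \<Longrightarrow> dist (F i t) 0 \<le> 2 * dist (rep_L2 x t) 0"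
      using borel_measurable_implies_sequence_metric[OF m, of 0] by blast
    have "square_integrable (\<lambda>t. \<bar>rep_L2 x t\<bar>)"
      by (rule square_integrable_bound[OF sq]) (use m in auto)
    then have w: "square_integrable (\<lambda>t. 2 * \<bar>rep_L2 x t\<bar>)" by (rule square_integrable_cmult)
    have "(\<lambda>i. abs_L2 (F i)) \<longlonglongrightarrow> abs_L2 (rep_L2 x)"
    proof (rule abs_L2_tendsto(3)[OF _ m _ w])
      show "F n \<in> borel_measurable unit_cube" for n
        using F(1) by (rule borel_measurable_simple_function)
      show "AE t in unit_cube. (\<lambda>n. F n t) \<longlonglongrightarrow> rep_L2 x t"
        using F(2) by (intro AE_I2)
      show "AE t in unit_cube. \<bar>F n t\<bar> \<le> 2 * \<bar>rep_L2 x t\<bar>" for n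
        using F(3) by (intro AE_I2) (simp add: dist_real_def)
    qed
    then show ?thesis using simple_V[OF F(1)] V_lim[of "\<lambda>i. abs_L2 (F i)" x] by simp
  qed
  then show ?thesis by (auto simp: V_def)
qed

instance L2 :: (euclidean_space) second_countable_topology
proof
  obtain \<B> :: "'a set set" where \<B>: "countable \<B>" "topological_basis \<B>"
    using ex_countable_basis by blast
  let ?S = "(\<lambda>F. abs_L2 (indicator (\<Union>F)) :: 'a L2) ` {F. finite F \<and> F \<subseteq> \<B>}"
  have cS: "countable ?S"
    using \<B>(1) countable_Collect_finite_subset[of \<B>] by simp
  obtain D :: "'a L2 set" where "countable D" "closure D = UNIV"
    using countable_dense_closure_span[OF cS closure_span_indicators_L2[OF \<B>]] by blast
  then show "\<exists>B::'a L2 set set. countable B \<and> open = generate_topology B"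
    by (rule second_countable_topologyI_dense)
qed

subsection \<open>Kernels on the product of two unit cubes\<close>

lemma unit_cube_prod:
  "(unit_cube :: ('a::euclidean_space \<times> 'b::euclidean_space) measure) =
     unit_cube \<Otimes>\<^sub>M unit_cube"
proof (rule pair_measure_eqI[symmetric])
  let ?A = "cbox 0 One :: 'a set" and ?B = "cbox 0 One :: 'b set"
  have One: "(One :: 'a \<times> 'b) = (One, One)"
  proof (rule euclidean_eqI)
    fix i :: "'a \<times> 'b" assume i: "i \<in> Basis"
    have "(One :: 'a \<times> 'b) \<bullet> i = 1" using i by (rule inner_sum_Basis)
    moreover have "(One :: 'a, One :: 'b) \<bullet> i = 1"
      using i by (auto simp: Basis_prod_def inner_sum_Basis)
    ultimately show "(One :: 'a \<times> 'b) \<bullet> i = (One, One) \<bullet> i" by simp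
  qed
  then have cube: "cbox 0 (One :: 'a \<times> 'b) = ?A \<times> ?B"
    by (simp add: zero_prod_def cbox_Pair_eq)
  show "sigma_finite_measure (unit_cube :: 'a measure)" "sigma_finite_measure (unit_cube :: 'b measure)"
    by (rule unit_cube.sigma_finite_measure_axioms)+
  have sp: "space (unit_cube :: 'a measure) = ?A" "space (unit_cube :: 'b measure) = ?B"
    "space (unit_cube :: ('a \<times> 'b) measure) = ?A \<times> ?B"
    by (simp_all add: unit_cube_def cube[symmetric] space_restrict_space)
  have rect: "X \<times> Y \<in> sets (unit_cube :: ('a \<times> 'b) measure)"
    if XY: "X \<in> sets (unit_cube :: 'a measure)" "Y \<in> sets (unit_cube :: 'b measure)" for X Y
  proof -
    have "X \<in> sets borel" "Y \<in> sets borel" using XY by (auto intro: sets_unit_cube_borel)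
    then have "X \<times> Y \<in> sets (borel :: ('a \<times> 'b) measure)" by (rule borel_Times)
    moreover have "X \<times> Y \<subseteq> cbox 0 (One :: 'a \<times> 'b)"
      using sets.sets_into_space[OF XY(1)] sets.sets_into_space[OF XY(2)]
      unfolding sp cube by auto
    ultimately show ?thesis by (simp add: unit_cube_def sets_restrict_space_iff)
  qed
  show "sets ((unit_cube :: 'a measure) \<Otimes>\<^sub>M (unit_cube :: 'b measure)) = sets unit_cube"
  proof
    show "sets ((unit_cube :: 'a measure) \<Otimes>\<^sub>M (unit_cube :: 'b measure)) \<subseteq> sets unit_cube"
      unfolding sets_pair_measure sp
      by (rule sets.sigma_sets_subset'[of _ unit_cube, unfolded sp])
        (use rect sets.top[of "unit_cube :: ('a \<times> 'b) measure"] in \<open>auto simp: sp\<close>)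
    show "sets unit_cube \<subseteq> sets ((unit_cube :: 'a measure) \<Otimes>\<^sub>M (unit_cube :: 'b measure))"
    proof
      fix C :: "('a \<times> 'b) set" assume C': "C \<in> sets unit_cube"
      have C: "C \<in> sets borel" "C \<subseteq> ?A \<times> ?B"
        using sets_unit_cube_borel[OF C'] sets.sets_into_space[OF C'] by (simp_all add: sp)
      have "(\<lambda>p. (fst p, snd p)) \<in> (unit_cube \<Otimes>\<^sub>M unit_cube) \<rightarrow>\<^sub>M (borel \<Otimes>\<^sub>M borel :: ('a \<times> 'b) measure)"
      proof (rule measurable_Pair)
        have "(\<lambda>x. x) \<in> borel_measurable (unit_cube :: 'a measure)"
          by (rule borel_measurable_unit_cubeI) simp
        then show "fst \<in> borel_measurable ((unit_cube :: 'a measure) \<Otimes>\<^sub>M (unit_cube :: 'b measure))"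
          using measurable_compose[OF measurable_fst] by blast
        have "(\<lambda>x. x) \<in> borel_measurable (unit_cube :: 'b measure)"
          by (rule borel_measurable_unit_cubeI) simp
        then show "snd \<in> borel_measurable ((unit_cube :: 'a measure) \<Otimes>\<^sub>M (unit_cube :: 'b measure))"
          using measurable_compose[OF measurable_snd] by blast
      qed
      then have "(\<lambda>p. (fst p, snd p)) -` C \<inter> space ((unit_cube :: 'a measure) \<Otimes>\<^sub>M (unit_cube :: 'b measure))
          \<in> sets (unit_cube \<Otimes>\<^sub>M unit_cube)"
        by (rule measurable_sets) (unfold borel_prod, rule C(1))
      moreover have "(\<lambda>p. (fst p, snd p)) -` C \<inter>
          space ((unit_cube :: 'a measure) \<Otimes>\<^sub>M (unit_cube :: 'b measure)) = C"
        using C(2) by (auto simp: space_pair_measure sp)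
      ultimately show "C \<in> sets ((unit_cube :: 'a measure) \<Otimes>\<^sub>M (unit_cube :: 'b measure))"
        by simp
    qed
  qed
  fix X :: "'a set" and Y :: "'b set"
  assume XY: "X \<in> sets unit_cube" "Y \<in> sets unit_cube"
  then have b: "X \<in> sets borel" "Y \<in> sets borel" by (auto intro: sets_unit_cube_borel)
  have sub: "X \<subseteq> ?A" "Y \<subseteq> ?B"
    using sets.sets_into_space[OF XY(1)] sets.sets_into_space[OF XY(2)] by (simp_all add: sp)
  have "emeasure (unit_cube :: ('a \<times> 'b) measure) (X \<times> Y) = emeasure lborel (X \<times> Y)"
    unfolding unit_cube_def
  proof (rule emeasure_restrict_space)
    show "X \<times> Y \<subseteq> cbox 0 One" unfolding cube using sub by auto
  qed simp
  also have "\<dots> = emeasure (lborel \<Otimes>\<^sub>M lborel) (X \<times> Y)" by (simp add: lborel_prod)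
  also have "\<dots> = emeasure lborel X * emeasure lborel Y"
    using b by (intro lborel.emeasure_pair_measure_Times) auto
  also have "\<dots> = emeasure unit_cube X * emeasure unit_cube Y"
    unfolding unit_cube_def using sub by (simp add: emeasure_restrict_space)
  finally show "emeasure unit_cube X * emeasure unit_cube Y =
      emeasure (unit_cube :: ('a \<times> 'b) measure) (X \<times> Y)" ..
qed

lemma square_integrable_tensor:
  fixes f :: "'a::euclidean_space \<Rightarrow> real" and g :: "'b::euclidean_space \<Rightarrow> real"
  assumes f: "square_integrable f" and g: "square_integrable g"
  shows "square_integrable (\<lambda>(s, t). f s * g t)"
proof -
  interpret P: pair_sigma_finite "unit_cube :: 'a measure" "unit_cube :: 'b measure" ..
  have m [measurable]: "f \<in> borel_measurable unit_cube" "g \<in> borel_measurable unit_cube"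
    using f g by (auto dest: square_integrableD)
  have "integrable (unit_cube \<Otimes>\<^sub>M unit_cube) (\<lambda>p. (f (fst p))\<^sup>2 * (g (snd p))\<^sup>2)"
  proof (rule P.Fubini_integrable)
    show "integrable unit_cube (\<lambda>x. LINT y|unit_cube. norm ((f (fst (x, y)))\<^sup>2 * (g (snd (x, y)))\<^sup>2))"
      using f by (simp add: square_integrable_def)
    show "AE x in unit_cube. integrable unit_cube (\<lambda>y. (f (fst (x, y)))\<^sup>2 * (g (snd (x, y)))\<^sup>2)"
      using g by (simp add: square_integrable_def)
  qed measurable
  then show ?thesis
    unfolding square_integrable_def unit_cube_prod
    by (simp add: case_prod_beta power_mult_distrib)
qed

text \<open>The kernel \<open>(x \<otimes> y)(s, t) = x(s) y(t)\<close>.\<close>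

lift_definition tensor :: "'a::euclidean_space L2 \<Rightarrow> 'b::euclidean_space L2 \<Rightarrow> ('a \<times> 'b) L2" is
  "\<lambda>f g (s, t). f s * g t"
proof (intro conjI)
  fix f f' :: "'a \<Rightarrow> real" and g g' :: "'b \<Rightarrow> real"
  assume f: "square_integrable f \<and> square_integrable f' \<and> (AE x in unit_cube. f x = f' x)"
    and g: "square_integrable g \<and> square_integrable g' \<and> (AE x in unit_cube. g x = g' x)"
  show "square_integrable (\<lambda>(s, t). f s * g t)" "square_integrable (\<lambda>(s, t). f' s * g' t)"
    using f g by (auto intro: square_integrable_tensor)
  interpret P: pair_sigma_finite "unit_cube :: 'a measure" "unit_cube :: 'b measure" ..
  have m [measurable]: "f \<in> borel_measurable unit_cube" "f' \<in> borel_measurable unit_cube"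
    "g \<in> borel_measurable unit_cube" "g' \<in> borel_measurable unit_cube"
    using f g by (auto dest: square_integrableD)
  have "AE p in unit_cube \<Otimes>\<^sub>M unit_cube. f (fst p) * g (snd p) = f' (fst p) * g' (snd p)"
  proof (rule P.AE_pair_measure)
    show "AE s in unit_cube. AE t in unit_cube.
        f (fst (s, t)) * g (snd (s, t)) = f' (fst (s, t)) * g' (snd (s, t))"
      using f g by auto
  qed measurable
  then show "AE p in unit_cube. (case p of (s, t) \<Rightarrow> f s * g t) = (case p of (s, t) \<Rightarrow> f' s * g' t)"
    unfolding case_prod_beta by (subst unit_cube_prod)
qed


section \<open>Random elements and processes\<close>

definition in_Lp :: "'w measure \<Rightarrow> real \<Rightarrow> ('w \<Rightarrow> 'h::real_normed_vector) \<Rightarrow> bool" where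
  "in_Lp M p X \<longleftrightarrow> X \<in> borel_measurable M \<and> integrable M (\<lambda>\<omega>. norm (X \<omega>) powr p)"

definition v_norm :: "'w measure \<Rightarrow> real \<Rightarrow> ('w \<Rightarrow> 'h::real_normed_vector) \<Rightarrow> real" where
  "v_norm M p X = (\<integral>\<omega>. norm (X \<omega>) powr p \<partial>M) powr (1 / p)"

definition strictly_stationary ::
    "'w measure \<Rightarrow> (int \<Rightarrow> 'w \<Rightarrow> 'h::topological_space) \<Rightarrow> bool" where
  "strictly_stationary M X \<longleftrightarrow>
     (\<forall>J k. finite J \<longrightarrow>
        distr M (\<Pi>\<^sub>M j\<in>J. borel) (\<lambda>\<omega>. \<lambda>j\<in>J. X (j + k) \<omega>) =
        distr M (\<Pi>\<^sub>M j\<in>J. borel) (\<lambda>\<omega>. \<lambda>j\<in>J. X j \<omega>))"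

text \<open>
  \<open>X T t\<close> is the triangular array and \<open>Y u\<close> is the stationary process associated
  with \<open>u\<close>. The moment bound is stated for the Lebesgue integral with values in
  \<open>[0, \<infinity>]\<close>, so it includes finiteness of the moment.
\<close>

definition locally_stationary ::
    "'w measure \<Rightarrow> real \<Rightarrow> real \<Rightarrow> (nat \<Rightarrow> nat \<Rightarrow> 'w \<Rightarrow> 'h::real_normed_vector) \<Rightarrow>
     (real \<Rightarrow> int \<Rightarrow> 'w \<Rightarrow> 'h) \<Rightarrow> bool" where
  "locally_stationary M p \<rho> X Y \<longleftrightarrow>
     (\<forall>T\<ge>1. \<forall>t\<in>{1..T}. in_Lp M p (X T t)) \<and>
     (\<forall>u\<in>{0..1}. (\<forall>t. in_Lp M p (Y u t)) \<and> strictly_stationary M (Y u)) \<and>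
     \<rho> > 0 \<and>
     (\<exists>(C :: real) (U :: real \<Rightarrow> nat \<Rightarrow> nat \<Rightarrow> 'w \<Rightarrow> real).
        \<forall>u\<in>{0..1}. \<forall>T\<ge>1. \<forall>t\<in>{1..T}.
          U u T t \<in> borel_measurable M \<and>
          (\<forall>\<omega>\<in>space M. U u T t \<omega> > 0) \<and>
          (\<integral>\<^sup>+\<omega>. ennreal (U u T t \<omega> powr \<rho>) \<partial>M) < ennreal C \<and>
          (AE \<omega> in M. norm (X T t \<omega> - Y u (int t) \<omega>) \<le>
             (\<bar>real t / real T - u\<bar> + 1 / real T) * U u T t \<omega>))"

definition iid_family :: "'w measure \<Rightarrow> 's measure \<Rightarrow> (int \<Rightarrow> 'w \<Rightarrow> 's) \<Rightarrow> bool" where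
  "iid_family M S \<epsilon> \<longleftrightarrow>
     prob_space.indep_vars M (\<lambda>_. S) \<epsilon> UNIV \<and>
     (\<forall>j. distr M S (\<epsilon> j) = distr M S (\<epsilon> 0))"

text \<open>
  The sequences \<open>\<epsilon>' t m\<close>, for \<open>t \<in> \<int>\<close> and \<open>m \<ge> 1\<close>, have the same law as \<open>\<epsilon>\<close>, and the
  sequence \<open>\<epsilon>\<close> (index \<open>None\<close>) together with all the sequences \<open>\<epsilon>' t m\<close> is an
  independent family.
\<close>

definition independent_copies ::
    "'w measure \<Rightarrow> 's measure \<Rightarrow> (int \<Rightarrow> 'w \<Rightarrow> 's) \<Rightarrow>
     (int \<Rightarrow> nat \<Rightarrow> int \<Rightarrow> 'w \<Rightarrow> 's) \<Rightarrow> bool" where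
  "independent_copies M S \<epsilon> \<epsilon>' \<longleftrightarrow>
     (\<forall>t. \<forall>m\<ge>1. distr M (\<Pi>\<^sub>M k\<in>UNIV. S) (\<lambda>\<omega> k. \<epsilon>' t m k \<omega>) =
                distr M (\<Pi>\<^sub>M k\<in>UNIV. S) (\<lambda>\<omega> k. \<epsilon> k \<omega>)) \<and>
     prob_space.indep_vars M (\<lambda>_. \<Pi>\<^sub>M k\<in>UNIV. S)
       (\<lambda>i \<omega> k. case i of None \<Rightarrow> \<epsilon> k \<omega> | Some (t, m) \<Rightarrow> \<epsilon>' t m k \<omega>)
       (insert None (Some ` (UNIV \<times> {1..})))"

text \<open>
  In \<open>f (\<lambda>j. \<dots>)\<close> the argument with index \<open>j\<close> is the innovation at time \<open>t - j\<close>;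
  \<open>coupled f \<epsilon> \<epsilon>' m t\<close> is the process written \<open>X\<^sub>m\<^sub>,\<^sub>t\<close>, where the innovations with
  \<open>j \<ge> m\<close> are replaced by those of the copy belonging to \<open>t\<close> and \<open>m\<close>.
\<close>

definition coupled ::
    "((nat \<Rightarrow> 's) \<Rightarrow> 'h) \<Rightarrow> (int \<Rightarrow> 'w \<Rightarrow> 's) \<Rightarrow> (int \<Rightarrow> nat \<Rightarrow> int \<Rightarrow> 'w \<Rightarrow> 's) \<Rightarrow>
     nat \<Rightarrow> int \<Rightarrow> 'w \<Rightarrow> 'h" where
  "coupled f \<epsilon> \<epsilon>' m t \<omega> =
     f (\<lambda>j. if j < m then \<epsilon> (t - int j) \<omega> else \<epsilon>' t m (t - int j) \<omega>)"

definition Lp_m_approximable ::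
    "'w measure \<Rightarrow> 's measure \<Rightarrow> real \<Rightarrow> (int \<Rightarrow> 'w \<Rightarrow> 'h::real_normed_vector) \<Rightarrow> bool" where
  "Lp_m_approximable M S p X \<longleftrightarrow>
     (\<forall>t. in_Lp M p (X t)) \<and>
     (\<exists>f \<epsilon> \<epsilon>'.
        f \<in> borel_measurable (\<Pi>\<^sub>M j\<in>(UNIV :: nat set). S) \<and>
        iid_family M S \<epsilon> \<and> independent_copies M S \<epsilon> \<epsilon>' \<and>
        (\<forall>t. AE \<omega> in M. X t \<omega> = f (\<lambda>j. \<epsilon> (t - int j) \<omega>)) \<and>
        (\<forall>t. summable (\<lambda>m. v_norm M p (\<lambda>\<omega>. X t \<omega> - coupled f \<epsilon> \<epsilon>' (Suc m) t \<omega>))))"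


section \<open>Covariance kernels, Gaussian elements, convergence in distribution\<close>

text \<open>
  The kernel \<open>(s\<^sub>1, s\<^sub>2) \<mapsto> E[X(s\<^sub>1) Y(s\<^sub>2)]\<close>. Elements of \<open>L2\<close> have no point values, so
  the expectation is the Bochner integral of the product kernel in \<open>L2\<close> of the
  product cube.
\<close>

definition cov_kernel ::
    "'w measure \<Rightarrow> ('w \<Rightarrow> 'a::euclidean_space L2) \<Rightarrow> ('w \<Rightarrow> 'a L2) \<Rightarrow> ('a \<times> 'a) L2" where
  "cov_kernel M X Y = (\<integral>\<omega>. tensor (X \<omega>) (Y \<omega>) \<partial>M)"

text \<open>The second series has the terms \<open>(s\<^sub>1, s\<^sub>2) \<mapsto> E[X\<^sub>0(s\<^sub>2) X\<^sub>t(s\<^sub>1)]\<close>.\<close>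

definition long_run_cov ::
    "'w measure \<Rightarrow> (int \<Rightarrow> 'w \<Rightarrow> 'a::euclidean_space L2) \<Rightarrow> ('a \<times> 'a) L2" where
  "long_run_cov M X =
     cov_kernel M (X 0) (X 0) +
     (\<Sum>t. cov_kernel M (X 0) (X (int (Suc t)))) +
     (\<Sum>t. cov_kernel M (X (int (Suc t))) (X 0))"

text \<open>Degenerate (constant) real Gaussian variables are included, as \<open>\<sigma> = 0\<close>.\<close>

definition normal_law :: "real \<Rightarrow> real \<Rightarrow> real measure" where
  "normal_law \<mu> \<sigma> =
     (if \<sigma> = 0 then return borel \<mu> else density lborel (\<lambda>x. ennreal (normal_density \<mu> \<sigma> x)))"

definition gaussian_element :: "'w measure \<Rightarrow> ('w \<Rightarrow> 'h::real_inner) \<Rightarrow> bool" where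
  "gaussian_element M G \<longleftrightarrow>
     G \<in> borel_measurable M \<and>
     (\<forall>x. \<exists>\<mu> \<sigma>. \<sigma> \<ge> 0 \<and> distr M borel (\<lambda>\<omega>. G \<omega> \<bullet> x) = normal_law \<mu> \<sigma>)"

definition converges_in_distribution ::
    "'w measure \<Rightarrow> (nat \<Rightarrow> 'w \<Rightarrow> 'h::topological_space) \<Rightarrow> 'v measure \<Rightarrow> ('v \<Rightarrow> 'h) \<Rightarrow> bool" where
  "converges_in_distribution M Z N G \<longleftrightarrow>
     (\<forall>\<phi> :: 'h \<Rightarrow> real. continuous_on UNIV \<phi> \<and> bounded (range \<phi>) \<longrightarrow>
        (\<lambda>n. \<integral>\<omega>. \<phi> (Z n \<omega>) \<partial>M) \<longlonglongrightarrow> (\<integral>\<omega>. \<phi> (G \<omega>) \<partial>N))"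

definition kernel_mean ::
    "(real \<Rightarrow> real) \<Rightarrow> (nat \<Rightarrow> real) \<Rightarrow> (nat \<Rightarrow> nat \<Rightarrow> 'w \<Rightarrow> 'h::real_vector) \<Rightarrow>
     real \<Rightarrow> nat \<Rightarrow> 'w \<Rightarrow> 'h" where
  "kernel_mean K h X u T \<omega> =
     (1 / (real T * h T)) *\<^sub>R (\<Sum>t=1..T. K ((u - real t / real T) / h T) *\<^sub>R X T t \<omega>)"

end

theory Submission
  imports Defs
begin

text \<open>
  Since \<open>T h\<^sup>3 \<rightarrow> 0\<close>, local stationarity lets us replace \<open>X\<^sub>t\<^sub>,\<^sub>T\<close> by the stationary process
  \<open>X\<^sub>t\<^sup>(\<^sup>u\<^sup>)\<close>. Cut the time axis into blocks of a fixed length \<open>q\<close> and replace, inside each block,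
  the innovations before the block by independent copies. The block sums become independent and
  identically distributed. With \<open>\<delta>\<^sub>k\<close> the \<open>L\<^sup>2\<close> distance between \<open>X\<^sub>t\<^sup>(\<^sup>u\<^sup>)\<close> and its coupling at lag \<open>k\<close>,
  the errors at times \<open>s < t\<close> in different blocks have a covariance bounded by \<open>\<delta>\<^sub>i \<delta>\<^sub>t\<^sub>-\<^sub>s\<close>, where \<open>i\<close>
  is the position of \<open>s\<close> in its block. Summability of \<open>\<delta>\<close> therefore bounds the
  error in \<open>L\<^sup>2\<close> by a multiple of \<open>1 / \<surd>q\<close>, uniformly in large \<open>T\<close>. The kernel weights vary slowly, so
  they may be frozen on each block, and characteristic functions of weighted sums of i.i.d.
  variables give the limit for fixed \<open>q\<close>; then \<open>q \<rightarrow> \<infinity>\<close>.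

  The same approximation yields tightness: the part of the sum outside the span of finitely many
  basis vectors is small uniformly in \<open>T\<close>. Together with the convergence of characteristic
  functions and the Stone-Weierstrass theorem for trigonometric functions on compact sets this
  gives convergence in distribution. The Gaussian limit is built from white noise by a Cholesky
  decomposition of its covariance in an orthonormal basis.
\<close>

section \<open>Orthonormal expansions\<close>

text \<open>The hypothesis supplies a separate copy for each pair of time and lag, so two times in
  one block see different pasts. The block sums are still exactly independent, without gaps between
  the blocks, because copies attached to different times are independent; but their variance has no
  direct formula. It is compared with the variance of the plain partial sum of length
  \<open>q\<close>. The two sums differ in L^2 by at most \<open>2 * \<Delta>\<close>, which is
  negligible against sqrt q, and the latter variance divided by \<open>q\<close> is a Cesaro mean
  that converges to the long-run variance.

  Approximation of the weighted sums is measured in mean norm. This suffices for characteristic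
  functions, as exp(i x) is 1-Lipschitz, and for the residual outside a finite span. About T h
  weights of size 1 / sqrt (T h) multiply local stationarity errors of order h + 1/T, and sqrt (T h)
  (h + 1/T) = sqrt (T h^3) + sqrt (h / T): this is where the upper restriction on the bandwidth
  comes from.\<close>

fun gram_schmidt :: "(nat \<Rightarrow> 'h::real_inner) \<Rightarrow> nat \<Rightarrow> 'h" where
  "gram_schmidt d n =
     sgn (d n - (\<Sum>k<n. (d n \<bullet> gram_schmidt d k) *\<^sub>R gram_schmidt d k))"

declare gram_schmidt.simps [simp del]

text \<open>The vectors are orthonormal up to zero vectors, so that linearly dependent input
  and finite dimension need no separate treatment.\<close>

lemma gram_schmidt_norm:
  "gram_schmidt d n \<bullet> gram_schmidt d n = (if gram_schmidt d n = 0 then 0 else 1)"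
  by (subst (1 2 3) gram_schmidt.simps) (simp add: dot_square_norm norm_sgn sgn_zero_iff)

text \<open>In the inner product of the subtracted projection with an earlier vector, induction
  leaves only the summand \<open>k = j\<close>, and it cancels
  \<open>d i \<bullet> gram_schmidt d j\<close>. If the earlier vector is zero, both terms are
  zero.\<close>

lemma gram_schmidt_orthogonal_less:
  "j < i \<Longrightarrow> gram_schmidt d i \<bullet> gram_schmidt d j = 0"
proof (induction i arbitrary: j rule: less_induct)
  case (less i)
  let ?g = "gram_schmidt d"
  have "(\<Sum>k<i. (d i \<bullet> ?g k) *\<^sub>R ?g k) \<bullet> ?g j = (\<Sum>k<i. if k = j then d i \<bullet> ?g j else 0)"
    unfolding inner_sum_left
  proof (intro sum.cong refl)
    fix k assume "k \<in> {..<i}"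
    moreover have "?g k \<bullet> ?g j = 0" if "k < i" "k \<noteq> j" for k
      using that less.prems less.IH[of k j] less.IH[of j k]
      by (cases j k rule: linorder_cases) (auto simp: inner_commute[of "?g j"])
    ultimately show "(d i \<bullet> ?g k) *\<^sub>R ?g k \<bullet> ?g j = (if k = j then d i \<bullet> ?g j else 0)"
      using gram_schmidt_norm[of d j] by auto
  qed
  also have "\<dots> = d i \<bullet> ?g j" using less.prems by simp
  finally show ?case
    by (subst gram_schmidt.simps) (simp add: sgn_div_norm inner_diff_left)
qed

text \<open>The coefficient along the new vector is the norm of the residual \<open>r\<close>, and
  \<open>norm r *\<^sub>R sgn r = r\<close> holds for \<open>r = 0\<close> too.\<close>

lemma gram_schmidt_expansion:
  "d n = (\<Sum>k<Suc n. (d n \<bullet> gram_schmidt d k) *\<^sub>R gram_schmidt d k)"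
proof -
  let ?g = "gram_schmidt d"
  define r where "r = d n - (\<Sum>k<n. (d n \<bullet> ?g k) *\<^sub>R ?g k)"
  have gn: "?g n = sgn r" by (subst gram_schmidt.simps) (simp add: r_def)
  have "(\<Sum>k<n. (d n \<bullet> ?g k) *\<^sub>R ?g k) \<bullet> ?g n = 0"
    unfolding inner_sum_left
    by (intro sum.neutral ballI)
       (simp add: inner_commute[of _ "?g n"] gram_schmidt_orthogonal_less)
  then have "d n \<bullet> ?g n = r \<bullet> ?g n"
    by (simp add: r_def inner_diff_left)
  also have "\<dots> = r \<bullet> sgn r" by (simp only: gn)
  also have "\<dots> = norm r"
    by (cases "r = 0") (simp_all add: sgn_div_norm dot_square_norm power2_eq_square)
  finally have "d n \<bullet> ?g n = norm r" .
  then have "(d n \<bullet> ?g n) *\<^sub>R ?g n = norm r *\<^sub>R sgn r" by (simp only: gn)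
  also have "\<dots> = r" by (cases "r = 0") (simp_all add: sgn_div_norm)
  finally have "(d n \<bullet> ?g n) *\<^sub>R ?g n = r" .
  then show ?thesis by (simp add: r_def)
qed

locale hilbert_basis =
  fixes b :: "nat \<Rightarrow> 'h::{real_inner, banach, second_countable_topology}"
  assumes inner_basis: "b i \<bullet> b j = (if i = j \<and> b i \<noteq> 0 then 1 else 0)"
    and expansion: "(\<lambda>n. \<Sum>k<n. (x \<bullet> b k) *\<^sub>R b k) \<longlonglongrightarrow> x"
begin

definition proj :: "nat \<Rightarrow> 'h \<Rightarrow> 'h" where
  "proj n x = (\<Sum>k<n. (x \<bullet> b k) *\<^sub>R b k)"

lemma proj_tendsto: "(\<lambda>n. proj n x) \<longlonglongrightarrow> x"
  unfolding proj_def by (rule expansion)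

lemma proj_add: "proj n (x + y) = proj n x + proj n y"
  by (simp add: proj_def inner_add_left scaleR_add_left sum.distrib)

lemma proj_diff: "proj n (x - y) = proj n x - proj n y"
  by (simp add: proj_def inner_diff_left scaleR_diff_left sum_subtractf)

lemma proj_scaleR: "proj n (c *\<^sub>R x) = c *\<^sub>R proj n x"
  by (simp add: proj_def scaleR_sum_right)

lemma proj_zero: "proj n 0 = 0"
  by (simp add: proj_def)

lemma inner_proj: "proj n x \<bullet> y = (\<Sum>k<n. (x \<bullet> b k) * (y \<bullet> b k))"
  by (simp add: proj_def inner_sum_left inner_commute[of "b _"])

lemma inner_proj_commute: "proj n x \<bullet> y = x \<bullet> proj n y"
  using inner_proj[of n x y] inner_proj[of n y x]
  by (simp add: inner_commute mult.commute)

text \<open>An inner product cannot recover a coefficient that stands in front of a zero vector,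
  hence the hypothesis on \<open>c\<close>.\<close>

lemma sum_orthogonal_inner:
  assumes "\<And>k. b k = 0 \<Longrightarrow> c k = 0"
  shows "(\<Sum>k\<in>{m..<n}. c k *\<^sub>R b k) \<bullet> b j = (if j \<in> {m..<n} then c j else 0)"
proof -
  have "(\<Sum>k\<in>{m..<n}. c k *\<^sub>R b k) \<bullet> b j = (\<Sum>k\<in>{m..<n}. if k = j then c j else 0)"
    unfolding inner_sum_left
    by (intro sum.cong refl) (use assms in \<open>auto simp: inner_basis\<close>)
  then show ?thesis by simp
qed

text \<open>Only an inequality: coefficients in front of zero vectors are lost on the left-hand
  side.\<close>

lemma norm_sum_orthogonal:
  "(norm (\<Sum>k\<in>{m..<n}. c k *\<^sub>R b k))\<^sup>2 \<le> (\<Sum>k\<in>{m..<n}. (c k)\<^sup>2)"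
proof -
  define c' where "c' k = (if b k = 0 then 0 else c k)" for k
  have eq: "(\<Sum>k\<in>{m..<n}. c k *\<^sub>R b k) = (\<Sum>k\<in>{m..<n}. c' k *\<^sub>R b k)"
    by (intro sum.cong) (auto simp: c'_def)
  have "(norm (\<Sum>k\<in>{m..<n}. c k *\<^sub>R b k))\<^sup>2 = (\<Sum>k\<in>{m..<n}. (c' k)\<^sup>2)"
    unfolding eq power2_norm_eq_inner
    by (subst inner_sum_right)
       (simp add: sum_orthogonal_inner c'_def power2_eq_square cong: if_cong)
  also have "\<dots> \<le> (\<Sum>k\<in>{m..<n}. (c k)\<^sup>2)"
    by (intro sum_mono) (auto simp: c'_def)
  finally show ?thesis .
qed

lemma proj_basis: "proj n x \<bullet> b j = (if j < n then x \<bullet> b j else 0)"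
  using sum_orthogonal_inner[of "\<lambda>k. x \<bullet> b k" 0 n j]
  by (auto simp: proj_def atLeast0LessThan)

lemma proj_proj: "proj n (proj n x) = proj n x"
  by (subst (1 2) proj_def) (auto intro!: sum.cong simp: proj_basis)

lemma norm_proj_Pythagoras: "(norm x)\<^sup>2 = (norm (proj n x))\<^sup>2 + (norm (x - proj n x))\<^sup>2"
proof -
  have "proj n x \<bullet> (x - proj n x) = 0"
    by (simp add: inner_proj_commute proj_diff proj_proj)
  then show ?thesis
    by (simp add: power2_norm_eq_inner inner_diff_left inner_diff_right inner_commute)
qed

lemma norm_proj_le: "norm (proj n x) \<le> norm x"
  and norm_minus_proj_le: "norm (x - proj n x) \<le> norm x"
  by (rule power2_le_imp_le; use norm_proj_Pythagoras[of x n] in simp)+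

lemma norm_proj_power2: "(norm (proj n x))\<^sup>2 = (\<Sum>k<n. (x \<bullet> b k)\<^sup>2)"
  unfolding power2_norm_eq_inner inner_proj[of n x "proj n x"]
  by (intro sum.cong) (auto simp: proj_basis power2_eq_square)

lemma bounded_linear_proj: "bounded_linear (proj n)"
  by (rule bounded_linear_intro[of _ 1]) (auto simp: proj_add proj_scaleR norm_proj_le)

lemma measurable_proj [measurable]: "proj n \<in> borel_measurable borel"
  by (rule borel_measurable_continuous_onI)
     (simp add: bounded_linear.linear linear_continuous_on bounded_linear_proj)

end

text \<open>Gram-Schmidt is applied to a dense sequence. \<open>p n\<close> fixes \<open>d k\<close>
  for \<open>k < n\<close>, and \<open>x - p n x\<close> is never longer than \<open>x\<close>; used
  for \<open>x - d k\<close>, this bounds the residual of \<open>x\<close> by its distance to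
  \<open>d k\<close>.\<close>

lemma hilbert_basis_exists:
  obtains b :: "nat \<Rightarrow> 'h::{real_inner, banach, second_countable_topology}"
  where "hilbert_basis b"
proof -
  obtain D :: "'h set" where D: "countable D" "\<And>U. open U \<Longrightarrow> U \<noteq> {} \<Longrightarrow> \<exists>d\<in>D. d \<in> U"
    using countable_dense_exists by blast
  have "D \<noteq> {}" using D(2)[of UNIV] by auto
  then obtain d :: "nat \<Rightarrow> 'h" where d: "range d = D"
    using D(1) uncountable_def[of D] by metis
  define b where "b = gram_schmidt d"
  have orth: "b i \<bullet> b j = (if i = j \<and> b i \<noteq> 0 then 1 else 0)" for i j
    using gram_schmidt_norm[of d i] gram_schmidt_orthogonal_less[of i j d]
      gram_schmidt_orthogonal_less[of j i d]
    by (cases i j rule: linorder_cases) (auto simp: b_def inner_commute)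
  define p where "p n x = (\<Sum>k<n. (x \<bullet> b k) *\<^sub>R b k)" for n x
  have p_b: "p n x \<bullet> b j = (if j < n then x \<bullet> b j else 0)" for n x j
  proof -
    have "p n x \<bullet> b j = (\<Sum>k<n. if k = j then x \<bullet> b j else 0)"
      unfolding p_def inner_sum_left by (intro sum.cong refl) (auto simp: orth)
    then show ?thesis by simp
  qed
  have p_norm: "norm (x - p n x) \<le> norm x" for n x
  proof -
    have "(x - p n x) \<bullet> p n x = (\<Sum>k<n. (x \<bullet> b k) * ((x - p n x) \<bullet> b k))"
      by (subst (2) p_def) (simp add: inner_sum_right)
    also have "\<dots> = 0" by (intro sum.neutral) (simp add: inner_diff_left p_b)
    finally have "(x - p n x) \<bullet> p n x = 0" .
    then have "x \<bullet> x = (x - p n x) \<bullet> (x - p n x) + p n x \<bullet> p n x"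
      by (simp add: algebra_simps inner_commute)
    then show ?thesis by (simp add: norm_le)
  qed
  have p_dense: "p n (d k) = d k" if "k < n" for n k
  proof -
    have "p n (d k) = p (Suc k) (d k)"
      unfolding p_def
    proof (rule sum.mono_neutral_right)
      show "\<forall>i\<in>{..<n} - {..<Suc k}. (d k \<bullet> b i) *\<^sub>R b i = 0"
      proof
        fix i assume i: "i \<in> {..<n} - {..<Suc k}"
        have "d k \<bullet> b i = (\<Sum>j<Suc k. (d k \<bullet> b j) *\<^sub>R b j) \<bullet> b i"
          using gram_schmidt_expansion[of d k] by (simp only: b_def)
        also have "\<dots> = 0"
          unfolding inner_sum_left by (rule sum.neutral) (use i in \<open>auto simp: orth\<close>)
        finally show "(d k \<bullet> b i) *\<^sub>R b i = 0" by simp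
      qed
    qed (use that in auto)
    then show ?thesis using gram_schmidt_expansion[of d k] by (simp add: p_def b_def)
  qed
  have "(\<lambda>n. p n x) \<longlonglongrightarrow> x" for x
  proof (rule LIMSEQ_I)
    fix e :: real assume e: "e > 0"
    obtain k where k: "d k \<in> ball x e" using D(2)[of "ball x e"] e d by auto
    have "norm (p n x - x) < e" if "n \<ge> Suc k" for n
    proof -
      have eq: "x - p n x = (x - d k) - p n (x - d k)"
        using p_dense[of k n] that
        by (simp add: p_def inner_diff_left scaleR_diff_left sum_subtractf)
      have "norm (x - p n x) \<le> norm (x - d k)"
        unfolding eq by (rule p_norm)
      then show ?thesis using k by (simp add: dist_norm norm_minus_commute)
    qed
    then show "\<exists>no. \<forall>n\<ge>no. norm (p n x - x) < e" by blast
  qed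
  then have "hilbert_basis b"
    by unfold_locales (auto simp: p_def orth)
  then show thesis by (rule that)
qed

section \<open>Weak convergence in a Hilbert space\<close>

text \<open>Only sums are built in, so that convergence of integrals passes through the induction.
  Closure under products, which Stone-Weierstrass demands, follows from the product-to-sum
  formulas.\<close>

inductive_set trig_algebra :: "('h::real_inner \<Rightarrow> real) set" where
  const: "(\<lambda>x. c) \<in> trig_algebra"
| cos: "(\<lambda>x. c * cos (x \<bullet> s)) \<in> trig_algebra"
| sin: "(\<lambda>x. c * sin (x \<bullet> s)) \<in> trig_algebra"
| add: "p \<in> trig_algebra \<Longrightarrow> q \<in> trig_algebra \<Longrightarrow> (\<lambda>x. p x + q x) \<in> trig_algebra"

lemma trig_algebra_cmult: "p \<in> trig_algebra \<Longrightarrow> (\<lambda>x. c * p x) \<in> trig_algebra"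
proof (induction rule: trig_algebra.induct)
  case (const c')
  show ?case by (rule trig_algebra.const)
next
  case (cos c' s)
  then show ?case using trig_algebra.cos[of "c * c'" s] by (simp add: mult.assoc)
next
  case (sin c' s)
  then show ?case using trig_algebra.sin[of "c * c'" s] by (simp add: mult.assoc)
next
  case (add p q)
  then show ?case using trig_algebra.add by (simp add: distrib_left)
qed

lemma trig_algebra_mult_cos:
  assumes "q \<in> trig_algebra"
  shows "(\<lambda>x. cos (x \<bullet> s) * q x) \<in> trig_algebra" "(\<lambda>x. sin (x \<bullet> s) * q x) \<in> trig_algebra"
  using assms
proof (induction rule: trig_algebra.induct)
  case (const c)
  show "(\<lambda>x. cos (x \<bullet> s) * c) \<in> trig_algebra" "(\<lambda>x. sin (x \<bullet> s) * c) \<in> trig_algebra"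
    using trig_algebra.cos[of c s] trig_algebra.sin[of c s] by (simp_all add: mult.commute)
next
  case (cos c t)
  have "(\<lambda>x. cos (x \<bullet> s) * (c * cos (x \<bullet> t))) =
      (\<lambda>x. c / 2 * cos (x \<bullet> (s - t)) + c / 2 * cos (x \<bullet> (s + t)))"
    by (simp add: fun_eq_iff inner_diff_right inner_add_right cos_diff cos_add field_simps)
  then show "(\<lambda>x. cos (x \<bullet> s) * (c * cos (x \<bullet> t))) \<in> trig_algebra"
    by (simp only: trig_algebra.add trig_algebra.cos)
  have "(\<lambda>x. sin (x \<bullet> s) * (c * cos (x \<bullet> t))) =
      (\<lambda>x. c / 2 * sin (x \<bullet> (s + t)) + c / 2 * sin (x \<bullet> (s - t)))"
    by (simp add: fun_eq_iff inner_diff_right inner_add_right sin_diff sin_add field_simps)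
  then show "(\<lambda>x. sin (x \<bullet> s) * (c * cos (x \<bullet> t))) \<in> trig_algebra"
    by (simp only: trig_algebra.add trig_algebra.sin)
next
  case (sin c t)
  have "(\<lambda>x. cos (x \<bullet> s) * (c * sin (x \<bullet> t))) =
      (\<lambda>x. c / 2 * sin (x \<bullet> (t + s)) + c / 2 * sin (x \<bullet> (t - s)))"
    by (simp add: fun_eq_iff inner_diff_right inner_add_right sin_diff sin_add field_simps)
  then show "(\<lambda>x. cos (x \<bullet> s) * (c * sin (x \<bullet> t))) \<in> trig_algebra"
    by (simp only: trig_algebra.add trig_algebra.sin)
  have "(\<lambda>x. sin (x \<bullet> s) * (c * sin (x \<bullet> t))) =
      (\<lambda>x. c / 2 * cos (x \<bullet> (s - t)) + (- c / 2) * cos (x \<bullet> (s + t)))"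
    by (simp add: fun_eq_iff inner_diff_right inner_add_right cos_diff cos_add field_simps)
  then show "(\<lambda>x. sin (x \<bullet> s) * (c * sin (x \<bullet> t))) \<in> trig_algebra"
    by (simp only: trig_algebra.add trig_algebra.cos)
next
  case (add p q)
  show "(\<lambda>x. cos (x \<bullet> s) * (p x + q x)) \<in> trig_algebra"
    "(\<lambda>x. sin (x \<bullet> s) * (p x + q x)) \<in> trig_algebra"
    unfolding distrib_left using add by (intro trig_algebra.add; simp)+
qed

lemma trig_algebra_mult:
  assumes "p \<in> trig_algebra" and q: "q \<in> trig_algebra"
  shows "(\<lambda>x. p x * q x) \<in> trig_algebra"
  using assms(1)
proof (induction rule: trig_algebra.induct)
  case (const c)
  then show ?case by (rule trig_algebra_cmult[OF q])
next
  case (cos c s)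
  then show ?case
    using trig_algebra_cmult[OF trig_algebra_mult_cos(1)[OF q], of c s] by (simp add: mult.assoc)
next
  case (sin c s)
  then show ?case
    using trig_algebra_cmult[OF trig_algebra_mult_cos(2)[OF q], of c s] by (simp add: mult.assoc)
next
  case (add p q)
  then show ?case unfolding distrib_right by (intro trig_algebra.add) auto
qed

lemma trig_algebra_continuous:
  "p \<in> trig_algebra \<Longrightarrow> continuous_on A p"
  by (induction rule: trig_algebra.induct) (auto intro!: continuous_intros)

lemma trig_algebra_bounded:
  "p \<in> trig_algebra \<Longrightarrow> \<exists>B. \<forall>x. \<bar>p x\<bar> \<le> B"
proof (induction rule: trig_algebra.induct)
  case (const c)
  then show ?case by auto
next
  case (cos c s)
  have "\<bar>c * cos (x \<bullet> s)\<bar> \<le> \<bar>c\<bar>" for x :: 'a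
    by (simp add: abs_mult mult_left_le)
  then show ?case by blast
next
  case (sin c s)
  have "\<bar>c * sin (x \<bullet> s)\<bar> \<le> \<bar>c\<bar>" for x :: 'a
    by (simp add: abs_mult mult_left_le)
  then show ?case by blast
next
  case (add p q)
  then obtain B C where "\<And>x. \<bar>p x\<bar> \<le> B" "\<And>x. \<bar>q x\<bar> \<le> C" by blast
  then have "\<bar>p x + q x\<bar> \<le> B + C" for x
    by (intro order_trans[OF abs_triangle_ineq] add_mono)
  then show ?case by blast
qed

lemma trig_algebra_polynomial:
  assumes "real_polynomial_function g" "p \<in> trig_algebra"
  shows "(\<lambda>x. g (p x)) \<in> trig_algebra"
  using assms(1)
proof (induction rule: real_polynomial_function.induct)
  case (linear g)
  then obtain c where "g = (\<lambda>x. x * c)"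
    by (metis real_bounded_linear)
  then show ?case using trig_algebra_cmult[OF assms(2), of c] by (simp add: mult.commute)
next
  case (const c)
  then show ?case by (rule trig_algebra.const)
next
  case (add f g)
  then show ?case by (intro trig_algebra.add)
next
  case (mult f g)
  then show ?case by (intro trig_algebra_mult)
qed

text \<open>The vector \<open>s\<close> is scaled so that the phases at \<open>x\<close> and
  \<open>y\<close> differ by exactly 1. If cosine and sine agreed at both points, the addition
  formula would give \<open>cos 1 = 1\<close>.\<close>

lemma trig_algebra_separating:
  fixes x y :: "'h::real_inner"
  assumes "x \<noteq> y"
  shows "\<exists>p\<in>trig_algebra. p x \<noteq> p y"
proof -
  define s where "s = (1 / (norm (x - y))\<^sup>2) *\<^sub>R (x - y)"
  have 1: "(x - y) \<bullet> s = 1"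
    using assms by (simp add: s_def power2_norm_eq_inner)
  show ?thesis
  proof (rule ccontr)
    assume *: "\<not> ?thesis"
    have "(\<lambda>x. 1 * cos (x \<bullet> s)) \<in> trig_algebra" "(\<lambda>x. 1 * sin (x \<bullet> s)) \<in> trig_algebra"
      by (rule trig_algebra.cos trig_algebra.sin)+
    with * have "cos (x \<bullet> s) = cos (y \<bullet> s)" "sin (x \<bullet> s) = sin (y \<bullet> s)" by fastforce+
    then have "cos ((x - y) \<bullet> s) = 1"
      by (simp add: inner_diff_left cos_diff)
    then have "cos (1::real) = 1" by (simp only: 1)
    then show False using cos_monotone_0_pi[of 0 1] pi_gt3 by simp
  qed
qed

text \<open>Stone-Weierstrass gives an approximation \<open>p\<close> on the compact set only. Composing
  \<open>p\<close> with a polynomial that is close to the clamping function on the range of \<open>p\<close>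
  keeps it in the algebra and bounds it on the whole space.\<close>

lemma trig_algebra_approximation:
  fixes \<phi> :: "'h::real_inner \<Rightarrow> real"
  assumes K: "compact K" and \<phi>: "continuous_on K \<phi>" and M: "\<And>x. \<bar>\<phi> x\<bar> \<le> M" and e: "e > 0"
  obtains p where "p \<in> trig_algebra" "\<And>x. x \<in> K \<Longrightarrow> \<bar>\<phi> x - p x\<bar> < e" "\<And>x. \<bar>p x\<bar> \<le> M + e"
proof -
  interpret function_ring_on trig_algebra K
  proof
    show "\<exists>f\<in>trig_algebra. f x \<noteq> f y" if "x \<in> K" "y \<in> K" "x \<noteq> y" for x y
      using trig_algebra_separating[OF that(3)] .
  qed (auto simp: K trig_algebra_continuous trig_algebra_mult intro: trig_algebra.const trig_algebra.add)
  have "e / 2 > 0" using e by simp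
  from Stone_Weierstrass_basic[OF \<phi> this]
  obtain p where p: "p \<in> trig_algebra" "\<And>x. x \<in> K \<Longrightarrow> \<bar>\<phi> x - p x\<bar> < e / 2" by blast
  obtain B where B: "\<And>x. \<bar>p x\<bar> \<le> B" using trig_algebra_bounded[OF p(1)] by blast
  define \<tau> where "\<tau> z = max (- M) (min M z)" for z :: real
  have M0: "M \<ge> 0" using M[of undefined] by simp
  have "continuous_on {-B..B} \<tau>" unfolding \<tau>_def by (intro continuous_intros)
  then obtain g where g: "real_polynomial_function g" "\<And>z. z \<in> {-B..B} \<Longrightarrow> \<bar>\<tau> z - g z\<bar> < e / 2"
    using Stone_Weierstrass_real_polynomial_function[of "{-B..B}" \<tau> "e / 2"] e by auto
  have g': "\<bar>\<tau> (p x) - g (p x)\<bar> < e / 2" for x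
    using g(2)[of "p x"] B[of x] by (simp add: abs_le_iff)
  show thesis
  proof (rule that)
    show "(\<lambda>x. g (p x)) \<in> trig_algebra" using trig_algebra_polynomial[OF g(1) p(1)] .
    show "\<bar>\<phi> x - g (p x)\<bar> < e" if "x \<in> K" for x
    proof -
      have "\<bar>\<phi> x - \<tau> (p x)\<bar> \<le> \<bar>\<phi> x - p x\<bar>" using M[of x] unfolding \<tau>_def by linarith
      then show ?thesis using g'[of x] p(2)[OF that] by linarith
    qed
    show "\<bar>g (p x)\<bar> \<le> M + e" for x
    proof -
      have "\<bar>\<tau> (p x)\<bar> \<le> M" using M0 unfolding \<tau>_def by linarith
      then show ?thesis using g'[of x] e by linarith
    qed
  qed
qed

text \<open>Balls are not compact in infinite dimension; these boxes, which contain the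
  finite-dimensional projections of a ball, take their place. Each induction step adds a segment,
  and a sum of two compact sets is compact.\<close>

lemma compact_span_box:
  fixes b :: "nat \<Rightarrow> 'h::real_normed_vector"
  shows "compact {\<Sum>k<n. c k *\<^sub>R b k |c. \<forall>k<n. \<bar>c k\<bar> \<le> R}"
proof (induction n)
  case 0
  have "{\<Sum>k<0. c k *\<^sub>R b k |c. \<forall>k<0. \<bar>c k\<bar> \<le> R} = {0 :: 'h}" by auto
  then show ?case by simp
next
  case (Suc n)
  have "compact ((\<lambda>r. r *\<^sub>R b n) ` {-R..R})"
    by (intro compact_continuous_image continuous_intros) auto
  from compact_sums[OF Suc this]
  have "compact {x + y |x y. x \<in> {\<Sum>k<n. c k *\<^sub>R b k |c. \<forall>k<n. \<bar>c k\<bar> \<le> R} \<and>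
      y \<in> (\<lambda>r. r *\<^sub>R b n) ` {-R..R}}" .
  also have "{x + y |x y. x \<in> {\<Sum>k<n. c k *\<^sub>R b k |c. \<forall>k<n. \<bar>c k\<bar> \<le> R} \<and>
      y \<in> (\<lambda>r. r *\<^sub>R b n) ` {-R..R}} =
      {\<Sum>k<Suc n. c k *\<^sub>R b k |c. \<forall>k<Suc n. \<bar>c k\<bar> \<le> R}" (is "?A = ?B")
  proof (intro equalityI subsetI)
    fix z assume "z \<in> ?A"
    then obtain x r where x: "x \<in> {\<Sum>k<n. c k *\<^sub>R b k |c. \<forall>k<n. \<bar>c k\<bar> \<le> R}"
      and r: "r \<in> {-R..R}" and z: "z = x + r *\<^sub>R b n" by blast
    from x obtain c where c: "\<forall>k<n. \<bar>c k\<bar> \<le> R" "x = (\<Sum>k<n. c k *\<^sub>R b k)" by blast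
    define c' where "c' = c(n := r)"
    have "z = (\<Sum>k<Suc n. c' k *\<^sub>R b k)" by (simp add: z c(2) c'_def)
    moreover have "\<forall>k<Suc n. \<bar>c' k\<bar> \<le> R" using c(1) r by (auto simp: c'_def less_Suc_eq)
    ultimately show "z \<in> ?B" by blast
  next
    fix z assume "z \<in> ?B"
    then obtain c where c: "\<forall>k<Suc n. \<bar>c k\<bar> \<le> R" "z = (\<Sum>k<Suc n. c k *\<^sub>R b k)" by blast
    have "c n \<in> {-R..R}" using c(1) by (auto simp: abs_le_iff dest!: spec[of _ n])
    moreover have "z = (\<Sum>k<n. c k *\<^sub>R b k) + c n *\<^sub>R b n" by (simp add: c(2))
    moreover have "\<forall>k<n. \<bar>c k\<bar> \<le> R" using c(1) by simp
    ultimately show "z \<in> ?A" by blast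
  qed
  finally show ?case .
qed

text \<open>The Pasch-Hausdorff envelope: for bounded \<open>\<phi>\<close> the largest function
  below \<open>\<phi>\<close> with Lipschitz constant \<open>n\<close>. It reduces continuous test
  functions to Lipschitz ones.\<close>

definition inf_convolution :: "('h::metric_space \<Rightarrow> real) \<Rightarrow> nat \<Rightarrow> 'h \<Rightarrow> real" where
  "inf_convolution \<phi> n x = (INF y. \<phi> y + real n * dist x y)"

context
  fixes \<phi> :: "'h::metric_space \<Rightarrow> real" and C :: real
  assumes bound: "\<And>x. \<bar>\<phi> x\<bar> \<le> C"
begin

lemma bdd_below_inf_convolution: "bdd_below (range (\<lambda>y. \<phi> y + real n * dist x y))"
proof (intro bdd_belowI[of _ "- C"], elim imageE)
  fix z y assume "z = \<phi> y + real n * dist x y"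
  moreover have "real n * dist x y \<ge> 0" by simp
  ultimately show "- C \<le> z" using bound[of y] by linarith
qed

lemma inf_convolution_le: "inf_convolution \<phi> n x \<le> \<phi> y + real n * dist x y"
  unfolding inf_convolution_def by (intro cINF_lower bdd_below_inf_convolution) simp

lemma inf_convolution_greatest:
  "(\<And>y. c \<le> \<phi> y + real n * dist x y) \<Longrightarrow> c \<le> inf_convolution \<phi> n x"
  unfolding inf_convolution_def by (intro cINF_greatest) auto

lemma inf_convolution_lipschitz:
  "\<bar>inf_convolution \<phi> n x - inf_convolution \<phi> n y\<bar> \<le> real n * dist x y"
proof -
  have "inf_convolution \<phi> n x - real n * dist x y \<le> inf_convolution \<phi> n y" for x y
  proof (rule inf_convolution_greatest)
    fix z
    have "real n * dist x z \<le> real n * (dist x y + dist y z)"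
      by (intro mult_left_mono dist_triangle) simp
    then show "inf_convolution \<phi> n x - real n * dist x y \<le> \<phi> z + real n * dist y z"
      using inf_convolution_le[of n x z] by (simp add: distrib_left)
  qed
  from this[of x y] this[of y x] show ?thesis
    by (simp add: dist_commute abs_le_iff)
qed

lemma inf_convolution_bound: "\<bar>inf_convolution \<phi> n x\<bar> \<le> C"
proof -
  have "- C \<le> inf_convolution \<phi> n x"
  proof (rule inf_convolution_greatest)
    fix y
    have "real n * dist x y \<ge> 0" by simp
    then show "- C \<le> \<phi> y + real n * dist x y" using bound[of y] by linarith
  qed
  then show ?thesis using inf_convolution_le[of n x x] bound[of x] by simp
qed

text \<open>Points within distance \<open>d\<close> of \<open>x\<close> lower the infimum by at most
  \<open>e / 2\<close>, by continuity. Farther away the penalty \<open>n * d\<close> exceeds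
  \<open>2 * C\<close>, the largest possible drop of \<open>\<phi>\<close>.\<close>

lemma inf_convolution_tendsto:
  assumes "isCont \<phi> x"
  shows "(\<lambda>n. inf_convolution \<phi> n x) \<longlonglongrightarrow> \<phi> x"
proof (rule LIMSEQ_I)
  fix e :: real assume e: "e > 0"
  then have "e / 2 > 0" by simp
  then obtain d where d: "d > 0" "\<And>y. dist y x < d \<Longrightarrow> dist (\<phi> y) (\<phi> x) < e / 2"
    using assms unfolding continuous_at_eps_delta by blast
  obtain m :: nat where m: "real m > 2 * C / d" using reals_Archimedean2 by blast
  show "\<exists>no. \<forall>n\<ge>no. norm (inf_convolution \<phi> n x - \<phi> x) < e"
  proof (intro exI allI impI)
    fix n assume "n \<ge> m"
    have "\<phi> x - e / 2 \<le> inf_convolution \<phi> n x"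
    proof (rule inf_convolution_greatest)
      fix y
      show "\<phi> x - e / 2 \<le> \<phi> y + real n * dist x y"
      proof (cases "dist y x < d")
        case True
        have "real n * dist x y \<ge> 0" by simp
        then show ?thesis using d(2)[OF True] unfolding dist_real_def by linarith
      next
        case False
        have "2 * C < real m * d" using m d(1) by (simp add: pos_divide_less_eq)
        also have "\<dots> \<le> real n * dist x y"
          using \<open>n \<ge> m\<close> False d(1) by (intro mult_mono) (auto simp: dist_commute)
        finally show ?thesis using bound[of x] bound[of y] e by linarith
      qed
    qed
    then show "norm (inf_convolution \<phi> n x - \<phi> x) < e"
      using inf_convolution_le[of n x x] e by simp
  qed
qed

end

lemma lipschitz_imp_borel_measurable:
  fixes \<phi> :: "'h::metric_space \<Rightarrow> real"
  assumes "\<And>x y. \<bar>\<phi> x - \<phi> y\<bar> \<le> L * dist x y"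
  shows "\<phi> \<in> borel_measurable borel"
proof -
  have "(max L 0)-lipschitz_on UNIV \<phi>"
  proof (rule lipschitz_onI)
    fix x y :: 'h
    have "L * dist x y \<le> max L 0 * dist x y" by (intro mult_right_mono) auto
    then show "dist (\<phi> x) (\<phi> y) \<le> max L 0 * dist x y"
      using assms[of x y] by (simp add: dist_real_def)
  qed simp
  then show ?thesis
    by (intro borel_measurable_continuous_onI lipschitz_on_continuous_on)
qed

text \<open>The envelopes lie below the test function and converge to it pointwise. Dominated
  convergence under \<open>N\<close> and convergence of the integrals of one envelope give the
  one-sided bound \<open>lower\<close>; applied to the negated function it yields the other
  side.\<close>

lemma converges_lipschitz_imp_continuous:
  fixes Z :: "nat \<Rightarrow> 'w \<Rightarrow> 'h::metric_space" and G :: "'v \<Rightarrow> 'h"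
  assumes M: "prob_space M" and N: "prob_space N"
    and Z: "\<And>n. Z n \<in> borel_measurable M" and G: "G \<in> borel_measurable N"
    and lip: "\<And>\<phi> L C. (\<And>x y. \<bar>\<phi> x - \<phi> y\<bar> \<le> L * dist x y) \<Longrightarrow> (\<And>x. \<bar>\<phi> x\<bar> \<le> C) \<Longrightarrow>
      (\<lambda>n. \<integral>\<omega>. \<phi> (Z n \<omega>) \<partial>M) \<longlonglongrightarrow> (\<integral>\<omega>. \<phi> (G \<omega>) \<partial>N)"
    and \<phi>: "continuous_on UNIV \<phi>" "bounded (range \<phi>)"
  shows "(\<lambda>n. \<integral>\<omega>. \<phi> (Z n \<omega>) \<partial>M) \<longlonglongrightarrow> (\<integral>\<omega>. (\<phi> (G \<omega>) :: real) \<partial>N)"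
proof -
  interpret M: prob_space M by fact
  interpret N: prob_space N by fact
  have int: "integrable M (\<lambda>\<omega>. \<psi> (Z n \<omega>))" "integrable N (\<lambda>\<omega>. \<psi> (G \<omega>))"
    if "\<psi> \<in> borel_measurable borel" "\<And>x. \<bar>\<psi> x\<bar> \<le> C" for \<psi> :: "'h \<Rightarrow> real" and C n
    using that Z[of n] G
    by (auto intro!: M.integrable_const_bound[where B = C] N.integrable_const_bound[where B = C])
  have lower: "\<forall>\<^sub>F n in sequentially. (\<integral>\<omega>. \<psi> (Z n \<omega>) \<partial>M) > (\<integral>\<omega>. \<psi> (G \<omega>) \<partial>N) - e"
    if \<psi>: "continuous_on UNIV \<psi>" and C: "\<And>x. \<bar>\<psi> x\<bar> \<le> C" and e: "e > 0"
    for \<psi> :: "'h \<Rightarrow> real" and C e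
  proof -
    let ?J = "inf_convolution \<psi>"
    have meas: "?J k \<in> borel_measurable borel" "\<psi> \<in> borel_measurable borel" for k
      using lipschitz_imp_borel_measurable[OF inf_convolution_lipschitz[of \<psi>, OF C]] \<psi>
      by (auto intro: borel_measurable_continuous_onI)
    have "(\<lambda>k. \<integral>\<omega>. ?J k (G \<omega>) \<partial>N) \<longlonglongrightarrow> (\<integral>\<omega>. \<psi> (G \<omega>) \<partial>N)"
    proof (rule integral_dominated_convergence)
      show "integrable N (\<lambda>\<omega>. C)" by simp
      show "AE x in N. (\<lambda>k. ?J k (G x)) \<longlonglongrightarrow> \<psi> (G x)"
        using \<psi> by (intro AE_I2 inf_convolution_tendsto[of \<psi>, OF C]) (simp add: continuous_on_eq_continuous_at)
      show "AE x in N. norm (?J k (G x)) \<le> C" for k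
        using inf_convolution_bound[of \<psi>, OF C] by simp
    qed (use G meas in auto)
    then have "\<forall>\<^sub>F k in sequentially. (\<integral>\<omega>. \<psi> (G \<omega>) \<partial>N) - e / 2 < (\<integral>\<omega>. ?J k (G \<omega>) \<partial>N)"
      by (rule order_tendstoD) (use e in simp)
    then obtain k where k: "(\<integral>\<omega>. \<psi> (G \<omega>) \<partial>N) - e / 2 < (\<integral>\<omega>. ?J k (G \<omega>) \<partial>N)"
      by (auto simp: eventually_sequentially)
    have "(\<lambda>n. \<integral>\<omega>. ?J k (Z n \<omega>) \<partial>M) \<longlonglongrightarrow> (\<integral>\<omega>. ?J k (G \<omega>) \<partial>N)"
      by (rule lip[OF inf_convolution_lipschitz[of \<psi>, OF C] inf_convolution_bound[of \<psi>, OF C]])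
    then have "\<forall>\<^sub>F n in sequentially. (\<integral>\<omega>. ?J k (G \<omega>) \<partial>N) - e / 2 < (\<integral>\<omega>. ?J k (Z n \<omega>) \<partial>M)"
      by (rule order_tendstoD) (use e in simp)
    then show ?thesis
    proof eventually_elim
      case (elim n)
      have "(\<integral>\<omega>. ?J k (Z n \<omega>) \<partial>M) \<le> (\<integral>\<omega>. \<psi> (Z n \<omega>) \<partial>M)"
      proof (rule integral_mono)
        show "?J k (Z n \<omega>) \<le> \<psi> (Z n \<omega>)" for \<omega>
          using inf_convolution_le[of \<psi>, OF C, of k "Z n \<omega>" "Z n \<omega>"] by simp
      qed (use int meas C inf_convolution_bound[of \<psi>, OF C] in blast)+
      with elim k show ?case by (simp add: field_simps)
    qed
  qed
  obtain C where C: "\<And>x. \<bar>\<phi> x\<bar> \<le> C"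
    using \<phi>(2) by (auto simp: bounded_iff)
  show ?thesis
  proof (rule LIMSEQ_I)
    fix e :: real assume e: "e > 0"
    have neg: "continuous_on UNIV (\<lambda>x. - \<phi> x)" using \<phi>(1) by (intro continuous_intros)
    have "\<forall>\<^sub>F n in sequentially. (\<integral>\<omega>. - \<phi> (Z n \<omega>) \<partial>M) > (\<integral>\<omega>. - \<phi> (G \<omega>) \<partial>N) - e"
      by (rule lower[OF neg _ e, of C]) (simp add: C)
    with lower[OF \<phi>(1) C e]
    have "\<forall>\<^sub>F n in sequentially. norm ((\<integral>\<omega>. \<phi> (Z n \<omega>) \<partial>M) - (\<integral>\<omega>. \<phi> (G \<omega>) \<partial>N)) < e"
      by eventually_elim (simp add: abs_less_iff)
    then show "\<exists>no. \<forall>n\<ge>no. norm ((\<integral>\<omega>. \<phi> (Z n \<omega>) \<partial>M) - (\<integral>\<omega>. \<phi> (G \<omega>) \<partial>N)) < e"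
      by (simp add: eventually_sequentially)
  qed
qed

section \<open>From characteristic functions and tightness to weak convergence\<close>

lemma trig_algebra_integral_tendsto:
  fixes Z :: "nat \<Rightarrow> 'w \<Rightarrow> 'h::{real_inner, second_countable_topology}" and G :: "'v \<Rightarrow> 'h"
  assumes M: "prob_space M" and N: "prob_space N"
    and Z: "\<And>n. Z n \<in> borel_measurable M" and G: "G \<in> borel_measurable N"
    and char: "\<And>s. (\<lambda>n. \<integral>\<omega>. iexp (Z n \<omega> \<bullet> s) \<partial>M) \<longlonglongrightarrow> (\<integral>\<omega>. iexp (G \<omega> \<bullet> s) \<partial>N)"
    and "p \<in> trig_algebra"
  shows "(\<lambda>n. \<integral>\<omega>. p (Z n \<omega>) \<partial>M) \<longlonglongrightarrow> (\<integral>\<omega>. p (G \<omega>) \<partial>N)"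
proof -
  interpret M: prob_space M by fact
  interpret N: prob_space N by fact
  note [measurable] = Z G
  have iM: "integrable M (\<lambda>\<omega>. iexp (Z n \<omega> \<bullet> s))" and iN: "integrable N (\<lambda>\<omega>. iexp (G \<omega> \<bullet> s))" for n s
    by (rule M.integrable_iexp N.integrable_iexp; simp)+
  have lim_cos: "(\<lambda>n. \<integral>\<omega>. cos (Z n \<omega> \<bullet> s) \<partial>M) \<longlonglongrightarrow> (\<integral>\<omega>. cos (G \<omega> \<bullet> s) \<partial>N)" for s
    using tendsto_Re[OF char[of s]]
    unfolding integral_Re[OF iM, symmetric] integral_Re[OF iN, symmetric] by (simp add: Re_exp)
  have lim_sin: "(\<lambda>n. \<integral>\<omega>. sin (Z n \<omega> \<bullet> s) \<partial>M) \<longlonglongrightarrow> (\<integral>\<omega>. sin (G \<omega> \<bullet> s) \<partial>N)" for s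
    using tendsto_Im[OF char[of s]]
    unfolding integral_Im[OF iM, symmetric] integral_Im[OF iN, symmetric] by (simp add: Im_exp)
  have int: "integrable M (\<lambda>\<omega>. p (Z n \<omega>))" "integrable N (\<lambda>\<omega>. p (G \<omega>))"
    if p: "p \<in> trig_algebra" for p n
  proof -
    obtain B where B: "\<And>x. \<bar>p x\<bar> \<le> B" using trig_algebra_bounded[OF p] by blast
    have [measurable]: "p \<in> borel_measurable borel"
      by (intro borel_measurable_continuous_onI trig_algebra_continuous p)
    show "integrable M (\<lambda>\<omega>. p (Z n \<omega>))" "integrable N (\<lambda>\<omega>. p (G \<omega>))"
      using B by (auto intro!: M.integrable_const_bound[where B = B] N.integrable_const_bound[where B = B])
  qed
  from \<open>p \<in> trig_algebra\<close> show ?thesis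
  proof (induction rule: trig_algebra.induct)
    case (const c)
    then show ?case by (simp add: M.prob_space N.prob_space)
  next
    case (cos c s)
    then show ?case by (simp add: tendsto_mult_left lim_cos)
  next
    case (sin c s)
    then show ?case by (simp add: tendsto_mult_left lim_sin)
  next
    case (add p q)
    then show ?case by (simp add: int tendsto_add)
  qed
qed

lemma (in hilbert_basis) proj_in_box:
  assumes "norm x \<le> R"
  shows "proj m x \<in> {\<Sum>k<m. c k *\<^sub>R b k |c. \<forall>k<m. \<bar>c k\<bar> \<le> R}"
proof -
  have "\<bar>x \<bullet> b k\<bar> \<le> R" for k
  proof -
    have "norm (b k) \<le> 1" using inner_basis[of k k] by (cases "b k = 0") (auto simp: norm_eq_sqrt_inner)
    then have "norm x * norm (b k) \<le> norm x" by (simp add: mult_left_le)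
    then show ?thesis using Cauchy_Schwarz_ineq2[of x "b k"] assms by linarith
  qed
  then show ?thesis
    unfolding proj_def mem_Collect_eq by (intro exI[of _ "\<lambda>k. x \<bullet> b k"]) simp
qed

text \<open>In infinite dimension convergence of characteristic functions to that of
  \<open>G\<close> does not by itself prevent mass from escaping, hence \<open>bdd\<close> and
  \<open>tight\<close>. Markov's inequality is built into the pointwise estimate \<open>pw\<close>,
  whose integral involves first moments only.\<close>

theorem (in hilbert_basis) weak_convergence_char:
  fixes Z :: "nat \<Rightarrow> 'w \<Rightarrow> 'h" and G :: "'v \<Rightarrow> 'h"
  assumes M: "prob_space M" and N: "prob_space N"
    and Z: "\<And>n. integrable M (Z n)" and G: "integrable N G"
    and char: "\<And>s. (\<lambda>n. \<integral>\<omega>. iexp (Z n \<omega> \<bullet> s) \<partial>M) \<longlonglongrightarrow> (\<integral>\<omega>. iexp (G \<omega> \<bullet> s) \<partial>N)"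
    and bdd: "\<forall>\<^sub>F n in sequentially. (\<integral>\<omega>. norm (Z n \<omega>) \<partial>M) \<le> B"
    and tight: "\<And>e. e > 0 \<Longrightarrow> \<exists>m0. \<forall>m\<ge>m0. \<forall>\<^sub>F n in sequentially.
      (\<integral>\<omega>. norm (Z n \<omega> - proj m (Z n \<omega>)) \<partial>M) \<le> e"
    and \<phi>: "continuous_on UNIV \<phi>" "bounded (range \<phi>)"
  shows "(\<lambda>n. \<integral>\<omega>. \<phi> (Z n \<omega>) \<partial>M) \<longlonglongrightarrow> (\<integral>\<omega>. (\<phi> (G \<omega>) :: real) \<partial>N)"
proof (rule converges_lipschitz_imp_continuous[OF M N _ _ _ \<phi>])
  interpret M: prob_space M by fact
  interpret N: prob_space N by fact
  show Zm [measurable]: "Z n \<in> borel_measurable M" for n using Z by auto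
  show Gm [measurable]: "G \<in> borel_measurable N" using G by auto
  fix \<phi> :: "'h \<Rightarrow> real" and L' C'
  assume L': "\<And>x y. \<bar>\<phi> x - \<phi> y\<bar> \<le> L' * dist x y" and C': "\<And>x. \<bar>\<phi> x\<bar> \<le> C'"
  define L where "L = max L' 1"
  define C where "C = max C' 0"
  have C: "\<bar>\<phi> x\<bar> \<le> C" for x using C'[of x] by (simp add: C_def)
  have L: "\<bar>\<phi> x - \<phi> y\<bar> \<le> L * dist x y" for x y
    using L'[of x y] mult_right_mono[of L' L "dist x y"] by (simp add: L_def)
  have L0: "L > 0" by (simp add: L_def)
  have C0: "C \<ge> 0" by (simp add: C_def)
  have \<phi>_m [measurable]: "\<phi> \<in> borel_measurable borel"
    using lipschitz_imp_borel_measurable[OF L] .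
  show "(\<lambda>n. \<integral>\<omega>. \<phi> (Z n \<omega>) \<partial>M) \<longlonglongrightarrow> (\<integral>\<omega>. \<phi> (G \<omega>) \<partial>N)"
  proof (rule LIMSEQ_I)
    fix e :: real assume e: "e > 0"
    \<comment> \<open>Errors of size \<open>3 * d\<close> arise from \<open>approx\<close> for
      \<open>Z\<close> and for \<open>G\<close>, and one \<open>d\<close> from the trigonometric
      limit, so \<open>7 * d < e\<close> suffices. The bound \<open>d \<le> 1\<close> makes the sum
      of the bounds of \<open>\<phi>\<close> and \<open>p\<close> at most
      \<open>2 * C + 1\<close>.\<close>
    define d where "d = min 1 (e / 8)"
    have d: "d > 0" "d \<le> 1" "d \<le> e / 8" using e by (auto simp: d_def)
    obtain m0 where m0: "\<And>m. m \<ge> m0 \<Longrightarrow> \<forall>\<^sub>F n in sequentially.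
        (\<integral>\<omega>. norm (Z n \<omega> - proj m (Z n \<omega>)) \<partial>M) \<le> d / L"
      using tight[of "d / L"] d L0 by auto
    have "(\<lambda>m. \<integral>\<omega>. norm (G \<omega> - proj m (G \<omega>)) \<partial>N) \<longlonglongrightarrow> (\<integral>\<omega>. 0 \<partial>N)"
    proof (rule integral_dominated_convergence)
      show "integrable N (\<lambda>\<omega>. norm (G \<omega>))" using G by simp
      show "AE x in N. (\<lambda>m. norm (G x - proj m (G x))) \<longlonglongrightarrow> 0"
      proof (rule AE_I2)
        fix x
        have "(\<lambda>m. norm (G x - proj m (G x))) \<longlonglongrightarrow> norm (G x - G x)"
          by (intro tendsto_intros proj_tendsto)
        then show "(\<lambda>m. norm (G x - proj m (G x))) \<longlonglongrightarrow> 0" by simp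
      qed
    qed (auto simp: norm_minus_proj_le)
    then have "\<forall>\<^sub>F m in sequentially. (\<integral>\<omega>. norm (G \<omega> - proj m (G \<omega>)) \<partial>N) < d / L"
      by (rule order_tendstoD) (use d L0 in simp)
    then obtain m1 where m1: "\<And>m. m \<ge> m1 \<Longrightarrow> (\<integral>\<omega>. norm (G \<omega> - proj m (G \<omega>)) \<partial>N) < d / L"
      by (auto simp: eventually_sequentially)
    define m where "m = max m0 m1"
    have mG: "(\<integral>\<omega>. norm (G \<omega> - proj m (G \<omega>)) \<partial>N) \<le> d / L"
      and mZ: "\<forall>\<^sub>F n in sequentially. (\<integral>\<omega>. norm (Z n \<omega> - proj m (Z n \<omega>)) \<partial>M) \<le> d / L"
      using m0[of m] m1[of m] by (auto simp: m_def)
    define B' where "B' = max 1 (max B (\<integral>\<omega>. norm (G \<omega>) \<partial>N))"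
    have B': "B' \<ge> B" "B' \<ge> (\<integral>\<omega>. norm (G \<omega>) \<partial>N)" "B' \<ge> 1" by (auto simp: B'_def)
    \<comment> \<open>With this radius the tail term \<open>(2 * C + 1) / R * B'\<close> of the
      integrated estimate becomes \<open>d\<close>.\<close>
    define R where "R = (2 * C + 1) * B' / d"
    have R: "R > 0" using C0 B' d by (simp add: R_def)
    obtain p where p: "p \<in> trig_algebra" "\<And>x. \<bar>p x\<bar> \<le> C + d"
      "\<And>x. x \<in> {\<Sum>k<m. c k *\<^sub>R b k |c. \<forall>k<m. \<bar>c k\<bar> \<le> R} \<Longrightarrow> \<bar>\<phi> x - p x\<bar> < d"
    proof (rule trig_algebra_approximation[OF compact_span_box[of b m R] _ C d(1)])
      have "(max L 0)-lipschitz_on UNIV \<phi>"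
        using L L0 by (intro lipschitz_onI) (auto simp: dist_real_def max_def)
      from lipschitz_on_continuous_on[OF this]
      show "continuous_on {\<Sum>k<m. c k *\<^sub>R b k |c. \<forall>k<m. \<bar>c k\<bar> \<le> R} \<phi>"
        by (rule continuous_on_subset) simp
    qed blast
    have [measurable]: "p \<in> borel_measurable borel"
      by (intro borel_measurable_continuous_onI trig_algebra_continuous p(1))
    \<comment> \<open>Outside the ball of radius \<open>R\<close> the trivial bound
      \<open>2 * C + 1\<close> is multiplied by \<open>norm z / R\<close>, which is at least 1
      there.\<close>
    have pw: "\<bar>\<phi> z - p (proj m z)\<bar> \<le> L * norm (z - proj m z) + d + (2 * C + 1) / R * norm z" for z
    proof -
      have 1: "\<bar>\<phi> z - \<phi> (proj m z)\<bar> \<le> L * norm (z - proj m z)"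
        using L[of z "proj m z"] by (simp add: dist_norm)
      have "\<bar>\<phi> (proj m z) - p (proj m z)\<bar> \<le> d + (2 * C + 1) / R * norm z"
      proof (cases "norm z \<le> R")
        case True
        have "0 \<le> (2 * C + 1) / R * norm z" using C0 R by simp
        then show ?thesis using p(3)[OF proj_in_box[OF True]] by linarith
      next
        case False
        have "(2 * C + 1) * 1 \<le> (2 * C + 1) * (norm z / R)"
          using False R C0 by (intro mult_left_mono) auto
        then have "2 * C + 1 \<le> (2 * C + 1) / R * norm z" by simp
        then show ?thesis using C[of "proj m z"] p(2)[of "proj m z"] d by linarith
      qed
      then show ?thesis using 1 by linarith
    qed
    have "2 * C + 1 \<noteq> 0" "B' \<noteq> 0" "d \<noteq> 0" using C0 B' d by auto
    then have R': "(2 * C + 1) / R * B' \<le> d" by (simp add: R_def)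
    have approx: "\<bar>(\<integral>\<omega>. \<phi> (F \<omega>) \<partial>Q) - (\<integral>\<omega>. p (proj m (F \<omega>)) \<partial>Q)\<bar> \<le> 3 * d"
      if Q: "prob_space Q" and F: "integrable Q F" "(\<integral>\<omega>. norm (F \<omega>) \<partial>Q) \<le> B'"
        "(\<integral>\<omega>. norm (F \<omega> - proj m (F \<omega>)) \<partial>Q) \<le> d / L" for Q :: "'q measure" and F
    proof -
      interpret Q: prob_space Q by fact
      have [measurable]: "F \<in> borel_measurable Q" using F by auto
      have i1: "integrable Q (\<lambda>\<omega>. \<phi> (F \<omega>))"
        by (rule Q.integrable_const_bound[where B = C]) (use C in auto)
      have i2: "integrable Q (\<lambda>\<omega>. p (proj m (F \<omega>)))"
        by (rule Q.integrable_const_bound[where B = "C + d"]) (use p(2) in auto)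
      have i3: "integrable Q (\<lambda>\<omega>. norm (F \<omega> - proj m (F \<omega>)))"
        by (rule Bochner_Integration.integrable_bound[OF F(1)]) (auto simp: norm_minus_proj_le)
      have "\<bar>(\<integral>\<omega>. \<phi> (F \<omega>) \<partial>Q) - (\<integral>\<omega>. p (proj m (F \<omega>)) \<partial>Q)\<bar> =
          \<bar>\<integral>\<omega>. \<phi> (F \<omega>) - p (proj m (F \<omega>)) \<partial>Q\<bar>" using i1 i2 by simp
      also have "\<dots> \<le> (\<integral>\<omega>. \<bar>\<phi> (F \<omega>) - p (proj m (F \<omega>))\<bar> \<partial>Q)"
        by (rule integral_abs_bound)
      also have "\<dots> \<le> (\<integral>\<omega>. L * norm (F \<omega> - proj m (F \<omega>)) + d + (2 * C + 1) / R * norm (F \<omega>) \<partial>Q)"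
        using i1 i2 i3 F(1) pw by (intro integral_mono) auto
      also have "\<dots> = L * (\<integral>\<omega>. norm (F \<omega> - proj m (F \<omega>)) \<partial>Q) + d
          + (2 * C + 1) / R * (\<integral>\<omega>. norm (F \<omega>) \<partial>Q)"
        using i3 F(1) by (simp add: Q.prob_space)
      also have "\<dots> \<le> L * (d / L) + d + (2 * C + 1) / R * B'"
        using F L0 C0 R by (intro add_mono mult_left_mono) auto
      also have "\<dots> \<le> 3 * d" using R' L0 by simp
      finally show ?thesis .
    qed
    have "(\<lambda>n. \<integral>\<omega>. p (proj m (Z n \<omega>)) \<partial>M) \<longlonglongrightarrow> (\<integral>\<omega>. p (proj m (G \<omega>)) \<partial>N)"
    proof (rule trig_algebra_integral_tendsto[OF M N, where p = p and Z = "\<lambda>n \<omega>. proj m (Z n \<omega>)"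
          and G = "\<lambda>\<omega>. proj m (G \<omega>)"])
      show "(\<lambda>n. \<integral>\<omega>. iexp (proj m (Z n \<omega>) \<bullet> s) \<partial>M) \<longlonglongrightarrow> (\<integral>\<omega>. iexp (proj m (G \<omega>) \<bullet> s) \<partial>N)" for s
        using char[of "proj m s"] by (simp add: inner_proj_commute)
    qed (auto intro: p(1))
    then have "\<forall>\<^sub>F n in sequentially.
        dist (\<integral>\<omega>. p (proj m (Z n \<omega>)) \<partial>M) (\<integral>\<omega>. p (proj m (G \<omega>)) \<partial>N) < d"
      using d(1) by (rule tendstoD)
    with bdd mZ have "\<forall>\<^sub>F n in sequentially. norm ((\<integral>\<omega>. \<phi> (Z n \<omega>) \<partial>M) - (\<integral>\<omega>. \<phi> (G \<omega>) \<partial>N)) < e"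
    proof eventually_elim
      case (elim n)
      have "\<bar>(\<integral>\<omega>. \<phi> (Z n \<omega>) \<partial>M) - (\<integral>\<omega>. p (proj m (Z n \<omega>)) \<partial>M)\<bar> \<le> 3 * d"
        using elim B' by (intro approx M Z) auto
      moreover have "\<bar>(\<integral>\<omega>. \<phi> (G \<omega>) \<partial>N) - (\<integral>\<omega>. p (proj m (G \<omega>)) \<partial>N)\<bar> \<le> 3 * d"
        using mG B' by (intro approx N G) auto
      ultimately show ?case using elim(3) d e unfolding dist_real_def real_norm_def by linarith
    qed
    then show "\<exists>no. \<forall>n\<ge>no. norm ((\<integral>\<omega>. \<phi> (Z n \<omega>) \<partial>M) - (\<integral>\<omega>. \<phi> (G \<omega>) \<partial>N)) < e"
      by (simp add: eventually_sequentially)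
  qed
qed

section \<open>Gaussian elements with a given covariance\<close>

locale psd_form =
  fixes B :: "'a::real_vector \<Rightarrow> 'a \<Rightarrow> real"
  assumes add: "B (x + y) z = B x z + B y z"
    and scale: "B (c *\<^sub>R x) z = c * B x z"
    and sym: "B x y = B y x"
    and nonneg: "B x x \<ge> 0"
begin

lemma add_right: "B z (x + y) = B z x + B z y"
  by (metis add sym)

lemma scale_right: "B z (c *\<^sub>R x) = c * B z x"
  by (metis scale sym)

lemma Cauchy_Schwarz: "(B x y)\<^sup>2 \<le> B x x * B y y"
proof -
  have expand: "B (x + t *\<^sub>R y) (x + t *\<^sub>R y) = B x x + 2 * t * B x y + t\<^sup>2 * B y y" for t
    by (simp add: add scale add_right scale_right sym[of y x] power2_eq_square algebra_simps)
  show ?thesis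
  proof (cases "B y y = 0")
    case True
    have "B x y = 0"
    proof (rule ccontr)
      assume "B x y \<noteq> 0"
      \<comment> \<open>For \<open>B y y = 0\<close> the quadratic in \<open>t\<close> is affine;
        unless its slope vanishes it takes the value -1 at the chosen \<open>t\<close>.\<close>
      then have "B x x + 2 * (- (B x x + 1) / (2 * B x y)) * B x y = - 1" by (simp add: field_simps)
      then show False
        using nonneg[of "x + (- (B x x + 1) / (2 * B x y)) *\<^sub>R y"] True by (simp add: expand)
    qed
    then show ?thesis using True by simp
  next
    case False
    then have "B y y > 0" using nonneg[of y] by simp
    have "0 \<le> B x x + 2 * (- B x y / B y y) * B x y + (- B x y / B y y)\<^sup>2 * B y y"
      using nonneg[of "x + (- B x y / B y y) *\<^sub>R y"] by (simp only: expand)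
    also have "\<dots> = B x x - (B x y)\<^sup>2 / B y y"
      using False by (simp add: power2_eq_square field_simps)
    finally show ?thesis using \<open>B y y > 0\<close> by (simp add: field_simps)
  qed
qed

lemma null: "B y y = 0 \<Longrightarrow> B x y = 0"
  using Cauchy_Schwarz[of x y] by simp

text \<open>This is \<open>B\<close> on vectors from which the \<open>B\<close>-component along
  \<open>e\<close> has been removed. Nonnegativity is the Cauchy-Schwarz inequality; for
  \<open>B e e = 0\<close> the form is \<open>B\<close> itself.\<close>

lemma schur_complement: "psd_form (\<lambda>x y. B x y - B x e * B y e / B e e)"
proof
  show "0 \<le> B x x - B x e * B x e / B e e" for x
  proof (cases "B e e = 0")
    case True
    then show ?thesis using nonneg by simp
  next
    case False
    then have "B e e > 0" using nonneg[of e] by simp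
    then show ?thesis using Cauchy_Schwarz[of x e] by (simp add: field_simps power2_eq_square)
  qed
  show "B x y - B x e * B y e / B e e = B y x - B y e * B x e / B e e" for x y
    by (simp add: sym[of x y] mult.commute)
qed (simp_all add: add scale add_divide_distrib distrib_right right_diff_distrib mult.assoc)

end

text \<open>The Cholesky decomposition of the infinite matrix \<open>B (e i) (e j)\<close>, by repeated Schur
  complements; a vanishing pivot gives a zero column because of \<open>x / 0 = 0\<close>.\<close>

primrec schur :: "('a \<Rightarrow> 'a \<Rightarrow> real) \<Rightarrow> (nat \<Rightarrow> 'a) \<Rightarrow> nat \<Rightarrow> 'a \<Rightarrow> 'a \<Rightarrow> real" where
  "schur B e 0 = B"
| "schur B e (Suc n) = (\<lambda>x y. schur B e n x y -
     schur B e n x (e n) * schur B e n y (e n) / schur B e n (e n) (e n))"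

definition cholesky :: "('a \<Rightarrow> 'a \<Rightarrow> real) \<Rightarrow> (nat \<Rightarrow> 'a) \<Rightarrow> nat \<Rightarrow> nat \<Rightarrow> real" where
  "cholesky B e i k = schur B e k (e i) (e k) / sqrt (schur B e k (e k) (e k))"

context psd_form
begin

lemma psd_form_schur: "psd_form (schur B e n)"
proof (induction n)
  case 0
  show ?case by (simp add: psd_form_axioms)
next
  case (Suc n)
  then show ?case by (simp add: psd_form.schur_complement)
qed

text \<open>Step \<open>n\<close> annihilates \<open>e n\<close>, for a zero pivot because of
  \<open>null\<close>. Zeros created earlier persist, since by symmetry the subtracted product has a
  vanishing factor.\<close>

lemma schur_vanishes: "k < n \<Longrightarrow> schur B e n x (e k) = 0"
proof (induction n arbitrary: x)
  case (Suc n)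
  interpret S: psd_form "schur B e n" by (rule psd_form_schur)
  show ?case
  proof (cases "k = n")
    case True
    then show ?thesis using S.null[of "e n" x] by (cases "schur B e n (e n) (e n) = 0") auto
  next
    case False
    then show ?thesis using Suc S.sym[of "e k" "e n"] by simp
  qed
qed simp

lemma schur_eq: "schur B e n (e i) (e j) = B (e i) (e j) - (\<Sum>k<n. cholesky B e i k * cholesky B e j k)"
proof (induction n)
  case (Suc n)
  interpret S: psd_form "schur B e n" by (rule psd_form_schur)
  have "cholesky B e i n * cholesky B e j n =
      schur B e n (e i) (e n) * schur B e n (e j) (e n) / schur B e n (e n) (e n)"
    using S.nonneg[of "e n"] by (simp add: cholesky_def)
  then show ?case using Suc by simp
qed simp

lemma cholesky_zero: "i < k \<Longrightarrow> cholesky B e i k = 0"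
  using psd_form.sym[OF psd_form_schur, of e k "e i" "e k"] schur_vanishes[of i k e "e k"]
  by (simp add: cholesky_def)

text \<open>The remainder after \<open>n\<close> steps is \<open>schur B e n (e i) (e j)\<close>,
  which vanishes as soon as one of the two indices has been eliminated.\<close>

lemma cholesky_decomposition:
  assumes "j < n"
  shows "B (e i) (e j) = (\<Sum>k<n. cholesky B e i k * cholesky B e j k)"
  using schur_eq[of e n i j] schur_vanishes[OF assms, of e "e i"] by simp

end

text \<open>The law is written as a scaled standard normal rather than by a density, which covers
  the degenerate case \<open>v = 0\<close>.\<close>

lemma char_gaussian_law:
  fixes Z :: "'w \<Rightarrow> real"
  assumes M: "prob_space M" and Z: "Z \<in> borel_measurable M" and v: "v \<ge> 0"
    and char: "\<And>t. (\<integral>\<omega>. iexp (t * Z \<omega>) \<partial>M) = exp (- v * t\<^sup>2 / 2)"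
  shows "distr M borel Z = distr std_normal_distribution borel (\<lambda>x. sqrt v * x)"
proof (rule Levy_uniqueness)
  interpret M: prob_space M by fact
  interpret N: real_distribution std_normal_distribution by (rule real_dist_normal_dist)
  show "real_distribution (distr M borel Z)" using Z by (rule M.real_distribution_distr)
  show "real_distribution (distr std_normal_distribution borel (\<lambda>x. sqrt v * x))"
    by (rule N.real_distribution_distr) simp
  show "char (distr M borel Z) = char (distr std_normal_distribution borel (\<lambda>x. sqrt v * x))"
  proof
    fix t
    have "char (distr std_normal_distribution borel (\<lambda>x. sqrt v * x)) t =
        char std_normal_distribution (t * sqrt v)"
      by (simp add: char_def integral_distr mult.assoc)
    also have "\<dots> = exp (- v * t\<^sup>2 / 2)"
      using v by (simp add: char_std_normal_distribution power_mult_distrib mult.commute)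
    also have "\<dots> = char (distr M borel Z) t"
      using Z char[of t] by (simp add: char_def integral_distr)
    finally show "char (distr M borel Z) t =
        char (distr std_normal_distribution borel (\<lambda>x. sqrt v * x)) t" ..
  qed
qed

lemma char_gaussian_moments:
  fixes Z :: "'w \<Rightarrow> real"
  assumes M: "prob_space M" and Z: "Z \<in> borel_measurable M" and v: "v \<ge> 0"
    and char: "\<And>t. (\<integral>\<omega>. iexp (t * Z \<omega>) \<partial>M) = exp (- v * t\<^sup>2 / 2)"
  shows "integrable M Z" "(\<integral>\<omega>. Z \<omega> \<partial>M) = 0"
    "integrable M (\<lambda>\<omega>. (Z \<omega>)\<^sup>2)" "(\<integral>\<omega>. (Z \<omega>)\<^sup>2 \<partial>M) = v"
proof -
  note law = char_gaussian_law[OF assms]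
  let ?N = std_normal_distribution
  have tr: "integrable M (\<lambda>\<omega>. g (Z \<omega>)) \<longleftrightarrow> integrable ?N (\<lambda>x. g (sqrt v * x))"
    "(\<integral>\<omega>. g (Z \<omega>) \<partial>M) = (\<integral>x. g (sqrt v * x) \<partial>?N)"
    if [measurable]: "g \<in> borel_measurable borel" for g :: "real \<Rightarrow> real"
  proof -
    have "integrable M (\<lambda>\<omega>. g (Z \<omega>)) \<longleftrightarrow> integrable (distr M borel Z) g"
      using Z by (simp add: integrable_distr_eq)
    also have "\<dots> \<longleftrightarrow> integrable ?N (\<lambda>x. g (sqrt v * x))"
      unfolding law by (simp add: integrable_distr_eq)
    finally show "integrable M (\<lambda>\<omega>. g (Z \<omega>)) \<longleftrightarrow> integrable ?N (\<lambda>x. g (sqrt v * x))" .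
    have "(\<integral>\<omega>. g (Z \<omega>) \<partial>M) = integral\<^sup>L (distr M borel Z) g"
      using Z by (simp add: integral_distr)
    also have "\<dots> = (\<integral>x. g (sqrt v * x) \<partial>?N)"
      unfolding law by (simp add: integral_distr)
    finally show "(\<integral>\<omega>. g (Z \<omega>) \<partial>M) = (\<integral>x. g (sqrt v * x) \<partial>?N)" .
  qed
  show "integrable M Z" "integrable M (\<lambda>\<omega>. (Z \<omega>)\<^sup>2)"
    using tr(1)[of "\<lambda>x. x"] tr(1)[of "\<lambda>x. x\<^sup>2"] integrable_std_normal_distribution_moment[of 1]
      integrable_std_normal_distribution_moment[of 2]
    by (simp_all add: power_mult_distrib)
  show "(\<integral>\<omega>. Z \<omega> \<partial>M) = 0"
    using tr(2)[of "\<lambda>x. x"] integral_std_normal_distribution_moment_odd[of 1] by simp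
  have "(\<integral>\<omega>. (Z \<omega>)\<^sup>2 \<partial>M) = v * (\<integral>x. x\<^sup>2 \<partial>?N)"
    using tr(2)[of "\<lambda>x. x\<^sup>2"] v by (simp add: power_mult_distrib)
  also have "(\<integral>x. x\<^sup>2 \<partial>?N) = 1"
    using std_normal_distribution_even_moments(1)[of 1] by simp
  finally show "(\<integral>\<omega>. (Z \<omega>)\<^sup>2 \<partial>M) = v" by simp
qed

section \<open>White noise and the construction of Gaussian elements\<close>

definition white_noise :: "(nat \<Rightarrow> real) measure" where
  "white_noise = (\<Pi>\<^sub>M k\<in>UNIV. std_normal_distribution)"

interpretation white_noise: product_prob_space "\<lambda>_. std_normal_distribution" "UNIV :: nat set"
proof -
  interpret N: real_distribution std_normal_distribution by (rule real_dist_normal_dist)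
  show "product_prob_space (\<lambda>_. std_normal_distribution)" ..
qed

lemma prob_space_white_noise: "prob_space white_noise"
  unfolding white_noise_def by (rule white_noise.prob_space_axioms)

lemma white_noise_component [measurable]: "(\<lambda>\<omega>. \<omega> k) \<in> borel_measurable white_noise"
  unfolding white_noise_def by simp

lemma char_white_noise:
  "(\<integral>\<omega>. iexp (t * (\<Sum>k<n. c k * \<omega> k)) \<partial>white_noise) = exp (- (\<Sum>k<n. (c k)\<^sup>2) * t\<^sup>2 / 2)"
proof -
  interpret W: prob_space white_noise by (rule prob_space_white_noise)
  have law: "distr white_noise borel (\<lambda>\<omega>. \<omega> k) = std_normal_distribution" for k
  proof -
    have "distr white_noise borel (\<lambda>\<omega>. \<omega> k) = distr white_noise std_normal_distribution (\<lambda>\<omega>. \<omega> k)"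
      by (rule distr_cong) auto
    also have "\<dots> = std_normal_distribution"
      unfolding white_noise_def by (rule white_noise.PiM_component) simp
    finally show ?thesis .
  qed
  have "W.indep_vars (\<lambda>_. borel) (\<lambda>k \<omega>. \<omega> k) UNIV"
  proof (subst W.indep_vars_iff_distr_eq_PiM')
    have sets: "sets white_noise = sets (\<Pi>\<^sub>M k\<in>(UNIV :: nat set). borel :: real measure)"
      unfolding white_noise_def by (intro sets_PiM_cong) auto
    have "distr white_noise (\<Pi>\<^sub>M k\<in>(UNIV :: nat set). borel) (\<lambda>\<omega>. \<lambda>k\<in>UNIV. \<omega> k) = white_noise"
      using distr_id2[OF sets[symmetric]] by (simp add: restrict_UNIV)
    also have "\<dots> = (\<Pi>\<^sub>M k\<in>UNIV. distr white_noise borel (\<lambda>\<omega>. \<omega> k))"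
      unfolding law by (simp add: white_noise_def)
    finally show "distr white_noise (\<Pi>\<^sub>M k\<in>(UNIV :: nat set). borel) (\<lambda>\<omega>. \<lambda>k\<in>UNIV. \<omega> k) =
      (\<Pi>\<^sub>M k\<in>UNIV. distr white_noise borel (\<lambda>\<omega>. \<omega> k))" .
  qed auto
  then have indep: "W.indep_vars (\<lambda>_. borel) (\<lambda>k \<omega>. c k * \<omega> k) {..<n}"
    by (intro W.indep_vars_compose2[where Y = "\<lambda>k x. c k * x" and X = "\<lambda>k \<omega>. \<omega> k"])
       (auto intro: W.indep_vars_subset)
  have "(\<integral>\<omega>. iexp (t * (\<Sum>k<n. c k * \<omega> k)) \<partial>white_noise) =
      char (distr white_noise borel (\<lambda>\<omega>. \<Sum>k<n. c k * \<omega> k)) t"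
    by (simp add: char_def integral_distr)
  also have "\<dots> = (\<Prod>k<n. char (distr white_noise borel (\<lambda>\<omega>. c k * \<omega> k)) t)"
    by (rule W.char_distr_sum[OF indep])
  also have "\<dots> = (\<Prod>k<n. complex_of_real (exp (- (c k)\<^sup>2 * t\<^sup>2 / 2)))"
  proof (rule prod.cong[OF refl])
    fix k
    have "char (distr white_noise borel (\<lambda>\<omega>. c k * \<omega> k)) t =
        char (distr white_noise borel (\<lambda>\<omega>. \<omega> k)) (t * c k)"
      by (simp add: char_def integral_distr mult.assoc)
    also have "\<dots> = complex_of_real (exp (- (c k)\<^sup>2 * t\<^sup>2 / 2))"
      by (simp add: law char_std_normal_distribution power_mult_distrib mult.commute)
    finally show "char (distr white_noise borel (\<lambda>\<omega>. c k * \<omega> k)) t =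
        complex_of_real (exp (- (c k)\<^sup>2 * t\<^sup>2 / 2))" .
  qed
  also have "\<dots> = complex_of_real (exp (\<Sum>k<n. - (c k)\<^sup>2 * t\<^sup>2 / 2))"
    by (simp only: of_real_prod[symmetric] exp_sum finite_lessThan)
  also have "(\<Sum>k<n. - (c k)\<^sup>2 * t\<^sup>2 / 2) = - (\<Sum>k<n. (c k)\<^sup>2) * t\<^sup>2 / 2"
    by (simp add: sum_negf sum_distrib_right sum_divide_distrib)
  finally show ?thesis .
qed

text \<open>The coordinates \<open>X i\<close> are finite combinations of white noise with
  covariances \<open>B (b i) (b j)\<close>. By \<open>trace\<close> the expected sum of their
  squares is finite, so the series along the basis converges almost surely and has a finite second
  moment. A partial sum tested against \<open>x\<close> has variance
  \<open>B (proj n x) (proj n x)\<close>, and boundedness of \<open>B\<close> allows the passage to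
  the limit.\<close>

theorem (in hilbert_basis) gaussian_exists:
  fixes B :: "'h \<Rightarrow> 'h \<Rightarrow> real"
  assumes B: "psd_form B" and bounded: "bounded_bilinear B"
    and trace: "summable (\<lambda>i. B (b i) (b i))"
  obtains N :: "'h measure" where "prob_space N" "sets N = sets borel"
    "integrable N (\<lambda>g. (norm g)\<^sup>2)"
    "\<And>x. (\<integral>g. iexp (g \<bullet> x) \<partial>N) = exp (- B x x / 2)"
proof -
  interpret B: psd_form B by fact
  interpret W: prob_space white_noise by (rule prob_space_white_noise)
  define v where "v i = B (b i) (b i)" for i
  have v: "v i \<ge> 0" for i by (simp add: v_def B.nonneg)
  have v_sum: "summable v" using trace by (simp add: v_def[abs_def])
  define L where "L i k = cholesky B b i k" for i k
  define X where "X i \<omega> = (\<Sum>k<Suc i. L i k * \<omega> k)" for i :: nat and \<omega> :: "nat \<Rightarrow> real"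
  have X_m [measurable]: "X i \<in> borel_measurable white_noise" for i
    unfolding X_def by measurable
  have X2: "integrable white_noise (\<lambda>\<omega>. (X i \<omega>)\<^sup>2)" "(\<integral>\<omega>. (X i \<omega>)\<^sup>2 \<partial>white_noise) = v i" for i
  proof -
    have "(\<Sum>k<Suc i. (L i k)\<^sup>2) = v i"
      using B.cholesky_decomposition[of i "Suc i" b i] by (simp add: v_def L_def power2_eq_square)
    then have "(\<integral>\<omega>. iexp (t * X i \<omega>) \<partial>white_noise) = exp (- v i * t\<^sup>2 / 2)" for t
      using char_white_noise[of t "L i" "Suc i"] by (simp only: X_def)
    note m = char_gaussian_moments[OF prob_space_white_noise X_m v this]
    show "integrable white_noise (\<lambda>\<omega>. (X i \<omega>)\<^sup>2)" "(\<integral>\<omega>. (X i \<omega>)\<^sup>2 \<partial>white_noise) = v i"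
      using m by auto
  qed
  define Q where "Q \<omega> = (\<Sum>i. (X i \<omega>)\<^sup>2)" for \<omega>
  have nnX: "(\<integral>\<^sup>+\<omega>. ennreal ((X i \<omega>)\<^sup>2) \<partial>white_noise) = ennreal (v i)" for i
    using nn_integral_eq_integral[OF X2(1)[of i]] X2(2)[of i] by simp
  have nn: "(\<integral>\<^sup>+\<omega>. (\<Sum>i. ennreal ((X i \<omega>)\<^sup>2)) \<partial>white_noise) = ennreal (\<Sum>i. v i)"
    using v_sum v by (subst nn_integral_suminf) (auto simp: nnX suminf_ennreal2)
  have "AE \<omega> in white_noise. (\<Sum>i. ennreal ((X i \<omega>)\<^sup>2)) \<noteq> \<infinity>"
    by (rule nn_integral_PInf_AE) (measurable, simp add: nn)
  then have AE_sum: "AE \<omega> in white_noise. summable (\<lambda>i. (X i \<omega>)\<^sup>2)"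
    by eventually_elim (rule summable_suminf_not_top, simp_all)
  have Q: "integrable white_noise Q"
  proof (rule integrableI_bounded)
    show "Q \<in> borel_measurable white_noise" unfolding Q_def by measurable
    have "(\<integral>\<^sup>+\<omega>. ennreal (norm (Q \<omega>)) \<partial>white_noise) =
        (\<integral>\<^sup>+\<omega>. (\<Sum>i. ennreal ((X i \<omega>)\<^sup>2)) \<partial>white_noise)"
    proof (rule nn_integral_cong_AE, use AE_sum in eventually_elim)
      case (elim \<omega>)
      then show ?case by (simp add: Q_def suminf_ennreal2 suminf_nonneg)
    qed
    then show "(\<integral>\<^sup>+\<omega>. ennreal (norm (Q \<omega>)) \<partial>white_noise) < \<infinity>" by (simp add: nn)
  qed
  define S where "S n \<omega> = (\<Sum>i<n. X i \<omega> *\<^sub>R b i)" for n and \<omega> :: "nat \<Rightarrow> real"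
  \<comment> \<open>Where the series diverges, \<open>lim\<close> is an unspecified value. This
    concerns a null set only, and \<open>G\<close> is measurable everywhere.\<close>
  define G where "G \<omega> = lim (\<lambda>n. S n \<omega>)" for \<omega>
  have S_m [measurable]: "S n \<in> borel_measurable white_noise" for n unfolding S_def by measurable
  have G_m [measurable]: "G \<in> borel_measurable white_noise" unfolding G_def by measurable
  have conv: "S n \<omega> \<bullet> x = (\<Sum>i<n. X i \<omega> * (b i \<bullet> x))" for n \<omega> x
    by (simp add: S_def inner_sum_left)
  have lim: "(\<lambda>n. S n \<omega>) \<longlonglongrightarrow> G \<omega>" if sum: "summable (\<lambda>i. (X i \<omega>)\<^sup>2)" for \<omega>
  proof -
    have "summable (\<lambda>i. X i \<omega> *\<^sub>R b i)"
      unfolding summable_Cauchy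
    proof (intro allI impI)
      fix e :: real assume "e > 0"
      then obtain m where m: "\<And>k n. k \<ge> m \<Longrightarrow> norm (\<Sum>i\<in>{k..<n}. (X i \<omega>)\<^sup>2) < e\<^sup>2"
        using sum[unfolded summable_Cauchy, rule_format, of "e\<^sup>2"] by auto
      show "\<exists>m. \<forall>k\<ge>m. \<forall>n. norm (\<Sum>i\<in>{k..<n}. X i \<omega> *\<^sub>R b i) < e"
      proof (intro exI[of _ m] allI impI)
        fix k n assume "k \<ge> m"
        have "(norm (\<Sum>i\<in>{k..<n}. X i \<omega> *\<^sub>R b i))\<^sup>2 \<le> (\<Sum>i\<in>{k..<n}. (X i \<omega>)\<^sup>2)"
          by (rule norm_sum_orthogonal)
        also have "\<dots> < e\<^sup>2" using m[OF \<open>k \<ge> m\<close>, of n] by simp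
        finally show "norm (\<Sum>i\<in>{k..<n}. X i \<omega> *\<^sub>R b i) < e"
          using \<open>e > 0\<close> by (simp add: power2_less_imp_less)
      qed
    qed
    then show ?thesis
      unfolding G_def S_def summable_iff_convergent convergent_LIMSEQ_iff .
  qed
  have G2: "integrable white_noise (\<lambda>\<omega>. (norm (G \<omega>))\<^sup>2)"
  proof (rule Bochner_Integration.integrable_bound[OF Q])
    show "AE \<omega> in white_noise. norm ((norm (G \<omega>))\<^sup>2) \<le> norm (Q \<omega>)"
      using AE_sum
    proof eventually_elim
      case (elim \<omega>)
      have "(\<lambda>n. (norm (S n \<omega>))\<^sup>2) \<longlonglongrightarrow> (norm (G \<omega>))\<^sup>2"
        using lim[OF elim] by (intro tendsto_intros)
      moreover have "(norm (S n \<omega>))\<^sup>2 \<le> Q \<omega>" for n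
      proof -
        have "(norm (S n \<omega>))\<^sup>2 \<le> (\<Sum>i<n. (X i \<omega>)\<^sup>2)"
          using norm_sum_orthogonal[of "\<lambda>i. X i \<omega>" 0 n] by (simp add: S_def atLeast0LessThan)
        also have "\<dots> \<le> Q \<omega>" unfolding Q_def by (rule sum_le_suminf[OF elim]) auto
        finally show ?thesis .
      qed
      ultimately have "(norm (G \<omega>))\<^sup>2 \<le> Q \<omega>" by (intro LIMSEQ_le_const2) auto
      then show ?case by simp
    qed
  qed measurable
  have char: "(\<integral>\<omega>. iexp (G \<omega> \<bullet> x) \<partial>white_noise) = exp (- B x x / 2)" for x
  proof -
    define c where "c n k = (\<Sum>i<n. L i k * (b i \<bullet> x))" for n k
    have Sx: "S n \<omega> \<bullet> x = (\<Sum>k<n. c n k * \<omega> k)" for n \<omega>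
    proof -
      \<comment> \<open>Rows of the triangular Cholesky factor are padded with zeros, so that all
        coordinates below \<open>n\<close> use the same \<open>n\<close> noise variables and the
        double sum can be exchanged.\<close>
      have "X i \<omega> = (\<Sum>k<n. L i k * \<omega> k)" if "i < n" for i
        unfolding X_def
        by (rule sum.mono_neutral_left) (use that in \<open>auto simp: L_def B.cholesky_zero\<close>)
      then have "S n \<omega> \<bullet> x = (\<Sum>i<n. (\<Sum>k<n. L i k * \<omega> k) * (b i \<bullet> x))"
        by (simp add: conv)
      also have "\<dots> = (\<Sum>k<n. \<Sum>i<n. L i k * \<omega> k * (b i \<bullet> x))"
        unfolding sum_distrib_right by (rule sum.swap)
      also have "\<dots> = (\<Sum>k<n. c n k * \<omega> k)"
        by (simp add: c_def sum_distrib_left mult_ac)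
      finally show ?thesis .
    qed
    have "(\<Sum>k<n. (c n k)\<^sup>2) = B (proj n x) (proj n x)" for n
    proof -
      interpret bb: bounded_bilinear B by fact
      have "(\<Sum>k<n. (c n k)\<^sup>2) =
          (\<Sum>k<n. \<Sum>i<n. \<Sum>j<n. (b i \<bullet> x) * (b j \<bullet> x) * (L i k * L j k))"
        by (simp add: c_def power2_eq_square sum_product mult_ac)
      also have "\<dots> = (\<Sum>i<n. \<Sum>k<n. \<Sum>j<n. (b i \<bullet> x) * (b j \<bullet> x) * (L i k * L j k))"
        by (rule sum.swap)
      also have "\<dots> = (\<Sum>i<n. \<Sum>j<n. \<Sum>k<n. (b i \<bullet> x) * (b j \<bullet> x) * (L i k * L j k))"
        by (intro sum.cong refl sum.swap)
      also have "\<dots> = (\<Sum>i<n. \<Sum>j<n. (b i \<bullet> x) * (b j \<bullet> x) * B (b i) (b j))"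
        by (intro sum.cong refl)
           (simp add: B.cholesky_decomposition[of _ n b] L_def sum_distrib_left)
      also have "\<dots> = B (proj n x) (proj n x)"
        by (simp add: proj_def bb.sum_left bb.sum_right bb.scaleR_left bb.scaleR_right
            inner_commute sum_distrib_left mult_ac B.sym)
      finally show ?thesis .
    qed
    then have Sn: "(\<integral>\<omega>. iexp (S n \<omega> \<bullet> x) \<partial>white_noise) =
        exp (- B (proj n x) (proj n x) / 2)" for n
      using char_white_noise[of 1 "c n" n] by (simp add: Sx)
    have "(\<lambda>n. \<integral>\<omega>. iexp (S n \<omega> \<bullet> x) \<partial>white_noise) \<longlonglongrightarrow> (\<integral>\<omega>. iexp (G \<omega> \<bullet> x) \<partial>white_noise)"
    proof (rule integral_dominated_convergence)
      show "integrable white_noise (\<lambda>_. 1 :: real)" by simp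
      show "AE \<omega> in white_noise. (\<lambda>n. iexp (S n \<omega> \<bullet> x)) \<longlonglongrightarrow> iexp (G \<omega> \<bullet> x)"
        using AE_sum
      proof eventually_elim
        case (elim \<omega>)
        show ?case using lim[OF elim] by (intro tendsto_intros)
      qed
    qed auto
    moreover have "(\<lambda>n. complex_of_real (exp (- B (proj n x) (proj n x) / 2))) \<longlonglongrightarrow>
        complex_of_real (exp (- B x x / 2))"
      by (intro tendsto_intros bounded_bilinear.tendsto[OF bounded] proj_tendsto) auto
    ultimately show ?thesis unfolding Sn by (rule LIMSEQ_unique)
  qed
  show thesis
  proof (rule that[of "distr white_noise borel G"])
    show "prob_space (distr white_noise borel G)" by (rule W.prob_space_distr) simp
    show "integrable (distr white_noise borel G) (\<lambda>g. (norm g)\<^sup>2)"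
      using G2 by (simp add: integrable_distr_eq)
    show "(\<integral>g. iexp (g \<bullet> x) \<partial>distr white_noise borel G) = exp (- B x x / 2)" for x
      using char[of x] by (simp add: integral_distr)
  qed simp
qed

section \<open>Weighted sums of independent variables\<close>

text \<open>The upper half rests on \<open>(1 - y + y\<^sup>2) * (1 + y) = 1 + y ^ 3\<close>, which
  is at least 1, together with \<open>1 + y \<le> exp y\<close>.\<close>

lemma exp_minus_quadratic_bound:
  fixes y :: real
  assumes "y \<ge> 0"
  shows "\<bar>exp (- y) - (1 - y)\<bar> \<le> y\<^sup>2"
proof -
  have "1 \<le> (1 - y + y\<^sup>2) * (1 + y)"
    using assms by (simp add: algebra_simps power2_eq_square)
  also have "\<dots> \<le> (1 - y + y\<^sup>2) * exp y"
  proof (rule mult_left_mono)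
    have "0 \<le> (1 / 2 - y)\<^sup>2" by simp
    then show "0 \<le> 1 - y + y\<^sup>2" by (simp add: power2_eq_square algebra_simps)
  qed (rule exp_ge_add_one_self)
  finally have "exp (- y) \<le> 1 - y + y\<^sup>2"
    by (simp add: exp_minus field_simps)
  moreover have "1 - y \<le> exp (- y)" using exp_ge_add_one_self[of "- y"] by simp
  ultimately show ?thesis by simp
qed

text \<open>Lindeberg's argument: two products of numbers in the unit disc differ by at most the sum
  of the differences of their factors. For \<open>\<bar>x\<bar> \<le> \<alpha>\<close> a factor
  differs from its Gaussian counterpart by at most \<open>x\<^sup>2 * h \<alpha>\<close>. The
  squared weights have bounded sums, and \<open>h \<alpha>\<close> becomes small with
  \<open>\<alpha>\<close> under a second moment alone.\<close>

lemma (in prob_space) weighted_iid_clt: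
  fixes V :: "nat \<Rightarrow> 'a \<Rightarrow> real"
  assumes indep: "indep_vars (\<lambda>_. borel) V UNIV"
    and distr: "\<And>j. distr M borel (V j) = distr M borel (V 0)"
    and V2: "integrable M (\<lambda>\<omega>. (V 0 \<omega>)\<^sup>2)" and mean: "expectation (V 0) = 0"
    and small: "\<And>e. e > 0 \<Longrightarrow> \<forall>\<^sub>F T in sequentially. \<forall>j<T. \<bar>a T j\<bar> \<le> e"
    and lim: "(\<lambda>T. \<Sum>j<T. (a T j)\<^sup>2) \<longlonglongrightarrow> A"
  shows "(\<lambda>T. \<integral>\<omega>. iexp (\<Sum>j<T. a T j * V j \<omega>) \<partial>M) \<longlonglongrightarrow>
    exp (- A * expectation (\<lambda>\<omega>. (V 0 \<omega>)\<^sup>2) / 2)"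
proof -
  define s where "s = expectation (\<lambda>\<omega>. (V 0 \<omega>)\<^sup>2)"
  have s: "s \<ge> 0" by (simp add: s_def)
  have V_m [measurable]: "V j \<in> borel_measurable M" for j
    using indep by (simp add: indep_vars_def2)
  have V1: "integrable M (V 0)" by (rule square_integrable_imp_integrable[OF V_m V2])
  define \<mu> where "\<mu> = distr M borel (V 0)"
  interpret \<mu>: real_distribution \<mu> unfolding \<mu>_def by (rule real_distribution_distr) simp
  \<comment> \<open>The first summand comes from the third-order Taylor estimate of the
    characteristic function, where \<open>min\<close> keeps the integrand below a multiple of the
    square. The second comes from \<open>exp_minus_quadratic_bound\<close> with one factor
    \<open>x\<^sup>2\<close> replaced by \<open>\<alpha>\<^sup>2\<close>.\<close>
  define h where "h \<alpha> = (1 / 6) * expectation (\<lambda>\<omega>. min (6 * (V 0 \<omega>)\<^sup>2) (\<alpha> * \<bar>V 0 \<omega>\<bar> ^ 3)) + \<alpha>\<^sup>2 * s\<^sup>2" for \<alpha> :: real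
  have h_lim: "(\<lambda>n. h (inverse (real (Suc n)))) \<longlonglongrightarrow> 0"
  proof -
    have l1: "(\<lambda>n. expectation (\<lambda>\<omega>. min (6 * (V 0 \<omega>)\<^sup>2) (inverse (real (Suc n)) * \<bar>V 0 \<omega>\<bar> ^ 3)))
        \<longlonglongrightarrow> expectation (\<lambda>\<omega>. 0)"
    proof (rule integral_dominated_convergence)
      show "integrable M (\<lambda>\<omega>. 6 * (V 0 \<omega>)\<^sup>2)" using V2 by simp
      show "AE \<omega> in M. (\<lambda>n. min (6 * (V 0 \<omega>)\<^sup>2) (inverse (real (Suc n)) * \<bar>V 0 \<omega>\<bar> ^ 3)) \<longlonglongrightarrow> 0"
      proof (rule AE_I2)
        fix \<omega>
        have "(\<lambda>n. min (6 * (V 0 \<omega>)\<^sup>2) (inverse (real (Suc n)) * \<bar>V 0 \<omega>\<bar> ^ 3)) \<longlonglongrightarrow>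
            min (6 * (V 0 \<omega>)\<^sup>2) (0 * \<bar>V 0 \<omega>\<bar> ^ 3)"
          by (intro tendsto_intros LIMSEQ_inverse_real_of_nat)
        then show "(\<lambda>n. min (6 * (V 0 \<omega>)\<^sup>2) (inverse (real (Suc n)) * \<bar>V 0 \<omega>\<bar> ^ 3)) \<longlonglongrightarrow> 0"
          by simp
      qed
    qed auto
    have l2: "(\<lambda>n. (inverse (real (Suc n)))\<^sup>2 * s\<^sup>2) \<longlonglongrightarrow> 0\<^sup>2 * s\<^sup>2"
      by (intro tendsto_intros LIMSEQ_inverse_real_of_nat)
    have "(\<lambda>n. h (inverse (real (Suc n)))) \<longlonglongrightarrow> (1 / 6) * expectation (\<lambda>\<omega>. 0) + 0\<^sup>2 * s\<^sup>2"
      unfolding h_def by (rule tendsto_add[OF tendsto_mult_left[OF l1] l2])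
    then show ?thesis by simp
  qed
  have step: "cmod (char \<mu> x - exp (- x\<^sup>2 * s / 2)) \<le> x\<^sup>2 * h \<alpha>" if x: "\<bar>x\<bar> \<le> \<alpha>" for x \<alpha>
  proof -
    have int: "integrable M (\<lambda>\<omega>. min (6 * (V 0 \<omega>)\<^sup>2) (c * \<bar>V 0 \<omega>\<bar> ^ 3))" if "c \<ge> 0" for c
      by (rule Bochner_Integration.integrable_bound[where f = "\<lambda>\<omega>. 6 * (V 0 \<omega>)\<^sup>2"])
         (use V2 that in auto)
    have "cmod (char \<mu> x - (1 - x\<^sup>2 * s / 2)) \<le>
        (x\<^sup>2 / 6) * expectation (\<lambda>\<omega>. min (6 * (V 0 \<omega>)\<^sup>2) (\<bar>x\<bar> * \<bar>V 0 \<omega>\<bar> ^ 3))"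
      by (rule char_approx3') (use V1 V2 mean in \<open>auto simp: \<mu>_def s_def\<close>)
    also have "\<dots> \<le> (x\<^sup>2 / 6) * expectation (\<lambda>\<omega>. min (6 * (V 0 \<omega>)\<^sup>2) (\<alpha> * \<bar>V 0 \<omega>\<bar> ^ 3))"
      by (intro mult_left_mono integral_mono int min.mono mult_right_mono) (use x in auto)
    finally have 1: "cmod (char \<mu> x - (1 - x\<^sup>2 * s / 2)) \<le>
        (x\<^sup>2 / 6) * expectation (\<lambda>\<omega>. min (6 * (V 0 \<omega>)\<^sup>2) (\<alpha> * \<bar>V 0 \<omega>\<bar> ^ 3))" .
    have "\<bar>exp (- (x\<^sup>2 * s / 2)) - (1 - x\<^sup>2 * s / 2)\<bar> \<le> (x\<^sup>2 * s / 2)\<^sup>2"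
      using s by (intro exp_minus_quadratic_bound) simp
    also have "\<dots> \<le> x\<^sup>2 * (\<alpha>\<^sup>2 * s\<^sup>2)"
    proof -
      have "x\<^sup>2 \<le> \<alpha>\<^sup>2" using x by (simp add: abs_le_square_iff[symmetric])
      then have "x\<^sup>2 * s\<^sup>2 * x\<^sup>2 \<le> x\<^sup>2 * s\<^sup>2 * \<alpha>\<^sup>2" by (intro mult_left_mono) auto
      moreover have "0 \<le> x\<^sup>2 * s\<^sup>2 * x\<^sup>2" by simp
      moreover have "(x\<^sup>2 * s / 2)\<^sup>2 = (x\<^sup>2 * s\<^sup>2 * x\<^sup>2) / 4"
        by (simp add: power2_eq_square)
      ultimately have "(x\<^sup>2 * s / 2)\<^sup>2 \<le> x\<^sup>2 * s\<^sup>2 * \<alpha>\<^sup>2" by linarith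
      also have "\<dots> = x\<^sup>2 * (\<alpha>\<^sup>2 * s\<^sup>2)" by simp
      finally show ?thesis .
    qed
    finally have "cmod (complex_of_real (exp (- (x\<^sup>2 * s / 2)) - (1 - x\<^sup>2 * s / 2))) \<le> x\<^sup>2 * (\<alpha>\<^sup>2 * s\<^sup>2)"
      by (simp only: norm_of_real)
    then have 2: "cmod ((1 - x\<^sup>2 * s / 2) - exp (- x\<^sup>2 * s / 2)) \<le> x\<^sup>2 * (\<alpha>\<^sup>2 * s\<^sup>2)"
      by (simp add: norm_minus_commute)
    have "cmod (char \<mu> x - exp (- x\<^sup>2 * s / 2)) \<le>
        (x\<^sup>2 / 6) * expectation (\<lambda>\<omega>. min (6 * (V 0 \<omega>)\<^sup>2) (\<alpha> * \<bar>V 0 \<omega>\<bar> ^ 3)) + x\<^sup>2 * (\<alpha>\<^sup>2 * s\<^sup>2)"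
      using norm_triangle_le[OF add_mono[OF 1 2]] by simp
    also have "\<dots> = x\<^sup>2 * h \<alpha>" by (simp add: h_def algebra_simps)
    finally show ?thesis .
  qed
  have prod: "(\<integral>\<omega>. iexp (\<Sum>j<T. a T j * V j \<omega>) \<partial>M) = (\<Prod>j<T. char \<mu> (a T j))" for T
  proof -
    have ind: "indep_vars (\<lambda>_. borel) (\<lambda>j \<omega>. a T j * V j \<omega>) {..<T}"
      by (rule indep_vars_compose2[where Y = "\<lambda>j x. a T j * x" and X = V])
         (auto intro: indep_vars_subset[OF indep])
    have "(\<integral>\<omega>. iexp (\<Sum>j<T. a T j * V j \<omega>) \<partial>M) =
        char (distr M borel (\<lambda>\<omega>. \<Sum>j<T. a T j * V j \<omega>)) 1"
      by (simp add: char_def integral_distr)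
    also have "\<dots> = (\<Prod>j<T. char (distr M borel (\<lambda>\<omega>. a T j * V j \<omega>)) 1)"
      by (rule char_distr_sum[OF ind])
    also have "\<dots> = (\<Prod>j<T. char \<mu> (a T j))"
    proof (rule prod.cong[OF refl])
      fix j
      have "char (distr M borel (\<lambda>\<omega>. a T j * V j \<omega>)) 1 = char (distr M borel (V j)) (a T j)"
        by (simp add: char_def integral_distr)
      then show "char (distr M borel (\<lambda>\<omega>. a T j * V j \<omega>)) 1 = char \<mu> (a T j)"
        by (simp only: distr[of j] \<mu>_def)
    qed
    finally show ?thesis .
  qed
  have exps: "(\<Prod>j<T. complex_of_real (exp (- (a T j)\<^sup>2 * s / 2))) = exp (- (\<Sum>j<T. (a T j)\<^sup>2) * s / 2)" for T
  proof -
    have "(\<Prod>j<T. complex_of_real (exp (- (a T j)\<^sup>2 * s / 2))) =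
        complex_of_real (exp (\<Sum>j<T. - (a T j)\<^sup>2 * s / 2))"
      by (simp only: of_real_prod[symmetric] exp_sum finite_lessThan)
    also have "(\<Sum>j<T. - (a T j)\<^sup>2 * s / 2) = - (\<Sum>j<T. (a T j)\<^sup>2) * s / 2"
      by (simp add: sum_negf sum_distrib_right sum_divide_distrib)
    finally show ?thesis .
  qed
  have "(\<lambda>T. (\<Prod>j<T. char \<mu> (a T j)) - exp (- (\<Sum>j<T. (a T j)\<^sup>2) * s / 2)) \<longlonglongrightarrow> 0"
  proof (rule LIMSEQ_I)
    fix e :: real assume e: "e > 0"
    have A: "A \<ge> 0" by (rule LIMSEQ_le_const[OF lim]) (intro exI[of _ 0] allI impI sum_nonneg zero_le_power2)
    have "\<forall>\<^sub>F n in sequentially. h (inverse (real (Suc n))) < e / (A + 1)"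
      by (rule order_tendstoD[OF h_lim]) (use e A in simp)
    then obtain n where n: "h (inverse (real (Suc n))) < e / (A + 1)"
      by (auto simp: eventually_sequentially)
    define \<alpha> where "\<alpha> = inverse (real (Suc n))"
    have \<alpha>: "\<alpha> > 0" by (simp add: \<alpha>_def)
    have h0: "h \<alpha> \<ge> 0" unfolding h_def using \<alpha>
      by (intro add_nonneg_nonneg mult_nonneg_nonneg integral_nonneg) auto
    have "\<forall>\<^sub>F T in sequentially. (\<Sum>j<T. (a T j)\<^sup>2) < A + 1"
      by (rule order_tendstoD[OF lim]) simp
    with small[OF \<alpha>] have "\<forall>\<^sub>F T in sequentially.
        norm ((\<Prod>j<T. char \<mu> (a T j)) - exp (- (\<Sum>j<T. (a T j)\<^sup>2) * s / 2) - 0) < e"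
    proof eventually_elim
      case (elim T)
      have "norm ((\<Prod>j<T. char \<mu> (a T j)) - (\<Prod>j<T. complex_of_real (exp (- (a T j)\<^sup>2 * s / 2)))) \<le>
          (\<Sum>j<T. norm (char \<mu> (a T j) - complex_of_real (exp (- (a T j)\<^sup>2 * s / 2))))"
        by (intro norm_prod_diff) (use s in \<open>auto simp: \<mu>.cmod_char_le_1\<close>)
      also have "\<dots> \<le> (\<Sum>j<T. (a T j)\<^sup>2 * h \<alpha>)"
        using elim by (intro sum_mono step) auto
      also have "\<dots> = (\<Sum>j<T. (a T j)\<^sup>2) * h \<alpha>" by (simp add: sum_distrib_right)
      also have "\<dots> \<le> (A + 1) * h \<alpha>" using elim h0 by (intro mult_right_mono) auto
      also have "\<dots> < e" using n A by (simp add: \<alpha>_def field_simps)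
      finally show ?case unfolding exps by simp
    qed
    then show "\<exists>no. \<forall>T\<ge>no. norm ((\<Prod>j<T. char \<mu> (a T j)) - exp (- (\<Sum>j<T. (a T j)\<^sup>2) * s / 2) - 0) < e"
      by (simp add: eventually_sequentially)
  qed
  moreover have "(\<lambda>T. complex_of_real (exp (- (\<Sum>j<T. (a T j)\<^sup>2) * s / 2))) \<longlonglongrightarrow> exp (- A * s / 2)"
    by (intro tendsto_intros lim) simp
  ultimately have "(\<lambda>T. \<Prod>j<T. char \<mu> (a T j)) \<longlonglongrightarrow> 0 + exp (- A * s / 2)"
    using tendsto_add by fastforce
  then show ?thesis by (simp only: prod s_def add_0)
qed

section \<open>Square integrable variables and innovations\<close>

text \<open>The case p = 2 of \<open>in_Lp\<close>, with a plain square in place of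
  \<open>powr\<close>; likewise \<open>L2_norm\<close> for \<open>v_norm\<close>. The links are
  \<open>in_Lp_2_iff\<close> and \<open>v_norm_2\<close>.\<close>

definition L2_rv :: "'w measure \<Rightarrow> ('w \<Rightarrow> 'h::{real_normed_vector, second_countable_topology}) \<Rightarrow> bool" where
  "L2_rv M X \<longleftrightarrow> X \<in> borel_measurable M \<and> integrable M (\<lambda>\<omega>. (norm (X \<omega>))\<^sup>2)"

definition L2_norm :: "'w measure \<Rightarrow> ('w \<Rightarrow> 'h::real_normed_vector) \<Rightarrow> real" where
  "L2_norm M X = sqrt (\<integral>\<omega>. (norm (X \<omega>))\<^sup>2 \<partial>M)"

lemma L2_rv_measurable: "L2_rv M X \<Longrightarrow> X \<in> borel_measurable M"
  by (simp add: L2_rv_def)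

lemma L2_norm_nonneg: "L2_norm M X \<ge> 0"
  by (simp add: L2_norm_def)

lemma L2_norm_power2: "(L2_norm M X)\<^sup>2 = (\<integral>\<omega>. (norm (X \<omega>))\<^sup>2 \<partial>M)"
  by (simp add: L2_norm_def)

lemma L2_rv_bound:
  assumes "L2_rv M X" "Y \<in> borel_measurable M" "\<And>\<omega>. norm (Y \<omega>) \<le> c * norm (X \<omega>)"
  shows "L2_rv M Y"
  unfolding L2_rv_def
proof
  show "integrable M (\<lambda>\<omega>. (norm (Y \<omega>))\<^sup>2)"
  proof (rule Bochner_Integration.integrable_bound)
    show "integrable M (\<lambda>\<omega>. c\<^sup>2 * (norm (X \<omega>))\<^sup>2)"
      using assms(1) by (simp add: L2_rv_def)
    have "(norm (Y \<omega>))\<^sup>2 \<le> (c * norm (X \<omega>))\<^sup>2" for \<omega>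
      using assms(3) by (intro power_mono) auto
    then show "AE \<omega> in M. norm ((norm (Y \<omega>))\<^sup>2) \<le> norm (c\<^sup>2 * (norm (X \<omega>))\<^sup>2)"
      by (simp add: power_mult_distrib)
  qed (use assms(2) in measurable)
qed fact

lemma L2_rv_add:
  assumes "L2_rv M X" "L2_rv M Y"
  shows "L2_rv M (\<lambda>\<omega>. X \<omega> + Y \<omega>)"
  unfolding L2_rv_def
proof
  have [measurable]: "X \<in> borel_measurable M" "Y \<in> borel_measurable M"
    using assms by (auto simp: L2_rv_def)
  show "(\<lambda>\<omega>. X \<omega> + Y \<omega>) \<in> borel_measurable M" by measurable
  show "integrable M (\<lambda>\<omega>. (norm (X \<omega> + Y \<omega>))\<^sup>2)"
  proof (rule Bochner_Integration.integrable_bound)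
    show "integrable M (\<lambda>\<omega>. 2 * (norm (X \<omega>))\<^sup>2 + 2 * (norm (Y \<omega>))\<^sup>2)"
      using assms by (simp add: L2_rv_def)
    have "(norm (X \<omega> + Y \<omega>))\<^sup>2 \<le> 2 * (norm (X \<omega>))\<^sup>2 + 2 * (norm (Y \<omega>))\<^sup>2" for \<omega>
    proof -
      have "(norm (X \<omega> + Y \<omega>))\<^sup>2 \<le> (norm (X \<omega>) + norm (Y \<omega>))\<^sup>2"
        by (intro power_mono norm_triangle_ineq) simp
      then show ?thesis
        using sum_squares_bound[of "norm (X \<omega>)" "norm (Y \<omega>)"] by (simp add: power2_sum)
    qed
    then show "AE \<omega> in M. norm ((norm (X \<omega> + Y \<omega>))\<^sup>2) \<le> norm (2 * (norm (X \<omega>))\<^sup>2 + 2 * (norm (Y \<omega>))\<^sup>2)"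
      by simp
  qed measurable
qed

lemma L2_rv_scaleR: "L2_rv M X \<Longrightarrow> L2_rv M (\<lambda>\<omega>. c *\<^sub>R X \<omega>)"
  by (rule L2_rv_bound[where c = "\<bar>c\<bar>"]) (auto simp: L2_rv_def)

lemma L2_rv_diff: "L2_rv M X \<Longrightarrow> L2_rv M Y \<Longrightarrow> L2_rv M (\<lambda>\<omega>. X \<omega> - Y \<omega>)"
  using L2_rv_add[of M X "\<lambda>\<omega>. - 1 *\<^sub>R Y \<omega>"] L2_rv_scaleR[of M Y "- 1"] by simp

lemma L2_rv_zero: "L2_rv M (\<lambda>\<omega>. 0)"
  by (simp add: L2_rv_def)

lemma L2_rv_sum: "(\<And>i. i \<in> A \<Longrightarrow> L2_rv M (X i)) \<Longrightarrow> L2_rv M (\<lambda>\<omega>. \<Sum>i\<in>A. X i \<omega>)"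
  by (induction A rule: infinite_finite_induct) (simp_all add: L2_rv_zero L2_rv_add)

lemma L2_rv_inner: "L2_rv M X \<Longrightarrow> L2_rv M (\<lambda>\<omega>. X \<omega> \<bullet> (x :: 'h::{real_inner, second_countable_topology}))"
  by (rule L2_rv_bound[where c = "norm x"])
     (auto simp: L2_rv_def mult.commute[of "norm x"] intro: order_trans[OF Cauchy_Schwarz_ineq2])

lemma L2_rv_integrable_norm_mult:
  assumes "L2_rv M X" "L2_rv M Y"
  shows "integrable M (\<lambda>\<omega>. norm (X \<omega>) * norm (Y \<omega>))"
proof (rule Bochner_Integration.integrable_bound)
  have [measurable]: "X \<in> borel_measurable M" "Y \<in> borel_measurable M"
    using assms by (auto simp: L2_rv_def)
  show "integrable M (\<lambda>\<omega>. (norm (X \<omega>))\<^sup>2 + (norm (Y \<omega>))\<^sup>2)"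
    using assms by (simp add: L2_rv_def)
  have "norm (X \<omega>) * norm (Y \<omega>) \<le> (norm (X \<omega>))\<^sup>2 + (norm (Y \<omega>))\<^sup>2" for \<omega>
  proof -
    have "0 \<le> norm (X \<omega>) * norm (Y \<omega>)" by simp
    then show ?thesis using sum_squares_bound[of "norm (X \<omega>)" "norm (Y \<omega>)"] by linarith
  qed
  then show "AE \<omega> in M. norm (norm (X \<omega>) * norm (Y \<omega>)) \<le> norm ((norm (X \<omega>))\<^sup>2 + (norm (Y \<omega>))\<^sup>2)"
    by simp
  show "(\<lambda>\<omega>. norm (X \<omega>) * norm (Y \<omega>)) \<in> borel_measurable M" by measurable
qed

lemma L2_Cauchy_Schwarz:
  assumes X: "L2_rv M X" and Y: "L2_rv M Y"
  shows "(\<integral>\<omega>. norm (X \<omega>) * norm (Y \<omega>) \<partial>M) \<le> L2_norm M X * L2_norm M Y"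
proof -
  have [measurable]: "X \<in> borel_measurable M" "Y \<in> borel_measurable M"
    using assms by (auto simp: L2_rv_def)
  have nn: "(\<integral>\<^sup>+\<omega>. (ennreal (norm (Z \<omega>)))\<^sup>2 \<partial>M) = ennreal ((L2_norm M Z)\<^sup>2)"
    if "L2_rv M Z" for Z :: "'a \<Rightarrow> 'z::{real_normed_vector, second_countable_topology}"
    using that nn_integral_eq_integral[of M "\<lambda>\<omega>. (norm (Z \<omega>))\<^sup>2"]
    by (simp add: L2_norm_power2 L2_rv_def ennreal_power)
  have "ennreal ((\<integral>\<omega>. norm (X \<omega>) * norm (Y \<omega>) \<partial>M)\<^sup>2) =
      (\<integral>\<^sup>+\<omega>. ennreal (norm (X \<omega>)) * ennreal (norm (Y \<omega>)) \<partial>M)\<^sup>2"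
    using nn_integral_eq_integral[OF L2_rv_integrable_norm_mult[OF X Y]]
    by (simp add: ennreal_mult ennreal_power)
  also have "\<dots> \<le> (\<integral>\<^sup>+\<omega>. (ennreal (norm (X \<omega>)))\<^sup>2 \<partial>M) * (\<integral>\<^sup>+\<omega>. (ennreal (norm (Y \<omega>)))\<^sup>2 \<partial>M)"
    by (rule Cauchy_Schwarz_nn_integral) measurable
  also have "\<dots> = ennreal ((L2_norm M X * L2_norm M Y)\<^sup>2)"
    by (simp add: nn[OF X] nn[OF Y] ennreal_mult power_mult_distrib)
  finally have "(\<integral>\<omega>. norm (X \<omega>) * norm (Y \<omega>) \<partial>M)\<^sup>2 \<le> (L2_norm M X * L2_norm M Y)\<^sup>2"
    by (subst (asm) ennreal_le_iff) simp_all
  then show ?thesis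
    by (rule power2_le_imp_le) (simp add: L2_norm_nonneg)
qed

lemma (in prob_space) L2_rv_integrable:
  fixes X :: "'a \<Rightarrow> 'h::{banach, second_countable_topology}"
  assumes X: "L2_rv M X"
  shows "integrable M X"
proof -
  have "L2_rv M (\<lambda>\<omega>. 1 :: real)" by (simp add: L2_rv_def)
  from L2_rv_integrable_norm_mult[OF X this] show ?thesis
    using X by (auto simp: L2_rv_def integrable_norm_iff)
qed

lemma (in prob_space) L1_le_L2_norm:
  fixes X :: "'a \<Rightarrow> 'h::{banach, second_countable_topology}"
  assumes X: "L2_rv M X"
  shows "expectation (\<lambda>\<omega>. norm (X \<omega>)) \<le> L2_norm M X"
proof -
  have 1: "L2_rv M (\<lambda>\<omega>. 1 :: real)" by (simp add: L2_rv_def)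
  from L2_Cauchy_Schwarz[OF X this] show ?thesis
    by (simp add: L2_norm_def prob_space)
qed

text \<open>Stated for a general bounded bilinear \<open>p\<close>, since covariances are taken with
  the inner product, with products of two linear functionals and with the tensor kernel.\<close>

lemma L2_rv_integrable_bilinear:
  fixes X :: "'w \<Rightarrow> 'h::{banach, second_countable_topology}"
    and Y :: "'w \<Rightarrow> 'g::{banach, second_countable_topology}"
    and p :: "'h \<Rightarrow> 'g \<Rightarrow> 'k::{banach, second_countable_topology}"
  assumes p: "bounded_bilinear p" and K: "\<And>a b. norm (p a b) \<le> K * (norm a * norm b)" and K0: "K \<ge> 0"
    and X: "L2_rv M X" and Y: "L2_rv M Y"
  shows "integrable M (\<lambda>\<omega>. p (X \<omega>) (Y \<omega>))"
    and "norm (\<integral>\<omega>. p (X \<omega>) (Y \<omega>) \<partial>M) \<le> K * (L2_norm M X * L2_norm M Y)"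
proof -
  have m [measurable]: "X \<in> borel_measurable M" "Y \<in> borel_measurable M"
    using X Y by (auto simp: L2_rv_def)
  have "continuous_on UNIV (\<lambda>z. p (fst z) (snd z))"
    by (intro bounded_bilinear.continuous_on[OF p] continuous_intros)
  from borel_measurable_continuous_onI[OF this]
  have pm: "(\<lambda>\<omega>. p (X \<omega>) (Y \<omega>)) \<in> borel_measurable M"
    using measurable_compose[of "\<lambda>\<omega>. (X \<omega>, Y \<omega>)" M "borel" "\<lambda>z. p (fst z) (snd z)" borel]
    by (simp add: borel_prod[symmetric])
  have KK: "integrable M (\<lambda>\<omega>. K * (norm (X \<omega>) * norm (Y \<omega>)))"
    using L2_rv_integrable_norm_mult[OF X Y] by simp
  show int: "integrable M (\<lambda>\<omega>. p (X \<omega>) (Y \<omega>))"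
    by (rule Bochner_Integration.integrable_bound[OF KK pm])
       (auto intro: order_trans[OF K abs_ge_self])
  have "norm (\<integral>\<omega>. p (X \<omega>) (Y \<omega>) \<partial>M) \<le> (\<integral>\<omega>. norm (p (X \<omega>) (Y \<omega>)) \<partial>M)"
    by (rule integral_norm_bound)
  also have "\<dots> \<le> (\<integral>\<omega>. K * (norm (X \<omega>) * norm (Y \<omega>)) \<partial>M)"
    using int KK K by (intro integral_mono) auto
  also have "\<dots> = K * (\<integral>\<omega>. norm (X \<omega>) * norm (Y \<omega>) \<partial>M)" by simp
  also have "\<dots> \<le> K * (L2_norm M X * L2_norm M Y)"
    by (intro mult_left_mono L2_Cauchy_Schwarz X Y K0)
  finally show "norm (\<integral>\<omega>. p (X \<omega>) (Y \<omega>) \<partial>M) \<le> K * (L2_norm M X * L2_norm M Y)" .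
qed

text \<open>Fubini on the product law; each partial map of \<open>p\<close> is bounded linear and so
  commutes with the Bochner integral.\<close>

lemma (in prob_space) indep_var_bilinear:
  fixes X :: "'a \<Rightarrow> 'h::{banach, second_countable_topology}"
    and Y :: "'a \<Rightarrow> 'h"
    and p :: "'h \<Rightarrow> 'h \<Rightarrow> 'k::{banach, second_countable_topology}"
  assumes p: "bounded_bilinear p"
    and indep: "indep_var borel X borel Y" and X: "L2_rv M X" and Y: "L2_rv M Y"
  shows "(\<integral>\<omega>. p (X \<omega>) (Y \<omega>) \<partial>M) = p (expectation X) (expectation Y)"
proof -
  interpret p: bounded_bilinear p by fact
  have m [measurable]: "X \<in> borel_measurable M" "Y \<in> borel_measurable M"
    using X Y by (auto simp: L2_rv_def)
  obtain K where K: "\<And>a b. norm (p a b) \<le> norm a * norm b * K" "K \<ge> 0"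
    using p.nonneg_bounded by blast
  have "continuous_on UNIV (\<lambda>z. p (fst z) (snd z))"
    by (intro p.continuous_on continuous_intros)
  from borel_measurable_continuous_onI[OF this]
  have pm [measurable]: "(\<lambda>z. p (fst z) (snd z)) \<in> borel_measurable (borel \<Otimes>\<^sub>M borel)"
    by (simp add: borel_prod)
  interpret DX: prob_space "distr M borel X" by (rule prob_space_distr) simp
  interpret DY: prob_space "distr M borel Y" by (rule prob_space_distr) simp
  interpret P: pair_prob_space "distr M borel X" "distr M borel Y" ..
  have law: "distr M borel X \<Otimes>\<^sub>M distr M borel Y = distr M (borel \<Otimes>\<^sub>M borel) (\<lambda>\<omega>. (X \<omega>, Y \<omega>))"
    using indep by (simp add: indep_var_distribution_eq)
  have pmD: "(\<lambda>z. p (fst z) (snd z)) \<in> borel_measurable (distr M borel X \<Otimes>\<^sub>M distr M borel Y)"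
    by (simp add: law)
  have int: "integrable M (\<lambda>\<omega>. p (X \<omega>) (Y \<omega>))"
    by (rule L2_rv_integrable_bilinear(1)[OF p _ K(2) X Y]) (use K(1) in \<open>simp add: mult.commute\<close>)
  then have intD: "integrable (distr M borel X \<Otimes>\<^sub>M distr M borel Y) (\<lambda>(a, b). p a b)"
    unfolding law by (subst integrable_distr_eq) (simp_all add: case_prod_beta)
  have iX: "integrable M X" and iY: "integrable M Y"
    using X Y by (auto intro: L2_rv_integrable)
  have "(\<integral>\<omega>. p (X \<omega>) (Y \<omega>) \<partial>M) = (\<integral>z. p (fst z) (snd z) \<partial>(distr M borel X \<Otimes>\<^sub>M distr M borel Y))"
    unfolding law by (subst integral_distr) simp_all
  also have "\<dots> = (\<integral>a. (\<integral>b. p a b \<partial>distr M borel Y) \<partial>distr M borel X)"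
    using P.integral_fst'[OF intD] by (simp add: case_prod_unfold)
  also have "\<dots> = (\<integral>a. p a (expectation Y) \<partial>distr M borel X)"
  proof (rule Bochner_Integration.integral_cong[OF refl])
    fix a
    have "(\<integral>b. p a b \<partial>distr M borel Y) = p a (\<integral>b. b \<partial>distr M borel Y)"
      by (rule integral_bounded_linear[OF p.bounded_linear_right])
         (use iY in \<open>simp add: integrable_distr_eq\<close>)
    then show "(\<integral>b. p a b \<partial>distr M borel Y) = p a (expectation Y)"
      by (simp add: integral_distr)
  qed
  also have "\<dots> = p (\<integral>a. a \<partial>distr M borel X) (expectation Y)"
    by (rule integral_bounded_linear[OF p.bounded_linear_left])
       (use iX in \<open>simp add: integrable_distr_eq\<close>)
  also have "\<dots> = p (expectation X) (expectation Y)"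
    by (simp add: integral_distr)
  finally show ?thesis .
qed

section \<open>Measurable functions of an i.i.d. family\<close>

locale innovations = prob_space M for M :: "'w measure" +
  fixes S :: "'s measure" and \<eta> :: "'i \<Rightarrow> 'w \<Rightarrow> 's"
  assumes indep: "indep_vars (\<lambda>_. S) \<eta> UNIV"
    and same_law: "distr M S (\<eta> i) = distr M S (\<eta> j)"
begin

lemma innovation_measurable [measurable]: "\<eta> i \<in> measurable M S"
  using indep by (simp add: indep_vars_def2)

lemma measurable_reindex:
  "(\<lambda>\<omega> k. \<eta> (\<pi> k) \<omega>) \<in> measurable M (\<Pi>\<^sub>M k\<in>UNIV. S)"
  by (rule measurable_PiM_single') (auto intro: measurable_space[OF innovation_measurable])

text \<open>The joint law is a product of equal factors, so every injective selection of indices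
  yields the same product. Equality of laws for all variables built from the innovations is derived
  from this.\<close>

lemma distr_reindex:
  assumes "inj \<pi>"
  shows "distr M (\<Pi>\<^sub>M k\<in>UNIV. S) (\<lambda>\<omega> k. \<eta> (\<pi> k) \<omega>) = (\<Pi>\<^sub>M k\<in>UNIV. distr M S (\<eta> i))"
proof -
  let ?\<mu> = "distr M S (\<eta> i)"
  have \<mu>: "distr M S (\<eta> j) = ?\<mu>" for j by (rule same_law)
  have "distr M (\<Pi>\<^sub>M j\<in>UNIV. S) (\<lambda>\<omega> j. \<eta> j \<omega>) = (\<Pi>\<^sub>M j\<in>UNIV. distr M S (\<eta> j))"
    using indep indep_vars_iff_distr_eq_PiM'[where I = UNIV and M' = "\<lambda>_. S" and X = \<eta>] innovation_measurable
    unfolding restrict_UNIV by blast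
  also have "\<dots> = (\<Pi>\<^sub>M j\<in>UNIV. ?\<mu>)"
    by (intro PiM_cong refl \<mu>)
  finally have law: "distr M (\<Pi>\<^sub>M j\<in>UNIV. S) (\<lambda>\<omega> j. \<eta> j \<omega>) = (\<Pi>\<^sub>M j\<in>UNIV. ?\<mu>)" .
  have sets: "sets (\<Pi>\<^sub>M k\<in>UNIV. ?\<mu>) = sets (\<Pi>\<^sub>M k\<in>UNIV. S)"
    by (intro sets_PiM_cong) auto
  have "(\<Pi>\<^sub>M k\<in>UNIV. ?\<mu>) = distr (\<Pi>\<^sub>M j\<in>UNIV. ?\<mu>) (\<Pi>\<^sub>M k\<in>UNIV. ?\<mu>) (\<lambda>z. \<lambda>k\<in>UNIV. z (\<pi> k))"
    by (rule distr_PiM_reindex[symmetric]) (use assms in \<open>auto intro: prob_space_distr\<close>)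
  also have "\<dots> = distr (\<Pi>\<^sub>M j\<in>UNIV. ?\<mu>) (\<Pi>\<^sub>M k\<in>UNIV. S) (\<lambda>z k. z (\<pi> k))"
    by (rule distr_cong) (simp_all add: sets restrict_UNIV)
  also have "\<dots> = distr (distr M (\<Pi>\<^sub>M j\<in>UNIV. S) (\<lambda>\<omega> j. \<eta> j \<omega>)) (\<Pi>\<^sub>M k\<in>UNIV. S) (\<lambda>z k. z (\<pi> k))"
    unfolding law ..
  also have "\<dots> = distr M (\<Pi>\<^sub>M k\<in>UNIV. S) (\<lambda>\<omega> k. \<eta> (\<pi> k) \<omega>)"
  proof (subst distr_distr)
    show "(\<lambda>z k. z (\<pi> k)) \<in> measurable (\<Pi>\<^sub>M j\<in>UNIV. S) (\<Pi>\<^sub>M k\<in>UNIV. S)"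
      by (rule measurable_PiM_single') (auto simp: space_PiM)
    show "(\<lambda>\<omega> j. \<eta> j \<omega>) \<in> measurable M (\<Pi>\<^sub>M j\<in>UNIV. S)"
      by (rule measurable_reindex[of "\<lambda>j. j"])
  qed (simp add: comp_def)
  finally show ?thesis ..
qed

lemma distr_function_reindex:
  assumes g: "g \<in> measurable (\<Pi>\<^sub>M k\<in>UNIV. S) N" and "inj \<pi>" "inj \<pi>'"
  shows "distr M N (\<lambda>\<omega>. g (\<lambda>k. \<eta> (\<pi> k) \<omega>)) = distr M N (\<lambda>\<omega>. g (\<lambda>k. \<eta> (\<pi>' k) \<omega>))"
proof -
  have "distr M N (\<lambda>\<omega>. g (\<lambda>k. \<eta> (\<pi> k) \<omega>)) =
      distr (distr M (\<Pi>\<^sub>M k\<in>UNIV. S) (\<lambda>\<omega> k. \<eta> (\<pi> k) \<omega>)) N g" for \<pi>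
    using g by (subst distr_distr) (simp_all add: measurable_reindex comp_def)
  then show ?thesis
    using distr_reindex[OF assms(2), of undefined] distr_reindex[OF assms(3), of undefined] by simp
qed

definition depends_on :: "(('i \<Rightarrow> 's) \<Rightarrow> 'b) \<Rightarrow> 'i set \<Rightarrow> bool" where
  "depends_on F A \<longleftrightarrow> (\<forall>e e'. (\<forall>i\<in>A. e i = e' i) \<longrightarrow> F e = F e')"

text \<open>The missing coordinates are filled with the values of the innovations at one fixed
  sample point. These lie in \<open>space S\<close>, so the extension map is measurable, and by
  \<open>dep\<close> they do not influence the value of \<open>F\<close>.\<close>

lemma factor_through_restriction:
  assumes F: "F \<in> measurable (\<Pi>\<^sub>M k\<in>UNIV. S) N" and dep: "depends_on F A"
  obtains F' where "F' \<in> measurable (\<Pi>\<^sub>M k\<in>A. S) N"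
    "\<And>\<omega>. F' (restrict (\<lambda>i. \<eta> i \<omega>) A) = F (\<lambda>i. \<eta> i \<omega>)"
proof -
  obtain \<omega>0 where \<omega>0: "\<omega>0 \<in> space M" using not_empty by blast
  define ext where "ext z i = (if i \<in> A then z i else \<eta> i \<omega>0)" for z i
  have "ext \<in> measurable (\<Pi>\<^sub>M k\<in>A. S) (\<Pi>\<^sub>M k\<in>UNIV. S)"
  proof (rule measurable_PiM_single')
    show "(\<lambda>z. ext z i) \<in> measurable (\<Pi>\<^sub>M k\<in>A. S) S" for i
      using measurable_space[OF innovation_measurable \<omega>0] by (cases "i \<in> A") (auto simp: ext_def)
    show "(\<lambda>z i. ext z i) \<in> space (\<Pi>\<^sub>M k\<in>A. S) \<rightarrow> UNIV \<rightarrow>\<^sub>E space S"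
      using measurable_space[OF innovation_measurable \<omega>0] by (auto simp: ext_def space_PiM)
  qed
  then have "(\<lambda>z. F (ext z)) \<in> measurable (\<Pi>\<^sub>M k\<in>A. S) N"
    using F by (rule measurable_compose)
  moreover have "F (ext (restrict (\<lambda>i. \<eta> i \<omega>) A)) = F (\<lambda>i. \<eta> i \<omega>)" for \<omega>
    using dep unfolding depends_on_def by (auto simp: ext_def)
  ultimately show thesis by (rule that)
qed

lemma indep_functions:
  assumes F: "\<And>j. j \<in> L \<Longrightarrow> F j \<in> measurable (\<Pi>\<^sub>M k\<in>UNIV. S) (N j)"
    and dep: "\<And>j. j \<in> L \<Longrightarrow> depends_on (F j) (A j)"
    and disj: "disjoint_family_on A L"
  shows "indep_vars N (\<lambda>j \<omega>. F j (\<lambda>i. \<eta> i \<omega>)) L"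
proof -
  have "\<exists>F'. F' \<in> measurable (\<Pi>\<^sub>M k\<in>A j. S) (N j) \<and>
      (\<forall>\<omega>. F' (restrict (\<lambda>i. \<eta> i \<omega>) (A j)) = F j (\<lambda>i. \<eta> i \<omega>))" if "j \<in> L" for j
    using factor_through_restriction[OF F[OF that] dep[OF that]] by metis
  then obtain F' where F': "\<And>j. j \<in> L \<Longrightarrow> F' j \<in> measurable (\<Pi>\<^sub>M k\<in>A j. S) (N j)"
    "\<And>j \<omega>. j \<in> L \<Longrightarrow> F' j (restrict (\<lambda>i. \<eta> i \<omega>) (A j)) = F j (\<lambda>i. \<eta> i \<omega>)"
    by metis
  have "indep_vars (\<lambda>j. PiM (A j) (\<lambda>_. S)) (\<lambda>j \<omega>. restrict (\<lambda>i. \<eta> i \<omega>) (A j)) L"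
    by (rule indep_vars_restrict[OF indep _ disj]) simp
  then have "indep_vars N (\<lambda>j \<omega>. F' j (restrict (\<lambda>i. \<eta> i \<omega>) (A j))) L"
    by (rule indep_vars_compose2) (rule F'(1))
  then show ?thesis by (simp add: F'(2) cong: indep_vars_cong)
qed

lemma indep_pair:
  assumes F: "F \<in> borel_measurable (\<Pi>\<^sub>M k\<in>UNIV. S)" "depends_on F A"
    and G: "G \<in> borel_measurable (\<Pi>\<^sub>M k\<in>UNIV. S)" "depends_on G B"
    and AB: "A \<inter> B = {}"
  shows "indep_var borel (\<lambda>\<omega>. F (\<lambda>i. \<eta> i \<omega>)) borel (\<lambda>\<omega>. G (\<lambda>i. \<eta> i \<omega>))"
proof -
  obtain F' where F': "F' \<in> borel_measurable (\<Pi>\<^sub>M k\<in>A. S)"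
    "\<And>\<omega>. F' (restrict (\<lambda>i. \<eta> i \<omega>) A) = F (\<lambda>i. \<eta> i \<omega>)"
    by (rule factor_through_restriction[OF F]) blast
  obtain G' where G': "G' \<in> borel_measurable (\<Pi>\<^sub>M k\<in>B. S)"
    "\<And>\<omega>. G' (restrict (\<lambda>i. \<eta> i \<omega>) B) = G (\<lambda>i. \<eta> i \<omega>)"
    by (rule factor_through_restriction[OF G]) blast
  have "indep_var borel (F' \<circ> (\<lambda>\<omega>. restrict (\<lambda>i. \<eta> i \<omega>) A)) borel (G' \<circ> (\<lambda>\<omega>. restrict (\<lambda>i. \<eta> i \<omega>) B))"
    by (rule indep_var_compose[OF indep_var_restrict[OF indep AB] F'(1) G'(1)]) simp_all
  then show ?thesis by (simp add: comp_def F'(2) G'(2))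
qed

end

lemma integral_distr_cong:
  fixes g :: "'h \<Rightarrow> 'k::{banach, second_countable_topology}"
  assumes "distr M N X = distr M' N Y" "X \<in> measurable M N" "Y \<in> measurable M' N"
    "g \<in> borel_measurable N"
  shows "integrable M (\<lambda>\<omega>. g (X \<omega>)) \<longleftrightarrow> integrable M' (\<lambda>\<omega>. g (Y \<omega>))"
    "(\<integral>\<omega>. g (X \<omega>) \<partial>M) = (\<integral>\<omega>. g (Y \<omega>) \<partial>M')"
  using integrable_distr_eq[OF assms(2,4)] integrable_distr_eq[OF assms(3,4)]
    integral_distr[OF assms(2,4)] integral_distr[OF assms(3,4)] assms(1) by simp_all

text \<open>Copies are numbered from \<open>1\<close>; the copy with number \<open>Suc m\<close> is stored at the index \<open>m\<close>.\<close>

definition all_innovations ::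
    "(int \<Rightarrow> 'w \<Rightarrow> 's) \<Rightarrow> (int \<Rightarrow> nat \<Rightarrow> int \<Rightarrow> 'w \<Rightarrow> 's) \<Rightarrow> int + int \<times> nat \<times> int \<Rightarrow> 'w \<Rightarrow> 's" where
  "all_innovations \<epsilon> \<epsilon>' i = (case i of Inl k \<Rightarrow> \<epsilon> k | Inr (t, m, k) \<Rightarrow> \<epsilon>' t (Suc m) k)"

section \<open>The innovations and all their copies as one i.i.d. family\<close>

context prob_space
begin

context
  fixes S :: "'s measure" and \<epsilon> :: "int \<Rightarrow> 'a \<Rightarrow> 's" and \<epsilon>' :: "int \<Rightarrow> nat \<Rightarrow> int \<Rightarrow> 'a \<Rightarrow> 's"
  assumes iid: "iid_family M S \<epsilon>" and copies: "independent_copies M S \<epsilon> \<epsilon>'"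
begin

lemma iid_measurable: "\<epsilon> k \<in> measurable M S"
  using iid by (simp add: iid_family_def indep_vars_def2)

lemma iid_prob:
  assumes "A \<in> sets S"
  shows "prob (\<epsilon> k -` A \<inter> space M) = measure (distr M S (\<epsilon> 0)) A"
proof -
  have "prob (\<epsilon> k -` A \<inter> space M) = measure (distr M S (\<epsilon> k)) A"
    using assms by (simp add: measure_distr iid_measurable)
  also have "distr M S (\<epsilon> k) = distr M S (\<epsilon> 0)" using iid by (simp add: iid_family_def)
  finally show ?thesis .
qed

definition copy_sequence :: "(int \<times> nat) option \<Rightarrow> 'a \<Rightarrow> int \<Rightarrow> 's" where
  "copy_sequence c = (\<lambda>\<omega> k. case c of None \<Rightarrow> \<epsilon> k \<omega> | Some (t, m) \<Rightarrow> \<epsilon>' t m k \<omega>)"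

lemma copy_sequence_indep:
  "indep_vars (\<lambda>_. \<Pi>\<^sub>M k\<in>UNIV. S) copy_sequence (insert None (Some ` (UNIV \<times> {1..})))"
  using copies unfolding independent_copies_def copy_sequence_def by (rule conjunct2)

lemma copy_sequence_measurable:
  "c \<in> insert None (Some ` (UNIV \<times> {1..})) \<Longrightarrow> copy_sequence c \<in> measurable M (\<Pi>\<^sub>M k\<in>UNIV. S)"
  using copy_sequence_indep unfolding indep_vars_def2 by blast

lemma copy_sequence_law:
  "c \<in> insert None (Some ` (UNIV \<times> {1..})) \<Longrightarrow>
    distr M (\<Pi>\<^sub>M k\<in>UNIV. S) (copy_sequence c) = distr M (\<Pi>\<^sub>M k\<in>UNIV. S) (copy_sequence None)"
  using copies unfolding independent_copies_def copy_sequence_def by auto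

text \<open>Each copy has the law of the original sequence, whose coordinates are independent with a
  common law; hence cylinder probabilities factorize inside every copy.\<close>

lemma copy_sequence_cylinder:
  assumes c: "c \<in> insert None (Some ` (UNIV \<times> {1..}))" and J: "finite J"
    and A: "\<And>k. k \<in> J \<Longrightarrow> A k \<in> sets S"
  shows "prob (copy_sequence c -` {z \<in> space (\<Pi>\<^sub>M k\<in>UNIV. S). \<forall>k\<in>J. z k \<in> A k} \<inter> space M) =
    (\<Prod>k\<in>J. measure (distr M S (\<epsilon> 0)) (A k))"
proof -
  let ?C = "{z \<in> space (\<Pi>\<^sub>M k\<in>(UNIV :: int set). S). \<forall>k\<in>J. z k \<in> A k}"
  have C: "?C \<in> sets (\<Pi>\<^sub>M k\<in>UNIV. S)"
  proof (rule sets.sets_Collect_finite_All[OF _ J])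
    fix k assume "k \<in> J"
    show "{z \<in> space (\<Pi>\<^sub>M k\<in>(UNIV :: int set). S). z k \<in> A k} \<in> sets (\<Pi>\<^sub>M k\<in>UNIV. S)"
      using A[OF \<open>k \<in> J\<close>] by measurable
  qed
  have "prob (copy_sequence c -` ?C \<inter> space M) = prob (copy_sequence None -` ?C \<inter> space M)"
    using measure_distr[OF copy_sequence_measurable[OF c] C]
      measure_distr[OF copy_sequence_measurable[of None] C] copy_sequence_law[OF c] by simp
  also have "\<dots> = (\<Prod>k\<in>J. measure (distr M S (\<epsilon> 0)) (A k))"
  proof (cases "J = {}")
    case True
    have "copy_sequence None -` ?C \<inter> space M = space M"
      using measurable_space[OF copy_sequence_measurable[of None]] True by auto
    then show ?thesis using True by (simp add: prob_space)
  next
    case False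
    have "copy_sequence None -` ?C \<inter> space M = (\<Inter>k\<in>J. \<epsilon> k -` A k \<inter> space M)"
      using measurable_space[OF copy_sequence_measurable[of None]] False
      by (auto simp: copy_sequence_def)
    also have "prob \<dots> = (\<Prod>k\<in>J. prob (\<epsilon> k -` A k \<inter> space M))"
      using iid False J A unfolding iid_family_def
      by (intro indep_varsD[of "\<lambda>_. S" \<epsilon> UNIV]) auto
    also have "\<dots> = (\<Prod>k\<in>J. measure (distr M S (\<epsilon> 0)) (A k))"
      using A by (intro prod.cong refl iid_prob)
    finally show ?thesis .
  qed
  finally show ?thesis .
qed

lemma all_innovations_measurable: "all_innovations \<epsilon> \<epsilon>' i \<in> measurable M S"
proof (cases i)
  case (Inl k)
  then show ?thesis using iid_measurable by (simp add: all_innovations_def)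
next
  case (Inr p)
  obtain t m k where p: "p = (t, m, k)" by (cases p)
  have "(\<lambda>\<omega>. copy_sequence (Some (t, Suc m)) \<omega> k) \<in> measurable M S"
    by (rule measurable_compose[OF copy_sequence_measurable measurable_component_singleton]) auto
  then show ?thesis by (simp add: all_innovations_def Inr p copy_sequence_def)
qed

lemma all_innovations_prob:
  assumes A: "A \<in> sets S"
  shows "prob (all_innovations \<epsilon> \<epsilon>' i -` A \<inter> space M) = measure (distr M S (\<epsilon> 0)) A"
proof (cases i)
  case (Inl k)
  then show ?thesis using iid_prob[OF A] by (simp add: all_innovations_def)
next
  case (Inr p)
  obtain t m k where p: "p = (t, m, k)" by (cases p)
  have c: "Some (t, Suc m) \<in> insert None (Some ` (UNIV \<times> {1..}))" by auto
  have "all_innovations \<epsilon> \<epsilon>' i -` A \<inter> space M =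
      copy_sequence (Some (t, Suc m)) -` {z \<in> space (\<Pi>\<^sub>M k\<in>UNIV. S). \<forall>k\<in>{k}. z k \<in> A} \<inter> space M"
    using measurable_space[OF copy_sequence_measurable[OF c]]
    by (auto simp: all_innovations_def Inr p copy_sequence_def)
  then show ?thesis using copy_sequence_cylinder[OF c, of "{k}" "\<lambda>_. A"] A by simp
qed

text \<open>The hypotheses give independence between whole sequences, while cylinders factorize
  inside each. A finite set of indices is therefore grouped by sequence: the probability factors
  first over the sequences, then over the times within each.\<close>

theorem all_innovations_indep: "indep_vars (\<lambda>_. S) (all_innovations \<epsilon> \<epsilon>') UNIV"
  unfolding indep_vars_def2
proof (intro conjI ballI all_innovations_measurable indep_setsI)
  let ?\<eta> = "all_innovations \<epsilon> \<epsilon>'"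
  let ?F = "\<lambda>i. {?\<eta> i -` A \<inter> space M |A. A \<in> sets S}"
  show "?F i \<subseteq> events" for i
    using all_innovations_measurable by (auto intro: measurable_sets)
  fix A J assume J: "J \<noteq> {}" "finite J" and A: "\<forall>j\<in>J. A j \<in> ?F j"
  obtain B where B: "\<And>j. j \<in> J \<Longrightarrow> B j \<in> sets S" "\<And>j. j \<in> J \<Longrightarrow> A j = ?\<eta> j -` B j \<inter> space M"
    using A by (simp add: Bex_def) metis
  \<comment> \<open>\<open>lab\<close> and \<open>tim\<close> are the sequence and the time of an
    innovation. Together they determine its index, which \<open>idx\<close> recovers for members of
    \<open>J\<close>.\<close>
  define lab :: "int + int \<times> nat \<times> int \<Rightarrow> (int \<times> nat) option" where
    "lab i = (case i of Inl k \<Rightarrow> None | Inr (t, m, k) \<Rightarrow> Some (t, Suc m))" for i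
  define tim :: "int + int \<times> nat \<times> int \<Rightarrow> int" where
    "tim i = (case i of Inl k \<Rightarrow> k | Inr (t, m, k) \<Rightarrow> k)" for i
  have inj: "i = i'" if "lab i = lab i'" "tim i = tim i'" for i i'
    using that by (auto simp: lab_def tim_def split: sum.splits prod.splits)
  have \<eta>: "?\<eta> i \<omega> = copy_sequence (lab i) \<omega> (tim i)" for i \<omega>
    by (auto simp: lab_def tim_def all_innovations_def copy_sequence_def split: sum.splits prod.splits)
  define L where "L = lab ` J"
  have lab: "lab i \<in> insert None (Some ` (UNIV \<times> {1..}))" for i
    by (auto simp: lab_def split: sum.splits prod.splits)
  define idx where "idx c k = the_elem {j \<in> J. lab j = c \<and> tim j = k}" for c k
  have idx: "idx (lab j) (tim j) = j" if "j \<in> J" for j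
  proof -
    have "{i \<in> J. lab i = lab j \<and> tim i = tim j} = {j}" using inj that by auto
    then show ?thesis by (simp add: idx_def)
  qed
  define T where "T c = tim ` {j \<in> J. lab j = c}" for c
  define C where "C c = {z \<in> space (\<Pi>\<^sub>M k\<in>(UNIV :: int set). S). \<forall>k\<in>T c. z k \<in> B (idx c k)}" for c
  have T: "finite (T c)" for c using J by (simp add: T_def)
  have BT: "B (idx c k) \<in> sets S" if "k \<in> T c" for c k
    using that idx B(1) by (auto simp: T_def)
  have C_sets: "C c \<in> sets (\<Pi>\<^sub>M k\<in>UNIV. S)" for c
    unfolding C_def
  proof (rule sets.sets_Collect_finite_All[OF _ T])
    fix k assume "k \<in> T c"
    show "{z \<in> space (\<Pi>\<^sub>M k\<in>(UNIV :: int set). S). z k \<in> B (idx c k)} \<in> sets (\<Pi>\<^sub>M k\<in>UNIV. S)"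
      using BT[OF \<open>k \<in> T c\<close>] by measurable
  qed
  have "(\<Inter>j\<in>J. A j) = (\<Inter>c\<in>L. copy_sequence c -` C c \<inter> space M)"
  proof (intro equalityI subsetI)
    fix \<omega> assume \<omega>: "\<omega> \<in> (\<Inter>j\<in>J. A j)"
    then have sp: "\<omega> \<in> space M" using J B(2) by auto
    show "\<omega> \<in> (\<Inter>c\<in>L. copy_sequence c -` C c \<inter> space M)"
    proof (intro INT_I IntI vimageI2 sp)
      fix c assume c: "c \<in> L"
      then have "copy_sequence c \<omega> \<in> space (\<Pi>\<^sub>M k\<in>UNIV. S)"
        using measurable_space[OF copy_sequence_measurable sp] lab by (auto simp: L_def)
      moreover have "copy_sequence c \<omega> k \<in> B (idx c k)" if "k \<in> T c" for k
      proof -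
        from that obtain j where j: "j \<in> J" "lab j = c" "tim j = k" by (auto simp: T_def)
        then have "\<omega> \<in> A j" using \<omega> by blast
        then show ?thesis using j idx[OF j(1)] by (simp add: B(2)[OF j(1)] \<eta>)
      qed
      ultimately show "copy_sequence c \<omega> \<in> C c" by (simp add: C_def)
    qed
  next
    fix \<omega> assume \<omega>: "\<omega> \<in> (\<Inter>c\<in>L. copy_sequence c -` C c \<inter> space M)"
    show "\<omega> \<in> (\<Inter>j\<in>J. A j)"
    proof
      fix j assume j: "j \<in> J"
      then have "copy_sequence (lab j) \<omega> \<in> C (lab j)" "\<omega> \<in> space M"
        using INT_D[OF \<omega>, of "lab j"] by (auto simp: L_def)
      moreover have "tim j \<in> T (lab j)" using j by (auto simp: T_def)
      ultimately have "copy_sequence (lab j) \<omega> (tim j) \<in> B (idx (lab j) (tim j))"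
        by (simp add: C_def)
      then show "\<omega> \<in> A j" using \<open>\<omega> \<in> space M\<close> by (simp add: B(2)[OF j] \<eta> idx[OF j])
    qed
  qed
  also have "prob \<dots> = (\<Prod>c\<in>L. prob (copy_sequence c -` C c \<inter> space M))"
  proof (rule indep_varsD[OF copy_sequence_indep])
    show "L \<noteq> {}" "finite L" using J by (auto simp: L_def)
    show "L \<subseteq> insert None (Some ` (UNIV \<times> {1..}))" unfolding L_def using lab by (intro image_subsetI)
  qed (rule C_sets)
  also have "\<dots> = (\<Prod>c\<in>L. \<Prod>k\<in>T c. measure (distr M S (\<epsilon> 0)) (B (idx c k)))"
    unfolding C_def
    by (intro prod.cong refl copy_sequence_cylinder T BT) (auto simp only: L_def intro!: lab)
  also have "\<dots> = (\<Prod>c\<in>L. \<Prod>j\<in>{j \<in> J. lab j = c}. measure (distr M S (\<epsilon> 0)) (B j))"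
  proof (intro prod.cong refl)
    fix c
    have "inj_on tim {j \<in> J. lab j = c}" using inj by (auto intro!: inj_onI)
    then have "(\<Prod>k\<in>T c. measure (distr M S (\<epsilon> 0)) (B (idx c k))) =
        (\<Prod>j\<in>{j \<in> J. lab j = c}. measure (distr M S (\<epsilon> 0)) (B (idx c (tim j))))"
      unfolding T_def by (subst prod.reindex) simp_all
    also have "\<dots> = (\<Prod>j\<in>{j \<in> J. lab j = c}. measure (distr M S (\<epsilon> 0)) (B j))"
      by (intro prod.cong refl) (auto simp: idx)
    finally show "(\<Prod>k\<in>T c. measure (distr M S (\<epsilon> 0)) (B (idx c k))) =
        (\<Prod>j\<in>{j \<in> J. lab j = c}. measure (distr M S (\<epsilon> 0)) (B j))" .
  qed
  also have "\<dots> = (\<Prod>j\<in>J. measure (distr M S (\<epsilon> 0)) (B j))"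
    using J by (intro prod.group) (auto simp: L_def)
  also have "\<dots> = (\<Prod>j\<in>J. prob (A j))"
    using B by (intro prod.cong refl) (simp add: all_innovations_prob)
  finally show "prob (\<Inter>j\<in>J. A j) = (\<Prod>j\<in>J. prob (A j))" .
qed

lemma all_innovations_same_law: "distr M S (all_innovations \<epsilon> \<epsilon>' i) = distr M S (all_innovations \<epsilon> \<epsilon>' j)"
proof (rule measure_eqI)
  fix A assume "A \<in> sets (distr M S (all_innovations \<epsilon> \<epsilon>' i))"
  then have A: "A \<in> sets S" by simp
  show "emeasure (distr M S (all_innovations \<epsilon> \<epsilon>' i)) A = emeasure (distr M S (all_innovations \<epsilon> \<epsilon>' j)) A"
    using all_innovations_prob[OF A, of i] all_innovations_prob[OF A, of j] A
    by (simp add: emeasure_distr all_innovations_measurable emeasure_eq_measure)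
qed simp

end

end

section \<open>Block coupling of Bernoulli shifts\<close>

text \<open>In the application \<open>d k\<close> bounds the coupling error at position \<open>k\<close> of a block of length \<open>q\<close>
  and \<open>c s t\<close> is the covariance of the errors at the times \<open>s\<close> and \<open>t\<close>. The bound grows with the
  number of blocks, not with the number of times.\<close>

lemma block_sum_bound:
  fixes c :: "nat \<Rightarrow> nat \<Rightarrow> real" and d :: "nat \<Rightarrow> real"
  assumes q: "q > 0" and U: "finite U" and d: "\<And>k. d k \<ge> 0" and \<Delta>: "\<And>F. finite F \<Longrightarrow> sum d F \<le> \<Delta>"
    and sym: "\<And>s t. c s t = c t s"
    and same: "\<And>s t. s div q = t div q \<Longrightarrow> c s t \<le> d (s mod q) * d (t mod q)"
    and diff: "\<And>s t. s < t \<Longrightarrow> s div q \<noteq> t div q \<Longrightarrow> c s t \<le> d (s mod q) * d (t - s - 1)"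
  shows "(\<Sum>s\<in>U. \<Sum>t\<in>U. c s t) \<le> 4 * \<Delta>\<^sup>2 * card ((\<lambda>t. t div q) ` U)"
proof -
  \<comment> \<open>An unsymmetric majorant in which the row index \<open>s\<close> always supplies
    the factor \<open>d (s mod q)\<close>. Symmetrizing it at the end costs a factor 2.\<close>
  define g where "g s t = (if s div q = t div q then d (s mod q) * d (t mod q) else 0) +
    (if s < t then d (s mod q) * d (t - s - 1) else 0)" for s t
  have g0: "g s t \<ge> 0" for s t using d by (simp add: g_def)
  have \<Delta>0: "\<Delta> \<ge> 0" using \<Delta>[of "{}"] by simp
  have cg: "c s t \<le> g s t + g t s" for s t
  proof (cases "s div q = t div q")
    case True
    then have "c s t \<le> g s t" using same[OF True] d by (auto simp: g_def intro: add_increasing2)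
    then show ?thesis using g0[of t s] by linarith
  next
    case False
    then consider "s < t" | "t < s" by (cases s t rule: linorder_cases) auto
    then show ?thesis
    proof cases
      case 1
      then have "c s t \<le> g s t" using diff[OF 1 False] by (simp add: g_def False)
      then show ?thesis using g0[of t s] by linarith
    next
      case 2
      then have "c s t \<le> g t s" using diff[OF 2] False sym[of s t] by (simp add: g_def)
      then show ?thesis using g0[of s t] by linarith
    qed
  qed
  have inj_mod: "inj_on (\<lambda>t. t mod q) {t \<in> U. j = t div q}" for j
  proof (rule inj_onI)
    fix s t assume st: "s \<in> {t \<in> U. j = t div q}" "t \<in> {t \<in> U. j = t div q}" "s mod q = t mod q"
    then have "s div q = t div q" by simp
    then have "s div q * q + s mod q = t div q * q + t mod q" using st(3) by simp
    then show "s = t" by simp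
  qed
  \<comment> \<open>For fixed \<open>s\<close> the other factor runs through distinct arguments:
    positions in the same block, or the numbers \<open>t - s - 1\<close>. Each of the two sums is
    therefore at most \<open>\<Delta>\<close>.\<close>
  have g_sum: "(\<Sum>t\<in>U. g s t) \<le> 2 * \<Delta> * d (s mod q)" for s
  proof -
    let ?A = "{t \<in> U. s div q = t div q}" and ?B = "{t \<in> U. s < t}"
    have injA: "inj_on (\<lambda>t. t mod q) ?A"
      by (rule inj_mod)
    have injB: "inj_on (\<lambda>t. t - s - 1) ?B" by (intro inj_onI) auto
    have "(\<Sum>t\<in>U. g s t) = d (s mod q) * (\<Sum>t\<in>?A. d (t mod q)) + d (s mod q) * (\<Sum>t\<in>?B. d (t - s - 1))"
      using U by (simp add: g_def sum.distrib sum_distrib_left sum.inter_filter[symmetric])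
    also have "(\<Sum>t\<in>?A. d (t mod q)) = sum d ((\<lambda>t. t mod q) ` ?A)"
      using injA by (simp add: sum.reindex)
    also have "(\<Sum>t\<in>?B. d (t - s - 1)) = sum d ((\<lambda>t. t - s - 1) ` ?B)"
      using injB by (simp add: sum.reindex)
    also have "d (s mod q) * sum d ((\<lambda>t. t mod q) ` ?A) + d (s mod q) * sum d ((\<lambda>t. t - s - 1) ` ?B)
        \<le> d (s mod q) * \<Delta> + d (s mod q) * \<Delta>"
      using U d by (intro add_mono mult_left_mono \<Delta>) auto
    finally show ?thesis by (simp add: algebra_simps)
  qed
  \<comment> \<open>A block contains each position at most once and so contributes at most
    \<open>\<Delta>\<close>; this is how the number of blocks enters.\<close>
  have d_sum: "(\<Sum>s\<in>U. d (s mod q)) \<le> \<Delta> * card ((\<lambda>t. t div q) ` U)"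
  proof -
    have "(\<Sum>s\<in>U. d (s mod q)) = (\<Sum>j\<in>(\<lambda>t. t div q) ` U. \<Sum>s\<in>{s \<in> U. s div q = j}. d (s mod q))"
      using U by (intro sum.group[symmetric]) auto
    also have "\<dots> \<le> (\<Sum>j\<in>(\<lambda>t. t div q) ` U. \<Delta>)"
    proof (rule sum_mono)
      fix j
      have "inj_on (\<lambda>t. t mod q) {s \<in> U. s div q = j}"
        using inj_mod[of j] by (simp add: eq_commute)
      then have "(\<Sum>s\<in>{s \<in> U. s div q = j}. d (s mod q)) = sum d ((\<lambda>t. t mod q) ` {s \<in> U. s div q = j})"
        by (simp add: sum.reindex)
      also have "\<dots> \<le> \<Delta>" using U by (intro \<Delta>) auto
      finally show "(\<Sum>s\<in>{s \<in> U. s div q = j}. d (s mod q)) \<le> \<Delta>" .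
    qed
    finally show ?thesis by (simp add: mult.commute)
  qed
  have "(\<Sum>s\<in>U. \<Sum>t\<in>U. c s t) \<le> (\<Sum>s\<in>U. \<Sum>t\<in>U. g s t + g t s)"
    by (intro sum_mono cg)
  also have "\<dots> = 2 * (\<Sum>s\<in>U. \<Sum>t\<in>U. g s t)"
    using sum.swap[of "\<lambda>s t. g t s" U U] by (simp add: sum.distrib)
  also have "\<dots> \<le> 2 * (\<Sum>s\<in>U. 2 * \<Delta> * d (s mod q))"
    by (intro mult_left_mono sum_mono g_sum) auto
  also have "\<dots> = 4 * \<Delta> * (\<Sum>s\<in>U. d (s mod q))"
    by (simp add: sum_distrib_left mult.assoc)
  also have "\<dots> \<le> 4 * \<Delta> * (\<Delta> * card ((\<lambda>t. t div q) ` U))"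
    using \<Delta>0 by (intro mult_left_mono d_sum) auto
  finally show ?thesis by (simp add: power2_eq_square)
qed

section \<open>Index maps for the process, its couplings and time shifts\<close>

definition past :: "int \<Rightarrow> nat \<Rightarrow> int + int \<times> nat \<times> int" where
  "past t j = Inl (t - int j)"

text \<open>The copy with number \<open>m\<close> sits at index \<open>m - 1\<close>, so \<open>coupled_past\<close> is meaningful for \<open>m \<ge> 1\<close> only.\<close>

definition coupled_past :: "nat \<Rightarrow> int \<Rightarrow> nat \<Rightarrow> int + int \<times> nat \<times> int" where
  "coupled_past m t j = (if j < m then Inl (t - int j) else Inr (t, m - 1, t - int j))"

text \<open>The time label of a copy is translated together with the times. Thus the coupling at
  time \<open>s\<close> is carried to the coupling at time \<open>s + t\<close>, and the originals
  and their couplings are jointly stationary.\<close>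

definition shift :: "int \<Rightarrow> int + int \<times> nat \<times> int \<Rightarrow> int + int \<times> nat \<times> int" where
  "shift t i = (case i of Inl k \<Rightarrow> Inl (k + t) | Inr (s, m, k) \<Rightarrow> Inr (s + t, m, k + t))"

lemma inj_past: "inj (past t)" and inj_coupled_past: "inj (coupled_past m t)"
  by (auto simp: past_def coupled_past_def intro!: injI split: if_splits)

lemma inj_shift: "inj (shift t)"
proof (rule injI)
  show "i = j" if "shift t i = shift t j" for i j
    using that by (cases i; cases j) (auto simp: shift_def split: prod.splits)
qed

lemma shift_past: "shift t (past s j) = past (s + t) j"
  and shift_coupled_past: "shift t (coupled_past m s j) = coupled_past m (s + t) j"
  by (auto simp: past_def coupled_past_def shift_def)

lemma (in prob_space) same_law_L2:
  fixes X Y :: "'a \<Rightarrow> 'h::{banach, second_countable_topology}"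
  assumes law: "distr M borel X = distr M borel Y"
    and [measurable]: "X \<in> borel_measurable M" "Y \<in> borel_measurable M"
  shows "L2_rv M X \<longleftrightarrow> L2_rv M Y" "L2_norm M X = L2_norm M Y" "expectation X = expectation Y"
proof -
  have n: "(\<lambda>x::'h. (norm x)\<^sup>2) \<in> borel_measurable borel" and i: "(\<lambda>x::'h. x) \<in> borel_measurable borel"
    by measurable
  note l2 = integral_distr_cong[OF law assms(2,3) n] and l1 = integral_distr_cong(2)[OF law assms(2,3) i]
  show "L2_rv M X \<longleftrightarrow> L2_rv M Y" using l2(1) assms(2,3) by (simp add: L2_rv_def)
  show "L2_norm M X = L2_norm M Y" using l2(2) by (simp only: L2_norm_def)
  show "expectation X = expectation Y" by (rule l1)
qed

section \<open>Causal functions of the innovations and their couplings\<close>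

locale bernoulli_shift = innovations M S \<eta>
  for M :: "'w measure" and S :: "'s measure" and \<eta> :: "int + int \<times> nat \<times> int \<Rightarrow> 'w \<Rightarrow> 's" +
  fixes f :: "(nat \<Rightarrow> 's) \<Rightarrow> 'h::{real_inner, banach, second_countable_topology}"
  assumes f_measurable: "f \<in> borel_measurable (\<Pi>\<^sub>M k\<in>UNIV. S)"
    and f_L2: "L2_rv M (\<lambda>\<omega>. f (\<lambda>j. \<eta> (past 0 j) \<omega>))"
    and f_mean: "expectation (\<lambda>\<omega>. f (\<lambda>j. \<eta> (past 0 j) \<omega>)) = 0"
begin

definition Y :: "int \<Rightarrow> 'w \<Rightarrow> 'h" where
  "Y t \<omega> = f (\<lambda>j. \<eta> (past t j) \<omega>)"

definition C :: "nat \<Rightarrow> int \<Rightarrow> 'w \<Rightarrow> 'h" where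
  "C m t \<omega> = f (\<lambda>j. \<eta> (coupled_past m t j) \<omega>)"

definition \<delta> :: "nat \<Rightarrow> real" where
  "\<delta> m = L2_norm M (\<lambda>\<omega>. Y 0 \<omega> - C m 0 \<omega>)"

lemma \<delta>_nonneg: "\<delta> m \<ge> 0"
  by (simp add: \<delta>_def L2_norm_nonneg)

lemma measurable_reindexed_function:
  assumes "g \<in> measurable (\<Pi>\<^sub>M k\<in>UNIV. S) N"
  shows "(\<lambda>e. g (\<lambda>k. e (\<pi> k))) \<in> measurable (\<Pi>\<^sub>M k\<in>UNIV. S) N"
proof (rule measurable_compose[OF _ assms])
  show "(\<lambda>e k. e (\<pi> k)) \<in> measurable (\<Pi>\<^sub>M k\<in>UNIV. S) (\<Pi>\<^sub>M k\<in>UNIV. S)"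
    by (rule measurable_PiM_single') (auto simp: space_PiM)
qed

lemma Y_measurable [measurable]: "Y t \<in> borel_measurable M"
  and C_measurable [measurable]: "C m t \<in> borel_measurable M"
  unfolding Y_def[abs_def] C_def[abs_def]
  by (rule measurable_compose[OF measurable_reindex f_measurable])+

text \<open>Not only \<open>past\<close> but also \<open>coupled_past\<close> is injective: the
  coupled variable evaluates \<open>f\<close> on an i.i.d. sequence with the same law.\<close>

lemma Y_law: "distr M borel (Y t) = distr M borel (Y 0)"
  and C_law: "distr M borel (C m t) = distr M borel (Y 0)"
  unfolding Y_def[abs_def] C_def[abs_def]
  by (rule distr_function_reindex[OF f_measurable]; simp add: inj_past inj_coupled_past)+

lemma Y_L2: "L2_rv M (Y t)" and C_L2: "L2_rv M (C m t)"
  and Y_mean: "expectation (Y t) = 0" and C_mean: "expectation (C m t) = 0"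
proof -
  have 0: "L2_rv M (Y 0)" "expectation (Y 0) = 0"
    unfolding Y_def[abs_def] by (rule f_L2 f_mean)+
  note Yt = same_law_L2[OF Y_law[of t] Y_measurable Y_measurable]
  note Ct = same_law_L2[OF C_law[of m t] C_measurable Y_measurable]
  show "L2_rv M (Y t)" "L2_rv M (C m t)" "expectation (Y t) = 0" "expectation (C m t) = 0"
    by (simp_all only: Yt(1,3) Ct(1,3) 0)
qed

lemma shift_law:
  assumes "G \<in> measurable (\<Pi>\<^sub>M k\<in>UNIV. S) N"
  shows "distr M N (\<lambda>\<omega>. G (\<lambda>i. \<eta> (shift t i) \<omega>)) = distr M N (\<lambda>\<omega>. G (\<lambda>i. \<eta> i \<omega>))"
  using distr_function_reindex[OF assms, of "shift t" "\<lambda>i. i"] by (simp add: inj_shift)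

lemma Y_shift: "Y (s + t) \<omega> = f (\<lambda>j. \<eta> (shift t (past s j)) \<omega>)"
  and C_shift: "C m (s + t) \<omega> = f (\<lambda>j. \<eta> (shift t (coupled_past m s j)) \<omega>)"
  by (simp_all add: Y_def C_def shift_past shift_coupled_past)

lemma error_L2: "L2_rv M (\<lambda>\<omega>. Y t \<omega> - C m t \<omega>)"
  by (intro L2_rv_diff Y_L2 C_L2)

lemma error_mean: "expectation (\<lambda>\<omega>. Y t \<omega> - C m t \<omega>) = 0"
  using L2_rv_integrable[OF Y_L2] L2_rv_integrable[OF C_L2] by (simp add: Y_mean C_mean)

lemma error_L2_norm: "L2_norm M (\<lambda>\<omega>. Y t \<omega> - C m t \<omega>) = \<delta> m"
proof -
  let ?G = "\<lambda>e. f (\<lambda>j. e (past 0 j)) - f (\<lambda>j. e (coupled_past m 0 j))"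
  have G: "?G \<in> borel_measurable (\<Pi>\<^sub>M k\<in>UNIV. S)"
    by (rule borel_measurable_diff; rule measurable_reindexed_function[OF f_measurable])
  have law: "distr M borel (\<lambda>\<omega>. Y t \<omega> - C m t \<omega>) = distr M borel (\<lambda>\<omega>. Y 0 \<omega> - C m 0 \<omega>)"
    using shift_law[OF G, of t] Y_shift[of 0 t] C_shift[of m 0 t] by (simp add: Y_def C_def)
  show ?thesis unfolding \<delta>_def
    by (rule same_law_L2(2)[OF law]) measurable
qed

lemma stationary_pair:
  fixes p :: "'h \<Rightarrow> 'h \<Rightarrow> 'k::{banach, second_countable_topology}"
  assumes p: "bounded_bilinear p"
  shows "(\<integral>\<omega>. p (Y (s + t) \<omega>) (Y (s' + t) \<omega>) \<partial>M) = (\<integral>\<omega>. p (Y s \<omega>) (Y s' \<omega>) \<partial>M)"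
proof -
  have "continuous_on UNIV (\<lambda>z. p (fst z) (snd z))"
    by (intro bounded_bilinear.continuous_on[OF p] continuous_intros)
  from borel_measurable_continuous_onI[OF this]
  have pm: "(\<lambda>z. p (fst z) (snd z)) \<in> borel_measurable (borel \<Otimes>\<^sub>M borel)" by (simp add: borel_prod)
  let ?G = "\<lambda>e. (f (\<lambda>j. e (past s j)), f (\<lambda>j. e (past s' j)))"
  have G: "?G \<in> measurable (\<Pi>\<^sub>M k\<in>UNIV. S) (borel \<Otimes>\<^sub>M borel)"
    by (rule measurable_Pair; rule measurable_reindexed_function[OF f_measurable])
  have law: "distr M (borel \<Otimes>\<^sub>M borel) (\<lambda>\<omega>. (Y (s + t) \<omega>, Y (s' + t) \<omega>)) =
      distr M (borel \<Otimes>\<^sub>M borel) (\<lambda>\<omega>. (Y s \<omega>, Y s' \<omega>))"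
    using shift_law[OF G, of t] by (simp add: Y_shift) (simp add: Y_def)
  have "(\<integral>\<omega>. p (fst (Y (s + t) \<omega>, Y (s' + t) \<omega>)) (snd (Y (s + t) \<omega>, Y (s' + t) \<omega>)) \<partial>M) =
      (\<integral>\<omega>. p (fst (Y s \<omega>, Y s' \<omega>)) (snd (Y s \<omega>, Y s' \<omega>)) \<partial>M)"
    by (rule integral_distr_cong(2)[OF law _ _ pm]) measurable
  then show ?thesis by simp
qed

lemma depends_onI: "(\<And>e e'. (\<And>i. i \<in> A \<Longrightarrow> e i = e' i) \<Longrightarrow> F e = F e') \<Longrightarrow> depends_on F A"
  unfolding depends_on_def by blast

lemma depends_onD: "depends_on F A \<Longrightarrow> (\<And>i. i \<in> A \<Longrightarrow> e i = e' i) \<Longrightarrow> F e = F e'"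
  unfolding depends_on_def by blast

lemma depends_on_past: "depends_on (\<lambda>e. f (\<lambda>j. e (past t j))) {Inl k |k. k \<le> t}"
proof (rule depends_onI)
  fix e e' :: "int + int \<times> nat \<times> int \<Rightarrow> 's"
  assume eq: "\<And>i. i \<in> {Inl k |k. k \<le> t} \<Longrightarrow> e i = e' i"
  have "e (past t j) = e' (past t j)" for j by (rule eq) (simp add: past_def)
  then show "f (\<lambda>j. e (past t j)) = f (\<lambda>j. e' (past t j))" by simp
qed

lemma depends_on_coupled_past:
  "depends_on (\<lambda>e. f (\<lambda>j. e (coupled_past m t j)))
    ({Inl k |k. t - int m < k \<and> k \<le> t} \<union> {Inr (t, m - 1, k) |k. True})" (is "depends_on _ ?A")
proof (rule depends_onI)
  fix e e' :: "int + int \<times> nat \<times> int \<Rightarrow> 's"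
  assume eq: "\<And>i. i \<in> ?A \<Longrightarrow> e i = e' i"
  have "e (coupled_past m t j) = e' (coupled_past m t j)" for j
    by (rule eq) (simp add: coupled_past_def)
  then show "f (\<lambda>j. e (coupled_past m t j)) = f (\<lambda>j. e' (coupled_past m t j))" by simp
qed

lemma depends_on_mono: "depends_on F A \<Longrightarrow> A \<subseteq> B \<Longrightarrow> depends_on F B"
  unfolding depends_on_def by blast

lemma depends_on_diff:
  assumes "depends_on F A" "depends_on G A"
  shows "depends_on (\<lambda>e. F e - G e) A"
proof (rule depends_onI)
  fix e e' :: "int + int \<times> nat \<times> int \<Rightarrow> 's"
  assume "\<And>i. i \<in> A \<Longrightarrow> e i = e' i"
  then have "F e = F e'" "G e = G e'" using assms depends_onD by blast+
  then show "F e - G e = F e' - G e'" by simp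
qed

text \<open>Coupling \<open>Y k\<close> at lag \<open>k\<close> removes all innovations up to time
  0. The coupled variable is independent of \<open>Y 0\<close> and centred, so only the coupling
  error contributes to the covariance.\<close>

lemma covariance_bound:
  fixes p :: "'h \<Rightarrow> 'h \<Rightarrow> 'k::{banach, second_countable_topology}"
  assumes p: "bounded_bilinear p" and K: "\<And>a b. norm (p a b) \<le> K * (norm a * norm b)" "K \<ge> 0"
    and k: "k \<ge> 1"
  shows "norm (\<integral>\<omega>. p (Y 0 \<omega>) (Y (int k) \<omega>) \<partial>M) \<le> K * (L2_norm M (Y 0) * \<delta> k)"
proof -
  interpret p: bounded_bilinear p by fact
  have "indep_var borel (Y 0) borel (C k (int k))"
    unfolding Y_def[abs_def] C_def[abs_def]
    by (rule indep_pair[OF measurable_reindexed_function[OF f_measurable] depends_on_past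
          measurable_reindexed_function[OF f_measurable] depends_on_coupled_past]) auto
  then have 0: "(\<integral>\<omega>. p (Y 0 \<omega>) (C k (int k) \<omega>) \<partial>M) = 0"
    by (subst indep_var_bilinear[OF p]) (simp_all add: Y_L2 C_L2 Y_mean p.zero_left)
  have "(\<integral>\<omega>. p (Y 0 \<omega>) (Y (int k) \<omega>) \<partial>M) =
      (\<integral>\<omega>. p (Y 0 \<omega>) (Y (int k) \<omega> - C k (int k) \<omega>) \<partial>M)"
    using L2_rv_integrable_bilinear(1)[OF p K Y_L2[of 0] Y_L2[of "int k"]]
      L2_rv_integrable_bilinear(1)[OF p K Y_L2[of 0] C_L2[of k "int k"]] 0
    by (simp add: p.diff_right)
  also have "norm \<dots> \<le> K * (L2_norm M (Y 0) * L2_norm M (\<lambda>\<omega>. Y (int k) \<omega> - C k (int k) \<omega>))"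
    by (rule L2_rv_integrable_bilinear(2)[OF p K Y_L2 error_L2])
  finally show ?thesis by (simp add: error_L2_norm)
qed

end

section \<open>Averaging of autocovariances\<close>

lemma cesaro_mean:
  fixes x :: "nat \<Rightarrow> real"
  assumes "x \<longlonglongrightarrow> L"
  shows "(\<lambda>n. (\<Sum>t<n. x t) / real n) \<longlonglongrightarrow> L"
proof (rule LIMSEQ_I)
  fix e :: real assume e: "e > 0"
  then obtain N where N: "\<And>t. t \<ge> N \<Longrightarrow> \<bar>x t - L\<bar> < e / 2"
    using LIMSEQ_D[OF assms, of "e / 2"] by auto
  define A where "A = (\<Sum>t<N. \<bar>x t - L\<bar>)"
  have A: "A \<ge> 0" by (simp add: A_def)
  obtain m :: nat where m: "real m > 2 * A / e" using reals_Archimedean2 by blast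
  show "\<exists>no. \<forall>n\<ge>no. norm ((\<Sum>t<n. x t) / real n - L) < e"
  proof (intro exI[of _ "max (Suc m) N"] allI impI)
    fix n assume n: "n \<ge> max (Suc m) N"
    have n0: "real n > 0" using n by simp
    have "\<bar>\<Sum>t<n. x t - L\<bar> \<le> (\<Sum>t<n. \<bar>x t - L\<bar>)" by (rule sum_abs)
    also have "\<dots> = A + (\<Sum>t\<in>{N..<n}. \<bar>x t - L\<bar>)"
      using n sum.atLeastLessThan_concat[of 0 N n "\<lambda>t. \<bar>x t - L\<bar>"]
      by (simp add: A_def atLeast0LessThan)
    also have "\<dots> \<le> A + (\<Sum>t\<in>{N..<n}. e / 2)"
      using N by (intro add_left_mono sum_mono) (simp add: less_imp_le)
    also have "\<dots> \<le> A + real n * (e / 2)"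
      using e by (simp add: mult_right_mono)
    also have "A < real n * (e / 2)"
    proof -
      have "2 * A / e < real n" using m n by linarith
      then show ?thesis using e by (simp add: field_simps)
    qed
    finally have "\<bar>\<Sum>t<n. x t - L\<bar> < e * real n" by simp
    moreover have "(\<Sum>t<n. x t) / real n - L = (\<Sum>t<n. x t - L) / real n"
      using n0 by (simp add: sum_subtractf field_simps)
    ultimately show "norm ((\<Sum>t<n. x t) / real n - L) < e"
      using n0 by (simp add: pos_divide_less_eq)
  qed
qed

text \<open>Passing from \<open>n\<close> to \<open>n + 1\<close> adds a row and a column, each with
  the lags 1 to \<open>n\<close>, and a diagonal entry. In this form the variance of a sum, divided
  by its length, is a Cesaro mean of partial sums of the autocovariance series.\<close>

lemma double_sum_lag:
  fixes g :: "nat \<Rightarrow> real"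
  shows "(\<Sum>s<n. \<Sum>t<n. g (if s \<le> t then t - s else s - t)) =
    (\<Sum>t<n. g 0 + 2 * (\<Sum>k<t. g (Suc k)))"
proof (induction n)
  case (Suc n)
  let ?l = "\<lambda>s t. if s \<le> t then t - s else s - t"
  have rev: "(\<Sum>s<n. g (n - s)) = (\<Sum>k<n. g (Suc k))"
    by (rule sum.reindex_bij_witness[where i = "\<lambda>k. n - Suc k" and j = "\<lambda>s. n - Suc s"])
       (auto simp: Suc_diff_Suc)
  have a: "(\<Sum>s<n. g (?l s n)) = (\<Sum>s<n. g (n - s))" by (intro sum.cong) auto
  have b: "(\<Sum>t<n. g (?l n t)) = (\<Sum>s<n. g (n - s))" by (intro sum.cong) auto
  have "(\<Sum>s<Suc n. \<Sum>t<Suc n. g (?l s t)) =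
      (\<Sum>s<n. \<Sum>t<n. g (?l s t)) + (\<Sum>s<n. g (?l s n)) + (\<Sum>t<n. g (?l n t)) + g 0"
    by (simp add: sum.distrib)
  also have "\<dots> = (\<Sum>t<Suc n. g 0 + 2 * (\<Sum>k<t. g (Suc k)))"
    unfolding a b rev Suc by simp
  finally show ?case .
qed simp

section \<open>Approximation by independent blocks\<close>

locale approximable_shift = bernoulli_shift +
  assumes summable_\<delta>: "summable (\<lambda>m. \<delta> (Suc m))"
begin

definition \<Delta> :: real where
  "\<Delta> = (\<Sum>m. \<delta> (Suc m))"

lemma sum_\<delta>_le: "finite F \<Longrightarrow> (\<Sum>m\<in>F. \<delta> (Suc m)) \<le> \<Delta>"
  unfolding \<Delta>_def by (rule sum_le_suminf[OF summable_\<delta>]) (auto simp: \<delta>_nonneg)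

lemma \<Delta>_nonneg: "\<Delta> \<ge> 0"
  using sum_\<delta>_le[of "{}"] by simp

text \<open>The times \<open>t + 1\<close> with \<open>j q \<le> t < (j + 1) q\<close> form block number \<open>j\<close>. The coupling lag
  \<open>t mod q + 1\<close> is chosen so that exactly the innovations before the block are replaced.\<close>

definition D :: "nat \<Rightarrow> nat \<Rightarrow> 'a \<Rightarrow> 'c" where
  "D q t \<omega> = Y (int t + 1) \<omega> - C (Suc (t mod q)) (int t + 1) \<omega>"

lemma D_L2: "L2_rv M (D q t)"
  unfolding D_def[abs_def] by (rule error_L2)

lemma inner_D_bound:
  assumes "L2_rv M Z"
  shows "\<bar>expectation (\<lambda>\<omega>. D q s \<omega> \<bullet> Z \<omega>)\<bar> \<le> \<delta> (Suc (s mod q)) * L2_norm M Z"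
  using L2_rv_integrable_bilinear(2)[OF bounded_bilinear_inner _ _ D_L2[of q s] assms, of 1]
  by (simp add: D_def[abs_def] error_L2_norm Cauchy_Schwarz_ineq2)

lemma integrable_inner_D: "L2_rv M Z \<Longrightarrow> integrable M (\<lambda>\<omega>. D q s \<omega> \<bullet> Z \<omega>)"
  using L2_rv_integrable_bilinear(1)[OF bounded_bilinear_inner _ _ D_L2[of q s], of 1 Z]
  by (simp add: Cauchy_Schwarz_ineq2)

lemma D_covariance_same:
  "\<bar>expectation (\<lambda>\<omega>. D q s \<omega> \<bullet> D q t \<omega>)\<bar> \<le> \<delta> (Suc (s mod q)) * \<delta> (Suc (t mod q))"
  using inner_D_bound[OF D_L2[of q t], of q s]
  by (simp add: D_def[abs_def] error_L2_norm)

text \<open>The later variable is also coupled at lag \<open>k = t - s\<close>. The difference of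
  its two coupled versions reads only innovations after time \<open>s + 1\<close> and copies
  attached to its own time, so it is independent of \<open>D q s\<close> and drops out. What remains
  is the coupling error at lag \<open>k\<close>.\<close>

lemma D_covariance_diff:
  assumes st: "s < t" "s div q \<noteq> t div q"
  shows "\<bar>expectation (\<lambda>\<omega>. D q s \<omega> \<bullet> D q t \<omega>)\<bar> \<le> \<delta> (Suc (s mod q)) * \<delta> (Suc (t - s - 1))"
proof -
  define k i \<tau> where "k = t - s" and "i = Suc (t mod q)" and "\<tau> = int t + 1"
  have q: "q > 0" using st by (cases q) auto
  have "s div q < t div q" using st div_le_mono[of s t q] by simp
  then have "s < (t div q) * q" using q by (simp add: div_less_iff_less_mult)
  \<comment> \<open>As \<open>s\<close> precedes the block of \<open>t\<close>, the lag
    \<open>i\<close> used in \<open>D q t\<close> is at most \<open>k\<close>; so the coupling at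
    lag \<open>i\<close> also stays within the last \<open>k\<close> innovations.\<close>
  then have ik: "i \<le> k" using div_mult_mod_eq[of t q] unfolding i_def k_def by linarith
  let ?F = "\<lambda>e. f (\<lambda>j. e (past (int s + 1) j)) - f (\<lambda>j. e (coupled_past (Suc (s mod q)) (int s + 1) j))"
  let ?G = "\<lambda>e. f (\<lambda>j. e (coupled_past k \<tau> j)) - f (\<lambda>j. e (coupled_past i \<tau> j))"
  let ?A = "{Inl l |l. l \<le> int s + 1} \<union> {Inr (int s + 1, s mod q, l) |l. True}"
  let ?B = "{Inl l |l. \<tau> - int k < l \<and> l \<le> \<tau>} \<union> {Inr (\<tau>, m, l) |m l. True}"
  have "indep_var borel (\<lambda>\<omega>. ?F (\<lambda>i. \<eta> i \<omega>)) borel (\<lambda>\<omega>. ?G (\<lambda>i. \<eta> i \<omega>))"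
  proof (rule indep_pair)
    show "?F \<in> borel_measurable (\<Pi>\<^sub>M k\<in>UNIV. S)" "?G \<in> borel_measurable (\<Pi>\<^sub>M k\<in>UNIV. S)"
      by (rule borel_measurable_diff; rule measurable_reindexed_function[OF f_measurable])+
    show "depends_on ?F ?A"
      by (rule depends_on_diff; rule depends_on_mono, rule depends_on_past depends_on_coupled_past) auto
    show "depends_on ?G ?B"
      by (rule depends_on_diff; rule depends_on_mono, rule depends_on_coupled_past) (use ik in auto)
    show "?A \<inter> ?B = {}" using st by (auto simp: \<tau>_def k_def)
  qed
  then have ind: "indep_var borel (D q s) borel (\<lambda>\<omega>. C k \<tau> \<omega> - C i \<tau> \<omega>)"
    by (simp add: D_def[abs_def] Y_def C_def)
  have CC: "L2_rv M (\<lambda>\<omega>. C k \<tau> \<omega> - C i \<tau> \<omega>)" by (intro L2_rv_diff C_L2)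
  have "expectation (D q s) = 0" unfolding D_def[abs_def] by (rule error_mean)
  then have 0: "expectation (\<lambda>\<omega>. D q s \<omega> \<bullet> (C k \<tau> \<omega> - C i \<tau> \<omega>)) = 0"
    by (subst indep_var_bilinear[OF bounded_bilinear_inner ind D_L2 CC]) simp
  have YC: "L2_rv M (\<lambda>\<omega>. Y \<tau> \<omega> - C k \<tau> \<omega>)" by (rule error_L2)
  have "expectation (\<lambda>\<omega>. D q s \<omega> \<bullet> D q t \<omega>) =
      expectation (\<lambda>\<omega>. D q s \<omega> \<bullet> (Y \<tau> \<omega> - C k \<tau> \<omega>) + D q s \<omega> \<bullet> (C k \<tau> \<omega> - C i \<tau> \<omega>))"
    by (intro Bochner_Integration.integral_cong refl)
       (simp add: D_def[of q t] i_def \<tau>_def inner_diff_right)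
  also have "\<dots> = expectation (\<lambda>\<omega>. D q s \<omega> \<bullet> (Y \<tau> \<omega> - C k \<tau> \<omega>))"
    using integrable_inner_D[OF YC, of q s] integrable_inner_D[OF CC, of q s] 0 by simp
  also have "\<bar>\<dots>\<bar> \<le> \<delta> (Suc (s mod q)) * \<delta> k"
    using inner_D_bound[OF YC, of q s] by (simp add: error_L2_norm)
  finally show ?thesis using st by (simp add: k_def Suc_diff_Suc)
qed

lemma L2_norm_weighted_sum:
  assumes "finite U" "\<And>t. t \<in> U \<Longrightarrow> L2_rv M (Z t)"
  shows "(L2_norm M (\<lambda>\<omega>. \<Sum>t\<in>U. w t *\<^sub>R (Z t \<omega> :: 'c)))\<^sup>2 =
    (\<Sum>s\<in>U. \<Sum>t\<in>U. w s * w t * expectation (\<lambda>\<omega>. Z s \<omega> \<bullet> Z t \<omega>))"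
proof -
  have int: "integrable M (\<lambda>\<omega>. Z s \<omega> \<bullet> Z t \<omega>)" if "s \<in> U" "t \<in> U" for s t
    using L2_rv_integrable_bilinear(1)[OF bounded_bilinear_inner _ _ assms(2)[OF that(1)]
        assms(2)[OF that(2)], of 1] by (simp add: Cauchy_Schwarz_ineq2)
  have "(norm (\<Sum>t\<in>U. w t *\<^sub>R Z t \<omega>))\<^sup>2 = (\<Sum>s\<in>U. \<Sum>t\<in>U. w s * w t * (Z s \<omega> \<bullet> Z t \<omega>))" for \<omega>
  proof -
    have "(norm (\<Sum>t\<in>U. w t *\<^sub>R Z t \<omega>))\<^sup>2 = (\<Sum>s\<in>U. w s * (Z s \<omega> \<bullet> (\<Sum>t\<in>U. w t *\<^sub>R Z t \<omega>)))"
      by (subst power2_norm_eq_inner, subst inner_sum_left) simp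
    then show ?thesis by (simp add: inner_sum_right sum_distrib_left mult.assoc)
  qed
  then show ?thesis
    unfolding L2_norm_power2 using int
    by (simp add: Bochner_Integration.integral_sum)
qed

lemma block_error:
  assumes q: "q > 0" and U: "finite U" and w: "\<And>t. \<bar>w t\<bar> \<le> W"
  shows "(L2_norm M (\<lambda>\<omega>. \<Sum>t\<in>U. w t *\<^sub>R D q t \<omega>))\<^sup>2 \<le> W\<^sup>2 * (4 * \<Delta>\<^sup>2 * card ((\<lambda>t. t div q) ` U))"
proof -
  let ?c = "\<lambda>s t. \<bar>expectation (\<lambda>\<omega>. D q s \<omega> \<bullet> D q t \<omega>)\<bar>"
  have "(L2_norm M (\<lambda>\<omega>. \<Sum>t\<in>U. w t *\<^sub>R D q t \<omega>))\<^sup>2 =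
      (\<Sum>s\<in>U. \<Sum>t\<in>U. w s * w t * expectation (\<lambda>\<omega>. D q s \<omega> \<bullet> D q t \<omega>))"
    by (rule L2_norm_weighted_sum[OF U D_L2])
  also have "\<dots> \<le> (\<Sum>s\<in>U. \<Sum>t\<in>U. W\<^sup>2 * ?c s t)"
  proof (intro sum_mono)
    fix s t
    have "w s * w t * expectation (\<lambda>\<omega>. D q s \<omega> \<bullet> D q t \<omega>) \<le> \<bar>w s\<bar> * \<bar>w t\<bar> * ?c s t"
      by (simp add: abs_mult[symmetric])
    also have "\<dots> \<le> W * W * ?c s t"
      by (intro mult_right_mono mult_mono w) (auto intro: order_trans[OF abs_ge_zero w])
    finally show "w s * w t * expectation (\<lambda>\<omega>. D q s \<omega> \<bullet> D q t \<omega>) \<le> W\<^sup>2 * ?c s t"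
      by (simp add: power2_eq_square)
  qed
  also have "\<dots> = W\<^sup>2 * (\<Sum>s\<in>U. \<Sum>t\<in>U. ?c s t)"
    by (simp add: sum_distrib_left)
  also have "\<dots> \<le> W\<^sup>2 * (4 * \<Delta>\<^sup>2 * card ((\<lambda>t. t div q) ` U))"
  proof (intro mult_left_mono block_sum_bound[where d = "\<lambda>m. \<delta> (Suc m)"] q U)
    show "?c s t = ?c t s" for s t by (simp add: inner_commute)
  qed (auto simp: \<delta>_nonneg sum_\<delta>_le D_covariance_same D_covariance_diff[simplified])
  finally show ?thesis .
qed

definition V :: "nat \<Rightarrow> nat \<Rightarrow> 'a \<Rightarrow> 'c" where
  "V q j \<omega> = (\<Sum>i<q. C (Suc i) (int (j * q + i) + 1) \<omega>)"

lemma V_L2: "L2_rv M (V q j)"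
  unfolding V_def[abs_def] by (intro L2_rv_sum C_L2)

lemma V_mean: "expectation (V q j) = 0"
  unfolding V_def[abs_def]
  by (subst Bochner_Integration.integral_sum) (auto simp: C_mean L2_rv_integrable[OF C_L2])

lemma sum_blocks:
  "(\<Sum>t<N * q. a (t div q) *\<^sub>R C (Suc (t mod q)) (int t + 1) \<omega>) = (\<Sum>j<N. a j *\<^sub>R V q j \<omega>)"
proof -
  let ?g = "\<lambda>t. a (t div q) *\<^sub>R C (Suc (t mod q)) (int t + 1) \<omega>"
  have "sum ?g {..<N * q} = (\<Sum>j<N. sum ?g {j * q..<j * q + q})"
    by (rule sum.nat_group[symmetric])
  also have "\<dots> = (\<Sum>j<N. a j *\<^sub>R V q j \<omega>)"
  proof (rule sum.cong[OF refl])
    fix j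
    have "sum ?g {j * q..<j * q + q} = (\<Sum>i<q. ?g (j * q + i))"
      using sum.shift_bounds_nat_ivl[of ?g 0 "j * q" q] by (simp add: atLeast0LessThan add.commute)
    also have "\<dots> = (\<Sum>i<q. a j *\<^sub>R C (Suc i) (int (j * q + i) + 1) \<omega>)"
      by (intro sum.cong) auto
    finally show "sum ?g {j * q..<j * q + q} = a j *\<^sub>R V q j \<omega>"
      by (simp add: V_def scaleR_sum_right)
  qed
  finally show ?thesis .
qed

definition block_function :: "nat \<Rightarrow> nat \<Rightarrow> (int + int \<times> nat \<times> int \<Rightarrow> 'b) \<Rightarrow> 'c" where
  "block_function q j e = (\<Sum>i<q. f (\<lambda>l. e (coupled_past (Suc i) (int (j * q + i) + 1) l)))"

lemma V_eq: "V q j \<omega> = block_function q j (\<lambda>i. \<eta> i \<omega>)"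
  by (simp add: V_def block_function_def C_def)

lemma block_function_measurable: "block_function q j \<in> borel_measurable (\<Pi>\<^sub>M k\<in>UNIV. S)"
  unfolding block_function_def[abs_def]
  by (rule borel_measurable_sum, rule measurable_reindexed_function[OF f_measurable])

text \<open>A block reads original innovations at its own times and copies labelled by these times.
  The time labels keep the copies used by different blocks apart.\<close>

lemma V_indep: "indep_vars (\<lambda>_. borel) (V q) UNIV"
proof -
  define A :: "nat \<Rightarrow> (int + int \<times> nat \<times> int) set" where
    "A j = {Inl k |k. int (j * q) < k \<and> k \<le> int (j * q + q)} \<union>
      {Inr (t, m, k) |t m k. int (j * q) < t \<and> t \<le> int (j * q + q)}" for j
  have "indep_vars (\<lambda>_. borel) (\<lambda>j \<omega>. block_function q j (\<lambda>i. \<eta> i \<omega>)) UNIV"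
  proof (rule indep_functions)
    show "depends_on (block_function q j) (A j)" for j
    proof (rule depends_onI)
      fix e e' :: "int + int \<times> nat \<times> int \<Rightarrow> 'b"
      assume eq: "\<And>i. i \<in> A j \<Longrightarrow> e i = e' i"
      have "e (coupled_past (Suc i) (int (j * q + i) + 1) l) = e' (coupled_past (Suc i) (int (j * q + i) + 1) l)"
        if "i < q" for i l
        by (rule eq) (use that in \<open>auto simp: A_def coupled_past_def\<close>)
      then show "block_function q j e = block_function q j e'"
        by (simp add: block_function_def)
    qed
    show "disjoint_family_on A UNIV"
    proof -
      have "A j \<inter> A j' = {}" if "j < j'" for j j'
      proof -
        have "j * q + q \<le> j' * q" using mult_le_mono1[of "Suc j" j' q] that by simp
        then have "int (j * q + q) \<le> int (j' * q)" by (simp only: of_nat_le_iff)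
        then show ?thesis by (auto simp: A_def simp del: of_nat_add of_nat_mult)
      qed
      then show ?thesis unfolding disjoint_family_on_def by (metis Int_commute linorder_neqE_nat)
    qed
  qed (rule block_function_measurable)
  then show ?thesis by (simp add: V_eq[abs_def])
qed

lemma V_law: "distr M borel (V q j) = distr M borel (V q 0)"
proof -
  have "V q j \<omega> = block_function q 0 (\<lambda>i. \<eta> (shift (int (j * q)) i) \<omega>)" for \<omega>
    by (simp add: V_eq block_function_def shift_coupled_past algebra_simps)
  then have "distr M borel (V q j) =
      distr M borel (\<lambda>\<omega>. block_function q 0 (\<lambda>i. \<eta> (shift (int (j * q)) i) \<omega>))" by presburger
  also have "\<dots> = distr M borel (V q 0)"
    unfolding shift_law[OF block_function_measurable] by (simp add: V_eq[abs_def])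
  finally show ?thesis .
qed

end

section \<open>Long-run variance\<close>

context approximable_shift
begin

lemma autocovariance_bound:
  fixes p :: "'c \<Rightarrow> 'c \<Rightarrow> 'k::{banach, second_countable_topology}"
  assumes p: "bounded_bilinear p" and K: "\<And>a b. norm (p a b) \<le> K * (norm a * norm b)" "K \<ge> 0"
  shows "summable (\<lambda>k. norm (\<integral>\<omega>. p (Y 0 \<omega>) (Y (int (Suc k)) \<omega>) \<partial>M))"
    "summable (\<lambda>k. norm (\<integral>\<omega>. p (Y (int (Suc k)) \<omega>) (Y 0 \<omega>) \<partial>M))"
proof -
  have s: "summable (\<lambda>k. K * (L2_norm M (Y 0) * \<delta> (Suc k)))"
    by (intro summable_mult summable_\<delta>)
  show "summable (\<lambda>k. norm (\<integral>\<omega>. p (Y 0 \<omega>) (Y (int (Suc k)) \<omega>) \<partial>M))"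
    using covariance_bound[OF p K, of "Suc k" for k]
    by (intro summable_comparison_test'[OF s]) simp
  have K': "norm (p b a) \<le> K * (norm a * norm b)" for a b
    using K(1)[of b a] by (simp add: mult.commute)
  show "summable (\<lambda>k. norm (\<integral>\<omega>. p (Y (int (Suc k)) \<omega>) (Y 0 \<omega>) \<partial>M))"
    using covariance_bound[OF bounded_bilinear.flip[OF p] K' K(2), of "Suc k" for k]
    by (intro summable_comparison_test'[OF s]) simp
qed

definition partial_sum :: "nat \<Rightarrow> 'a \<Rightarrow> 'c" where
  "partial_sum q \<omega> = (\<Sum>t<q. Y (int t + 1) \<omega>)"

lemma partial_sum_L2: "L2_rv M (partial_sum q)"
  unfolding partial_sum_def[abs_def] by (intro L2_rv_sum Y_L2)

lemma partial_sum_quadratic: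
  fixes p :: "'c \<Rightarrow> 'c \<Rightarrow> real"
  assumes p: "bounded_bilinear p" and K: "\<And>a b. norm (p a b) \<le> K * (norm a * norm b)" "K \<ge> 0"
    and sym: "\<And>a b. p a b = p b a"
  defines "r \<equiv> \<lambda>k. expectation (\<lambda>\<omega>. p (Y 0 \<omega>) (Y (int k) \<omega>))"
  shows "expectation (\<lambda>\<omega>. p (partial_sum q \<omega>) (partial_sum q \<omega>)) =
    (\<Sum>t<q. r 0 + 2 * (\<Sum>k<t. r (Suc k)))"
proof -
  interpret p: bounded_bilinear p by fact
  have int: "integrable M (\<lambda>\<omega>. p (Y s \<omega>) (Y t \<omega>))" for s t
    by (rule L2_rv_integrable_bilinear(1)[OF p K Y_L2 Y_L2])
  have lag: "expectation (\<lambda>\<omega>. p (Y (int s + 1) \<omega>) (Y (int t + 1) \<omega>)) =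
      r (if s \<le> t then t - s else s - t)" for s t
  proof (cases "s \<le> t")
    case True
    then show ?thesis
      using stationary_pair[OF p, of 0 "int s + 1" "int (t - s)"] by (simp add: r_def of_nat_diff)
  next
    case False
    then show ?thesis
      using stationary_pair[OF p, of "int (s - t)" "int t + 1" 0]
      by (simp add: r_def of_nat_diff sym[of "Y (int s - int t) _"])
  qed
  have "expectation (\<lambda>\<omega>. p (partial_sum q \<omega>) (partial_sum q \<omega>)) =
      (\<Sum>s<q. \<Sum>t<q. expectation (\<lambda>\<omega>. p (Y (int s + 1) \<omega>) (Y (int t + 1) \<omega>)))"
    by (simp add: partial_sum_def p.sum_left p.sum_right int Bochner_Integration.integral_sum)
       (rule sum.swap)
  also have "\<dots> = (\<Sum>t<q. r 0 + 2 * (\<Sum>k<t. r (Suc k)))"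
    unfolding lag by (rule double_sum_lag)
  finally show ?thesis .
qed

text \<open>The quadratic form of the long-run covariance kernel at \<open>x\<close>. The two
  cross-covariance series coincide on the diagonal, hence the factor 2.\<close>

definition long_run_variance :: "'c \<Rightarrow> real" where
  "long_run_variance x = expectation (\<lambda>\<omega>. (Y 0 \<omega> \<bullet> x) * (Y 0 \<omega> \<bullet> x)) +
    2 * (\<Sum>k. expectation (\<lambda>\<omega>. (Y 0 \<omega> \<bullet> x) * (Y (int (Suc k)) \<omega> \<bullet> x)))"

lemma bounded_bilinear_inner_mult: "bounded_bilinear (\<lambda>a b. (a \<bullet> x) * (b \<bullet> (y :: 'c)))"
  by (rule bounded_bilinear.comp[OF bounded_bilinear_mult bounded_linear_inner_left bounded_linear_inner_left])

lemma norm_inner_mult_le: "norm ((a \<bullet> x) * (b \<bullet> (y :: 'c))) \<le> (norm x * norm y) * (norm a * norm b)"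
proof -
  have "\<bar>a \<bullet> x\<bar> * \<bar>b \<bullet> y\<bar> \<le> (norm a * norm x) * (norm b * norm y)"
    by (intro mult_mono Cauchy_Schwarz_ineq2) auto
  then show ?thesis by (simp add: abs_mult mult_ac)
qed

lemma partial_sum_variance_tendsto:
  "(\<lambda>q. expectation (\<lambda>\<omega>. (partial_sum q \<omega> \<bullet> x)\<^sup>2) / real q) \<longlonglongrightarrow> long_run_variance x"
proof -
  let ?r = "\<lambda>k. expectation (\<lambda>\<omega>. (Y 0 \<omega> \<bullet> x) * (Y (int k) \<omega> \<bullet> x))"
  have "summable (\<lambda>k. norm (?r (Suc k)))"
    by (rule autocovariance_bound(1)[OF bounded_bilinear_inner_mult norm_inner_mult_le]) simp
  then have "(\<lambda>t. ?r 0 + 2 * (\<Sum>k<t. ?r (Suc k))) \<longlonglongrightarrow> ?r 0 + 2 * (\<Sum>k. ?r (Suc k))"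
    by (intro tendsto_intros summable_LIMSEQ) (rule summable_norm_cancel)
  from cesaro_mean[OF this]
  show ?thesis
    using partial_sum_quadratic[OF bounded_bilinear_inner_mult norm_inner_mult_le, of x x]
    by (simp add: long_run_variance_def power2_eq_square mult.commute)
qed

lemma partial_sum_norm_bound:
  obtains c where "c \<ge> 0" "\<And>q. (L2_norm M (partial_sum q))\<^sup>2 \<le> c * real q"
proof -
  let ?r = "\<lambda>k. expectation (\<lambda>\<omega>. Y 0 \<omega> \<bullet> Y (int k) \<omega>)"
  have s: "summable (\<lambda>k. norm (?r (Suc k)))"
    by (rule autocovariance_bound(1)[OF bounded_bilinear_inner, of 1]) (simp_all add: Cauchy_Schwarz_ineq2)
  define c where "c = \<bar>?r 0\<bar> + 2 * (\<Sum>k. norm (?r (Suc k)))"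
  have c: "c \<ge> 0" using s by (simp add: c_def suminf_nonneg)
  have "(L2_norm M (partial_sum q))\<^sup>2 \<le> c * real q" for q
  proof -
    have "(L2_norm M (partial_sum q))\<^sup>2 = (\<Sum>t<q. ?r 0 + 2 * (\<Sum>k<t. ?r (Suc k)))"
      using partial_sum_quadratic[OF bounded_bilinear_inner, of 1 q]
      by (simp add: L2_norm_power2 power2_norm_eq_inner inner_commute Cauchy_Schwarz_ineq2)
    also have "\<dots> \<le> (\<Sum>t<q. c)"
    proof (rule sum_mono)
      fix t
      have "(\<Sum>k<t. ?r (Suc k)) \<le> (\<Sum>k<t. norm (?r (Suc k)))" by (intro sum_mono) simp
      also have "\<dots> \<le> (\<Sum>k. norm (?r (Suc k)))" by (rule sum_le_suminf[OF s]) auto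
      finally show "?r 0 + 2 * (\<Sum>k<t. ?r (Suc k)) \<le> c" by (simp add: c_def)
    qed
    finally show ?thesis by (simp add: mult.commute)
  qed
  with c show thesis by (rule that)
qed

text \<open>All times lie in one block, so \<open>block_error\<close> with unit weights gives the
  squared bound \<open>4 * \<Delta>\<^sup>2\<close> whatever the length \<open>q\<close>.\<close>

lemma V_partial_sum_error:
  assumes q: "q > 0"
  shows "L2_norm M (\<lambda>\<omega>. partial_sum q \<omega> - V q 0 \<omega>) \<le> 2 * \<Delta>"
proof -
  have eq: "partial_sum q \<omega> - V q 0 \<omega> = (\<Sum>t<q. 1 *\<^sub>R D q t \<omega>)" for \<omega>
    by (simp add: partial_sum_def V_def D_def sum_subtractf)
  have "card ((\<lambda>t. t div q) ` {..<q}) = 1"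
  proof -
    have "(\<lambda>t. t div q) ` {..<q} = {0}" using q by (auto intro!: image_eqI[of _ _ 0])
    then show ?thesis by simp
  qed
  then have "(L2_norm M (\<lambda>\<omega>. partial_sum q \<omega> - V q 0 \<omega>))\<^sup>2 \<le> (2 * \<Delta>)\<^sup>2"
    using block_error[OF q, of "{..<q}" "\<lambda>_. 1" 1] by (simp add: eq power_mult_distrib)
  then show ?thesis by (rule power2_le_imp_le) (simp add: \<Delta>_nonneg)
qed

text \<open>With \<open>E\<close> the difference and \<open>S\<close> the partial sum, the squares
  differ by \<open>E\<^sup>2 - 2 * E * S\<close> after testing against \<open>x\<close>. The norm of
  \<open>E\<close> is bounded and that of \<open>S\<close> is of order sqrt q, so the difference
  divided by \<open>q\<close> is of order 1 / sqrt q.\<close>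

lemma V_variance_tendsto:
  "(\<lambda>q. expectation (\<lambda>\<omega>. (V q 0 \<omega> \<bullet> x)\<^sup>2) / real q) \<longlonglongrightarrow> long_run_variance x"
proof -
  obtain c where c: "c \<ge> 0" "\<And>q. (L2_norm M (partial_sum q))\<^sup>2 \<le> c * real q"
    using partial_sum_norm_bound by blast
  define a where "a q = expectation (\<lambda>\<omega>. (partial_sum q \<omega> \<bullet> x)\<^sup>2)" for q
  define v where "v q = expectation (\<lambda>\<omega>. (V q 0 \<omega> \<bullet> x)\<^sup>2)" for q
  let ?B = "(norm x)\<^sup>2 * (4 * \<Delta>\<^sup>2)"
  have bound: "\<bar>v q / real q - a q / real q\<bar> \<le> ?B / real q + 4 * (norm x)\<^sup>2 * \<Delta> * sqrt c / sqrt (real q)"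
    if q: "q > 0" for q
  proof -
    let ?E = "\<lambda>\<omega>. partial_sum q \<omega> - V q 0 \<omega>"
    let ?p = "\<lambda>a b. (a \<bullet> x) * (b \<bullet> x)"
    have E: "L2_rv M ?E" by (intro L2_rv_diff partial_sum_L2 V_L2)
    have K: "norm x * norm x \<ge> 0" by simp
    note bl = L2_rv_integrable_bilinear[OF bounded_bilinear_inner_mult norm_inner_mult_le K]
    have "(V q 0 \<omega> \<bullet> x)\<^sup>2 - (partial_sum q \<omega> \<bullet> x)\<^sup>2 = ?p (?E \<omega>) (?E \<omega>) - 2 * ?p (?E \<omega>) (partial_sum q \<omega>)" for \<omega>
      by (simp add: inner_diff_left power2_eq_square algebra_simps)
    moreover have iV: "integrable M (\<lambda>\<omega>. (V q 0 \<omega> \<bullet> x)\<^sup>2)" and ia: "integrable M (\<lambda>\<omega>. (partial_sum q \<omega> \<bullet> x)\<^sup>2)"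
      using bl(1)[OF V_L2[of q 0] V_L2[of q 0]] bl(1)[OF partial_sum_L2[of q] partial_sum_L2[of q]]
      by (simp_all add: power2_eq_square)
    ultimately have "v q - a q = expectation (\<lambda>\<omega>. ?p (?E \<omega>) (?E \<omega>) - 2 * ?p (?E \<omega>) (partial_sum q \<omega>))"
      unfolding v_def a_def by (subst Bochner_Integration.integral_diff[symmetric]) simp_all
    also have "\<dots> = expectation (\<lambda>\<omega>. ?p (?E \<omega>) (?E \<omega>)) - 2 * expectation (\<lambda>\<omega>. ?p (?E \<omega>) (partial_sum q \<omega>))"
      using bl(1)[OF E E] bl(1)[OF E partial_sum_L2[of q]] by (simp del: inner_diff_left)
    finally have "\<bar>v q - a q\<bar> \<le> \<bar>expectation (\<lambda>\<omega>. ?p (?E \<omega>) (?E \<omega>))\<bar> +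
        2 * \<bar>expectation (\<lambda>\<omega>. ?p (?E \<omega>) (partial_sum q \<omega>))\<bar>" by linarith
    also have "\<bar>expectation (\<lambda>\<omega>. ?p (?E \<omega>) (?E \<omega>))\<bar> \<le> norm x * norm x * (L2_norm M ?E * L2_norm M ?E)"
      using bl(2)[OF E E] by simp
    also have "\<dots> \<le> norm x * norm x * ((2 * \<Delta>) * (2 * \<Delta>))"
      using V_partial_sum_error[OF q] \<Delta>_nonneg by (intro mult_left_mono mult_mono) (auto simp: L2_norm_nonneg)
    also have "\<bar>expectation (\<lambda>\<omega>. ?p (?E \<omega>) (partial_sum q \<omega>))\<bar> \<le>
        norm x * norm x * (L2_norm M ?E * L2_norm M (partial_sum q))"
      using bl(2)[OF E partial_sum_L2[of q]] by simp
    also have "\<dots> \<le> norm x * norm x * ((2 * \<Delta>) * sqrt (c * real q))"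
      using V_partial_sum_error[OF q] \<Delta>_nonneg c(2)[of q]
      by (intro mult_left_mono mult_mono real_le_rsqrt) (auto simp: L2_norm_nonneg)
    finally have "\<bar>v q - a q\<bar> \<le> ?B + 4 * (norm x)\<^sup>2 * \<Delta> * sqrt c * sqrt (real q)"
      by (simp add: power2_eq_square real_sqrt_mult mult_ac)
    then have "\<bar>v q - a q\<bar> / real q \<le> (?B + 4 * (norm x)\<^sup>2 * \<Delta> * sqrt c * sqrt (real q)) / real q"
      by (intro divide_right_mono) auto
    also have "\<dots> = ?B / real q + 4 * (norm x)\<^sup>2 * \<Delta> * sqrt c * (sqrt (real q) / real q)"
      by (simp add: add_divide_distrib)
    also have "sqrt (real q) / real q = 1 / sqrt (real q)"
      by (simp add: sqrt_divide_self_eq inverse_eq_divide)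
    finally show ?thesis by (simp add: diff_divide_distrib[symmetric] abs_divide)
  qed
  have "(\<lambda>q. ?B / real q + 4 * (norm x)\<^sup>2 * \<Delta> * sqrt c / sqrt (real q)) \<longlonglongrightarrow> 0 + 0"
    by (intro tendsto_add lim_const_over_n tendsto_divide_0[OF tendsto_const
          filterlim_at_top_imp_at_infinity[OF filterlim_compose[OF sqrt_at_top filterlim_real_sequentially]]])
  then have "(\<lambda>q. v q / real q - a q / real q) \<longlonglongrightarrow> 0"
  proof (rule Lim_null_comparison[rotated, OF tendsto_eq_rhs])
    show "\<forall>\<^sub>F q in sequentially. norm (v q / real q - a q / real q) \<le>
        ?B / real q + 4 * (norm x)\<^sup>2 * \<Delta> * sqrt c / sqrt (real q)"
      using eventually_ge_at_top[of 1] by eventually_elim (use bound in simp)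
  qed simp
  then have "(\<lambda>q. (v q / real q - a q / real q) + a q / real q) \<longlonglongrightarrow> 0 + long_run_variance x"
    using partial_sum_variance_tendsto[of x] unfolding a_def by (rule tendsto_add)
  then show ?thesis by (simp add: v_def)
qed

lemma long_run_variance_nonneg: "long_run_variance x \<ge> 0"
  by (rule LIMSEQ_le_const[OF partial_sum_variance_tendsto]) (intro exI[of _ 0] allI impI divide_nonneg_nonneg, auto)

text \<open>Bessel's inequality bounds the sum of finitely many coordinate variances of the partial
  sum by its squared norm, which is at most \<open>c * real q\<close>. Division by \<open>q\<close>
  and the limit in \<open>q\<close> give the bound \<open>c\<close> for every finite section of the
  trace.\<close>

lemma long_run_variance_trace:
  assumes "hilbert_basis b"
  shows "summable (\<lambda>i. long_run_variance (b i))"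
proof -
  interpret hilbert_basis b by fact
  obtain c where c: "c \<ge> 0" "\<And>q. (L2_norm M (partial_sum q))\<^sup>2 \<le> c * real q"
    using partial_sum_norm_bound by blast
  have "(\<Sum>i<n. long_run_variance (b i)) \<le> c" for n
  proof (rule LIMSEQ_le_const2)
    show "(\<lambda>q. \<Sum>i<n. expectation (\<lambda>\<omega>. (partial_sum q \<omega> \<bullet> b i)\<^sup>2) / real q) \<longlonglongrightarrow>
        (\<Sum>i<n. long_run_variance (b i))"
      by (intro tendsto_sum partial_sum_variance_tendsto)
    show "\<exists>N. \<forall>q\<ge>N. (\<Sum>i<n. expectation (\<lambda>\<omega>. (partial_sum q \<omega> \<bullet> b i)\<^sup>2) / real q) \<le> c"
    proof (intro exI[of _ 1] allI impI)
      fix q :: nat assume q: "q \<ge> 1"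
      have int: "integrable M (\<lambda>\<omega>. (partial_sum q \<omega> \<bullet> b i)\<^sup>2)" for i
        using L2_rv_inner[OF partial_sum_L2, of q "b i"] by (simp add: L2_rv_def)
      have "(\<Sum>i<n. expectation (\<lambda>\<omega>. (partial_sum q \<omega> \<bullet> b i)\<^sup>2)) =
          expectation (\<lambda>\<omega>. (norm (proj n (partial_sum q \<omega>)))\<^sup>2)"
        using int by (simp add: norm_proj_power2 Bochner_Integration.integral_sum)
      also have "\<dots> \<le> expectation (\<lambda>\<omega>. (norm (partial_sum q \<omega>))\<^sup>2)"
      proof (rule integral_mono)
        show "integrable M (\<lambda>\<omega>. (norm (proj n (partial_sum q \<omega>)))\<^sup>2)"
          using int by (simp add: norm_proj_power2)
        show "integrable M (\<lambda>\<omega>. (norm (partial_sum q \<omega>))\<^sup>2)"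
          using partial_sum_L2 by (simp add: L2_rv_def)
      qed (auto intro: power_mono norm_proj_le)
      also have "\<dots> \<le> c * real q" using c(2)[of q] by (simp add: L2_norm_power2)
      finally show "(\<Sum>i<n. expectation (\<lambda>\<omega>. (partial_sum q \<omega> \<bullet> b i)\<^sup>2) / real q) \<le> c"
        using q by (simp add: sum_divide_distrib[symmetric] pos_divide_le_eq)
    qed
  qed
  then have "(\<Sum>i\<le>n. long_run_variance (b i)) \<le> c" for n
    by (simp only: lessThan_Suc_atMost[symmetric])
  then show ?thesis
    by (intro bounded_imp_summable[of _ c]) (simp_all add: long_run_variance_nonneg)
qed

end

section \<open>Kernel weights\<close>

text \<open>The nodes descend from \<open>x\<close> and, by the conditions on \<open>x\<close>,
  cover the support. The sum is the integral of a step function that differs from \<open>g\<close>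
  by at most \<open>L * m\<close>, and only on the support enlarged by one mesh width on either
  side.\<close>

lemma lipschitz_riemann_sum_error:
  fixes g :: "real \<Rightarrow> real"
  assumes lip: "\<And>x y. \<bar>g x - g y\<bar> \<le> L * \<bar>x - y\<bar>" and L: "L \<ge> 0"
    and supp: "\<And>z. \<bar>z\<bar> \<ge> c \<Longrightarrow> g z = 0" and c: "c \<ge> 0" and m: "m > 0"
    and x: "x \<ge> c" "x - real N * m \<le> - c"
  shows "\<bar>(\<Sum>j<N. g (x - real j * m)) * m - (\<integral>z. g z \<partial>lborel)\<bar> \<le> L * m * (2 * (c + m))"
proof -
  define I where "I j = {x - real (Suc j) * m<..x - real j * m}" for j
  define s where "s z = (\<Sum>j<N. g (x - real j * m) * indicator (I j) z)" for z
  have lipg: "L-lipschitz_on UNIV g" using lip L by (intro lipschitz_onI) (auto simp: dist_real_def)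
  have [measurable]: "g \<in> borel_measurable borel"
    by (intro borel_measurable_continuous_onI lipschitz_on_continuous_on[OF lipg])
  have int_I: "integrable lborel (indicator (I j) :: real \<Rightarrow> real)"
    "(\<integral>z. indicator (I j) z \<partial>lborel) = m" for j
    using m by (simp_all add: I_def algebra_simps)
  have int_s: "integrable lborel s"
    unfolding s_def by (intro Bochner_Integration.integrable_sum integrable_mult_right int_I)
  have "(\<integral>z. s z \<partial>lborel) = (\<Sum>j<N. \<integral>z. g (x - real j * m) * indicator (I j) z \<partial>lborel)"
    unfolding s_def by (intro Bochner_Integration.integral_sum integrable_mult_right int_I)
  then have s_int: "(\<integral>z. s z \<partial>lborel) = (\<Sum>j<N. g (x - real j * m)) * m"
    by (simp only: integral_mult_right_zero int_I(2) sum_distrib_right)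
  have int_g: "integrable lborel g"
  proof (rule Bochner_Integration.integrable_bound)
    show "integrable lborel (\<lambda>z. (L * (2 * c) + \<bar>g 0\<bar>) * indicator {-c..c} z)"
      using c by (intro integrable_mult_right integrable_real_indicator) simp_all
    have "\<bar>g z\<bar> \<le> (L * (2 * c) + \<bar>g 0\<bar>) * indicator {-c..c} z" for z
    proof (cases "\<bar>z\<bar> \<ge> c")
      case True
      then show ?thesis using supp[OF True] L c by (simp add: indicator_def)
    next
      case False
      then have "L * \<bar>z - 0\<bar> \<le> L * (2 * c)" using L c by (intro mult_left_mono) auto
      then have "\<bar>g z - g 0\<bar> \<le> L * (2 * c)" using lip[of z 0] by linarith
      then have "\<bar>g z\<bar> \<le> L * (2 * c) + \<bar>g 0\<bar>" by linarith
      moreover have "z \<in> {-c..c}" using False by auto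
      ultimately show ?thesis by simp
    qed
    then have "norm (g z) \<le> norm ((L * (2 * c) + \<bar>g 0\<bar>) * indicator {-c..c} z)" for z
      unfolding real_norm_def by (rule order_trans) (rule abs_ge_self)
    then show "AE z in lborel. norm (g z) \<le> norm ((L * (2 * c) + \<bar>g 0\<bar>) * indicator {-c..c} z)"
      by (rule AE_I2)
  qed simp
  have pw: "\<bar>s z - g z\<bar> \<le> L * m * indicator {-(c + m)..c + m} z" for z
  proof -
    \<comment> \<open>The half-open cells partition the line from \<open>x\<close> downwards, and
      the floor function gives the number of the cell that contains \<open>z\<close>.\<close>
    have mem: "z \<in> I j \<longleftrightarrow> \<lfloor>(x - z) / m\<rfloor> = int j" for j
    proof -
      have "z \<in> I j \<longleftrightarrow> real j * m \<le> x - z \<and> x - z < (real j + 1) * m"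
        by (auto simp: I_def algebra_simps)
      also have "\<dots> \<longleftrightarrow> real j \<le> (x - z) / m \<and> (x - z) / m < real j + 1"
        using m by (simp only: pos_le_divide_eq pos_divide_less_eq)
      also have "\<dots> \<longleftrightarrow> \<lfloor>(x - z) / m\<rfloor> = int j" by (simp add: floor_eq_iff)
      finally show ?thesis .
    qed
    show ?thesis
    proof (cases "\<lfloor>(x - z) / m\<rfloor> \<in> int ` {..<N}")
      case True
      then obtain j0 where j0: "j0 < N" "\<lfloor>(x - z) / m\<rfloor> = int j0" by auto
      have "s z = (\<Sum>j<N. if j = j0 then g (x - real j * m) else 0)"
        unfolding s_def by (intro sum.cong refl) (auto simp: indicator_def mem j0(2))
      then have sz: "s z = g (x - real j0 * m)" using j0(1) by simp
      have "z \<in> I j0" using mem j0 by simp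
      then have d: "\<bar>(x - real j0 * m) - z\<bar> \<le> m" using m by (simp add: I_def algebra_simps)
      show ?thesis
      proof (cases "z \<in> {-(c + m)..c + m}")
        case True
        have "\<bar>s z - g z\<bar> \<le> L * \<bar>(x - real j0 * m) - z\<bar>" unfolding sz by (rule lip)
        also have "\<dots> \<le> L * m" using d L by (rule mult_left_mono)
        finally show ?thesis using True by simp
      next
        case False
        then have "\<bar>z\<bar> \<ge> c" "\<bar>x - real j0 * m\<bar> \<ge> c" using d m c by auto
        then show ?thesis using supp[of z] supp[of "x - real j0 * m"] sz False by simp
      qed
    next
      case False
      then have "s z = 0" unfolding s_def by (intro sum.neutral) (auto simp: indicator_def mem)
      moreover have "\<bar>z\<bar> \<ge> c"
      proof (rule ccontr)
        assume "\<not> \<bar>z\<bar> \<ge> c"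
        then have "0 \<le> (x - z) / m" "(x - z) / m < real N" using x m by (auto simp: field_simps)
        then have "0 \<le> \<lfloor>(x - z) / m\<rfloor>" "\<lfloor>(x - z) / m\<rfloor> < int N" by (auto simp: floor_less_iff)
        then have "\<lfloor>(x - z) / m\<rfloor> = int (nat \<lfloor>(x - z) / m\<rfloor>)" "nat \<lfloor>(x - z) / m\<rfloor> < N"
          by (simp_all add: nat_less_iff)
        then show False using False by blast
      qed
      ultimately show ?thesis using supp[of z] L m by (simp add: indicator_def)
    qed
  qed
  have "\<bar>(\<Sum>j<N. g (x - real j * m)) * m - (\<integral>z. g z \<partial>lborel)\<bar> = \<bar>\<integral>z. s z - g z \<partial>lborel\<bar>"
    using int_s int_g s_int by simp
  also have "\<dots> \<le> (\<integral>z. \<bar>s z - g z\<bar> \<partial>lborel)" by (rule integral_abs_bound)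
  also have "\<dots> \<le> (\<integral>z. L * m * indicator {-(c + m)..c + m} z \<partial>lborel)"
    using int_s int_g pw c m
    by (intro integral_mono integrable_mult_right integrable_real_indicator) auto
  also have "\<dots> = L * m * (2 * (c + m))"
    using c m by simp
  finally show ?thesis .
qed

lemma card_nat_interval_le:
  assumes "finite A" "\<And>n. n \<in> A \<Longrightarrow> a \<le> real n \<and> real n \<le> a + l" "l \<ge> 0"
  shows "real (card A) \<le> l + 1"
proof (cases "A = {}")
  case True
  then show ?thesis using assms by simp
next
  case False
  have "A \<subseteq> {Min A..Max A}" using assms(1) by auto
  then have "card A \<le> card {Min A..Max A}" by (intro card_mono) auto
  moreover have "Min A \<le> Max A" using assms(1) False by simp
  moreover have "real (Max A) - real (Min A) \<le> l"
    using assms(2)[OF Max_in[OF assms(1) False]] assms(2)[OF Min_in[OF assms(1) False]] by linarith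
  ultimately show ?thesis by (simp add: of_nat_diff)
qed

lemma card_blocks_le:
  assumes "finite A" "\<And>n. n \<in> A \<Longrightarrow> a \<le> real n \<and> real n \<le> a + l" "l \<ge> 0" "q > 0"
  shows "real (card ((\<lambda>t. t div q) ` A)) \<le> l / real q + 2"
proof -
  have "real (card ((\<lambda>t. t div q) ` A)) \<le> (l / real q + 1) + 1"
  proof (rule card_nat_interval_le)
    fix j assume "j \<in> (\<lambda>t. t div q) ` A"
    then obtain t where t: "t \<in> A" "j = t div q" by auto
    have "q * j \<le> t" "t \<le> q * j + q"
      using assms(4) mult_div_mod_eq[of q t] mod_less_divisor[of q t] unfolding t(2) by - linarith+
    then have "real (q * j) \<le> real t" "real t \<le> real (q * j) + real q"
      by (simp_all only: of_nat_le_iff of_nat_add[symmetric])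
    then show "a / real q - 1 \<le> real j \<and> real j \<le> a / real q - 1 + (l / real q + 1)"
      using assms(2)[OF t(1)] assms(4) by (auto simp: field_simps)
  qed (use assms in auto)
  then show ?thesis by simp
qed

section \<open>Weights of the kernel mean\<close>

locale smoothing_kernel =
  fixes K :: "real \<Rightarrow> real" and B L c :: real and h :: "nat \<Rightarrow> real" and u :: real
  assumes K_bound: "\<And>z. \<bar>K z\<bar> \<le> B"
    and K_lipschitz: "\<And>x y. \<bar>K x - K y\<bar> \<le> L * \<bar>x - y\<bar>" and L_nonneg: "L \<ge> 0"
    and K_support: "\<And>z. \<bar>z\<bar> \<ge> c \<Longrightarrow> K z = 0" and c_pos: "c > 0"
    and h_pos: "\<And>T. T \<ge> 1 \<Longrightarrow> h T > 0" and h_lim: "h \<longlonglongrightarrow> 0"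
    and Th_lim: "filterlim (\<lambda>T. real T * h T) at_top sequentially"
    and Th3_lim: "(\<lambda>T. real T * h T ^ 3) \<longlonglongrightarrow> 0"
    and u: "0 < u" "u < 1"
begin

lemma B_nonneg: "B \<ge> 0"
  using K_bound[of 0] by linarith

text \<open>Normalised for \<open>sqrt (T h)\<close> times the kernel mean: at most about
  \<open>2 * c * T * h\<close> weights are nonzero and each is of order 1 / sqrt (T h), so their
  squares have bounded sums.\<close>

definition kernel_weight :: "nat \<Rightarrow> real \<Rightarrow> real" where
  "kernel_weight T t = K ((u - t / real T) / h T) / sqrt (real T * h T)"

definition rate :: "nat \<Rightarrow> real" where
  "rate T = real T * h T"

lemma rate_pos: "T \<ge> 1 \<Longrightarrow> rate T > 0"
  using h_pos[of T] by (simp add: rate_def)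

lemma kernel_weight_bound: "T \<ge> 1 \<Longrightarrow> \<bar>kernel_weight T t\<bar> \<le> B / sqrt (rate T)"
  using K_bound[of "(u - t / real T) / h T"] rate_pos[of T]
  by (simp add: kernel_weight_def rate_def abs_divide divide_right_mono)

lemma kernel_weight_lipschitz:
  assumes T: "T \<ge> 1"
  shows "\<bar>kernel_weight T t - kernel_weight T t'\<bar> \<le> L * \<bar>t - t'\<bar> / rate T / sqrt (rate T)"
proof -
  have "(u - t / real T) / h T - (u - t' / real T) / h T = (t' - t) / rate T"
    using T h_pos[OF T] by (simp add: rate_def field_simps)
  then have "\<bar>K ((u - t / real T) / h T) - K ((u - t' / real T) / h T)\<bar> \<le> L * \<bar>t - t'\<bar> / rate T"
    using K_lipschitz[of "(u - t / real T) / h T" "(u - t' / real T) / h T"] rate_pos[OF T]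
    by (simp add: abs_divide abs_minus_commute)
  then have "\<bar>K ((u - t / real T) / h T) - K ((u - t' / real T) / h T)\<bar> / sqrt (rate T) \<le>
      L * \<bar>t - t'\<bar> / rate T / sqrt (rate T)"
    using rate_pos[OF T] by (intro divide_right_mono) auto
  then show ?thesis
    using rate_pos[OF T] by (simp add: kernel_weight_def rate_def diff_divide_distrib[symmetric] abs_divide)
qed

lemma kernel_weight_support:
  assumes "T \<ge> 1" "kernel_weight T t \<noteq> 0"
  shows "real T * u - c * rate T \<le> t" "t \<le> real T * u + c * rate T"
proof -
  have "\<bar>(u - t / real T) / h T\<bar> < c"
    using K_support[of "(u - t / real T) / h T"] assms(2) by (force simp: kernel_weight_def)
  then have "\<bar>u - t / real T\<bar> < c * h T"
    using h_pos[OF assms(1)] by (simp add: abs_divide pos_divide_less_eq)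
  then have "real T * \<bar>u - t / real T\<bar> < real T * (c * h T)" using assms(1) by simp
  moreover have "real T * (c * h T) = c * rate T" by (simp add: rate_def)
  moreover have "real T * \<bar>u - t / real T\<bar> = \<bar>real T * u - t\<bar>"
  proof -
    have "real T * \<bar>u - t / real T\<bar> = \<bar>real T * (u - t / real T)\<bar>" by (simp add: abs_mult)
    also have "real T * (u - t / real T) = real T * u - t" using assms(1) by (simp add: algebra_simps)
    finally show ?thesis .
  qed
  ultimately have "\<bar>real T * u - t\<bar> < c * rate T" by simp
  then show "real T * u - c * rate T \<le> t" "t \<le> real T * u + c * rate T"
    by - linarith+
qed

text \<open>Since \<open>u < 1\<close>, the support of the weights ends before \<open>T\<close> once
  \<open>h\<close> is small. Sums over whole blocks may therefore run past \<open>T\<close> without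
  changing.\<close>

lemma eventually_kernel_weight_zero:
  "\<forall>\<^sub>F T in sequentially. \<forall>t\<ge>real T. kernel_weight T t = 0"
proof -
  have "\<forall>\<^sub>F T in sequentially. h T < (1 - u) / c"
    by (rule order_tendstoD[OF h_lim]) (use u c_pos in simp)
  then show ?thesis using eventually_ge_at_top[of 1]
  proof eventually_elim
    case (elim T)
    show ?case
    proof (intro allI impI, rule ccontr)
      fix t assume t: "t \<ge> real T" "kernel_weight T t \<noteq> 0"
      have "real T \<le> real T * u + c * rate T" using kernel_weight_support(2)[OF elim(2) t(2)] t(1) by simp
      then have "real T * 1 \<le> real T * (u + c * h T)" by (simp add: rate_def algebra_simps)
      then have "1 \<le> u + c * h T" using elim by (subst (asm) mult_le_cancel_left_pos) auto
      then show False using elim c_pos by (simp add: field_simps)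
    qed
  qed
qed

lemma rate_at_top: "filterlim rate at_top sequentially"
  using Th_lim by (simp add: rate_def[abs_def])

lemma inverse_rate_tendsto: "(\<lambda>T. C / rate T) \<longlonglongrightarrow> 0"
  by (intro tendsto_divide_0[OF tendsto_const] filterlim_at_top_imp_at_infinity rate_at_top)

lemma inverse_sqrt_rate_tendsto: "(\<lambda>T. C / sqrt (rate T)) \<longlonglongrightarrow> 0"
  by (intro tendsto_divide_0[OF tendsto_const] filterlim_at_top_imp_at_infinity
      filterlim_compose[OF sqrt_at_top rate_at_top])

text \<open>Up to the factor \<open>1 / q\<close>, the squared weights at the block starts form a
  Riemann sum of the squared kernel with mesh \<open>q / (T h)\<close>.\<close>

lemma block_weights_square_sum:
  assumes q: "q > 0"
  shows "(\<lambda>T. \<Sum>j<T. (kernel_weight T (real (j * q)))\<^sup>2) \<longlonglongrightarrow> (\<integral>z. (K z)\<^sup>2 \<partial>lborel) / real q"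
proof -
  let ?I = "\<integral>z. (K z)\<^sup>2 \<partial>lborel"
  let ?L = "2 * B * L"
  define m where "m T = real q / rate T" for T
  have m_lim: "m \<longlonglongrightarrow> 0" unfolding m_def[abs_def] by (rule inverse_rate_tendsto)
  have lip: "\<bar>(K x)\<^sup>2 - (K y)\<^sup>2\<bar> \<le> ?L * \<bar>x - y\<bar>" for x y
  proof -
    have "(K x)\<^sup>2 - (K y)\<^sup>2 = (K x + K y) * (K x - K y)" by (simp add: power2_eq_square algebra_simps)
    then have "\<bar>(K x)\<^sup>2 - (K y)\<^sup>2\<bar> = \<bar>K x + K y\<bar> * \<bar>K x - K y\<bar>" by (simp add: abs_mult)
    also have "\<dots> \<le> (2 * B) * (L * \<bar>x - y\<bar>)"
      using K_bound[of x] K_bound[of y] B_nonneg by (intro mult_mono K_lipschitz) auto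
    finally show ?thesis by simp
  qed
  \<comment> \<open>The nodes run from \<open>u / h\<close> down to \<open>(u - q) / h\<close>. They
    cover the support of \<open>K\<close> on both sides for small \<open>h\<close>, because
    \<open>u\<close> is an interior point and \<open>q\<close> is at least 1.\<close>
  have ev1: "\<forall>\<^sub>F T in sequentially. h T < u / c"
    by (rule order_tendstoD[OF h_lim]) (use u c_pos in simp)
  have ev2: "\<forall>\<^sub>F T in sequentially. h T < (1 - u) / c"
    by (rule order_tendstoD[OF h_lim]) (use u c_pos in simp)
  have "\<forall>\<^sub>F T in sequentially.
      \<bar>(\<Sum>j<T. (kernel_weight T (real (j * q)))\<^sup>2) - ?I / real q\<bar> \<le> ?L * m T * (2 * (c + m T)) / real q"
    using ev1 ev2 eventually_ge_at_top[of 1]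
  proof eventually_elim
    case (elim T)
    have hT: "h T > 0" using h_pos elim by simp
    have mT: "m T > 0" using rate_pos[OF elim(3)] q by (simp add: m_def)
    have "\<bar>(\<Sum>j<T. (K (u / h T - real j * m T))\<^sup>2) * m T - ?I\<bar> \<le> ?L * m T * (2 * (c + m T))"
    proof (rule lipschitz_riemann_sum_error[OF lip])
      show "0 \<le> ?L" using B_nonneg L_nonneg by simp
      show "c \<le> u / h T" using elim(1) hT c_pos by (simp add: field_simps)
      have "real T * m T = real q / h T" using elim(3) by (simp add: m_def rate_def)
      moreover have "u / h T - real q / h T \<le> - c"
      proof -
        have "c * h T \<le> real q - u" using elim(2) c_pos q by (simp add: field_simps)
        then have "c \<le> (real q - u) / h T" using hT by (simp add: pos_le_divide_eq)
        then show ?thesis by (simp add: diff_divide_distrib)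
      qed
      ultimately show "u / h T - real T * m T \<le> - c" by simp
    qed (use K_support c_pos mT in auto)
    moreover have "(kernel_weight T (real (j * q)))\<^sup>2 = (K (u / h T - real j * m T))\<^sup>2 * m T / real q" for j
    proof -
      have "(u - real (j * q) / real T) / h T = u / h T - real j * m T"
        using elim(3) hT by (simp add: m_def rate_def field_simps)
      moreover have "m T / real q = 1 / rate T" using q by (simp add: m_def)
      ultimately show ?thesis
        using rate_pos[OF elim(3)] q by (simp add: kernel_weight_def rate_def power_divide m_def)
    qed
    then have "(\<Sum>j<T. (kernel_weight T (real (j * q)))\<^sup>2) =
        (\<Sum>j<T. (K (u / h T - real j * m T))\<^sup>2) * m T / real q"
      by (simp add: sum_distrib_right sum_divide_distrib)
    ultimately show ?case
      using q by (simp add: diff_divide_distrib[symmetric] abs_divide divide_right_mono)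
  qed
  moreover have "(\<lambda>T. ?L * m T * (2 * (c + m T)) / real q) \<longlonglongrightarrow> ?L * 0 * (2 * (c + 0)) / real q"
    using q by (intro tendsto_intros m_lim) simp
  ultimately have "(\<lambda>T. (\<Sum>j<T. (kernel_weight T (real (j * q)))\<^sup>2) - ?I / real q) \<longlonglongrightarrow> 0"
    by - (rule Lim_null_comparison[where g = "\<lambda>T. ?L * m T * (2 * (c + m T)) / real q"], simp_all)
  then show ?thesis by (rule LIM_zero_cancel)
qed

end

section \<open>The tensor product kernels\<close>

lemma tensor_abs_L2:
  assumes "square_integrable f" "square_integrable g"
  shows "tensor (abs_L2 f) (abs_L2 g) = abs_L2 (\<lambda>(s, t). f s * g t)"
  using assms by (simp add: tensor.abs_eq)

lemma inner_abs_L2: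
  assumes "square_integrable f" "square_integrable g"
  shows "abs_L2 f \<bullet> abs_L2 g = (\<integral>z. f z * g z \<partial>unit_cube)"
  using assms by (simp add: inner_L2.abs_eq)

lemma inner_tensor:
  fixes x x' :: "'a::euclidean_space L2" and y y' :: "'b::euclidean_space L2"
  shows "tensor x y \<bullet> tensor x' y' = (x \<bullet> x') * (y \<bullet> y')"
proof -
  interpret P: pair_sigma_finite "unit_cube :: 'a measure" "unit_cube :: 'b measure" ..
  define f f' g g' where "f = rep_L2 x" and "f' = rep_L2 x'" and "g = rep_L2 y" and "g' = rep_L2 y'"
  have sq: "square_integrable f" "square_integrable f'" "square_integrable g" "square_integrable g'"
    by (simp_all add: f_def f'_def g_def g'_def square_integrable_rep)
  have abs: "x = abs_L2 f" "x' = abs_L2 f'" "y = abs_L2 g" "y' = abs_L2 g'"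
    by (simp_all add: f_def f'_def g_def g'_def)
  have int: "integrable (unit_cube \<Otimes>\<^sub>M unit_cube) (\<lambda>(s, t). (f s * g t) * (f' s * g' t))"
    using square_integrable_mult[OF square_integrable_tensor[OF sq(1,3)] square_integrable_tensor[OF sq(2,4)]]
    by (simp add: unit_cube_prod case_prod_unfold)
  have "tensor x y \<bullet> tensor x' y' = (\<integral>z. (case z of (s, t) \<Rightarrow> f s * g t) * (case z of (s, t) \<Rightarrow> f' s * g' t) \<partial>unit_cube)"
    unfolding abs tensor_abs_L2[OF sq(1,3)] tensor_abs_L2[OF sq(2,4)]
    by (intro inner_abs_L2 square_integrable_tensor sq)
  also have "\<dots> = (\<integral>z. (case z of (s, t) \<Rightarrow> (f s * g t) * (f' s * g' t)) \<partial>(unit_cube \<Otimes>\<^sub>M unit_cube))"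
    by (simp add: unit_cube_prod case_prod_unfold)
  also have "\<dots> = (\<integral>s. (\<integral>t. (f s * g t) * (f' s * g' t) \<partial>unit_cube) \<partial>unit_cube)"
    using P.integral_fst'[OF int] by simp
  also have "\<dots> = (\<integral>s. f s * f' s * (y \<bullet> y') \<partial>unit_cube)"
  proof (rule Bochner_Integration.integral_cong[OF refl])
    fix s
    have "(\<integral>t. (f s * g t) * (f' s * g' t) \<partial>unit_cube) = (\<integral>t. (f s * f' s) * (g t * g' t) \<partial>unit_cube)"
      by (simp add: mult_ac)
    then show "(\<integral>t. (f s * g t) * (f' s * g' t) \<partial>unit_cube) = f s * f' s * (y \<bullet> y')"
      by (simp add: abs inner_abs_L2 sq)
  qed
  also have "\<dots> = (x \<bullet> x') * (y \<bullet> y')"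
    by (simp add: abs inner_abs_L2 sq)
  finally show ?thesis .
qed

lemma norm_tensor: "norm (tensor x y) = norm x * norm y"
  by (simp add: norm_eq_sqrt_inner inner_tensor real_sqrt_mult)

text \<open>Each identity is verified by computing the squared norm of the difference of its sides
  from \<open>inner_tensor\<close>, without returning to representatives.\<close>

lemma tensor_add_left: "tensor (x + x') y = tensor x y + tensor x' y"
  and tensor_add_right: "tensor x (y + y') = tensor x y + tensor x y'"
  and tensor_scaleR_left: "tensor (c *\<^sub>R x) y = c *\<^sub>R tensor x y"
  and tensor_scaleR_right: "tensor x (c *\<^sub>R y) = c *\<^sub>R tensor x y"
proof -
  have eq: "k = k'" if "(k - k') \<bullet> (k - k') = 0" for k k' :: "('a \<times> 'b) L2"
    using that by simp
  show "tensor (x + x') y = tensor x y + tensor x' y"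
    by (rule eq) (simp add: inner_diff_left inner_diff_right inner_add_left inner_add_right inner_tensor
        inner_commute algebra_simps)
  show "tensor x (y + y') = tensor x y + tensor x y'"
    by (rule eq) (simp add: inner_diff_left inner_diff_right inner_add_left inner_add_right inner_tensor
        inner_commute algebra_simps)
  show "tensor (c *\<^sub>R x) y = c *\<^sub>R tensor x y"
    by (rule eq) (simp add: inner_diff_left inner_diff_right inner_tensor inner_commute algebra_simps)
  show "tensor x (c *\<^sub>R y) = c *\<^sub>R tensor x y"
    by (rule eq) (simp add: inner_diff_left inner_diff_right inner_tensor inner_commute algebra_simps)
qed

lemma bounded_bilinear_tensor: "bounded_bilinear tensor"
proof
  show "\<exists>K. \<forall>a b. norm (tensor a b) \<le> norm a * norm b * K"
    by (intro exI[of _ 1]) (simp add: norm_tensor)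
qed (rule tensor_add_left tensor_add_right tensor_scaleR_left tensor_scaleR_right)+

text \<open>Testing with indicators shows that the kernel integrates to zero over rectangles. These
  form an intersection-stable generator, so the same holds for all measurable sets, in particular
  for the two sets where the kernel has constant sign.\<close>

lemma tensor_total:
  fixes k :: "('a::euclidean_space \<times> 'b::euclidean_space) L2"
  assumes orth: "\<And>x y. k \<bullet> tensor x y = 0"
  shows "k = 0"
proof -
  let ?U = "unit_cube :: ('a \<times> 'b) measure"
  let ?A = "unit_cube :: 'a measure" and ?B = "unit_cube :: 'b measure"
  define g where "g = rep_L2 k"
  have sq: "square_integrable g" by (simp add: g_def square_integrable_rep)
  then have [measurable]: "g \<in> borel_measurable ?U" by measurable
  have int: "integrable ?U g" by (rule integral_abs_le_norm_L2(1)[OF sq])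
  have rect: "(\<integral>z. indicator (X \<times> Y) z * g z \<partial>?U) = 0" if X: "X \<in> sets ?A" and Y: "Y \<in> sets ?B" for X Y
  proof -
    have sX: "square_integrable (indicator X :: 'a \<Rightarrow> real)" and sY: "square_integrable (indicator Y :: 'b \<Rightarrow> real)"
      using sets_unit_cube_borel[OF X] sets_unit_cube_borel[OF Y] by (auto intro: square_integrable_indicator)
    have "0 = k \<bullet> tensor (abs_L2 (indicator X)) (abs_L2 (indicator Y))" by (simp add: orth)
    also have "\<dots> = (\<integral>z. g z * (case z of (s, t) \<Rightarrow> indicator X s * indicator Y t) \<partial>?U)"
      unfolding tensor_abs_L2[OF sX sY] using inner_abs_L2[OF sq square_integrable_tensor[OF sX sY]]
      by (simp add: g_def)
    also have "\<dots> = (\<integral>z. indicator (X \<times> Y) z * g z \<partial>?U)"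
      by (intro Bochner_Integration.integral_cong refl) (auto simp: indicator_def)
    finally show ?thesis by simp
  qed
  have sets_U: "sets ?U = sigma_sets (space ?A \<times> space ?B) {X \<times> Y |X Y. X \<in> sets ?A \<and> Y \<in> sets ?B}"
    unfolding unit_cube_prod by (rule sets_pair_measure)
  have space_U: "space ?U = space ?A \<times> space ?B"
    unfolding unit_cube_prod by (rule space_pair_measure)
  have all: "(\<integral>z. indicator Z z * g z \<partial>?U) = 0" if "Z \<in> sets ?U" for Z
  proof -
    have "{X \<times> Y |X Y. X \<in> sets ?A \<and> Y \<in> sets ?B} \<subseteq> Pow (space ?A \<times> space ?B)"
      by (auto dest: sets.sets_into_space)
    from Int_stable_pair_measure_generator this that[unfolded sets_U] show ?thesis
    proof (induction rule: sigma_sets_induct_disjoint)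
      case (basic Z)
      then show ?case using rect by auto
    next
      case empty
      show ?case by simp
    next
      case (compl Z)
      have Z: "Z \<in> sets ?U" using compl(1) unfolding sets_U .
      have "(\<integral>z. indicator (space ?A \<times> space ?B - Z) z * g z \<partial>?U) =
          (\<integral>z. indicator (space ?A \<times> space ?B) z * g z - indicator Z z * g z \<partial>?U)"
        using sets.sets_into_space[OF Z] unfolding space_U
        by (intro Bochner_Integration.integral_cong refl) (auto simp: indicator_def)
      also have "\<dots> = 0"
        using compl(2) rect[OF sets.top sets.top] Z sets.top[of ?U] int unfolding space_U
        by (subst Bochner_Integration.integral_diff) (auto intro: integrable_mult_indicator[of _ _ g, simplified])
      finally show ?case .
    next
      case (union Z)
      have Z: "Z i \<in> sets ?U" for i using union(2) unfolding sets_U by auto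
      have "(LINT z:(\<Union>i. Z i)|?U. g z) = (\<Sum>i. LINT z:Z i|?U. g z)"
      proof (rule lebesgue_integral_countable_add)
        show "set_integrable ?U (\<Union>i. Z i) g"
          unfolding set_integrable_def using Z int by (intro integrable_mult_indicator sets.countable_UN) auto
        show "Z i \<inter> Z j = {}" if "i \<noteq> j" for i j
          using union(1) that by (auto simp: disjoint_family_on_def)
      qed (rule Z)
      then show ?case using union(3) by (simp add: set_lebesgue_integral_def)
    qed
  qed
  have "AE z in ?U. g z = 0"
  proof -
    \<comment> \<open>On a set of constant sign the absolute value is \<open>c\<close> times
      \<open>g\<close> with \<open>c\<close> equal to 1 or -1, so its integral vanishes there by
      \<open>all\<close>.\<close>
    have zero: "AE z in ?U. indicator Z z * \<bar>g z\<bar> = 0"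
      if Z: "Z \<in> sets ?U" and s: "\<And>z. z \<in> Z \<Longrightarrow> \<bar>g z\<bar> = c * g z" for Z and c :: real
    proof -
      have eq: "(\<lambda>z. indicator Z z * \<bar>g z\<bar>) = (\<lambda>z. c * (indicator Z z * g z))"
        using s by (auto simp: indicator_def)
      have i: "integrable ?U (\<lambda>z. indicator Z z * \<bar>g z\<bar>)"
        using integrable_mult_indicator[OF Z integrable_abs[OF int]] by simp
      have "(\<integral>z. indicator Z z * \<bar>g z\<bar> \<partial>?U) = 0"
        unfolding eq using all[OF Z] by simp
      then show ?thesis
        using i by (subst (asm) integral_nonneg_eq_0_iff_AE) auto
    qed
    have sets: "{z \<in> space ?U. g z \<ge> 0} \<in> sets ?U" "{z \<in> space ?U. g z \<le> 0} \<in> sets ?U"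
      by measurable
    have "AE z in ?U. indicator {z \<in> space ?U. g z \<ge> 0} z * \<bar>g z\<bar> = 0"
      by (rule zero[where c = 1, OF sets(1)]) simp
    moreover have "AE z in ?U. indicator {z \<in> space ?U. g z \<le> 0} z * \<bar>g z\<bar> = 0"
      by (rule zero[where c = "-1", OF sets(2)]) simp
    ultimately show ?thesis
      using AE_space by eventually_elim (auto simp: indicator_def split: if_splits)
  qed
  then have "abs_L2 g = 0"
    unfolding abs_L2_zero[symmetric] by (intro abs_L2_eqI sq square_integrable_zero)
  then show ?thesis by (simp add: g_def)
qed

lemma tensor_eqI:
  fixes k k' :: "('a::euclidean_space \<times> 'b::euclidean_space) L2"
  assumes "\<And>x y. k \<bullet> tensor x y = k' \<bullet> tensor x y"
  shows "k = k'"
  using tensor_total[of "k - k'"] assms by (simp add: inner_diff_left)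

section \<open>Kernel means\<close>

lemma norm_iexp_diff_le: "cmod (iexp a - iexp b) \<le> \<bar>a - b\<bar>"
proof -
  have "iexp a - iexp b = iexp b * (iexp (a - b) - 1)"
    by (simp add: algebra_simps exp_diff exp_minus)
  also have "cmod \<dots> = cmod (iexp (a - b) - 1)" by (simp add: norm_mult)
  also have "\<dots> \<le> \<bar>a - b\<bar>" using iexp_approx1[of "a - b" 0] by simp
  finally show ?thesis .
qed

text \<open>The array \<open>X\<close> enters only through its mean distance to the stationary
  process; the moment condition of local stationarity is reduced to this by
  \<open>expectation_norm_le_moment\<close>.\<close>

locale kernel_clt = approximable_shift M S \<eta> f + smoothing_kernel K B L c h u
  for M :: "'w measure" and S :: "'s measure" and \<eta> :: "int + int \<times> nat \<times> int \<Rightarrow> 'w \<Rightarrow> 's"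
    and f :: "(nat \<Rightarrow> 's) \<Rightarrow> 'h::{real_inner, banach, second_countable_topology}"
    and K :: "real \<Rightarrow> real" and B L c :: real and h :: "nat \<Rightarrow> real" and u :: real +
  fixes X :: "nat \<Rightarrow> nat \<Rightarrow> 'w \<Rightarrow> 'h" and C0 :: real
  assumes X_integrable: "1 \<le> t \<Longrightarrow> t \<le> T \<Longrightarrow> integrable M (X T t)"
    and X_approx: "1 \<le> t \<Longrightarrow> t \<le> T \<Longrightarrow> expectation (\<lambda>\<omega>. norm (X T t \<omega> - Y (int t) \<omega>)) \<le>
      C0 * (\<bar>real t / real T - u\<bar> + 1 / real T)"
    and C0: "C0 \<ge> 0"
begin

lemma Y_integrable: "integrable M (Y t)"
  by (rule L2_rv_integrable[OF Y_L2])

definition Z :: "nat \<Rightarrow> 'w \<Rightarrow> 'h" where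
  "Z T \<omega> = (\<Sum>t=1..T. kernel_weight T (real t) *\<^sub>R X T t \<omega>)"

definition Z_stationary :: "nat \<Rightarrow> 'w \<Rightarrow> 'h" where
  "Z_stationary T \<omega> = (\<Sum>t=1..T. kernel_weight T (real t) *\<^sub>R Y (int t) \<omega>)"

definition block_weight :: "nat \<Rightarrow> nat \<Rightarrow> nat \<Rightarrow> real" where
  "block_weight q T j = kernel_weight T (real (j * q))"

text \<open>\<open>T\<close> blocks of length \<open>q\<close> reach up to time
  \<open>T * q\<close>. Weights from \<open>T\<close> on vanish for large \<open>T\<close>, so this
  range avoids rounding \<open>T / q\<close>.\<close>

definition Z_block :: "nat \<Rightarrow> nat \<Rightarrow> 'w \<Rightarrow> 'h" where
  "Z_block q T \<omega> = (\<Sum>j<T. block_weight q T j *\<^sub>R V q j \<omega>)"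

lemma Z_integrable: "integrable M (Z T)"
  unfolding Z_def[abs_def]
  by (intro Bochner_Integration.integrable_sum integrable_scaleR_right) (auto intro: X_integrable)

lemma Z_stationary_integrable: "integrable M (Z_stationary T)"
  unfolding Z_stationary_def[abs_def]
  by (intro Bochner_Integration.integrable_sum integrable_scaleR_right Y_integrable)

lemma Z_block_L2: "L2_rv M (Z_block q T)"
  unfolding Z_block_def[abs_def] by (intro L2_rv_sum L2_rv_scaleR V_L2)

lemma Z_block_integrable: "integrable M (Z_block q T)"
  by (rule L2_rv_integrable[OF Z_block_L2])

lemma expectation_norm_sum_le:
  assumes "finite U" "\<And>t. t \<in> U \<Longrightarrow> integrable M (R t)"
  shows "expectation (\<lambda>\<omega>. norm (\<Sum>t\<in>U. w t *\<^sub>R (R t \<omega> :: 'h))) \<le>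
    (\<Sum>t\<in>U. \<bar>w t\<bar> * expectation (\<lambda>\<omega>. norm (R t \<omega>)))"
proof -
  have "expectation (\<lambda>\<omega>. norm (\<Sum>t\<in>U. w t *\<^sub>R R t \<omega>)) \<le> expectation (\<lambda>\<omega>. \<Sum>t\<in>U. \<bar>w t\<bar> * norm (R t \<omega>))"
  proof (rule integral_mono)
    show "integrable M (\<lambda>\<omega>. norm (\<Sum>t\<in>U. w t *\<^sub>R R t \<omega>))"
      using assms by (intro integrable_norm Bochner_Integration.integrable_sum integrable_scaleR_right) auto
    show "integrable M (\<lambda>\<omega>. \<Sum>t\<in>U. \<bar>w t\<bar> * norm (R t \<omega>))"
      using assms by (intro Bochner_Integration.integrable_sum integrable_mult_right integrable_norm) auto
    show "norm (\<Sum>t\<in>U. w t *\<^sub>R R t \<omega>) \<le> (\<Sum>t\<in>U. \<bar>w t\<bar> * norm (R t \<omega>))" for \<omega>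
      by (rule order_trans[OF norm_sum]) simp
  qed
  also have "\<dots> = (\<Sum>t\<in>U. \<bar>w t\<bar> * expectation (\<lambda>\<omega>. norm (R t \<omega>)))"
    using assms by (subst Bochner_Integration.integral_sum) auto
  finally show ?thesis .
qed

lemma kernel_support_card:
  assumes T: "T \<ge> 1" and A: "finite A" "\<And>t. t \<in> A \<Longrightarrow> kernel_weight T (real t) \<noteq> 0"
  shows "real (card A) \<le> 2 * c * rate T + 1"
proof (rule card_nat_interval_le[OF A(1)])
  show "real T * u - c * rate T \<le> real t \<and> real t \<le> real T * u - c * rate T + 2 * c * rate T"
    if "t \<in> A" for t
    using kernel_weight_support[OF T A(2)[OF that]] by simp
qed (use c_pos rate_pos[OF T] in simp)

text \<open>At most \<open>(2 * c + 1) * rate T\<close> weights are nonzero, each is at most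
  \<open>B / sqrt (rate T)\<close>, and each error has mean at most
  \<open>C0 * (c * h T + 1 / T)\<close>. In the product,
  \<open>sqrt (rate T) / T = sqrt (h T / T)\<close> is estimated by
  \<open>sqrt (h T)\<close>.\<close>

lemma bias_bound:
  assumes T: "T \<ge> 1" and r: "rate T \<ge> 1"
  shows "expectation (\<lambda>\<omega>. norm (Z T \<omega> - Z_stationary T \<omega>)) \<le>
    (2 * c + 1) * B * C0 * (c * sqrt (real T * h T ^ 3) + sqrt (h T))"
proof -
  define A where "A = {t \<in> {1..T}. kernel_weight T (real t) \<noteq> 0}"
  have r0: "rate T > 0" using r by simp
  have hT: "h T > 0" using h_pos T by simp
  have fin: "finite A" by (simp add: A_def)
  have restrict: "Z T \<omega> - Z_stationary T \<omega> = (\<Sum>t\<in>A. kernel_weight T (real t) *\<^sub>R (X T t \<omega> - Y (int t) \<omega>))" for \<omega>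
  proof -
    have "Z T \<omega> - Z_stationary T \<omega> = (\<Sum>t=1..T. kernel_weight T (real t) *\<^sub>R (X T t \<omega> - Y (int t) \<omega>))"
      by (simp add: Z_def Z_stationary_def sum_subtractf scaleR_diff_right)
    also have "\<dots> = (\<Sum>t\<in>A. kernel_weight T (real t) *\<^sub>R (X T t \<omega> - Y (int t) \<omega>))"
      by (rule sum.mono_neutral_right) (auto simp: A_def)
    finally show ?thesis .
  qed
  have "expectation (\<lambda>\<omega>. norm (Z T \<omega> - Z_stationary T \<omega>)) \<le>
      (\<Sum>t\<in>A. \<bar>kernel_weight T (real t)\<bar> * expectation (\<lambda>\<omega>. norm (X T t \<omega> - Y (int t) \<omega>)))"
    unfolding restrict using fin
    by (intro expectation_norm_sum_le) (auto simp: A_def intro!: Bochner_Integration.integrable_diff X_integrable Y_integrable)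
  also have "\<dots> \<le> (\<Sum>t\<in>A. (B / sqrt (rate T)) * (C0 * (c * h T + 1 / real T)))"
  proof (intro sum_mono mult_mono kernel_weight_bound T)
    fix t assume t: "t \<in> A"
    then have t': "1 \<le> t" "t \<le> T" "kernel_weight T (real t) \<noteq> 0" by (auto simp: A_def)
    have "\<bar>real t - real T * u\<bar> \<le> c * rate T"
      using kernel_weight_support[OF T t'(3)] by linarith
    then have "\<bar>real t - real T * u\<bar> / real T \<le> c * h T"
      using T by (simp add: rate_def pos_divide_le_eq mult_ac)
    moreover have "\<bar>real t / real T - u\<bar> = \<bar>real t - real T * u\<bar> / real T"
    proof -
      have "real t / real T - u = (real t - real T * u) / real T" using T by (simp add: field_simps)
      then show ?thesis by (simp add: abs_divide)
    qed
    ultimately have "\<bar>real t / real T - u\<bar> + 1 / real T \<le> c * h T + 1 / real T" by simp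
    then show "expectation (\<lambda>\<omega>. norm (X T t \<omega> - Y (int t) \<omega>)) \<le> C0 * (c * h T + 1 / real T)"
      using X_approx[OF t'(1,2)] mult_left_mono[OF _ C0] by (meson order_trans)
  qed (use B_nonneg r0 in auto)
  also have "\<dots> = real (card A) * ((B / sqrt (rate T)) * (C0 * (c * h T + 1 / real T)))" by simp
  also have "\<dots> \<le> ((2 * c + 1) * rate T) * ((B / sqrt (rate T)) * (C0 * (c * h T + 1 / real T)))"
  proof (rule mult_right_mono)
    have "real (card A) \<le> 2 * c * rate T + 1"
      by (rule kernel_support_card[OF T fin]) (simp add: A_def)
    also have "\<dots> \<le> (2 * c + 1) * rate T" using r by (simp add: algebra_simps)
    finally show "real (card A) \<le> (2 * c + 1) * rate T" .
    show "0 \<le> (B / sqrt (rate T)) * (C0 * (c * h T + 1 / real T))"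
      using B_nonneg C0 c_pos hT r0 by simp
  qed
  also have "\<dots> = (2 * c + 1) * B * C0 * ((rate T / sqrt (rate T)) * (c * h T + 1 / real T))"
    by (simp add: mult_ac)
  also have "rate T / sqrt (rate T) = sqrt (rate T)" using r0 by (simp add: real_div_sqrt)
  also have "sqrt (rate T) * (c * h T + 1 / real T) = c * (sqrt (rate T) * h T) + sqrt (rate T) / real T"
    by (simp add: algebra_simps)
  also have "sqrt (rate T) * h T = sqrt (real T * h T ^ 3)"
  proof -
    have "sqrt (rate T) * h T = sqrt (rate T) * sqrt ((h T)\<^sup>2)" using hT by simp
    also have "\<dots> = sqrt (real T * h T ^ 3)"
      by (simp only: real_sqrt_mult[symmetric]) (simp add: rate_def power2_eq_square power3_eq_cube mult_ac)
    finally show ?thesis .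
  qed
  also have "(2 * c + 1) * B * C0 * (c * sqrt (real T * h T ^ 3) + sqrt (rate T) / real T) \<le>
      (2 * c + 1) * B * C0 * (c * sqrt (real T * h T ^ 3) + sqrt (h T))"
  proof (intro mult_left_mono add_left_mono)
    have "sqrt (rate T) / real T = sqrt (h T) * (sqrt (real T) / real T)"
      by (simp add: rate_def real_sqrt_mult)
    also have "\<dots> \<le> sqrt (h T) * 1"
    proof (rule mult_left_mono)
      have "1 \<le> sqrt (real T)" using T by simp
      then show "sqrt (real T) / real T \<le> 1"
        using T by (simp add: sqrt_divide_self_eq inverse_le_1_iff)
    qed (use hT in simp)
    finally show "sqrt (rate T) / real T \<le> sqrt (h T)" by simp
  qed (use B_nonneg C0 c_pos in simp)
  finally show ?thesis .
qed

lemma eventually_rate_ge: "\<forall>\<^sub>F T in sequentially. rate T \<ge> r"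
  using rate_at_top by (simp add: filterlim_at_top)

lemma bias_negligible:
  assumes "e > 0"
  shows "\<forall>\<^sub>F T in sequentially. expectation (\<lambda>\<omega>. norm (Z T \<omega> - Z_stationary T \<omega>)) \<le> e"
proof -
  have "(\<lambda>T. (2 * c + 1) * B * C0 * (c * sqrt (real T * h T ^ 3) + sqrt (h T))) \<longlonglongrightarrow>
      (2 * c + 1) * B * C0 * (c * sqrt 0 + sqrt 0)"
    by (intro tendsto_intros Th3_lim h_lim)
  then have "\<forall>\<^sub>F T in sequentially. (2 * c + 1) * B * C0 * (c * sqrt (real T * h T ^ 3) + sqrt (h T)) < e"
    by (rule order_tendstoD) (use assms in simp)
  then show ?thesis
    using eventually_rate_ge[of 1] eventually_ge_at_top[of 1]
    by eventually_elim (use bias_bound in force)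
qed

definition frozen_weight_error :: "nat \<Rightarrow> nat \<Rightarrow> nat \<Rightarrow> real" where
  "frozen_weight_error q T s = kernel_weight T (real (Suc s)) - block_weight q T (s div q)"

lemma block_decomposition:
  assumes q: "q > 0" and zero: "\<And>t. t \<ge> real T \<Longrightarrow> kernel_weight T t = 0"
  shows "Z_stationary T \<omega> - Z_block q T \<omega> =
    (\<Sum>s<T * q. kernel_weight T (real (Suc s)) *\<^sub>R D q s \<omega>) +
    (\<Sum>s<T * q. frozen_weight_error q T s *\<^sub>R C (Suc (s mod q)) (int s + 1) \<omega>)"
proof -
  have "Z_stationary T \<omega> = (\<Sum>s<T. kernel_weight T (real (Suc s)) *\<^sub>R Y (int s + 1) \<omega>)"
    unfolding Z_stationary_def
    by (rule sum.reindex_bij_witness[where i = Suc and j = "\<lambda>t. t - 1"]) (auto simp: add.commute of_nat_diff)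
  also have "\<dots> = (\<Sum>s<T * q. kernel_weight T (real (Suc s)) *\<^sub>R Y (int s + 1) \<omega>)"
  proof (rule sum.mono_neutral_left)
    show "{..<T} \<subseteq> {..<T * q}"
    proof -
      have "T * 1 \<le> T * q" using q by (intro mult_le_mono2) simp
      then show ?thesis by auto
    qed
    show "\<forall>s\<in>{..<T * q} - {..<T}. kernel_weight T (real (Suc s)) *\<^sub>R Y (int s + 1) \<omega> = 0"
      by (auto simp: zero)
  qed simp
  finally have 1: "Z_stationary T \<omega> = (\<Sum>s<T * q. kernel_weight T (real (Suc s)) *\<^sub>R Y (int s + 1) \<omega>)" .
  have 2: "Z_block q T \<omega> = (\<Sum>s<T * q. block_weight q T (s div q) *\<^sub>R C (Suc (s mod q)) (int s + 1) \<omega>)"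
    unfolding Z_block_def by (rule sum_blocks[symmetric])
  show ?thesis
    unfolding 1 2 sum_subtractf[symmetric] sum.distrib[symmetric]
    by (intro sum.cong refl) (simp add: D_def frozen_weight_error_def algebra_simps)
qed

lemma block_error_bound:
  assumes q: "q > 0" and T: "T \<ge> 1" and r: "rate T \<ge> 2 * real q"
  shows "expectation (\<lambda>\<omega>. norm (\<Sum>s<T * q. kernel_weight T (real (Suc s)) *\<^sub>R D q s \<omega>)) \<le>
    2 * B * \<Delta> * sqrt (2 * c + 1) / sqrt (real q)"
proof -
  define A where "A = {s \<in> {..<T * q}. kernel_weight T (real (Suc s)) \<noteq> 0}"
  have r0: "rate T > 0" using rate_pos[OF T] .
  have A: "finite A" by (simp add: A_def)
  have eq: "(\<Sum>s<T * q. kernel_weight T (real (Suc s)) *\<^sub>R D q s \<omega>) =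
      (\<Sum>s\<in>A. kernel_weight T (real (Suc s)) *\<^sub>R D q s \<omega>)" for \<omega>
    by (rule sum.mono_neutral_right) (auto simp: A_def)
  have L2: "L2_rv M (\<lambda>\<omega>. \<Sum>s\<in>A. kernel_weight T (real (Suc s)) *\<^sub>R D q s \<omega>)"
    by (intro L2_rv_sum L2_rv_scaleR D_L2)
  have card: "real (card ((\<lambda>s. s div q) ` A)) \<le> 2 * c * rate T / real q + 2"
  proof (rule card_blocks_le[OF A _ _ q])
    fix s assume "s \<in> A"
    then have "kernel_weight T (real (Suc s)) \<noteq> 0" by (simp add: A_def)
    from kernel_weight_support[OF T this]
    show "real T * u - c * rate T - 1 \<le> real s \<and> real s \<le> real T * u - c * rate T - 1 + 2 * c * rate T"
      by simp
  qed (use c_pos r0 in simp)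
  have "(L2_norm M (\<lambda>\<omega>. \<Sum>s\<in>A. kernel_weight T (real (Suc s)) *\<^sub>R D q s \<omega>))\<^sup>2 \<le>
      (B / sqrt (rate T))\<^sup>2 * (4 * \<Delta>\<^sup>2 * real (card ((\<lambda>s. s div q) ` A)))"
    by (rule block_error[OF q A]) (rule kernel_weight_bound[OF T])
  also have "\<dots> \<le> (B / sqrt (rate T))\<^sup>2 * (4 * \<Delta>\<^sup>2 * ((2 * c + 1) * rate T / real q))"
  proof (intro mult_left_mono order_trans[OF card])
    \<comment> \<open>This absorbs the up to two extra blocks that the ends of the support meet; it
      is the reason for the assumption \<open>r\<close>.\<close>
    have "2 \<le> rate T / real q" using r q by (simp add: pos_le_divide_eq)
    then show "2 * c * rate T / real q + 2 \<le> (2 * c + 1) * rate T / real q"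
      by (simp add: distrib_right add_divide_distrib)
  qed auto
  also have "\<dots> = (2 * B * \<Delta> * sqrt (2 * c + 1) / sqrt (real q))\<^sup>2"
    using r0 c_pos by (simp add: power_divide power_mult_distrib)
  finally have "L2_norm M (\<lambda>\<omega>. \<Sum>s\<in>A. kernel_weight T (real (Suc s)) *\<^sub>R D q s \<omega>) \<le>
      2 * B * \<Delta> * sqrt (2 * c + 1) / sqrt (real q)"
    by (rule power2_le_imp_le) (use B_nonneg \<Delta>_nonneg c_pos in simp)
  then show ?thesis unfolding eq using L1_le_L2_norm[OF L2] by linarith
qed

text \<open>The triangle inequality suffices: for fixed \<open>q\<close> there are of the order of T
  h terms, and the Lipschitz bound makes each weight difference of order (T h) to the power
  -3/2.\<close>

lemma frozen_weight_error_bound: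
  assumes q: "q > 0" and T: "T \<ge> 1" and r: "rate T \<ge> 1"
  shows "expectation (\<lambda>\<omega>. norm (\<Sum>s<T * q. frozen_weight_error q T s *\<^sub>R C (Suc (s mod q)) (int s + 1) \<omega>)) \<le>
    (2 * c + real q + 2) * (L * real q) * L2_norm M (Y 0) / sqrt (rate T)"
proof -
  define A where "A = {s \<in> {..<T * q}. frozen_weight_error q T s \<noteq> 0}"
  let ?\<sigma> = "L2_norm M (Y 0)"
  have r0: "rate T > 0" using r by simp
  have A: "finite A" by (simp add: A_def)
  have close: "real (s div q * q) \<le> real s" "real s \<le> real (s div q * q) + real q - 1" for s
  proof -
    have "s div q * q + s mod q = s" "s mod q < q" using q by simp_all
    then have 1: "s div q * q \<le> s" and 2: "Suc s \<le> s div q * q + q" by linarith+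
    show "real (s div q * q) \<le> real s" using 1 by (simp only: of_nat_le_iff)
    have "real (Suc s) \<le> real (s div q * q + q)" using 2 by (simp only: of_nat_le_iff)
    then show "real s \<le> real (s div q * q) + real q - 1" by (simp only: of_nat_add of_nat_Suc)
  qed
  have eq: "(\<Sum>s<T * q. frozen_weight_error q T s *\<^sub>R C (Suc (s mod q)) (int s + 1) \<omega>) =
      (\<Sum>s\<in>A. frozen_weight_error q T s *\<^sub>R C (Suc (s mod q)) (int s + 1) \<omega>)" for \<omega>
    by (rule sum.mono_neutral_right) (auto simp: A_def)
  have C1: "expectation (\<lambda>\<omega>. norm (C m t \<omega>)) \<le> ?\<sigma>" for m t
    using L1_le_L2_norm[OF C_L2[of m t]] same_law_L2(2)[OF C_law[of m t] C_measurable Y_measurable] by simp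
  have w: "\<bar>frozen_weight_error q T s\<bar> \<le> L * real q / rate T / sqrt (rate T)" for s
  proof -
    have "\<bar>frozen_weight_error q T s\<bar> \<le> L * \<bar>real (Suc s) - real (s div q * q)\<bar> / rate T / sqrt (rate T)"
      unfolding frozen_weight_error_def block_weight_def by (rule kernel_weight_lipschitz[OF T])
    also have "\<dots> \<le> L * real q / rate T / sqrt (rate T)"
      using close[of s] L_nonneg r0 by (intro divide_right_mono mult_left_mono) auto
    finally show ?thesis .
  qed
  have card: "real (card A) \<le> (2 * c * rate T + real q) + 1"
  proof (rule card_nat_interval_le[OF A])
    fix s assume "s \<in> A"
    then have "kernel_weight T (real (Suc s)) \<noteq> 0 \<or> kernel_weight T (real (s div q * q)) \<noteq> 0"
      by (auto simp: A_def frozen_weight_error_def block_weight_def)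
    then show "real T * u - c * rate T - 1 \<le> real s \<and> real s \<le> real T * u - c * rate T - 1 + (2 * c * rate T + real q)"
    proof
      assume "kernel_weight T (real (Suc s)) \<noteq> 0"
      from kernel_weight_support[OF T this] show ?thesis by simp
    next
      assume "kernel_weight T (real (s div q * q)) \<noteq> 0"
      from kernel_weight_support[OF T this] close[of s] show ?thesis by linarith
    qed
  qed (use c_pos r0 in simp)
  have "expectation (\<lambda>\<omega>. norm (\<Sum>s\<in>A. frozen_weight_error q T s *\<^sub>R C (Suc (s mod q)) (int s + 1) \<omega>)) \<le>
      (\<Sum>s\<in>A. \<bar>frozen_weight_error q T s\<bar> * expectation (\<lambda>\<omega>. norm (C (Suc (s mod q)) (int s + 1) \<omega>)))"
    by (rule expectation_norm_sum_le[OF A]) (rule L2_rv_integrable[OF C_L2])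
  also have "\<dots> \<le> (\<Sum>s\<in>A. (L * real q / rate T / sqrt (rate T)) * ?\<sigma>)"
    using L_nonneg r0 by (intro sum_mono mult_mono w C1) auto
  also have "\<dots> = real (card A) * ((L * real q / rate T / sqrt (rate T)) * ?\<sigma>)" by simp
  also have "\<dots> \<le> ((2 * c + real q + 2) * rate T) * ((L * real q / rate T / sqrt (rate T)) * ?\<sigma>)"
  proof (rule mult_right_mono)
    have "real q + 1 \<le> (real q + 2) * 1" by simp
    also have "\<dots> \<le> (real q + 2) * rate T" using r by (intro mult_left_mono) auto
    finally have "real q + 1 \<le> (real q + 2) * rate T" .
    then show "real (card A) \<le> (2 * c + real q + 2) * rate T" using card by (simp add: algebra_simps)
    show "0 \<le> (L * real q / rate T / sqrt (rate T)) * ?\<sigma>"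
      using L_nonneg r0 by (simp add: L2_norm_nonneg)
  qed
  also have "\<dots> = (2 * c + real q + 2) * (L * real q) * ?\<sigma> / sqrt (rate T)"
    using r0 by simp
  finally show ?thesis unfolding eq .
qed

definition block_constant :: real where
  "block_constant = 2 * B * \<Delta> * sqrt (2 * c + 1) + 1"

lemma block_approximation:
  assumes q: "q > 0"
  shows "\<forall>\<^sub>F T in sequentially.
    expectation (\<lambda>\<omega>. norm (Z T \<omega> - Z_block q T \<omega>)) \<le> block_constant / sqrt (real q)"
proof -
  \<comment> \<open>For fixed \<open>q\<close> the bias and the freezing error vanish as
    \<open>T\<close> grows, so each is eventually below half of 1 / sqrt q. Together they account
    for the summand 1 in \<open>block_constant\<close>.\<close>
  let ?e = "1 / (2 * sqrt (real q))"
  have e: "?e > 0" using q by simp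
  have "\<forall>\<^sub>F T in sequentially. (2 * c + real q + 2) * (L * real q) * L2_norm M (Y 0) / sqrt (rate T) < ?e"
    by (rule order_tendstoD(2)[OF inverse_sqrt_rate_tendsto e])
  then show ?thesis
    using bias_negligible[OF e] eventually_kernel_weight_zero eventually_rate_ge[of "max 1 (2 * real q)"]
      eventually_ge_at_top[of 1]
  proof eventually_elim
    case (elim T)
    define E1 where "E1 \<omega> = (\<Sum>s<T * q. kernel_weight T (real (Suc s)) *\<^sub>R D q s \<omega>)" for \<omega>
    define E2 where "E2 \<omega> = (\<Sum>s<T * q. frozen_weight_error q T s *\<^sub>R C (Suc (s mod q)) (int s + 1) \<omega>)" for \<omega>
    have i1: "integrable M E1" and i2: "integrable M E2"
      unfolding E1_def[abs_def] E2_def[abs_def]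
      by (rule L2_rv_integrable, intro L2_rv_sum L2_rv_scaleR D_L2 C_L2)+
    have dec: "Z_stationary T \<omega> - Z_block q T \<omega> = E1 \<omega> + E2 \<omega>" for \<omega>
      unfolding E1_def E2_def by (rule block_decomposition[OF q]) (use elim(3) in simp)
    have "norm (Z T \<omega> - Z_block q T \<omega>) \<le> norm (Z T \<omega> - Z_stationary T \<omega>) + (norm (E1 \<omega>) + norm (E2 \<omega>))" for \<omega>
    proof -
      have "Z T \<omega> - Z_block q T \<omega> = (Z T \<omega> - Z_stationary T \<omega>) + (E1 \<omega> + E2 \<omega>)"
        by (simp add: dec[symmetric])
      then show ?thesis by (metis norm_triangle_le norm_triangle_ineq add_left_mono)
    qed
    then have "expectation (\<lambda>\<omega>. norm (Z T \<omega> - Z_block q T \<omega>)) \<le>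
        expectation (\<lambda>\<omega>. norm (Z T \<omega> - Z_stationary T \<omega>) + (norm (E1 \<omega>) + norm (E2 \<omega>)))"
      using i1 i2 Z_integrable Z_stationary_integrable Z_block_integrable
      by (intro integral_mono) auto
    also have "\<dots> = expectation (\<lambda>\<omega>. norm (Z T \<omega> - Z_stationary T \<omega>)) +
        (expectation (\<lambda>\<omega>. norm (E1 \<omega>)) + expectation (\<lambda>\<omega>. norm (E2 \<omega>)))"
      using i1 i2 Z_integrable Z_stationary_integrable by simp
    also have "\<dots> \<le> ?e + (2 * B * \<Delta> * sqrt (2 * c + 1) / sqrt (real q) + ?e)"
      using elim block_error_bound[OF q, of T] frozen_weight_error_bound[OF q, of T]
      unfolding E1_def E2_def by (intro add_mono) auto
    also have "\<dots> = block_constant / sqrt (real q)"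
      by (simp add: block_constant_def add_divide_distrib)
    finally show ?case .
  qed
qed

end

section \<open>Characteristic functions and tightness of the normalised kernel means\<close>

context kernel_clt
begin

definition \<kappa> :: real where
  "\<kappa> = (\<integral>z. (K z)\<^sup>2 \<partial>lborel)"

lemma block_weight_square_sum: "q > 0 \<Longrightarrow> (\<lambda>T. \<Sum>j<T. (block_weight q T j)\<^sup>2) \<longlonglongrightarrow> \<kappa> / real q"
  unfolding block_weight_def \<kappa>_def by (rule block_weights_square_sum)

lemma block_weight_small:
  assumes "e > 0"
  shows "\<forall>\<^sub>F T in sequentially. \<forall>j<T. \<bar>block_weight q T j\<bar> \<le> e"
proof -
  have "\<forall>\<^sub>F T in sequentially. B / sqrt (rate T) < e"
    by (rule order_tendstoD(2)[OF inverse_sqrt_rate_tendsto assms])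
  then show ?thesis
    using eventually_ge_at_top[of 1]
    by eventually_elim
       (auto simp: block_weight_def intro: order_trans[OF kernel_weight_bound less_imp_le])
qed

lemma block_char_tendsto:
  assumes q: "q > 0"
  shows "(\<lambda>T. \<integral>\<omega>. iexp (Z_block q T \<omega> \<bullet> x) \<partial>M) \<longlonglongrightarrow>
    exp (- (\<kappa> / real q) * expectation (\<lambda>\<omega>. (V q 0 \<omega> \<bullet> x)\<^sup>2) / 2)"
proof -
  let ?V = "\<lambda>j \<omega>. V q j \<omega> \<bullet> x"
  have Vm [measurable]: "V q j \<in> borel_measurable M" for j using V_L2 by (rule L2_rv_measurable)
  have "indep_vars (\<lambda>_. borel) ?V UNIV"
    by (rule indep_vars_compose2[OF V_indep]) measurable
  moreover have "distr M borel (?V j) = distr M borel (?V 0)" for j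
  proof -
    have "distr M borel (?V j) = distr (distr M borel (V q j)) borel (\<lambda>v. v \<bullet> x)" for j
      by (subst distr_distr) (simp_all add: comp_def)
    then show ?thesis by (simp only: V_law[of q j])
  qed
  moreover have "integrable M (\<lambda>\<omega>. (?V 0 \<omega>)\<^sup>2)"
    using L2_rv_inner[OF V_L2[of q 0], of x] by (simp add: L2_rv_def)
  moreover have "expectation (?V 0) = 0"
    using V_mean[of q 0] L2_rv_integrable[OF V_L2[of q 0]] by simp
  ultimately have "(\<lambda>T. \<integral>\<omega>. iexp (\<Sum>j<T. block_weight q T j * ?V j \<omega>) \<partial>M) \<longlonglongrightarrow>
      exp (- (\<kappa> / real q) * expectation (\<lambda>\<omega>. (?V 0 \<omega>)\<^sup>2) / 2)"
    by (rule weighted_iid_clt[OF _ _ _ _ block_weight_small block_weight_square_sum[OF q]])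
  then show ?thesis by (simp add: Z_block_def inner_sum_left)
qed

text \<open>First \<open>q\<close> is fixed, then \<open>T\<close> grows:
  \<open>block_approximation\<close> holds only from some \<open>T\<close> depending on
  \<open>q\<close>, but its error bound is free of \<open>T\<close>. It is turned into a bound for
  characteristic functions by the Lipschitz property of exp(i x).\<close>

theorem Z_char_tendsto:
  "(\<lambda>T. \<integral>\<omega>. iexp (Z T \<omega> \<bullet> x) \<partial>M) \<longlonglongrightarrow> exp (- \<kappa> * long_run_variance x / 2)"
proof (rule LIMSEQ_I)
  fix e :: real assume e: "e > 0"
  let ?v = "\<lambda>q. expectation (\<lambda>\<omega>. (V q 0 \<omega> \<bullet> x)\<^sup>2)"
  let ?l = "complex_of_real (exp (- \<kappa> * long_run_variance x / 2))"
  let ?lq = "\<lambda>q. complex_of_real (exp (- (\<kappa> / real q) * ?v q / 2))"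
  have "(\<lambda>q. complex_of_real (exp (- \<kappa> * (?v q / real q) / 2))) \<longlonglongrightarrow> ?l"
    by (intro tendsto_intros V_variance_tendsto) simp
  then have "?lq \<longlonglongrightarrow> ?l" by simp
  then have "\<forall>\<^sub>F q in sequentially. dist (?lq q) ?l < e / 3"
    by (rule tendstoD) (use e in simp)
  moreover have "\<forall>\<^sub>F q in sequentially. norm x * block_constant / sqrt (real q) < e / 3"
    by (rule order_tendstoD(2)[OF tendsto_divide_0[OF tendsto_const
          filterlim_at_top_imp_at_infinity[OF filterlim_compose[OF sqrt_at_top filterlim_real_sequentially]]]])
       (use e in simp)
  ultimately have "\<forall>\<^sub>F q in sequentially. q \<ge> 1 \<and> dist (?lq q) ?l < e / 3 \<and>
      norm x * block_constant / sqrt (real q) < e / 3"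
    using eventually_ge_at_top[of 1] by eventually_elim auto
  then obtain q :: nat where q: "q \<ge> 1" "dist (?lq q) ?l < e / 3" "norm x * block_constant / sqrt (real q) < e / 3"
    by (auto simp: eventually_sequentially)
  then have q0: "q > 0" by simp
  have [measurable]: "Z T \<in> borel_measurable M" "Z_block q T \<in> borel_measurable M" for T
    using Z_integrable Z_block_integrable by auto
  have "\<forall>\<^sub>F T in sequentially. dist (\<integral>\<omega>. iexp (Z_block q T \<omega> \<bullet> x) \<partial>M) (?lq q) < e / 3"
    by (rule tendstoD[OF block_char_tendsto[OF q0]]) (use e in simp)
  with block_approximation[OF q0]
  have "\<forall>\<^sub>F T in sequentially. norm ((\<integral>\<omega>. iexp (Z T \<omega> \<bullet> x) \<partial>M) - ?l) < e"
  proof eventually_elim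
    case (elim T)
    have i1: "integrable M (\<lambda>\<omega>. iexp (Z T \<omega> \<bullet> x))" and i2: "integrable M (\<lambda>\<omega>. iexp (Z_block q T \<omega> \<bullet> x))"
      by (rule integrable_iexp; simp)+
    have "norm ((\<integral>\<omega>. iexp (Z T \<omega> \<bullet> x) \<partial>M) - (\<integral>\<omega>. iexp (Z_block q T \<omega> \<bullet> x) \<partial>M)) =
        norm (\<integral>\<omega>. iexp (Z T \<omega> \<bullet> x) - iexp (Z_block q T \<omega> \<bullet> x) \<partial>M)"
      by (subst Bochner_Integration.integral_diff[OF i1 i2]) (rule refl)
    also have "\<dots> \<le> expectation (\<lambda>\<omega>. cmod (iexp (Z T \<omega> \<bullet> x) - iexp (Z_block q T \<omega> \<bullet> x)))"
      by (rule integral_norm_bound)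
    also have "\<dots> \<le> expectation (\<lambda>\<omega>. norm x * norm (Z T \<omega> - Z_block q T \<omega>))"
    proof (rule integral_mono)
      show "integrable M (\<lambda>\<omega>. cmod (iexp (Z T \<omega> \<bullet> x) - iexp (Z_block q T \<omega> \<bullet> x)))"
        using i1 i2 by (intro integrable_norm Bochner_Integration.integrable_diff)
      show "integrable M (\<lambda>\<omega>. norm x * norm (Z T \<omega> - Z_block q T \<omega>))"
        by (intro integrable_mult_right integrable_norm Bochner_Integration.integrable_diff
            Z_integrable Z_block_integrable)
      fix \<omega>
      have "cmod (iexp (Z T \<omega> \<bullet> x) - iexp (Z_block q T \<omega> \<bullet> x)) \<le> \<bar>(Z T \<omega> - Z_block q T \<omega>) \<bullet> x\<bar>"
        using norm_iexp_diff_le by (simp only: inner_diff_left)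
      also have "\<dots> \<le> norm x * norm (Z T \<omega> - Z_block q T \<omega>)"
        using Cauchy_Schwarz_ineq2[of "Z T \<omega> - Z_block q T \<omega>" x] by (simp add: mult.commute)
      finally show "cmod (iexp (Z T \<omega> \<bullet> x) - iexp (Z_block q T \<omega> \<bullet> x)) \<le> norm x * norm (Z T \<omega> - Z_block q T \<omega>)" .
    qed
    also have "\<dots> = norm x * expectation (\<lambda>\<omega>. norm (Z T \<omega> - Z_block q T \<omega>))" by simp
    also have "\<dots> \<le> norm x * (block_constant / sqrt (real q))"
      by (intro mult_left_mono elim(1)) simp
    also have "norm x * (block_constant / sqrt (real q)) < e / 3" using q(3) by simp
    finally have 1: "norm ((\<integral>\<omega>. iexp (Z T \<omega> \<bullet> x) \<partial>M) - (\<integral>\<omega>. iexp (Z_block q T \<omega> \<bullet> x) \<partial>M)) < e / 3" .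
    have "(\<integral>\<omega>. iexp (Z T \<omega> \<bullet> x) \<partial>M) - ?l =
        ((\<integral>\<omega>. iexp (Z T \<omega> \<bullet> x) \<partial>M) - (\<integral>\<omega>. iexp (Z_block q T \<omega> \<bullet> x) \<partial>M)) +
        (((\<integral>\<omega>. iexp (Z_block q T \<omega> \<bullet> x) \<partial>M) - ?lq q) + (?lq q - ?l))" by simp
    also have "norm \<dots> < e / 3 + (e / 3 + e / 3)"
      using 1 elim(2) q(2) by (intro norm_add_less) (simp_all only: dist_norm)
    finally show ?case by simp
  qed
  then show "\<exists>no. \<forall>T\<ge>no. norm ((\<integral>\<omega>. iexp (Z T \<omega> \<bullet> x) \<partial>M) - ?l) < e"
    by (simp add: eventually_sequentially)
qed

text \<open>Images of independent centred blocks under a bounded linear map are orthogonal. The map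
  is the identity for the bound on first moments and the residual of a projection for
  tightness.\<close>

lemma block_linear_norm:
  fixes g :: "'h \<Rightarrow> 'h"
  assumes g: "bounded_linear g"
  shows "(L2_norm M (\<lambda>\<omega>. g (Z_block q T \<omega>)))\<^sup>2 =
    (\<Sum>j<T. (block_weight q T j)\<^sup>2) * (L2_norm M (\<lambda>\<omega>. g (V q 0 \<omega>)))\<^sup>2"
proof -
  interpret g: bounded_linear g by fact
  have gm: "g \<in> borel_measurable borel"
    by (intro borel_measurable_continuous_onI linear_continuous_on g)
  have Vm [measurable]: "V q j \<in> borel_measurable M" for j using V_L2 by (rule L2_rv_measurable)
  obtain b where b: "\<And>x. norm (g x) \<le> norm x * b" using g.bounded by blast
  have L2: "L2_rv M (\<lambda>\<omega>. g (V q j \<omega>))" for j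
    by (rule L2_rv_bound[OF V_L2[of q j], where c = b])
       (use b measurable_compose[OF Vm gm] in \<open>auto simp: mult.commute\<close>)
  have mean: "expectation (\<lambda>\<omega>. g (V q j \<omega>)) = 0" for j
    using integral_bounded_linear[OF g L2_rv_integrable[OF V_L2[of q j]]] V_mean[of q j]
    by (simp add: g.zero)
  have cross: "expectation (\<lambda>\<omega>. g (V q i \<omega>) \<bullet> g (V q j \<omega>)) =
      (if i = j then (L2_norm M (\<lambda>\<omega>. g (V q 0 \<omega>)))\<^sup>2 else 0)" for i j
  proof (cases "i = j")
    case True
    have "L2_norm M (\<lambda>\<omega>. g (V q j \<omega>)) = L2_norm M (\<lambda>\<omega>. g (V q 0 \<omega>))"
    proof (rule same_law_L2(2))
      have "distr M borel (\<lambda>\<omega>. g (V q j \<omega>)) = distr (distr M borel (V q j)) borel g" for j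
        using gm by (subst distr_distr) (simp_all add: comp_def)
      then show "distr M borel (\<lambda>\<omega>. g (V q j \<omega>)) = distr M borel (\<lambda>\<omega>. g (V q 0 \<omega>))"
        by (simp only: V_law[of q j])
    qed (use measurable_compose[OF Vm gm] in auto)
    then show ?thesis using True by (simp add: L2_norm_power2[symmetric] power2_norm_eq_inner[symmetric])
  next
    case False
    have "indep_var borel (\<lambda>\<omega>. g (V q i \<omega>)) borel (\<lambda>\<omega>. g (V q j \<omega>))"
    proof -
      have "indep_var (Pi\<^sub>M {i} (\<lambda>_. borel)) (\<lambda>\<omega>. \<lambda>k\<in>{i}. V q k \<omega>) (Pi\<^sub>M {j} (\<lambda>_. borel)) (\<lambda>\<omega>. \<lambda>k\<in>{j}. V q k \<omega>)"
        by (rule indep_var_restrict[OF V_indep]) (use False in auto)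
      from indep_var_compose[OF this, of "\<lambda>z. g (z i)" borel "\<lambda>z. g (z j)" borel]
      show ?thesis using gm by (simp add: comp_def measurable_compose[OF measurable_component_singleton])
    qed
    from indep_var_bilinear[OF bounded_bilinear_inner this L2 L2] show ?thesis
      using False by (simp add: mean)
  qed
  have "(L2_norm M (\<lambda>\<omega>. g (Z_block q T \<omega>)))\<^sup>2 =
      (L2_norm M (\<lambda>\<omega>. \<Sum>j<T. block_weight q T j *\<^sub>R g (V q j \<omega>)))\<^sup>2"
    by (simp add: Z_block_def g.sum g.scaleR)
  also have "\<dots> = (\<Sum>i<T. \<Sum>j<T. block_weight q T i * block_weight q T j *
      expectation (\<lambda>\<omega>. g (V q i \<omega>) \<bullet> g (V q j \<omega>)))"
    by (rule L2_norm_weighted_sum[OF _ L2]) simp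
  also have "\<dots> = (\<Sum>i<T. \<Sum>j<T. if j = i then (block_weight q T i)\<^sup>2 * (L2_norm M (\<lambda>\<omega>. g (V q 0 \<omega>)))\<^sup>2 else 0)"
    unfolding cross by (intro sum.cong refl) (auto simp: power2_eq_square)
  also have "\<dots> = (\<Sum>j<T. (block_weight q T j)\<^sup>2) * (L2_norm M (\<lambda>\<omega>. g (V q 0 \<omega>)))\<^sup>2"
    by (simp add: sum_distrib_right)
  finally show ?thesis .
qed

lemma Z_linear_norm_eventually:
  fixes g :: "'h \<Rightarrow> 'h"
  assumes g: "bounded_linear g" and g1: "\<And>v. norm (g v) \<le> norm v" and q: "q > 0"
  shows "\<forall>\<^sub>F T in sequentially. expectation (\<lambda>\<omega>. norm (g (Z T \<omega>))) \<le>
    sqrt (\<kappa> / real q + 1) * L2_norm M (\<lambda>\<omega>. g (V q 0 \<omega>)) + block_constant / sqrt (real q)"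
proof -
  interpret g: bounded_linear g by fact
  have gm [measurable]: "g \<in> borel_measurable borel"
    by (intro borel_measurable_continuous_onI linear_continuous_on g)
  have "\<forall>\<^sub>F T in sequentially. (\<Sum>j<T. (block_weight q T j)\<^sup>2) < \<kappa> / real q + 1"
    by (rule order_tendstoD(2)[OF block_weight_square_sum[OF q]]) simp
  with block_approximation[OF q] show ?thesis
  proof eventually_elim
    case (elim T)
    have gL2: "L2_rv M (\<lambda>\<omega>. g (Z_block q T \<omega>))"
      by (rule L2_rv_bound[OF Z_block_L2[of q T], where c = 1])
         (use g1 measurable_compose[OF L2_rv_measurable[OF Z_block_L2] gm] in auto)
    have igZ: "integrable M (\<lambda>\<omega>. g (Z T \<omega>))"
      by (rule integrable_bounded_linear[OF g Z_integrable])
    have iD: "integrable M (\<lambda>\<omega>. norm (Z T \<omega> - Z_block q T \<omega>))"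
      by (intro integrable_norm Bochner_Integration.integrable_diff Z_integrable Z_block_integrable)
    have "expectation (\<lambda>\<omega>. norm (g (Z T \<omega>))) \<le>
        expectation (\<lambda>\<omega>. norm (g (Z_block q T \<omega>)) + norm (Z T \<omega> - Z_block q T \<omega>))"
    proof (rule integral_mono)
      fix \<omega>
      have "g (Z T \<omega>) = g (Z_block q T \<omega>) + g (Z T \<omega> - Z_block q T \<omega>)" by (simp add: g.diff)
      then show "norm (g (Z T \<omega>)) \<le> norm (g (Z_block q T \<omega>)) + norm (Z T \<omega> - Z_block q T \<omega>)"
        using norm_triangle_ineq[of "g (Z_block q T \<omega>)" "g (Z T \<omega> - Z_block q T \<omega>)"]
          g1[of "Z T \<omega> - Z_block q T \<omega>"] by simp
    qed (use igZ iD L2_rv_integrable[OF gL2] in auto)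
    also have "\<dots> = expectation (\<lambda>\<omega>. norm (g (Z_block q T \<omega>))) + expectation (\<lambda>\<omega>. norm (Z T \<omega> - Z_block q T \<omega>))"
      using iD L2_rv_integrable[OF gL2] by simp
    also have "\<dots> \<le> sqrt (\<kappa> / real q + 1) * L2_norm M (\<lambda>\<omega>. g (V q 0 \<omega>)) + block_constant / sqrt (real q)"
    proof (rule add_mono[OF order_trans[OF L1_le_L2_norm[OF gL2]] elim(1)])
      have \<kappa>: "\<kappa> \<ge> 0" by (simp add: \<kappa>_def)
      have "(L2_norm M (\<lambda>\<omega>. g (Z_block q T \<omega>)))\<^sup>2 \<le> (\<kappa> / real q + 1) * (L2_norm M (\<lambda>\<omega>. g (V q 0 \<omega>)))\<^sup>2"
        unfolding block_linear_norm[OF g] using elim(2) by (intro mult_right_mono) auto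
      also have "\<dots> = (sqrt (\<kappa> / real q + 1) * L2_norm M (\<lambda>\<omega>. g (V q 0 \<omega>)))\<^sup>2"
        using \<kappa> by (simp add: power_mult_distrib)
      finally show "L2_norm M (\<lambda>\<omega>. g (Z_block q T \<omega>)) \<le> sqrt (\<kappa> / real q + 1) * L2_norm M (\<lambda>\<omega>. g (V q 0 \<omega>))"
        by (rule power2_le_imp_le) (use \<kappa> in \<open>simp add: L2_norm_nonneg\<close>)
    qed
    finally show ?case .
  qed
qed

text \<open>For tightness, a large \<open>q\<close> makes the mean distance to the block sum smaller
  than \<open>e / 2\<close>. The residual of the block sum is controlled by that of the single
  variable \<open>V q 0\<close>, which tends to zero by dominated convergence; hence
  \<open>m0\<close> does not depend on \<open>T\<close>.\<close>

theorem weak_convergence: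
  fixes b :: "nat \<Rightarrow> 'h" and N :: "'h measure" and \<phi> :: "'h \<Rightarrow> real"
  assumes b: "hilbert_basis b" and N: "prob_space N" "sets N = sets borel" "integrable N (\<lambda>g. (norm g)\<^sup>2)"
    and char: "\<And>x. (\<integral>g. iexp (g \<bullet> x) \<partial>N) = exp (- \<kappa> * long_run_variance x / 2)"
    and \<phi>: "continuous_on UNIV \<phi>" "bounded (range \<phi>)"
  shows "(\<lambda>T. \<integral>\<omega>. \<phi> (Z T \<omega>) \<partial>M) \<longlonglongrightarrow> (\<integral>g. \<phi> g \<partial>N)"
proof -
  interpret hilbert_basis b by fact
  interpret N: prob_space N by fact
  have "L2_rv N (\<lambda>g. g)" using N by (simp add: L2_rv_def measurable_ident_sets)
  then have G: "integrable N (\<lambda>g. g)" by (rule N.L2_rv_integrable)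
  show ?thesis
  proof (rule weak_convergence_char[OF prob_space_axioms N(1), where Z = Z and G = "\<lambda>g. g" and \<phi> = \<phi>
        and B = "sqrt (\<kappa> / real 1 + 1) * L2_norm M (\<lambda>\<omega>. V 1 0 \<omega>) + block_constant / sqrt (real 1)"])
    show "integrable M (Z n)" for n by (rule Z_integrable)
    show "integrable N (\<lambda>g. g)" by (rule G)
    show "continuous_on UNIV \<phi>" "bounded (range \<phi>)" by (rule \<phi>)+
    show "(\<lambda>n. \<integral>\<omega>. iexp (Z n \<omega> \<bullet> s) \<partial>M) \<longlonglongrightarrow> (\<integral>g. iexp (g \<bullet> s) \<partial>N)" for s
      unfolding char by (rule Z_char_tendsto)
    show "\<forall>\<^sub>F n in sequentially. expectation (\<lambda>\<omega>. norm (Z n \<omega>)) \<le>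
        sqrt (\<kappa> / real 1 + 1) * L2_norm M (\<lambda>\<omega>. V 1 0 \<omega>) + block_constant / sqrt (real 1)"
      using Z_linear_norm_eventually[OF bounded_linear_ident, of 1] by simp
    fix e :: real assume e: "e > 0"
    have "\<forall>\<^sub>F q in sequentially. block_constant / sqrt (real q) < e / 2"
      by (rule order_tendstoD(2)[OF tendsto_divide_0[OF tendsto_const
            filterlim_at_top_imp_at_infinity[OF filterlim_compose[OF sqrt_at_top filterlim_real_sequentially]]]])
         (use e in simp)
    then have "\<forall>\<^sub>F q in sequentially. q \<ge> 1 \<and> block_constant / sqrt (real q) < e / 2"
      using eventually_ge_at_top[of 1] by eventually_elim auto
    then obtain q :: nat where q: "q \<ge> 1" "block_constant / sqrt (real q) < e / 2"
      by (auto simp: eventually_sequentially)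
    let ?s = "sqrt (\<kappa> / real q + 1)"
    have [measurable]: "V q 0 \<in> borel_measurable M" using V_L2 by (rule L2_rv_measurable)
    have "(\<lambda>m. expectation (\<lambda>\<omega>. (norm (V q 0 \<omega> - proj m (V q 0 \<omega>)))\<^sup>2)) \<longlonglongrightarrow> expectation (\<lambda>\<omega>. 0)"
    proof (rule integral_dominated_convergence)
      show "integrable M (\<lambda>\<omega>. (norm (V q 0 \<omega>))\<^sup>2)" using V_L2 by (simp add: L2_rv_def)
      show "AE \<omega> in M. (\<lambda>m. (norm (V q 0 \<omega> - proj m (V q 0 \<omega>)))\<^sup>2) \<longlonglongrightarrow> 0"
      proof (rule AE_I2)
        fix \<omega>
        have "(\<lambda>m. (norm (V q 0 \<omega> - proj m (V q 0 \<omega>)))\<^sup>2) \<longlonglongrightarrow> (norm (V q 0 \<omega> - V q 0 \<omega>))\<^sup>2"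
          by (intro tendsto_intros proj_tendsto)
        then show "(\<lambda>m. (norm (V q 0 \<omega> - proj m (V q 0 \<omega>)))\<^sup>2) \<longlonglongrightarrow> 0" by simp
      qed
      show "AE \<omega> in M. norm ((norm (V q 0 \<omega> - proj m (V q 0 \<omega>)))\<^sup>2) \<le> (norm (V q 0 \<omega>))\<^sup>2" for m
        by (intro AE_I2) (simp add: power_mono norm_minus_proj_le)
    qed measurable
    then have "(\<lambda>m. ?s * L2_norm M (\<lambda>\<omega>. V q 0 \<omega> - proj m (V q 0 \<omega>))) \<longlonglongrightarrow> ?s * sqrt (expectation (\<lambda>\<omega>. 0))"
      unfolding L2_norm_def by (intro tendsto_intros)
    then have "\<forall>\<^sub>F m in sequentially. ?s * L2_norm M (\<lambda>\<omega>. V q 0 \<omega> - proj m (V q 0 \<omega>)) < e / 2"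
      by (rule order_tendstoD) (use e in simp)
    then obtain m0 where m0: "\<And>m. m \<ge> m0 \<Longrightarrow> ?s * L2_norm M (\<lambda>\<omega>. V q 0 \<omega> - proj m (V q 0 \<omega>)) < e / 2"
      by (auto simp: eventually_sequentially)
    show "\<exists>m0. \<forall>m\<ge>m0. \<forall>\<^sub>F n in sequentially. expectation (\<lambda>\<omega>. norm (Z n \<omega> - proj m (Z n \<omega>))) \<le> e"
    proof (intro exI[of _ m0] allI impI)
      fix m assume m: "m \<ge> m0"
      have "bounded_linear (\<lambda>v. v - proj m v)"
        by (intro bounded_linear_sub bounded_linear_ident bounded_linear_proj)
      from Z_linear_norm_eventually[OF this norm_minus_proj_le, of q] q(1)
      have "\<forall>\<^sub>F n in sequentially. expectation (\<lambda>\<omega>. norm (Z n \<omega> - proj m (Z n \<omega>))) \<le>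
          ?s * L2_norm M (\<lambda>\<omega>. V q 0 \<omega> - proj m (V q 0 \<omega>)) + block_constant / sqrt (real q)" by simp
      then show "\<forall>\<^sub>F n in sequentially. expectation (\<lambda>\<omega>. norm (Z n \<omega> - proj m (Z n \<omega>))) \<le> e"
        by eventually_elim (use m0[OF m] q(2) in linarith)
    qed
  qed
qed

end

section \<open>Moments of the Gaussian limit and covariance kernels\<close>

lemma normal_law_eq_distr:
  assumes "\<sigma> \<ge> 0"
  shows "normal_law 0 \<sigma> = distr std_normal_distribution borel (\<lambda>x. \<sigma> * x)"
proof (cases "\<sigma> = 0")
  case True
  have "prob_space std_normal_distribution" by (rule prob_space_normal_density) simp
  then show ?thesis using True by (simp add: normal_law_def prob_space.distr_const)
next
  case False
  have N: "prob_space std_normal_distribution" by (rule prob_space_normal_density) simp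
  have "distr std_normal_distribution lborel (\<lambda>x. x) = std_normal_distribution"
    by (rule distr_id2) simp
  then have "distributed std_normal_distribution lborel (\<lambda>x. x) (normal_density 0 1)"
    by (simp add: distributed_def)
  from prob_space.normal_density_affine[OF N this, of \<sigma> 0]
  have "distr std_normal_distribution lborel (\<lambda>x. \<sigma> * x) = density lborel (normal_density 0 \<sigma>)"
    using False assms by (simp add: distributed_distr_eq_density)
  moreover have "distr std_normal_distribution lborel (\<lambda>x. \<sigma> * x) = distr std_normal_distribution borel (\<lambda>x. \<sigma> * x)"
    by (rule distr_cong) auto
  ultimately show ?thesis using False by (simp add: normal_law_def)
qed

text \<open>Evaluating \<open>char\<close> along the ray \<open>t *\<^sub>R x\<close> gives the law
  of the scalar variable \<open>g \<bullet> x\<close>, and with it all one-dimensional moments.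
  Mixed moments follow by polarization.\<close>

lemma gaussian_char_properties:
  fixes N :: "'h::{real_inner, banach, second_countable_topology} measure"
  assumes N: "prob_space N" "sets N = sets borel" "integrable N (\<lambda>g. (norm g)\<^sup>2)" and B: "psd_form B"
    and char: "\<And>x. (\<integral>g. iexp (g \<bullet> x) \<partial>N) = exp (- B x x / 2)"
  shows "gaussian_element N (\<lambda>g. g)" "L2_rv N (\<lambda>g. g)" "(\<integral>g. g \<partial>N) = 0"
    "(\<integral>g. (g \<bullet> x) * (g \<bullet> y) \<partial>N) = B x y"
proof -
  interpret N: prob_space N by fact
  interpret B: psd_form B by fact
  have [measurable]: "(\<lambda>g. g) \<in> borel_measurable N" using N(2) by (rule measurable_ident_sets)
  show L2: "L2_rv N (\<lambda>g. g)" using N(3) by (simp add: L2_rv_def)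
  have char': "(\<integral>g. iexp (t * (g \<bullet> x)) \<partial>N) = exp (- B x x * t\<^sup>2 / 2)" for t x
  proof -
    have "B (t *\<^sub>R x) (t *\<^sub>R x) = B x x * t\<^sup>2"
      by (simp add: B.scale B.scale_right power2_eq_square mult_ac)
    then show ?thesis using char[of "t *\<^sub>R x"] by simp
  qed
  have m: "(\<lambda>g. g \<bullet> x) \<in> borel_measurable N" for x by measurable
  note mom = char_gaussian_moments[OF N(1) m B.nonneg char']
  show "gaussian_element N (\<lambda>g. g)"
    unfolding gaussian_element_def
  proof (intro conjI allI exI)
    fix x
    show "distr N borel (\<lambda>\<omega>. \<omega> \<bullet> x) = normal_law 0 (sqrt (B x x))"
      using char_gaussian_law[OF N(1) m B.nonneg char', of x] B.nonneg[of x]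
      by (simp add: normal_law_eq_distr)
  qed (auto simp: B.nonneg)
  have "(\<integral>g. g \<partial>N) \<bullet> x = 0" for x
    using mom(2)[of x] N.L2_rv_integrable[OF L2] by simp
  then show "(\<integral>g. g \<partial>N) = 0" by (metis inner_eq_zero_iff)
  have "(\<integral>g. (g \<bullet> x) * (g \<bullet> y) \<partial>N) =
      (\<integral>g. ((g \<bullet> (x + y))\<^sup>2 - (g \<bullet> x)\<^sup>2 - (g \<bullet> y)\<^sup>2) / 2 \<partial>N)"
    by (intro Bochner_Integration.integral_cong refl) (simp add: inner_add_right power2_eq_square algebra_simps)
  also have "\<dots> = (B (x + y) (x + y) - B x x - B y y) / 2"
    using mom(3,4)[of "x + y"] mom(3,4)[of x] mom(3,4)[of y] by simp
  also have "\<dots> = B x y"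
    by (simp add: B.add B.add_right B.sym[of y x])
  finally show "(\<integral>g. (g \<bullet> x) * (g \<bullet> y) \<partial>N) = B x y" .
qed

lemma inner_cov_kernel:
  assumes X: "L2_rv M X" and Y: "L2_rv M Y"
  shows "cov_kernel M X Y \<bullet> tensor x y = (\<integral>\<omega>. (X \<omega> \<bullet> x) * (Y \<omega> \<bullet> y) \<partial>M)"
proof -
  have "integrable M (\<lambda>\<omega>. tensor (X \<omega>) (Y \<omega>))"
    by (rule L2_rv_integrable_bilinear(1)[OF bounded_bilinear_tensor, of 1, OF _ _ X Y])
       (simp_all add: norm_tensor)
  then show ?thesis by (simp add: cov_kernel_def integral_inner_left[symmetric] inner_tensor)
qed

lemma in_Lp_2_iff: "in_Lp M 2 X \<longleftrightarrow> L2_rv M X"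
  by (simp add: in_Lp_def L2_rv_def)

lemma v_norm_2: "v_norm M 2 X = L2_norm M X"
  by (simp add: v_norm_def L2_norm_def powr_half_sqrt)

lemma L2_rv_cong_AE:
  assumes "AE \<omega> in M. X \<omega> = X' \<omega>" "X' \<in> borel_measurable M" "L2_rv M X"
  shows "L2_rv M X'"
  unfolding L2_rv_def
proof
  have [measurable]: "X \<in> borel_measurable M" "X' \<in> borel_measurable M"
    using assms by (auto simp: L2_rv_def)
  have "integrable M (\<lambda>\<omega>. (norm (X \<omega>))\<^sup>2)" using assms(3) by (simp add: L2_rv_def)
  moreover have "integrable M (\<lambda>\<omega>. (norm (X \<omega>))\<^sup>2) \<longleftrightarrow> integrable M (\<lambda>\<omega>. (norm (X' \<omega>))\<^sup>2)"
    using assms(1) by (intro integrable_cong_AE) (auto elim: eventually_mono)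
  ultimately show "integrable M (\<lambda>\<omega>. (norm (X' \<omega>))\<^sup>2)" by simp
qed fact

lemma cov_kernel_cong_AE:
  fixes X X' Y Y' :: "'w \<Rightarrow> 'a::euclidean_space L2"
  assumes "AE \<omega> in M. X \<omega> = X' \<omega>" "AE \<omega> in M. Y \<omega> = Y' \<omega>"
    and m: "X \<in> borel_measurable M" "X' \<in> borel_measurable M" "Y \<in> borel_measurable M" "Y' \<in> borel_measurable M"
  shows "cov_kernel M X Y = cov_kernel M X' Y'"
  unfolding cov_kernel_def
proof (rule integral_cong_AE)
  have "continuous_on UNIV (\<lambda>z. tensor (fst z) (snd z) :: ('a \<times> 'a) L2)"
    by (intro bounded_bilinear.continuous_on[OF bounded_bilinear_tensor] continuous_intros)
  from borel_measurable_continuous_onI[OF this]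
  have t: "(\<lambda>z. tensor (fst z) (snd z)) \<in> borel_measurable ((borel :: 'a L2 measure) \<Otimes>\<^sub>M (borel :: 'a L2 measure))"
    by (simp add: borel_prod)
  show "(\<lambda>\<omega>. tensor (X \<omega>) (Y \<omega>)) \<in> borel_measurable M"
    "(\<lambda>\<omega>. tensor (X' \<omega>) (Y' \<omega>)) \<in> borel_measurable M"
    using measurable_compose[OF measurable_Pair[OF m(1,3)] t]
      measurable_compose[OF measurable_Pair[OF m(2,4)] t] by simp_all
  show "AE \<omega> in M. tensor (X \<omega>) (Y \<omega>) = tensor (X' \<omega>) (Y' \<omega>)"
    using assms(1,2) by eventually_elim simp
qed

text \<open>For \<open>\<rho> \<ge> 1\<close> the pointwise bound
  \<open>U \<le> 1 + U powr \<rho>\<close> passes from the moment of order \<open>\<rho>\<close> to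
  the first moment. Since \<open>C\<close> is an arbitrary real number, it enters as
  \<open>max C 0\<close>.\<close>

lemma (in prob_space) expectation_norm_le_moment:
  fixes W :: "'a \<Rightarrow> 'h::{banach, second_countable_topology}"
  assumes U [measurable]: "U \<in> borel_measurable M" and pos: "\<And>\<omega>. \<omega> \<in> space M \<Longrightarrow> U \<omega> > 0" and \<rho>: "\<rho> \<ge> 1"
    and moment: "(\<integral>\<^sup>+\<omega>. ennreal (U \<omega> powr \<rho>) \<partial>M) < ennreal C"
    and W: "integrable M W" and bound: "AE \<omega> in M. norm (W \<omega>) \<le> a * U \<omega>" and a: "a \<ge> 0"
  shows "expectation (\<lambda>\<omega>. norm (W \<omega>)) \<le> (1 + max C 0) * a"
proof -
  have fin: "(\<integral>\<^sup>+\<omega>. ennreal (U \<omega> powr \<rho>) \<partial>M) < \<infinity>"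
    using moment by (rule less_trans) simp
  then have i: "integrable M (\<lambda>\<omega>. U \<omega> powr \<rho>)"
    by (intro integrableI_bounded) auto
  have "ennreal (expectation (\<lambda>\<omega>. U \<omega> powr \<rho>)) < ennreal C"
    using moment nn_integral_eq_integral[OF i] by simp
  then have E: "expectation (\<lambda>\<omega>. U \<omega> powr \<rho>) \<le> max C 0"
    by (cases "C \<ge> 0") (auto simp: ennreal_less_iff ennreal_neg)
  have "expectation (\<lambda>\<omega>. norm (W \<omega>)) \<le> expectation (\<lambda>\<omega>. a * (1 + U \<omega> powr \<rho>))"
  proof (rule integral_mono_AE)
    show "AE \<omega> in M. norm (W \<omega>) \<le> a * (1 + U \<omega> powr \<rho>)"
      using bound AE_space
    proof eventually_elim
      case (elim \<omega>)
      have "U \<omega> \<le> 1 + U \<omega> powr \<rho>"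
      proof (cases "U \<omega> \<le> 1")
        case False
        then have "U \<omega> powr 1 \<le> U \<omega> powr \<rho>" using \<rho> by (intro powr_mono) auto
        then show ?thesis using False by simp
      qed (simp add: add_increasing2)
      then have "a * U \<omega> \<le> a * (1 + U \<omega> powr \<rho>)" using a by (rule mult_left_mono)
      then show ?case using elim by linarith
    qed
  qed (use W i in auto)
  also have "\<dots> = a * (1 + expectation (\<lambda>\<omega>. U \<omega> powr \<rho>))" using i by (simp add: prob_space)
  also have "\<dots> \<le> a * (1 + max C 0)" using a E by (intro mult_left_mono) auto
  finally show ?thesis by (simp add: mult.commute)
qed

theorem theorem3p2:
  fixes M :: "'w measure"
    and S :: "'s measure"
    and X :: "nat \<Rightarrow> nat \<Rightarrow> 'w \<Rightarrow> (real^'d) L2"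
    and Y :: "real \<Rightarrow> int \<Rightarrow> 'w \<Rightarrow> (real^'d) L2"
    and K :: "real \<Rightarrow> real"
    and h :: "nat \<Rightarrow> real"
    and \<rho> u :: real
  assumes "prob_space M"
    and "\<rho> \<ge> 2"
    and "locally_stationary M 2 \<rho> X Y"
    and "\<forall>v\<in>{0..1}. Lp_m_approximable M S 2 (Y v)"
    and "\<forall>v\<in>{0..1}. \<forall>t. (\<integral>\<omega>. Y v t \<omega> \<partial>M) = 0"
    and "\<forall>z. K (- z) = K z"
    and "bounded (range K)"
    and "\<exists>L. L-lipschitz_on UNIV K"
    and "compact (closure {z. K z \<noteq> 0})"
    and "(\<integral>z. K z \<partial>lborel) = 1"
    and "\<forall>T\<ge>1. h T > 0"
    and "h \<longlonglongrightarrow> 0"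
    and "filterlim (\<lambda>T. min (real T * h T) (1 / (real T * h T ^ 3))) at_top sequentially"
    and "u \<in> {0<..<1}"
  shows "summable (\<lambda>t. cov_kernel M (Y u 0) (Y u (int (Suc t)))) \<and>
    summable (\<lambda>t. cov_kernel M (Y u (int (Suc t))) (Y u 0)) \<and>
    (\<exists>(N :: (real^'d) L2 measure) (G :: (real^'d) L2 \<Rightarrow> (real^'d) L2).
       prob_space N \<and> gaussian_element N G \<and> in_Lp N 2 G \<and>
       (\<integral>\<omega>. G \<omega> \<partial>N) = 0 \<and>
       cov_kernel N G G = (\<integral>z. (K z)\<^sup>2 \<partial>lborel) *\<^sub>R long_run_cov M (Y u) \<and>
       converges_in_distribution M
         (\<lambda>T \<omega>. sqrt (real T * h T) *\<^sub>R kernel_mean K h X u T \<omega>) N G)"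
proof -
  interpret prob_space M by fact
  have uu: "0 < u" "u < 1" and u01: "u \<in> {0..1}" using assms(14) by auto
  have "Lp_m_approximable M S 2 (Y u)" using assms(4) u01 by blast
  then obtain f \<epsilon> \<epsilon>' where f: "f \<in> borel_measurable (\<Pi>\<^sub>M j\<in>(UNIV :: nat set). S)"
    and iid: "iid_family M S \<epsilon>" and copies: "independent_copies M S \<epsilon> \<epsilon>'"
    and rep: "\<And>t. AE \<omega> in M. Y u t \<omega> = f (\<lambda>j. \<epsilon> (t - int j) \<omega>)"
    and summ: "\<And>t. summable (\<lambda>m. v_norm M 2 (\<lambda>\<omega>. Y u t \<omega> - coupled f \<epsilon> \<epsilon>' (Suc m) t \<omega>))"
    and YLp: "\<And>t. in_Lp M 2 (Y u t)"
    unfolding Lp_m_approximable_def by blast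
  have Y_L2: "L2_rv M (Y u t)" for t using YLp by (simp add: in_Lp_2_iff)
  note Y_m = L2_rv_measurable[OF Y_L2]
  define \<eta> where "\<eta> = all_innovations \<epsilon> \<epsilon>'"
  interpret innovations M S \<eta>
    unfolding \<eta>_def
    by unfold_locales (rule all_innovations_indep[OF iid copies] all_innovations_same_law[OF iid copies])+
  \<comment> \<open>For each \<open>t\<close> the representation of \<open>Y u t\<close> holds only
    almost surely, whereas \<open>YY\<close> satisfies it everywhere. Expectations, covariances and
    mean distances are the same for both.\<close>
  define YY where "YY t \<omega> = f (\<lambda>j. \<eta> (past t j) \<omega>)" for t \<omega>
  have YY_eq: "YY t \<omega> = f (\<lambda>j. \<epsilon> (t - int j) \<omega>)" for t \<omega>
    by (simp add: YY_def \<eta>_def all_innovations_def past_def)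
  have YY: "AE \<omega> in M. Y u t \<omega> = YY t \<omega>" for t using rep[of t] by (simp add: YY_eq)
  have YY_m: "YY t \<in> borel_measurable M" for t
    unfolding YY_def[abs_def] by (rule measurable_compose[OF measurable_reindex f])
  have YY_L2: "L2_rv M (YY t)" for t by (rule L2_rv_cong_AE[OF YY YY_m Y_L2])
  have f_mean: "expectation (YY 0) = 0"
    using integral_cong_AE[OF Y_m YY_m YY, of 0] assms(5) u01 by simp
  interpret bernoulli_shift M S \<eta> f
    by unfold_locales (use f YY_L2 f_mean in \<open>simp_all add: YY_def[abs_def]\<close>)
  have Y_locale: "bernoulli_shift.Y \<eta> f = YY"
    by (intro ext) (simp add: Y_def YY_def)
  have \<delta>: "v_norm M 2 (\<lambda>\<omega>. Y u 0 \<omega> - coupled f \<epsilon> \<epsilon>' (Suc m) 0 \<omega>) = \<delta> (Suc m)" for m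
  proof -
    have c: "coupled f \<epsilon> \<epsilon>' (Suc m) 0 \<omega> = C (Suc m) 0 \<omega>" for \<omega>
      unfolding coupled_def C_def
      by (intro arg_cong[where f = f] ext) (simp add: \<eta>_def all_innovations_def coupled_past_def)
    have [measurable]: "Y u 0 \<in> borel_measurable M" "YY 0 \<in> borel_measurable M" by (rule Y_m YY_m)+
    have "(\<integral>\<omega>. (norm (Y u 0 \<omega> - C (Suc m) 0 \<omega>))\<^sup>2 \<partial>M) = (\<integral>\<omega>. (norm (YY 0 \<omega> - C (Suc m) 0 \<omega>))\<^sup>2 \<partial>M)"
      using YY[of 0] by (intro integral_cong_AE) (auto elim: eventually_mono)
    then show ?thesis by (simp add: v_norm_2 L2_norm_def c \<delta>_def Y_locale)
  qed
  interpret approximable_shift M S \<eta> f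
    by unfold_locales (use summ[of 0] \<delta> in simp)
  obtain B where B: "\<And>z. \<bar>K z\<bar> \<le> B" using assms(7) by (auto simp: bounded_iff)
  obtain L where L: "L-lipschitz_on UNIV K" using assms(8) by blast
  have "bounded {z. K z \<noteq> 0}"
    by (rule bounded_subset[OF compact_imp_bounded[OF assms(9)] closure_subset])
  then obtain c0 where c0: "\<And>z. K z \<noteq> 0 \<Longrightarrow> \<bar>z\<bar> \<le> c0" by (auto simp: bounded_iff)
  \<comment> \<open>The margin 1 makes \<open>c\<close> positive and lets the kernel vanish at
    \<open>\<bar>z\<bar> = c\<close> as well.\<close>
  define c where "c = max c0 0 + 1"
  have c: "c > 0" by (simp add: c_def)
  have K0: "K z = 0" if "\<bar>z\<bar> \<ge> c" for z
  proof (rule ccontr)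
    assume "K z \<noteq> 0"
    then show False using c0[of z] that by (simp add: c_def)
  qed
  have Th: "filterlim (\<lambda>T. real T * h T) at_top sequentially"
    by (rule filterlim_at_top_mono[OF assms(13)]) simp
  have Th3': "filterlim (\<lambda>T. 1 / (real T * h T ^ 3)) at_top sequentially"
    by (rule filterlim_at_top_mono[OF assms(13)]) simp
  have Th3: "(\<lambda>T. real T * h T ^ 3) \<longlonglongrightarrow> 0"
    using tendsto_inverse_0_at_top[OF Th3'] by simp
  note ls = assms(3)[unfolded locally_stationary_def]
  have X_Lp: "in_Lp M 2 (X T t)" if "T \<ge> 1" "t \<in> {1..T}" for T t
    using conjunct1[OF ls] that by simp
  from conjunct2[OF conjunct2[OF conjunct2[OF ls]]] obtain C1 :: real and U :: "real \<Rightarrow> nat \<Rightarrow> nat \<Rightarrow> 'w \<Rightarrow> real"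
    where U_all: "\<forall>u\<in>{0..1}. \<forall>T\<ge>1. \<forall>t\<in>{1..T}.
      U u T t \<in> borel_measurable M \<and> (\<forall>\<omega>\<in>space M. U u T t \<omega> > 0) \<and>
      (\<integral>\<^sup>+\<omega>. ennreal (U u T t \<omega> powr \<rho>) \<partial>M) < ennreal C1 \<and>
      (AE \<omega> in M. norm (X T t \<omega> - Y u (int t) \<omega>) \<le> (\<bar>real t / real T - u\<bar> + 1 / real T) * U u T t \<omega>)"
    by (elim exE)
  have X_int: "integrable M (X T t)" if "1 \<le> t" "t \<le> T" for T t
    using X_Lp[of T t] that L2_rv_integrable by (simp add: in_Lp_2_iff)
  have X_approx: "expectation (\<lambda>\<omega>. norm (X T t \<omega> - YY (int t) \<omega>)) \<le>
      (1 + max C1 0) * (\<bar>real t / real T - u\<bar> + 1 / real T)" if t: "1 \<le> t" "t \<le> T" for T t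
  proof -
    have T: "T \<ge> 1" "t \<in> {1..T}" using t by auto
    note Ut = U_all[rule_format, OF u01 T]
    show ?thesis
    proof (rule expectation_norm_le_moment[where U = "U u T t" and \<rho> = \<rho> and C = C1])
      show "AE \<omega> in M. norm (X T t \<omega> - YY (int t) \<omega>) \<le> (\<bar>real t / real T - u\<bar> + 1 / real T) * U u T t \<omega>"
        using Ut YY[of "int t"] by (auto elim!: eventually_elim2)
      show "integrable M (\<lambda>\<omega>. X T t \<omega> - YY (int t) \<omega>)"
        using X_int[OF t] L2_rv_integrable[OF YY_L2] by simp
    qed (use Ut assms(2) in auto)
  qed
  interpret kernel_clt M S \<eta> f K B L c h u X "1 + max C1 0"
  proof unfold_locales
    show "\<bar>K x - K y\<bar> \<le> L * \<bar>x - y\<bar>" for x y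
      using lipschitz_onD[OF L, of x y] by (simp add: dist_real_def)
    show "0 \<le> L" by (rule lipschitz_on_nonneg[OF L])
  qed (use B c K0 assms(11,12) Th Th3 uu X_int X_approx in \<open>simp_all add: Y_locale\<close>)
  have tens: "norm (tensor a b) \<le> 1 * (norm a * norm b)" for a b :: "(real^'d) L2"
    by (simp add: norm_tensor)
  have cov: "cov_kernel M (Y u s) (Y u t) = (\<integral>\<omega>. tensor (YY s \<omega>) (YY t \<omega>) \<partial>M)" for s t
    using cov_kernel_cong_AE[OF YY YY Y_m YY_m Y_m YY_m, of s t] by (simp only: cov_kernel_def)
  have s1: "summable (\<lambda>t. cov_kernel M (Y u 0) (Y u (int (Suc t))))"
    unfolding cov
    by (rule summable_norm_cancel) (rule autocovariance_bound(1)[OF bounded_bilinear_tensor tens, unfolded Y_locale], simp)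
  have s2: "summable (\<lambda>t. cov_kernel M (Y u (int (Suc t))) (Y u 0))"
    unfolding cov
    by (rule summable_norm_cancel) (rule autocovariance_bound(2)[OF bounded_bilinear_tensor tens, unfolded Y_locale], simp)
  let ?C = "long_run_cov M (Y u)"
  define r where "r s t x y = expectation (\<lambda>\<omega>. (YY s \<omega> \<bullet> x) * (YY t \<omega> \<bullet> y))" for s t x y
  have r_sym: "r s t x y = r t s y x" for s t x y by (simp add: r_def mult.commute)
  have inner_cov: "cov_kernel M (Y u s) (Y u t) \<bullet> tensor x y = r s t x y" for s t x y
    unfolding cov r_def using inner_cov_kernel[OF YY_L2 YY_L2, of s t x y] by (simp only: cov_kernel_def)
  have inner_lrc: "?C \<bullet> tensor x y = r 0 0 x y + (\<Sum>t. r 0 (int (Suc t)) x y) + (\<Sum>t. r (int (Suc t)) 0 x y)" for x y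
    unfolding long_run_cov_def inner_add_left
      bounded_linear.suminf[OF bounded_linear_inner_left s1] bounded_linear.suminf[OF bounded_linear_inner_left s2]
    by (simp only: inner_cov)
  have lrv: "?C \<bullet> tensor x x = long_run_variance x" for x
    unfolding inner_lrc long_run_variance_def Y_locale r_sym[of "int (Suc _)" 0] by (simp add: r_def)
  \<comment> \<open>The covariance form of the limit. Its nonnegativity is inherited from the
    variances of partial sums, whose normalised limit is \<open>long_run_variance\<close>.\<close>
  define Q where "Q x y = \<kappa> * (?C \<bullet> tensor x y)" for x y
  have \<kappa>0: "\<kappa> \<ge> 0" by (simp add: \<kappa>_def)
  have Q: "psd_form Q"
  proof
    show "Q x y = Q y x" for x y
      unfolding Q_def inner_lrc r_sym[of 0 0 x y] r_sym[of 0 "int (Suc _)" x y] r_sym[of "int (Suc _)" 0 x y]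
      by simp
    show "0 \<le> Q x x" for x
      using \<kappa>0 long_run_variance_nonneg[of x] by (simp add: Q_def lrv)
  qed (simp_all add: Q_def tensor_add_left tensor_scaleR_left inner_add_right distrib_left)
  have Q_bilinear: "bounded_bilinear Q"
  proof
    show "\<exists>c. \<forall>x y. norm (Q x y) \<le> norm x * norm y * c"
    proof (intro exI[of _ "\<kappa> * norm ?C"] allI)
      fix x y :: "(real^'d) L2"
      have "\<bar>?C \<bullet> tensor x y\<bar> \<le> norm ?C * (norm x * norm y)"
        using Cauchy_Schwarz_ineq2[of ?C "tensor x y"] by (simp add: norm_tensor)
      then have "\<kappa> * \<bar>?C \<bullet> tensor x y\<bar> \<le> \<kappa> * (norm ?C * (norm x * norm y))"
        using \<kappa>0 by (rule mult_left_mono)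
      then show "norm (Q x y) \<le> norm x * norm y * (\<kappa> * norm ?C)"
        using \<kappa>0 by (simp add: Q_def abs_mult mult_ac)
    qed
  qed (simp_all add: Q_def tensor_add_left tensor_add_right tensor_scaleR_left tensor_scaleR_right
      inner_add_right distrib_left)
  obtain b :: "nat \<Rightarrow> (real^'d) L2" where b: "hilbert_basis b" by (rule hilbert_basis_exists)
  have trace: "summable (\<lambda>i. Q (b i) (b i))"
    unfolding Q_def lrv by (intro summable_mult long_run_variance_trace b)
  obtain N :: "(real^'d) L2 measure" where N: "prob_space N" "sets N = sets borel"
    "integrable N (\<lambda>g. (norm g)\<^sup>2)" and char: "\<And>x. (\<integral>g. iexp (g \<bullet> x) \<partial>N) = exp (- Q x x / 2)"
    using hilbert_basis.gaussian_exists[OF b Q Q_bilinear trace] by blast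
  note G = gaussian_char_properties[OF N Q char]
  \<comment> \<open>A kernel is determined by its inner products with product kernels, and for the
    limit these are the mixed moments given by \<open>Q\<close>.\<close>
  have "cov_kernel N (\<lambda>g. g) (\<lambda>g. g) = \<kappa> *\<^sub>R ?C"
    by (rule tensor_eqI) (simp add: inner_cov_kernel[OF G(2) G(2)] G(4) Q_def)
  moreover have "converges_in_distribution M (\<lambda>T \<omega>. sqrt (real T * h T) *\<^sub>R kernel_mean K h X u T \<omega>) N (\<lambda>g. g)"
    unfolding converges_in_distribution_def
  proof (intro allI impI)
    fix \<phi> :: "(real^'d) L2 \<Rightarrow> real" assume \<phi>: "continuous_on UNIV \<phi> \<and> bounded (range \<phi>)"
    have eq: "sqrt (real T * h T) *\<^sub>R kernel_mean K h X u T \<omega> = Z T \<omega>" for T \<omega>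
    proof (cases "T = 0")
      case True
      then show ?thesis by (simp add: kernel_mean_def Z_def)
    next
      case False
      then have "real T * h T > 0" using rate_pos[of T] by (simp add: rate_def)
      then have "sqrt (real T * h T) * (1 / (real T * h T)) = 1 / sqrt (real T * h T)"
        by (simp add: sqrt_divide_self_eq inverse_eq_divide)
      then have "sqrt (real T * h T) *\<^sub>R kernel_mean K h X u T \<omega> =
          (1 / sqrt (real T * h T)) *\<^sub>R (\<Sum>t=1..T. K ((u - real t / real T) / h T) *\<^sub>R X T t \<omega>)"
        by (simp only: kernel_mean_def scaleR_scaleR)
      also have "\<dots> = Z T \<omega>"
        by (simp add: Z_def kernel_weight_def scaleR_sum_right)
      finally show ?thesis .
    qed
    have "(\<integral>g. iexp (g \<bullet> x) \<partial>N) = exp (- \<kappa> * long_run_variance x / 2)" for x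
      using char[of x] by (simp add: Q_def lrv)
    then show "(\<lambda>T. \<integral>\<omega>. \<phi> (sqrt (real T * h T) *\<^sub>R kernel_mean K h X u T \<omega>) \<partial>M) \<longlonglongrightarrow> (\<integral>\<omega>. \<phi> \<omega> \<partial>N)"
      unfolding eq using \<phi> by (intro weak_convergence[OF b N]) auto
  qed
  ultimately show ?thesis
    using s1 s2 N(1) G(1-3) unfolding \<kappa>_def
    by (intro conjI exI[of _ N] exI[of _ "\<lambda>g. g"]) (simp_all add: in_Lp_2_iff)
qed

end
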